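(* Let $\mathcal C=ABCD$ be a compressible cell in $\mathbb R^2$, let $\Omega$ be the interior of $\mathcal C$, and let $S$ be the associated closed set $S=\bigcap_{n\in\mathbb N}S_n$ (all these terms are defined in the context). There exist a bounded vector field $B\in BV(\Omega;\mathbb R^2)$ and a bounded function $\rho\colon\Omega\to\mathbb R$ such that: (i) the Cantor part $\operatorname{div}^c B$ of the divergence of $B$ is a nontrivial nonpositive measure concentrated on the set $S$; (ii) $|\operatorname{div}^c B|$-a.e. $x\in S$ belongs to the tangential set $T_B$ of $B$; (iii) $\rho(\Omega\setminus S)=\{1\}\cup\{r\}$, where $r:=|AB|/|CD|$; (iv) $\operatorname{div}(\rho B)=0$ in the sense of distributions in $\Omega$; (v) $|\operatorname{div}^c B|$-a.e. $x\in S$ is not an $L^1$ approximate continuity point of $\rho$.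
   Context: Cells. Fix an orthonormal basis $\{e_1,e_2\}$ of $\mathbb R^2$. A (nondegenerate) trapezium $ABCD$ with four different vertices is called a cell if: its bases $AB$ and $CD$ are parallel to $e_1$; $AD$ and $CB$ are its sides, and $\langle AD,e_2\rangle>0$ (where $AD$ is the vector from $A$ to $D$); and $|CD|\le|AB|$. The cell is incompressible if $|CD|=|AB|$ and compressible if $|CD|<|AB|$. $\operatorname{conv}(ABCD)$ denotes the convex hull of the vertices; the interior of the cell is the topological interior of this convex hull. Patch operation. If $\mathcal C$ is incompressible, $\mathsf{Patch}(\mathcal C):=\{\mathcal C\}$. If $\mathcal C=ABCD$ is compressible, let $E,F,G$ be points on $CD$ (in the order $D,E,F,G,C$) with $|DE|=|EF|=|FG|=|GC|$; let $L,M,N$ be points on $AB$ (in the order $A,L,M,N,B$) with $|AL|=|LM|=|MN|=|NB|$; let $U$ and $V$ be the midpoints of $AD$ and $CB$; let $X,Y,Z$ be points on $UV$ (in the order $U,X,Y,Z,V$) with $|UX|=|AL|$, $|XY|=|EF|$, $|YZ|=|MN|$, $|ZV|=|GC|$. Then $\mathsf{Patch}(\mathcal C)$ consists of the 4 incompressible cells $ALXU$, $XYFE$, $MNZY$, $ZVCG$ and the 4 compressible cells $UXED$, $LMYX$, $YZGF$, $NBVZ$. For a finite collection of cells, $\mathsf{Patch}$ is the union of the $\mathsf{Patch}$es of its members. $\mathcal P_n(\mathcal C)$ is the collection obtained from $\mathcal C$ by applying $\mathsf{Patch}$ $n$ times. The set $S$. $S_n$ is the union of $\operatorname{conv}\mathcal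 C'$ over all compressible cells $\mathcal C'\in\mathcal P_n(\mathcal C)$, and $S:=\bigcap_{n\in\mathbb N}S_n$. Cantor part. If $V\in L^\infty(\Omega;\mathbb R^d)$, $\Omega\subset\mathbb R^d$ open, has divergence a finite Radon measure $\mu$, then $\mu$ decomposes uniquely as $\mu=\mu^a+\mu^j+\mu^c$ with $\mu^a\ll\mathcal L^d$, $\mu^j+\mu^c\perp\mathcal L^d$, $\mu^c(E)=0$ for every set $E$ with $\mathcal H^{d-1}(E)<\infty$, and $\mu^j\ll\mathcal H^{d-1}$ concentrated on a set that is $\sigma$-finite with respect to $\mathcal H^{d-1}$. One writes $\operatorname{div}^aV,\operatorname{div}^jV,\operatorname{div}^cV$ for $\mu^a,\mu^j,\mu^c$. A measure is concentrated on a set if it vanishes on the complement. Tangential set. For a bounded $B\in BV(\Omega;\mathbb R^d)$ let $E$ be the set of $x\in\Omega$ such that the finite limit $M(x):=\lim_{r\to0}\frac{DB(B_r(x))}{|DB|(B_r(x))}$ exists (here $(DB)_{ij}=D_jB_i$ is the matrix-valued derivative measure and $B_r(x)$ the ball of radius $r$ at $x$) and the $L^1$ approximate limit $\tilde B(x)$ of $B$ at $x$ exists. The tangential set is $T_B:=\{x\in E: M(x)\cdot\tilde B(x)=0\}$. A point $x$ is an $L^1$ approximate continuity point of $\rho$ if there is a value $\tilde\rho(x)$ (the $L^1$ approximate limit) with $\lim_{\varepsilon\to0}\frac1{|B_\varepsilon(x)|}\int_{B_\varepsilon(x)}|\rho(y)-\tilde\rho(x)|\,dy=0$. *)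

theory Defs
  imports "HOL-Analysis.Analysis"
begin

section \<open>Cells and the patch operation\<close>

datatype quad = Quad "real ^ 2" "real ^ 2" "real ^ 2" "real ^ 2"

text \<open>
  The vertices of a trapezium \<open>ABCD\<close> are listed in cyclic order, so that \<open>AD\<close> and \<open>CB\<close> are
  sides and not diagonals; for parallel bases this means that the vectors from \<open>A\<close> to \<open>B\<close> and
  from \<open>D\<close> to \<open>C\<close> have the same direction (which may be that of \<open>e1\<close> or of \<open>- e1\<close>).
\<close>

fun is_cell :: "real ^ 2 \<Rightarrow> real ^ 2 \<Rightarrow> quad \<Rightarrow> bool" where
  "is_cell e1 e2 (Quad A B C D) \<longleftrightarrow>
     distinct [A, B, C, D] \<and>
     (\<exists>a c. B - A = a *\<^sub>R e1 \<and> C - D = c *\<^sub>R e1 \<and> 0 < a * c) \<and>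
     0 < (D - A) \<bullet> e2 \<and>
     dist C D \<le> dist A B"

fun compressible :: "quad \<Rightarrow> bool" where
  "compressible (Quad A B C D) \<longleftrightarrow> dist C D < dist A B"

fun quad_hull :: "quad \<Rightarrow> (real ^ 2) set" where
  "quad_hull (Quad A B C D) = convex hull {A, B, C, D}"

definition quad_interior :: "quad \<Rightarrow> (real ^ 2) set" where
  "quad_interior q = interior (quad_hull q)"

fun patch :: "quad \<Rightarrow> quad set" where
  "patch (Quad A B C D) =
    (if compressible (Quad A B C D) then
      let E = D + (1/4) *\<^sub>R (C - D); F = D + (2/4) *\<^sub>R (C - D); G = D + (3/4) *\<^sub>R (C - D);
          L = A + (1/4) *\<^sub>R (B - A); M = A + (2/4) *\<^sub>R (B - A); N = A + (3/4) *\<^sub>R (B - A);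
          U = midpoint A D; V = midpoint C B;
          X = U + dist A L *\<^sub>R sgn (V - U);
          Y = X + dist E F *\<^sub>R sgn (V - U);
          Z = Y + dist M N *\<^sub>R sgn (V - U)
      in {Quad A L X U, Quad X Y F E, Quad M N Z Y, Quad Z V C G,
          Quad U X E D, Quad L M Y X, Quad Y Z G F, Quad N B V Z}
     else {Quad A B C D})"

definition patch_set :: "quad set \<Rightarrow> quad set" where
  "patch_set Q = (\<Union>q\<in>Q. patch q)"

definition patch_iter :: "nat \<Rightarrow> quad \<Rightarrow> quad set" where
  "patch_iter n q = (patch_set ^^ n) {q}"

definition S_level :: "quad \<Rightarrow> nat \<Rightarrow> (real ^ 2) set" where
  "S_level q n = (\<Union>q'\<in>{q' \<in> patch_iter n q. compressible q'}. quad_hull q')"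

definition S_limit :: "quad \<Rightarrow> (real ^ 2) set" where
  "S_limit q = (\<Inter>n. S_level q n)"


section \<open>Finite signed and vector-valued Borel measures\<close>

text \<open>
  A finite Radon measure on an open set \<open>\<Omega>\<close> is a set function of which only the values on Borel
  subsets of \<open>\<Omega>\<close> matter. Every finite Borel measure on an open subset of a Euclidean space is
  Radon, and countable additivity with finite values gives finite total variation.
\<close>

abbreviation borel_subsets :: "'a::topological_space set \<Rightarrow> 'a set set" where
  "borel_subsets \<Omega> \<equiv> sets (restrict_space borel \<Omega>)"

definition vector_measure ::
    "'a::topological_space set \<Rightarrow> ('a set \<Rightarrow> 'b::real_normed_vector) \<Rightarrow> bool" where
  "vector_measure \<Omega> \<mu> \<longleftrightarrow>
     (\<forall>A. range A \<subseteq> borel_subsets \<Omega> \<longrightarrow> disjoint_family A \<longrightarrow>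
        (\<lambda>i::nat. \<mu> (A i)) sums \<mu> (\<Union>i. A i))"

definition total_var ::
    "('a::topological_space set \<Rightarrow> 'b::real_normed_vector) \<Rightarrow> 'a set \<Rightarrow> ennreal" where
  "total_var \<mu> E =
     (SUP A \<in> {A :: nat \<Rightarrow> 'a set. range A \<subseteq> sets borel \<and> disjoint_family A \<and> (\<Union>i. A i) = E}.
        \<Sum>i. ennreal (norm (\<mu> (A i))))"

definition var_measure ::
    "'a::topological_space set \<Rightarrow> ('a set \<Rightarrow> 'b::real_normed_vector) \<Rightarrow> 'a measure" where
  "var_measure \<Omega> \<mu> = measure_of \<Omega> (borel_subsets \<Omega>) (total_var \<mu>)"

text \<open>Jordan decomposition: the positive part of \<open>\<mu>\<close> is \<open>(|\<mu>| + \<mu>) / 2\<close>, the negative one \<open>(|\<mu>| - \<mu>) / 2\<close>.\<close>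

definition pos_measure :: "'a::topological_space set \<Rightarrow> ('a set \<Rightarrow> real) \<Rightarrow> 'a measure" where
  "pos_measure \<Omega> \<mu> =
     measure_of \<Omega> (borel_subsets \<Omega>) (\<lambda>E. ennreal ((enn2real (total_var \<mu> E) + \<mu> E) / 2))"

definition signed_integral ::
    "'a::topological_space set \<Rightarrow> ('a set \<Rightarrow> real) \<Rightarrow> ('a \<Rightarrow> real) \<Rightarrow> real" where
  "signed_integral \<Omega> \<mu> f =
     (\<integral>x. f x \<partial>pos_measure \<Omega> \<mu>) - (\<integral>x. f x \<partial>pos_measure \<Omega> (\<lambda>E. - \<mu> E))"

definition concentrated_on ::
    "'a::topological_space set \<Rightarrow> ('a set \<Rightarrow> real) \<Rightarrow> 'a set \<Rightarrow> bool" where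
  "concentrated_on \<Omega> \<mu> S \<longleftrightarrow> (\<forall>E\<in>borel_subsets \<Omega>. E \<inter> S = {} \<longrightarrow> \<mu> E = 0)"

text \<open>
  Hausdorff measure of integer dimension \<open>k\<close>. The factor is the usual normalisation; an empty
  covering set contributes \<open>0\<close> also when \<open>k = 0\<close>. Boundedness is required because
  \<^const>\<open>diameter\<close> is meaningless on unbounded sets.
\<close>

definition hausdorff_measure :: "nat \<Rightarrow> 'a::metric_space set \<Rightarrow> ennreal" where
  "hausdorff_measure k E =
     (SUP \<delta>\<in>{0<..}. INF A \<in> {A :: nat \<Rightarrow> 'a set.
          E \<subseteq> (\<Union>i. A i) \<and> (\<forall>i. bounded (A i) \<and> diameter (A i) \<le> \<delta>)}.
        \<Sum>i. ennreal (unit_ball_vol (real k) / 2 ^ k *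
                     (if A i = {} then 0 else diameter (A i) ^ k)))"

definition hausdorff_sigma_finite :: "nat \<Rightarrow> 'a::metric_space set \<Rightarrow> bool" where
  "hausdorff_sigma_finite k J \<longleftrightarrow>
     (\<exists>A :: nat \<Rightarrow> 'a set. range A \<subseteq> sets borel \<and> J = (\<Union>i. A i) \<and>
        (\<forall>i. hausdorff_measure k (A i) < \<infinity>))"


section \<open>Distributional derivatives, BV and the Cantor part of the divergence\<close>

definition partial_deriv :: "'n::finite \<Rightarrow> (real ^ 'n \<Rightarrow> real) \<Rightarrow> real ^ 'n \<Rightarrow> real" where
  "partial_deriv j f x = frechet_derivative f (at x) (axis j 1)"

primrec C_k :: "nat \<Rightarrow> (real ^ 'n::finite \<Rightarrow> real) \<Rightarrow> bool" where
  "C_k 0 f \<longleftrightarrow> continuous_on UNIV f"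
| "C_k (Suc k) f \<longleftrightarrow> f differentiable_on UNIV \<and> (\<forall>j. C_k k (partial_deriv j f))"

definition test_functions :: "(real ^ 'n::finite) set \<Rightarrow> (real ^ 'n \<Rightarrow> real) set" where
  "test_functions \<Omega> =
     {\<phi>. (\<forall>k. C_k k \<phi>) \<and> compact (closure {x. \<phi> x \<noteq> 0}) \<and> closure {x. \<phi> x \<noteq> 0} \<subseteq> \<Omega>}"

text \<open>\<open>DB E $ i $ j\<close> is the value on \<open>E\<close> of the distributional derivative of \<open>B\<^sub>i\<close> in direction \<open>j\<close>.\<close>

definition is_gradient_measure ::
    "(real ^ 'n::finite) set \<Rightarrow> (real ^ 'n \<Rightarrow> real ^ 'm::finite) \<Rightarrow>
     ((real ^ 'n) set \<Rightarrow> real ^ 'n ^ 'm) \<Rightarrow> bool" where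
  "is_gradient_measure \<Omega> B DB \<longleftrightarrow>
     vector_measure \<Omega> DB \<and>
     (\<forall>\<phi>\<in>test_functions \<Omega>. \<forall>i j.
        (LINT x:\<Omega>|lebesgue. B x $ i * partial_deriv j \<phi> x) =
        - signed_integral \<Omega> (\<lambda>E. DB E $ i $ j) \<phi>)"

definition BV :: "(real ^ 'n::finite) set \<Rightarrow> (real ^ 'n \<Rightarrow> real ^ 'm::finite) set" where
  "BV \<Omega> = {B. set_integrable lebesgue \<Omega> B \<and> (\<exists>DB. is_gradient_measure \<Omega> B DB)}"

definition is_divergence_measure ::
    "(real ^ 'n::finite) set \<Rightarrow> (real ^ 'n \<Rightarrow> real ^ 'n) \<Rightarrow> ((real ^ 'n) set \<Rightarrow> real) \<Rightarrow> bool" where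
  "is_divergence_measure \<Omega> B \<mu> \<longleftrightarrow>
     vector_measure \<Omega> \<mu> \<and>
     (\<forall>\<phi>\<in>test_functions \<Omega>.
        (LINT x:\<Omega>|lebesgue. \<Sum>i\<in>UNIV. B x $ i * partial_deriv i \<phi> x) = - signed_integral \<Omega> \<mu> \<phi>)"

definition divergence_free ::
    "(real ^ 'n::finite) set \<Rightarrow> (real ^ 'n \<Rightarrow> real ^ 'n) \<Rightarrow> bool" where
  "divergence_free \<Omega> B \<longleftrightarrow>
     (\<forall>\<phi>\<in>test_functions \<Omega>.
        (LINT x:\<Omega>|lebesgue. \<Sum>i\<in>UNIV. B x $ i * partial_deriv i \<phi> x) = 0)"

text \<open>
  The decomposition of a measure into absolutely continuous, jump and Cantor part, which is unique
  on Borel subsets of \<open>\<Omega>\<close>. For a signed measure, vanishing on all Borel sets that are null for a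
  positive (outer) measure amounts to the total variation vanishing on them.
\<close>

definition ajc_decomposition ::
    "(real ^ 'n::finite) set \<Rightarrow> ((real ^ 'n) set \<Rightarrow> real) \<Rightarrow> ((real ^ 'n) set \<Rightarrow> real) \<Rightarrow>
     ((real ^ 'n) set \<Rightarrow> real) \<Rightarrow> ((real ^ 'n) set \<Rightarrow> real) \<Rightarrow> bool" where
  "ajc_decomposition \<Omega> \<mu> \<mu>a \<mu>j \<mu>c \<longleftrightarrow>
     vector_measure \<Omega> \<mu>a \<and> vector_measure \<Omega> \<mu>j \<and> vector_measure \<Omega> \<mu>c \<and>
     (\<forall>E\<in>borel_subsets \<Omega>. \<mu> E = \<mu>a E + \<mu>j E + \<mu>c E) \<and>
     (\<forall>E\<in>borel_subsets \<Omega>. emeasure lborel E = 0 \<longrightarrow> \<mu>a E = 0) \<and>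
     (\<exists>N\<in>borel_subsets \<Omega>. emeasure lborel N = 0 \<and> concentrated_on \<Omega> (\<lambda>E. \<mu>j E + \<mu>c E) N) \<and>
     (\<forall>E\<in>borel_subsets \<Omega>. hausdorff_measure (CARD('n) - 1) E < \<infinity> \<longrightarrow> \<mu>c E = 0) \<and>
     (\<forall>E\<in>borel_subsets \<Omega>. hausdorff_measure (CARD('n) - 1) E = 0 \<longrightarrow> \<mu>j E = 0) \<and>
     (\<exists>J\<in>borel_subsets \<Omega>. hausdorff_sigma_finite (CARD('n) - 1) J \<and> concentrated_on \<Omega> \<mu>j J)"

definition is_div_cantor ::
    "(real ^ 'n::finite) set \<Rightarrow> (real ^ 'n \<Rightarrow> real ^ 'n) \<Rightarrow> ((real ^ 'n) set \<Rightarrow> real) \<Rightarrow> bool" where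
  "is_div_cantor \<Omega> B \<mu>c \<longleftrightarrow>
     (\<exists>\<mu> \<mu>a \<mu>j. is_divergence_measure \<Omega> B \<mu> \<and> ajc_decomposition \<Omega> \<mu> \<mu>a \<mu>j \<mu>c)"


section \<open>Approximate limits and the tangential set\<close>

text \<open>Only meaningful for functions that are Lebesgue integrable near \<open>x\<close>.\<close>

definition L1_approx_limit ::
    "('a::euclidean_space \<Rightarrow> 'b::euclidean_space) \<Rightarrow> 'a \<Rightarrow> 'b \<Rightarrow> bool" where
  "L1_approx_limit f x v \<longleftrightarrow>
     ((\<lambda>r. (LINT y:ball x r|lebesgue. norm (f y - v)) / measure lebesgue (ball x r))
        \<longlongrightarrow> 0) (at_right 0)"

definition L1_approx_continuity_point ::
    "('a::euclidean_space \<Rightarrow> 'b::euclidean_space) \<Rightarrow> 'a \<Rightarrow> bool" where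
  "L1_approx_continuity_point f x \<longleftrightarrow> (\<exists>v. L1_approx_limit f x v)"

text \<open>
  The gradient measure is unique on Borel subsets of \<open>\<Omega>\<close>, so it does not matter which one is taken.
  Positivity of \<open>|DB|\<close> on balls is required explicitly because the quotient whose limit
  is \<open>M\<close> is undefined otherwise, whereas division by zero gives \<open>0\<close> here.
\<close>

definition tangential_set ::
    "(real ^ 'n::finite) set \<Rightarrow> (real ^ 'n \<Rightarrow> real ^ 'n) \<Rightarrow> (real ^ 'n) set" where
  "tangential_set \<Omega> B =
     {x \<in> \<Omega>. \<exists>DB M b.
        is_gradient_measure \<Omega> B DB \<and>
        (\<forall>\<^sub>F r in at_right 0. 0 < total_var DB (ball x r)) \<and>
        ((\<lambda>r. DB (ball x r) /\<^sub>R enn2real (total_var DB (ball x r))) \<longlongrightarrow> M) (at_right 0) \<and>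
        L1_approx_limit B x b \<and>
        M *v b = 0}"

end

theory Submission
  imports Defs "HOL-Probability.Probability_Measure"
begin

text \<open>
  Up to an affine map the cell is \<open>{(x, y). 0 < y < 1, 0 < x < 1 - lam * y}\<close> with
  \<open>1 - lam = |CD| / |AB|\<close>. The field is the steady velocity of a flow that enters through the
  lower base and leaves through the upper one, the second coordinate playing the part of time. A
  particle is labelled by its mass coordinate \<open>m\<close> in the unit interval, whose digits in base
  four say in which quarter of the cell of each generation it runs: of the four columns below
  (above) the median two are incompressible strips, and \<open>m = 2 u' + 1/3 - t'\<close>, where \<open>u'\<close>, \<open>t'\<close>
  are the numbers whose base four digits are the binary digits of \<open>u\<close>, \<open>t\<close> (\<open>spread\<close>), encodes
  that the particle is in a compressible cell of every generation exactly at the height \<open>t\<close>, at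
  the crossing point of label \<open>u\<close>. Every particle hence meets \<open>S\<close> once; its width is 1 before
  and \<open>1 - lam\<close> afterwards, so the density \<open>\<rho>\<close> that the flow transports is 1 before and
  \<open>1 / (1 - lam)\<close> after the crossing.

  The position of a particle is \<open>m - lam * drift m y\<close>, where \<open>drift m y\<close> is the amount of mass
  to its left that has crossed before the height \<open>y\<close>. Its horizontal velocity is \<open>- lam * G\<close>,
  with \<open>G x y\<close> the proportion of the crossing points of height \<open>y\<close> lying left of \<open>x\<close>. The field
  is therefore \<open>B = q - lam G p\<close> in the frame of the cell, and transport of \<open>\<rho>\<close> along the
  particle paths gives \<open>div (\<rho> B) = 0\<close> (\<open>divergence_free_coords\<close>): the particle coordinates
  turn the integral of \<open>\<rho> B\<close> against the gradient of a test function into integrals of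
  exact derivatives.

  Let \<open>\<nu>\<close> be the image of Lebesgue measure on the square of all \<open>(u, y)\<close> under the crossing
  map. The \<open>x\<close>-derivative of \<open>G\<close> is \<open>\<nu>\<close>, so that \<open>div B = - lam \<nu>\<close>, up to the Jacobian.
  It lives on the null set \<open>S\<close>, and as crossing points of equal height with labels \<open>u\<close>, \<open>v\<close> are
  \<open>(u - v)\<^sup>2\<close> apart, up to a factor, \<open>\<nu> E\<close> is at most a multiple of
  \<open>(diameter E) powr (3/2)\<close> (\<open>nu_small_sets\<close>). Sets of finite length are thus null, and \<open>div B\<close>
  is purely a Cantor part. For the \<open>y\<close>-derivative, \<open>G\<close> is written as the average over \<open>u\<close> of the
  indicators of the regions right of the crossing curves \<open>xi u\<close>. The sheared curve
  \<open>eta u y = xi u y + lam * u * y\<close> is decreasing, so that its region has a measure as derivative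
  along the direction \<open>(- lam * u, 1)\<close>; in the average, \<open>D\<^sub>y G = lam u \<nu> + J\<close> with a
  positive measure \<open>J\<close> (\<open>integral_G_dy\<close>).

  Almost every height \<open>y\<close> is so badly approximated by dyadic rationals that \<open>spread\<close> is
  differentiable there with derivative zero (\<open>generic_flat\<close>). There \<open>\<nu>\<close> charges balls of
  radius \<open>r\<close> with at least \<open>c * r powr (3/2)\<close> (\<open>nu_ball_lower\<close>), whereas \<open>J\<close> charges them with
  \<open>o(r powr (3/2))\<close> (\<open>level_measure_ball_small\<close>). The polar of \<open>DB\<close> at a crossing point of label
  \<open>u\<close> is thus proportional to \<open>p \<otimes> (dx + lam * u * dy)\<close>, and it annihilates the
  approximate limit \<open>q - lam * u * p\<close> of \<open>B\<close>: the point is in the tangential set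
  (\<open>crossing_tangential\<close>). Finally both binary digits of such a height occur infinitely often;
  depending on the digit of order \<open>n\<close>, a fixed proportion of the disc of radius
  \<open>4\<^sup>-\<^sup>n\<close> about the crossing point is filled by particles that have, or have not,
  crossed yet. So \<open>\<rho>\<close> has no approximate limit there (\<open>dens_oscillation\<close>).
\<close>

section \<open>Binary digits read in base four\<close>

definition digit :: "real \<Rightarrow> int" where
  "digit x = \<lfloor>2 * x\<rfloor> mod 2"

text \<open>
  The binary digits of the argument read in base four; the values lie in a self-similar Cantor
  set.
\<close>

definition spread :: "real \<Rightarrow> real" where
  "spread x = (\<Sum>n. of_int (digit (2 ^ n * x)) / 4 ^ Suc n)"

lemma digit_cases: "digit x = 0 \<or> digit x = 1"
  unfolding digit_def by (metis mod2_eq_if)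

lemma digit_bounds: "0 \<le> real_of_int (digit x)" "real_of_int (digit x) \<le> 1"
  using digit_cases[of x] by auto

lemma digit_unit:
  assumes "0 \<le> x" "x < 1"
  shows "digit x = (if x < 1/2 then 0 else 1)"
proof -
  have "\<lfloor>2 * x\<rfloor> = (if x < 1/2 then 0 else 1)"
    using assms by (auto simp: floor_eq_iff)
  then show ?thesis by (auto simp: digit_def)
qed

lemma digit_add_int: "digit (x + of_int k) = digit x"
proof -
  have "2 * (x + of_int k) = 2 * x + of_int (2 * k)" by simp
  then have "\<lfloor>2 * (x + of_int k)\<rfloor> = \<lfloor>2 * x\<rfloor> + 2 * k"
    by (simp only: floor_add_int)
  then show ?thesis by (simp add: digit_def)
qed

lemma summable_spread: "summable (\<lambda>n. of_int (digit (2 ^ n * x)) / 4 ^ Suc n :: real)"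
proof (rule summable_comparison_test')
  show "summable (\<lambda>n. (1/4::real) ^ Suc n)"
    unfolding power_Suc by (intro summable_mult summable_geometric) auto
  show "norm (of_int (digit (2 ^ n * x)) / 4 ^ Suc n :: real) \<le> (1/4) ^ Suc n" if "0 \<le> n" for n
    using digit_bounds[of "2^n * x"] by (simp add: power_one_over field_simps)
qed

lemma spread_rec: "spread x = (of_int (digit x) + spread (2 * x)) / 4"
proof -
  have "spread x = of_int (digit x) / 4 + (\<Sum>n. of_int (digit (2 ^ Suc n * x)) / 4 ^ Suc (Suc n))"
    unfolding spread_def using suminf_split_head[OF summable_spread[of x]] by simp
  also have "(\<Sum>n. of_int (digit (2 ^ Suc n * x)) / 4 ^ Suc (Suc n) :: real)
      = (\<Sum>n. (1/4) * (of_int (digit (2 ^ n * (2 * x))) / 4 ^ Suc n))"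
    by (intro suminf_cong) (simp add: mult_ac)
  also have "\<dots> = (1/4) * spread (2 * x)"
    unfolding spread_def by (intro suminf_mult summable_spread)
  finally show ?thesis by simp
qed

lemma spread_add_int: "spread (x + of_int k) = spread x"
proof -
  have "digit (2 ^ n * (x + of_int k)) = digit (2 ^ n * x)" for n
  proof -
    have "2 ^ n * (x + of_int k) = 2 ^ n * x + of_int (2 ^ n * k)" by (simp add: algebra_simps)
    then show ?thesis by (simp only: digit_add_int)
  qed
  then show ?thesis by (simp add: spread_def)
qed

lemma spread_lower_half: "0 \<le> x \<Longrightarrow> x < 1/2 \<Longrightarrow> spread x = spread (2 * x) / 4"
  using spread_rec[of x] digit_unit[of x] by simp

lemma spread_upper_half: "1/2 \<le> x \<Longrightarrow> x < 1 \<Longrightarrow> spread x = (1 + spread (2 * x - 1)) / 4"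
  using spread_rec[of x] digit_unit[of x] spread_add_int[of "2*x" "-1"] by simp

lemma spread_nonneg: "0 \<le> spread x"
  unfolding spread_def by (intro suminf_nonneg summable_spread divide_nonneg_nonneg digit_bounds) simp

lemma spread_le: "spread x \<le> 1/3"
proof -
  have s: "(\<lambda>n. (1/4::real) ^ Suc n) sums (1/3)"
    using sums_mult[OF geometric_sums[of "1/4::real"], of "1/4"] by simp
  have "spread x \<le> (\<Sum>n. (1/4::real) ^ Suc n)"
    unfolding spread_def
  proof (rule suminf_le[OF _ summable_spread])
    show "summable (\<lambda>n. (1/4::real) ^ Suc n)" using s by (rule sums_summable)
    show "of_int (digit (2 ^ n * x)) / 4 ^ Suc n \<le> (1/4::real) ^ Suc n" for n
      using digit_bounds[of "2^n * x"] by (simp add: power_one_over field_simps)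
  qed
  then show ?thesis using s by (simp add: sums_iff)
qed

lemma spread_measurable [measurable]: "spread \<in> borel_measurable borel"
  unfolding spread_def digit_def by measurable

text \<open>
  The largest dyadic scale separating \<open>u\<close> from \<open>v\<close> governs the increment: the first differing
  digit, of order \<open>n\<close>, contributes \<open>4\<^sup>-\<^sup>n\<close>, which later digits cannot cancel. The
  induction is on a scale below which the two points are certainly separated.
\<close>

lemma spread_quadratic_aux:
  "0 \<le> u \<Longrightarrow> u < v \<Longrightarrow> v < 1 \<Longrightarrow> (1/2) ^ n \<le> v - u \<Longrightarrow> (v - u)\<^sup>2 / 6 \<le> spread v - spread u"
proof (induction n arbitrary: u v)
  case 0
  then show ?case by simp
next
  case (Suc n)
  consider "v < 1/2" | "1/2 \<le> u" | "u < 1/2" "1/2 \<le> v" by linarith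
  then show ?case
  proof cases
    case 1
    have "(2 * v - 2 * u)\<^sup>2 / 6 \<le> spread (2 * v) - spread (2 * u)"
      using Suc.prems 1 by (intro Suc.IH) auto
    moreover have "(2 * v - 2 * u)\<^sup>2 = 4 * (v - u)\<^sup>2" by (simp add: power2_eq_square algebra_simps)
    ultimately show ?thesis
      using spread_lower_half[of u] spread_lower_half[of v] 1 Suc.prems by simp
  next
    case 2
    have "((2 * v-1) - (2 * u-1))\<^sup>2 / 6 \<le> spread (2 * v-1) - spread (2 * u-1)"
      using Suc.prems 2 by (intro Suc.IH) auto
    moreover have "((2 * v-1) - (2 * u-1))\<^sup>2 = 4 * (v - u)\<^sup>2" by (simp add: power2_eq_square algebra_simps)
    ultimately show ?thesis
      using spread_upper_half[of u] spread_upper_half[of v] 2 Suc.prems by simp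
  next
    case 3
    have "spread v - spread u \<ge> 1/6"
      using spread_lower_half[of u] spread_upper_half[of v] 3 Suc.prems
        spread_le[of "2 * u"] spread_nonneg[of "2 * v-1"] by simp
    moreover have "(v - u)\<^sup>2 \<le> 1" using Suc.prems by (simp add: abs_square_le_1)
    ultimately show ?thesis by linarith
  qed
qed

lemma spread_quadratic:
  assumes "0 \<le> u" "u \<le> v" "v < 1"
  shows "(v - u)\<^sup>2 / 6 \<le> spread v - spread u"
proof (cases "u = v")
  case False
  obtain n where "(1/2) ^ n < v - u" using real_arch_pow_inv[of "v-u" "1/2"] False assms by auto
  then show ?thesis using spread_quadratic_aux[of u v n] False assms by auto
qed simp

lemma spread_strict_mono:
  assumes "0 \<le> u" "u < v" "v < 1"
  shows "spread u < spread v"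
proof -
  have "0 < (v - u)\<^sup>2 / 6" using assms by simp
  moreover have "(v - u)\<^sup>2 / 6 \<le> spread v - spread u" using spread_quadratic[of u v] assms by simp
  ultimately show ?thesis by linarith
qed

lemma spread_mono: "0 \<le> u \<Longrightarrow> u \<le> v \<Longrightarrow> v < 1 \<Longrightarrow> spread u \<le> spread v"
  using spread_strict_mono[of u v] by (cases "u = v") auto

lemma spread_less: "spread x < 1/3"
proof -
  have eq: "spread x = spread (frac x)"
    using spread_add_int[of "frac x" "\<lfloor>x\<rfloor>"] by (simp add: frac_def)
  have f: "0 \<le> frac x" "frac x < 1" by (auto simp: frac_lt_1)
  have "spread (frac x) < spread ((frac x + 1) / 2)"
    using f by (intro spread_strict_mono) auto
  then show ?thesis using spread_le[of "(frac x + 1)/2"] eq by simp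
qed

lemma floor_half_eq:
  fixes x y :: real
  assumes "\<lfloor>2 ^ Suc n * x\<rfloor> = \<lfloor>2 ^ Suc n * y\<rfloor>"
  shows "\<lfloor>2 ^ n * x\<rfloor> = \<lfloor>2 ^ n * y\<rfloor>"
proof -
  have *: "\<lfloor>2 ^ n * z\<rfloor> = \<lfloor>2 ^ Suc n * z\<rfloor> div 2" for z :: real
    using floor_divide_real_eq_div[of 2 "2 ^ Suc n * z"] by simp
  show ?thesis using * assms by metis
qed

lemma floor_level_mono:
  fixes x y :: real
  assumes "\<lfloor>2 ^ n * x\<rfloor> = \<lfloor>2 ^ n * y\<rfloor>" "k \<le> n"
  shows "\<lfloor>2 ^ k * x\<rfloor> = \<lfloor>2 ^ k * y\<rfloor>"
  using assms(2,1)
proof (induction rule: inc_induct)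
  case (step m)
  then show ?case using floor_half_eq[of m x y] by blast
qed

lemma spread_same_level:
  "\<lfloor>2 ^ n * x\<rfloor> = \<lfloor>2 ^ n * y\<rfloor> \<Longrightarrow> \<bar>spread x - spread y\<bar> \<le> (1/4) ^ n / 3"
proof (induction n arbitrary: x y)
  case 0
  have "\<bar>spread x - spread y\<bar> \<le> 1/3"
    using spread_nonneg[of x] spread_nonneg[of y] spread_le[of x] spread_le[of y] by linarith
  then show ?case by simp
next
  case (Suc n)
  have "\<lfloor>2 ^ 1 * x\<rfloor> = \<lfloor>2 ^ 1 * y\<rfloor>" using floor_level_mono[OF Suc.prems, of 1] by simp
  then have b: "digit x = digit y" by (simp add: digit_def)
  have "\<bar>spread (2*x) - spread (2*y)\<bar> \<le> (1/4) ^ n / 3"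
    using Suc.prems by (intro Suc.IH) (simp add: mult_ac)
  moreover have "spread x - spread y = (spread (2*x) - spread (2*y)) / 4"
    using spread_rec[of x] spread_rec[of y] b by simp
  ultimately show ?case by (simp add: abs_if split: if_splits)
qed

section \<open>The mass coordinate\<close>

text \<open>
  As \<open>1/3 = 0.111...\<close> in base four, the digits of the mass are \<open>2 * u\<^sub>n + 1 - t\<^sub>n\<close>,
  where \<open>u\<^sub>n\<close> and \<open>t\<^sub>n\<close> are binary digits. They run over 0, 1, 2, 3 bijectively, so
  that labels and crossing heights parametrize the unit interval of masses.
\<close>

definition mass :: "real \<Rightarrow> real \<Rightarrow> real" where
  "mass u t = 2 * spread u + 1/3 - spread t"

lemma mass_rec: "mass u t = (2 * of_int (digit u) + 1 - of_int (digit t) + mass (2 * u) (2*t)) / 4"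
  unfolding mass_def using spread_rec[of u] spread_rec[of t] by simp

lemma mass_pos: "0 < mass u t" and mass_less_1: "mass u t < 1"
  using spread_nonneg[of u] spread_nonneg[of t] spread_less[of u] spread_less[of t]
  by (auto simp: mass_def)

lemma mass_measurable [measurable]: "(\<lambda>z. mass (fst z) (snd z)) \<in> borel_measurable (borel \<Otimes>\<^sub>M borel)"
  unfolding mass_def by measurable

text \<open>
  A digit of the mass is even exactly if the corresponding digit of the crossing height is 1, so
  that the mass determines the spread of this height. As \<open>spread\<close> is strictly increasing,
  spreads suffice for comparing heights.
\<close>

definition crossing_spread :: "real \<Rightarrow> real" where
  "crossing_spread m = (\<Sum>n. of_int (1 - \<lfloor>4 ^ Suc n * m\<rfloor> mod 2) / 4 ^ Suc n)"

lemma crossing_spread_measurable [measurable]: "crossing_spread \<in> borel_measurable borel"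
  unfolding crossing_spread_def by measurable

lemma mass_digit: "\<lfloor>4 ^ Suc n * mass u t\<rfloor> mod 2 = 1 - digit (2 ^ n * t)"
proof (induction n arbitrary: u t)
  case 0
  have "4 * mass u t = mass (2 * u) (2*t) + of_int (2 * digit u + 1 - digit t)"
    using mass_rec[of u t] by simp
  then have "\<lfloor>4 * mass u t\<rfloor> = \<lfloor>mass (2 * u) (2*t)\<rfloor> + (2 * digit u + 1 - digit t)"
    by (simp only: floor_add_int)
  moreover have "\<lfloor>mass (2 * u) (2*t)\<rfloor> = 0"
    using mass_pos[of "2 * u" "2*t"] mass_less_1[of "2 * u" "2*t"] by (simp add: floor_eq_iff)
  ultimately have "\<lfloor>4 * mass u t\<rfloor> = 2 * digit u + 1 - digit t" by simp
  then show ?case using digit_cases[of u] digit_cases[of t] by auto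
next
  case (Suc n)
  have "4 ^ Suc (Suc n) * mass u t
      = 4 ^ Suc n * mass (2 * u) (2*t) + of_int (2 * (2 * 4 ^ n * (2 * digit u + 1 - digit t)))"
  proof -
    have "4 ^ Suc (Suc n) * mass u t = 4 ^ Suc n * (4 * mass u t)" by simp
    also have "4 * mass u t = 2 * of_int (digit u) + 1 - of_int (digit t) + mass (2 * u) (2*t)"
      using mass_rec[of u t] by simp
    finally show ?thesis by (simp add: algebra_simps)
  qed
  then have "\<lfloor>4 ^ Suc (Suc n) * mass u t\<rfloor>
      = \<lfloor>4 ^ Suc n * mass (2 * u) (2*t)\<rfloor> + 2 * (2 * 4 ^ n * (2 * digit u + 1 - digit t))"
    by (simp only: floor_add_int)
  then have "\<lfloor>4 ^ Suc (Suc n) * mass u t\<rfloor> mod 2 = \<lfloor>4 ^ Suc n * mass (2 * u) (2*t)\<rfloor> mod 2"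
    by (simp only: mod_mult_self2)
  then show ?case using Suc.IH[of "2 * u" "2*t"] by (simp add: mult_ac)
qed

lemma crossing_spread_mass: "crossing_spread (mass u t) = spread t"
  by (simp add: crossing_spread_def spread_def mass_digit del: power_Suc)

section \<open>Integration over the unit interval\<close>

text \<open>
  The half-open interval is the natural domain of \<open>spread\<close>, which has period 1.
\<close>

definition U :: "real measure" where
  "U = density lborel (\<lambda>x. ennreal (indicator {0..<1} x))"

lemma sets_U [simp, measurable_cong]: "sets U = sets borel"
  and space_U [simp]: "space U = UNIV"
  by (auto simp: U_def)

interpretation U: prob_space U
proof
  have "emeasure U (space U) = (\<integral>\<^sup>+x. indicator {0..<1} x \<partial>(lborel::real measure))"
    unfolding U_def by (subst emeasure_density) (auto simp: ennreal_indicator)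
  then show "emeasure U (space U) = 1" by simp
qed

interpretation UU: pair_prob_space U U ..

lemma integral_U:
  fixes f :: "real \<Rightarrow> real"
  assumes [measurable]: "f \<in> borel_measurable borel"
  shows "(\<integral>x. f x \<partial>U) = (\<integral>x. indicator {0..<1} x * f x \<partial>lborel)"
  unfolding U_def by (subst integral_density) auto

lemma AE_U_unit: "AE x in U. 0 \<le> x \<and> x < 1"
  unfolding U_def by (subst AE_density) (auto simp: indicator_def)

lemma integral_U_cong:
  fixes f :: "real \<Rightarrow> real"
  assumes "f \<in> borel_measurable borel" "g \<in> borel_measurable borel"
    "\<And>x. 0 \<le> x \<Longrightarrow> x < 1 \<Longrightarrow> f x = g x"
  shows "(\<integral>x. f x \<partial>U) = (\<integral>x. g x \<partial>U)"
  using assms by (auto simp: integral_U indicator_def intro!: Bochner_Integration.integral_cong)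

lemma integrable_U:
  fixes f :: "real \<Rightarrow> real"
  assumes [measurable]: "f \<in> borel_measurable borel" and "\<And>x. \<bar>f x\<bar> \<le> K"
  shows "integrable U f"
  using assms by (intro U.integrable_const_bound[where B=K]) auto

lemma integral_U_half:
  fixes f :: "real \<Rightarrow> real"
  assumes [measurable]: "f \<in> borel_measurable borel" and K: "\<And>x. \<bar>f x\<bar> \<le> K"
  shows "(\<integral>x. f x \<partial>U) = ((\<integral>x. f (x / 2) \<partial>U) + (\<integral>x. f ((1 + x) / 2) \<partial>U)) / 2"
proof -
  have 1: "(\<integral>x. f (x / 2) \<partial>U) = 2 * (\<integral>x. indicator {0..<1/2} x * f x \<partial>lborel)"
    by (subst integral_U, simp, subst lborel_integral_real_affine[where c=2 and t=0])
      (auto simp: indicator_def intro!: Bochner_Integration.integral_cong)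
  have 2: "(\<integral>x. f ((1 + x) / 2) \<partial>U) = 2 * (\<integral>x. indicator {1/2..<1} x * f x \<partial>lborel)"
    by (subst integral_U, simp, subst lborel_integral_real_affine[where c=2 and t="-1"])
      (auto simp: indicator_def intro!: Bochner_Integration.integral_cong)
  have int: "integrable lborel (\<lambda>x. indicator A x * f x)" 
    if "A \<subseteq> {0..<1}" and [measurable]: "A \<in> sets borel" for A
  proof -
    have "integrable U (\<lambda>x. indicator A x * f x)"
      using order_trans[OF abs_ge_zero K]
      by (intro integrable_U[where K=K]) (auto simp: indicator_def K)
    then have "integrable lborel (\<lambda>x. indicator {0..<1} x *\<^sub>R (indicator A x * f x))"
      unfolding U_def by (subst (asm) integrable_density) auto
    moreover have "(\<lambda>x. indicator {0..<1} x *\<^sub>R (indicator A x * f x)) = (\<lambda>x. indicator A x * f x)"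
      using that by (auto simp: indicator_def fun_eq_iff)
    ultimately show ?thesis by (simp only:)
  qed
  have "(\<integral>x. f x \<partial>U) = (\<integral>x. indicator {0..<1/2} x * f x + indicator {1/2..<1} x * f x \<partial>lborel)"
    by (subst integral_U) (auto simp: indicator_def intro!: Bochner_Integration.integral_cong)
  also have "\<dots> = (\<integral>x. indicator {0..<1/2} x * f x \<partial>lborel) + (\<integral>x. indicator {1/2..<1} x * f x \<partial>lborel)"
    by (intro Bochner_Integration.integral_add int) auto
  finally show ?thesis using 1 2 by simp
qed

lemma integral_U_interval:
  assumes "0 \<le> a" "a \<le> b" "b \<le> 1"
  shows "(\<integral>x. (if a \<le> x \<and> x < b then 1 else 0 :: real) \<partial>U) = b - a"
proof -
  have "(\<integral>x. (if a \<le> x \<and> x < b then 1 else 0 :: real) \<partial>U) = (\<integral>x. indicator {a..<b} x \<partial>lborel)"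
  proof -
    have "(\<lambda>x. indicator {0..<1} x * (if a \<le> x \<and> x < b then 1 else 0)) = indicat_real {a..<b}"
      using assms by (auto simp: fun_eq_iff indicator_def)
    then show ?thesis by (subst integral_U) (simp_all only:, measurable)
  qed
  also have "\<dots> = b - a" using assms by simp
  finally show ?thesis .
qed

lemma U_mono:
  fixes f :: "real \<Rightarrow> real"
  assumes "f \<in> borel_measurable borel" "g \<in> borel_measurable borel"
    "\<And>x. \<bar>f x\<bar> \<le> K" "\<And>x. \<bar>g x\<bar> \<le> K"
    "\<And>x. 0 \<le> x \<Longrightarrow> x < 1 \<Longrightarrow> f x \<le> g x"
  shows "(\<integral>x. f x \<partial>U) \<le> (\<integral>x. g x \<partial>U)"
  using assms AE_U_unit by (intro integral_mono_AE integrable_U[where K=K]) auto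

section \<open>Labels as a function of mass\<close>

text \<open>
  Among the crossing points of height \<open>t\<close>, ordered by mass, the proportion of those up to the
  mass \<open>m\<close>.
\<close>

definition label_cdf :: "real \<Rightarrow> real \<Rightarrow> real" where
  "label_cdf m t = (\<integral>u. (if mass u t \<le> m then 1 else 0) \<partial>U)"

lemma mass_measurable' [measurable (raw)]:
  assumes [measurable]: "f \<in> borel_measurable M" "g \<in> borel_measurable M"
  shows "(\<lambda>x. mass (f x) (g x)) \<in> borel_measurable M"
  unfolding mass_def by measurable

lemma label_cdf_measurable_pair [measurable]: "(\<lambda>z. label_cdf (fst z) (snd z)) \<in> borel_measurable (borel \<Otimes>\<^sub>M borel)"
  unfolding label_cdf_def by measurable

lemma label_cdf_measurable [measurable (raw)]:
  assumes [measurable]: "f \<in> borel_measurable M" "g \<in> borel_measurable M"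
  shows "(\<lambda>x. label_cdf (f x) (g x)) \<in> borel_measurable M"
proof -
  have "(\<lambda>x. label_cdf (fst (f x, g x)) (snd (f x, g x))) \<in> borel_measurable M"
    by (rule measurable_compose[OF _ label_cdf_measurable_pair]) measurable
  then show ?thesis by simp
qed

lemma label_cdf_bounds: "0 \<le> label_cdf m t" "label_cdf m t \<le> 1"
proof -
  show "0 \<le> label_cdf m t" unfolding label_cdf_def by (intro integral_nonneg_AE) auto
  have "label_cdf m t \<le> (\<integral>u. 1 \<partial>U)" unfolding label_cdf_def
    by (intro U_mono[where K=1]) auto
  then show "label_cdf m t \<le> 1" using U.prob_space by simp
qed

lemma label_cdf_abs: "\<bar>label_cdf m t\<bar> \<le> 1" using label_cdf_bounds[of m t] by simp

lemma label_cdf_eq_0: "m \<le> 0 \<Longrightarrow> label_cdf m t = 0"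
proof -
  assume "m \<le> 0"
  then have "\<not> mass u t \<le> m" for u using mass_pos[of u t] by linarith
  then show ?thesis by (simp add: label_cdf_def)
qed

lemma label_cdf_eq_1: "1 \<le> m \<Longrightarrow> label_cdf m t = 1"
proof -
  assume "1 \<le> m"
  then have "mass u t \<le> m" for u using mass_less_1[of u t] by linarith
  then show ?thesis using U.prob_space by (simp add: label_cdf_def)
qed

lemma label_cdf_mono:
  assumes "m \<le> m'" "spread t \<le> spread t'"
  shows "label_cdf m t \<le> label_cdf m' t'"
  unfolding label_cdf_def using assms by (intro U_mono[where K=1]) (auto simp: mass_def)

lemma label_cdf_le:
  assumes "0 \<le> v" "v < 1" "m < mass v t"
  shows "label_cdf m t \<le> v"
proof -
  have "label_cdf m t \<le> (\<integral>u. (if 0 \<le> u \<and> u < v then 1 else 0) \<partial>U)" unfolding label_cdf_def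
  proof (intro U_mono[where K=1])
    fix u :: real assume u: "0 \<le> u" "u < 1"
    show "(if mass u t \<le> m then 1 else 0) \<le> (if 0 \<le> u \<and> u < v then 1 else (0::real))"
      using assms u spread_mono[of v u] by (cases "v \<le> u") (auto simp: mass_def)
  qed auto
  then show ?thesis using integral_U_interval[of 0 v] assms by simp
qed

lemma label_cdf_ge:
  assumes "0 \<le> v" "v < 1" "mass v t \<le> m"
  shows "v \<le> label_cdf m t"
proof -
  have "(\<integral>u. (if 0 \<le> u \<and> u < v then 1 else 0) \<partial>U) \<le> label_cdf m t" unfolding label_cdf_def
  proof (intro U_mono[where K=1])
    fix u :: real assume u: "0 \<le> u" "u < 1"
    show "(if 0 \<le> u \<and> u < v then 1 else 0) \<le> (if mass u t \<le> m then 1 else (0::real))"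
      using assms u spread_mono[of u v] by (auto simp: mass_def)
  qed auto
  then show ?thesis using integral_U_interval[of 0 v] assms by simp
qed

lemma label_cdf_mass:
  assumes "0 \<le> u" "u < 1"
  shows "label_cdf (mass u t) t = u"
proof (rule antisym)
  show "u \<le> label_cdf (mass u t) t" using assms by (intro label_cdf_ge) auto
  show "label_cdf (mass u t) t \<le> u"
  proof (rule field_le_epsilon)
    fix e :: real assume e: "0 < e"
    \<comment> \<open>slightly larger than \<open>u\<close>, but still less than 1\<close>
    define v where "v = min (u + e) ((u + 1) / 2)"
    have v: "u < v" "v < 1" "v \<le> u + e" using assms e by (auto simp: v_def min_def)
    then have "label_cdf (mass u t) t \<le> v"
      using assms spread_strict_mono[of u v] by (intro label_cdf_le) (auto simp: mass_def)
    then show "label_cdf (mass u t) t \<le> u + e" using v by simp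
  qed
qed

lemma label_cdf_holder_aux:
  assumes "label_cdf m t < label_cdf m' t'"
  shows "(label_cdf m' t' - label_cdf m t)\<^sup>2 \<le> 3 * (m' - m + spread t' - spread t)"
proof (rule ccontr)
  let ?a = "label_cdf m t" and ?b = "label_cdf m' t'" and ?R = "3 * (m' - m + spread t' - spread t)"
  assume "\<not> ?thesis"
  then have c: "?R < (?b - ?a)\<^sup>2" by simp
  \<comment> \<open>a slightly smaller gap that still violates the claim\<close>
  obtain d where d: "0 < d" "d < ?b - ?a" "?R < d\<^sup>2"
  proof -
    have "sqrt (max 0 ?R) < ?b - ?a"
      using c assms by (intro real_less_lsqrt) auto
    then obtain d where "sqrt (max 0 ?R) < d" "d < ?b - ?a" using dense by blast
    moreover from this have "0 < d" by (meson le_less_trans max.cobounded1 real_sqrt_ge_zero)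
    moreover from calculation have "max 0 ?R < d\<^sup>2" by (metis real_less_rsqrt real_sqrt_less_iff real_sqrt_unique less_imp_le)
    ultimately show ?thesis using that by simp
  qed
  define u where "u = ?a + (?b - ?a - d) / 2"
  have u: "?a < u" "u + d < ?b" using d by (auto simp: u_def field_simps)
  have u01: "0 \<le> u" "u + d < 1" using u label_cdf_bounds[of m t] label_cdf_bounds[of m' t'] by auto
  have 1: "m < mass u t" using label_cdf_ge[of u t m] u u01 d by fastforce
  have 2: "mass (u + d) t' \<le> m'" using label_cdf_le[of "u+d" m' t'] u u01 d by fastforce
  have "d\<^sup>2 / 6 \<le> spread (u + d) - spread u" using spread_quadratic[of u "u+d"] u01 d by simp
  then show False using 1 2 d by (simp add: mass_def)
qed

text \<open>
  The inverse function \<open>u \<mapsto> mass u t\<close> expands distances at least quadratically, hence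
  the square root modulus of continuity in the mass; a change of the height translates the
  inverse by a difference of spreads.
\<close>

lemma label_cdf_holder: "(label_cdf m t - label_cdf m' t')\<^sup>2 \<le> 3 * (\<bar>m - m'\<bar> + \<bar>spread t - spread t'\<bar>)"
proof (cases "label_cdf m t" "label_cdf m' t'" rule: linorder_cases)
  case less
  have "m' - m + spread t' - spread t \<le> \<bar>m - m'\<bar> + \<bar>spread t - spread t'\<bar>" by linarith
  then show ?thesis using label_cdf_holder_aux[OF less] by (simp add: power2_commute)
next
  case greater
  have "m - m' + spread t - spread t' \<le> \<bar>m - m'\<bar> + \<bar>spread t - spread t'\<bar>" by linarith
  then show ?thesis using label_cdf_holder_aux[OF greater] by simp
qed simp

lemma mass_halves:
  assumes "0 \<le> u" "u < 1" "0 \<le> t" "t < 1"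
  shows "mass (u/2) (t/2) = (1 + mass u t) / 4"
    "mass ((1+u)/2) (t/2) = (3 + mass u t) / 4"
    "mass (u/2) ((1+t)/2) = (mass u t) / 4"
    "mass ((1+u)/2) ((1+t)/2) = (2 + mass u t) / 4"
proof -
  have l: "spread (z/2) = spread z / 4" and h: "spread ((1+z)/2) = (1 + spread z) / 4"
    if "0 \<le> z" "z < 1" for z
    proof -
    have e: "2 * ((1+z)/2) - 1 = z" by (simp add: field_simps)
    show "spread (z/2) = spread z / 4" using spread_lower_half[of "z/2"] that by auto
    show "spread ((1+z)/2) = (1 + spread z) / 4" using spread_upper_half[of "(1+z)/2"] that unfolding e by auto
  qed
  show "mass (u/2) (t/2) = (1 + mass u t) / 4"
    "mass ((1+u)/2) (t/2) = (3 + mass u t) / 4"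
    "mass (u/2) ((1+t)/2) = (mass u t) / 4"
    "mass ((1+u)/2) ((1+t)/2) = (2 + mass u t) / 4"
    using assms by (simp_all add: mass_def l h field_simps)
qed

lemma label_cdf_halves:
  assumes "0 \<le> t" "t < 1"
  shows "label_cdf m (t/2) = (label_cdf (4*m-1) t + label_cdf (4*m-3) t) / 2"
    "label_cdf m ((1+t)/2) = (label_cdf (4*m) t + label_cdf (4*m-2) t) / 2"
proof -
  have "label_cdf m (t/2) = ((\<integral>u. (if mass (u/2) (t/2) \<le> m then 1 else 0) \<partial>U)
      + (\<integral>u. (if mass ((1+u)/2) (t/2) \<le> m then 1 else 0) \<partial>U)) / 2"
    unfolding label_cdf_def by (subst integral_U_half[where K=1]) auto
  also have "(\<integral>u. (if mass (u/2) (t/2) \<le> m then 1 else 0) \<partial>U) = label_cdf (4*m-1) t"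
    unfolding label_cdf_def using assms by (intro integral_U_cong) (auto simp: mass_halves)
  also have "(\<integral>u. (if mass ((1+u)/2) (t/2) \<le> m then 1 else 0) \<partial>U) = label_cdf (4*m-3) t"
    unfolding label_cdf_def using assms by (intro integral_U_cong) (auto simp: mass_halves)
  finally show "label_cdf m (t/2) = (label_cdf (4*m-1) t + label_cdf (4*m-3) t) / 2" .
  have "label_cdf m ((1+t)/2) = ((\<integral>u. (if mass (u/2) ((1+t)/2) \<le> m then 1 else 0) \<partial>U)
      + (\<integral>u. (if mass ((1+u)/2) ((1+t)/2) \<le> m then 1 else 0) \<partial>U)) / 2"
    unfolding label_cdf_def by (subst integral_U_half[where K=1]) auto
  also have "(\<integral>u. (if mass (u/2) ((1+t)/2) \<le> m then 1 else 0) \<partial>U) = label_cdf (4*m) t"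
    unfolding label_cdf_def using assms by (intro integral_U_cong) (auto simp: mass_halves)
  also have "(\<integral>u. (if mass ((1+u)/2) ((1+t)/2) \<le> m then 1 else 0) \<partial>U) = label_cdf (4*m-2) t"
    unfolding label_cdf_def using assms by (intro integral_U_cong) (auto simp: mass_halves)
  finally show "label_cdf m ((1+t)/2) = (label_cdf (4*m) t + label_cdf (4*m-2) t) / 2" .
qed

definition clamp01 :: "real \<Rightarrow> real" where "clamp01 m = max 0 (min 1 m)"

text \<open>
  Halving \<open>u\<close> and \<open>t\<close> shifts the base four digits of the mass, and the four choices of first
  digits are equally likely.
\<close>

lemma integral_label_cdf_halves:
  "(\<integral>t. label_cdf m t \<partial>U) = ((\<integral>t. label_cdf (4*m) t \<partial>U) + (\<integral>t. label_cdf (4*m-1) t \<partial>U) + (\<integral>t. label_cdf (4*m-2) t \<partial>U) + (\<integral>t. label_cdf (4*m-3) t \<partial>U)) / 4"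
proof -
  have i: "integrable U (label_cdf k)" for k by (intro integrable_U[where K=1]) (auto simp: label_cdf_abs)
  have "(\<integral>t. label_cdf m t \<partial>U) = ((\<integral>t. label_cdf m (t/2) \<partial>U) + (\<integral>t. label_cdf m ((1+t)/2) \<partial>U)) / 2"
    by (intro integral_U_half[where K=1]) (auto simp: label_cdf_abs)
  also have "(\<integral>t. label_cdf m (t/2) \<partial>U) = (\<integral>t. (label_cdf (4*m-1) t + label_cdf (4*m-3) t) / 2 \<partial>U)"
    by (intro integral_U_cong) (auto simp: label_cdf_halves)
  also have "(\<integral>t. label_cdf m ((1+t)/2) \<partial>U) = (\<integral>t. (label_cdf (4*m) t + label_cdf (4*m-2) t) / 2 \<partial>U)"
    by (intro integral_U_cong) (auto simp: label_cdf_halves)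
  finally show ?thesis using i by (simp add: field_simps)
qed

text \<open>
  The mass of a random pair \<open>(u, t)\<close> is uniformly distributed. Both sides satisfy the same
  self-similarity relation, in which for each mass at most one of the four terms is not forced
  to be 0 or 1. So their largest distance is at most a quarter of itself.
\<close>

lemma integral_label_cdf: "(\<integral>t. label_cdf m t \<partial>U) = clamp01 m"
proof -
  define F where "F m = (\<integral>t. label_cdf m t \<partial>U)" for m
  have F0: "F m = 0" if "m \<le> 0" for m using that by (simp add: F_def label_cdf_eq_0)
  have F1: "F m = 1" if "1 \<le> m" for m using that U.prob_space by (simp add: F_def label_cdf_eq_1)
  have Frec: "F m = (F (4*m) + F (4*m-1) + F (4*m-2) + F (4*m-3)) / 4" for m
    unfolding F_def by (rule integral_label_cdf_halves)
  have Fb: "0 \<le> F m" "F m \<le> 1" for m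
  proof -
    show "0 \<le> F m" unfolding F_def by (intro integral_nonneg_AE) (auto simp: label_cdf_bounds)
    have "F m \<le> (\<integral>u. 1 \<partial>U)" unfolding F_def
      by (intro U_mono[where K=1]) (auto simp: label_cdf_bounds label_cdf_abs)
    then show "F m \<le> 1" using U.prob_space by simp
  qed
  have approx: "\<bar>F m - clamp01 m\<bar> \<le> (1/4)^n" for n
  proof (induction n arbitrary: m)
    case 0
    then show ?case using Fb[of m] by (auto simp: clamp01_def)
  next
    case (Suc n)
    have e: "F k = (if k \<le> 0 then 0 else if 1 \<le> k then 1 else F k)" for k
      using F0 F1 by auto
    have c: "\<bar>F k - k\<bar> \<le> (1/4)^n" if "0 < k" "k < 1" for k
      using Suc.IH[of k] that by (auto simp: clamp01_def)
    have z: "0 \<le> (1/4::real)^n" by simp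
    consider "m \<le> 0" | "1 \<le> m" | "0 < m" "m < 1/4" | "m = 1/4" | "1/4 < m" "m < 1/2" | "m = 1/2"
      | "1/2 < m" "m < 3/4" | "m = 3/4" | "3/4 < m" "m < 1" by linarith
    then have "\<bar>F m - clamp01 m\<bar> \<le> (1/4)^n / 4"
    proof cases
      case 3
      then show ?thesis using Frec[of m] F0[of "4*m-1"] F0[of "4*m-2"] F0[of "4*m-3"] c[of "4*m"]
        by (simp add: clamp01_def abs_if split: if_splits)
    next
      case 5
      then show ?thesis using Frec[of m] F1[of "4*m"] F0[of "4*m-2"] F0[of "4*m-3"] c[of "4*m-1"]
        by (simp add: clamp01_def abs_if split: if_splits)
    next
      case 7
      then show ?thesis using Frec[of m] F1[of "4*m"] F1[of "4*m-1"] F0[of "4*m-3"] c[of "4*m-2"]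
        by (simp add: clamp01_def abs_if split: if_splits)
    next
      case 9
      then show ?thesis using Frec[of m] F1[of "4*m"] F1[of "4*m-1"] F1[of "4*m-2"] c[of "4*m-3"]
        by (simp add: clamp01_def abs_if split: if_splits)
    next
      case 1
      then have "F m = clamp01 m" by (auto simp: clamp01_def F0)
      then show ?thesis by simp
    next
      case 2
      then have "F m = clamp01 m" by (auto simp: clamp01_def F1)
      then show ?thesis by simp
    next
      case 4
      then have "F m = clamp01 m" using Frec[of m] by (auto simp: clamp01_def F0 F1)
      then show ?thesis by simp
    next
      case 6
      then have "F m = clamp01 m" using Frec[of m] by (auto simp: clamp01_def F0 F1)
      then show ?thesis by simp
    next
      case 8
      then have "F m = clamp01 m" using Frec[of m] by (auto simp: clamp01_def F0 F1)
      then show ?thesis by simp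
    qed
    then show ?case by simp
  qed
  have "F m = clamp01 m"
  proof (rule ccontr)
    assume "F m \<noteq> clamp01 m"
    then obtain n where "(1/4)^n < \<bar>F m - clamp01 m\<bar>"
      using real_arch_pow_inv[of "\<bar>F m - clamp01 m\<bar>" "1/4"] by auto
    then show False using approx[of n] by simp
  qed
  then show ?thesis by (simp add: F_def)
qed

section \<open>The drift of the particles\<close>

text \<open>
  By \<open>integral_label_cdf\<close>, this is the part of the mass up to \<open>m\<close> whose crossing height is less
  than \<open>y\<close>.
\<close>

definition drift :: "real \<Rightarrow> real \<Rightarrow> real" where
  "drift m y = (\<integral>t. (if t < y then label_cdf m t else 0) \<partial>U)"

lemma drift_integrable: "integrable U (\<lambda>t. if t < y then label_cdf m t else 0)"
  by (intro integrable_U[where K=1]) (auto simp: label_cdf_abs)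

lemma label_cdf_integrable: "integrable U (\<lambda>t. label_cdf m t)"
  by (intro integrable_U[where K=1]) (auto simp: label_cdf_abs)

lemma drift_mono:
  assumes "m \<le> m'" shows "drift m y \<le> drift m' y"
  unfolding drift_def using assms by (intro integral_mono drift_integrable) (auto intro: label_cdf_mono)

lemma drift_lipschitz_mass:
  assumes "m \<le> m'" shows "drift m' y - drift m y \<le> m' - m"
proof -
  have "drift m' y - drift m y = (\<integral>t. (if t < y then label_cdf m' t else 0) - (if t < y then label_cdf m t else 0) \<partial>U)"
    unfolding drift_def by (intro Bochner_Integration.integral_diff[symmetric] drift_integrable)
  also have "\<dots> \<le> (\<integral>t. label_cdf m' t - label_cdf m t \<partial>U)"
    using assms by (intro integral_mono Bochner_Integration.integrable_diff drift_integrable label_cdf_integrable)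
      (auto intro: label_cdf_mono)
  also have "\<dots> = clamp01 m' - clamp01 m"
    by (subst Bochner_Integration.integral_diff) (auto simp: label_cdf_integrable integral_label_cdf)
  also have "\<dots> \<le> m' - m" using assms by (auto simp: clamp01_def)
  finally show ?thesis .
qed

lemma drift_diff_height:
  assumes "y \<le> y'"
  shows "drift m y' - drift m y = (\<integral>t. (if y \<le> t \<and> t < y' then label_cdf m t else 0) \<partial>U)"
proof -
  have "drift m y' - drift m y = (\<integral>t. (if t < y' then label_cdf m t else 0) - (if t < y then label_cdf m t else 0) \<partial>U)"
    unfolding drift_def by (intro Bochner_Integration.integral_diff[symmetric] drift_integrable)
  also have "\<dots> = (\<integral>t. (if y \<le> t \<and> t < y' then label_cdf m t else 0) \<partial>U)"
    using assms by (intro Bochner_Integration.integral_cong) auto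
  finally show ?thesis .
qed

lemma drift_height_bounds:
  assumes "0 \<le> y" "y \<le> y'" "y' \<le> 1" "0 \<le> c" "d \<le> 1"
    and "\<And>t. y \<le> t \<Longrightarrow> t < y' \<Longrightarrow> c \<le> label_cdf m t" "\<And>t. y \<le> t \<Longrightarrow> t < y' \<Longrightarrow> label_cdf m t \<le> d"
  shows "c * (y' - y) \<le> drift m y' - drift m y" "drift m y' - drift m y \<le> d * (y' - y)"
proof -
  have i: "(\<integral>t. (if y \<le> t \<and> t < y' then k else 0) \<partial>U) = k * (y' - y)" for k :: real
  proof -
    have "(\<integral>t. (if y \<le> t \<and> t < y' then k else 0) \<partial>U) = (\<integral>t. k * (if y \<le> t \<and> t < y' then 1 else 0) \<partial>U)"
      by (intro Bochner_Integration.integral_cong) auto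
    also have "\<dots> = k * (\<integral>t. (if y \<le> t \<and> t < y' then 1 else 0) \<partial>U)" by (rule integral_mult_right_zero)
    also have "\<dots> = k * (y' - y)" using integral_U_interval[of y y'] assms by simp
    finally show ?thesis .
  qed
  have "c * (y' - y) \<le> (\<integral>t. (if y \<le> t \<and> t < y' then label_cdf m t else 0) \<partial>U)"
    unfolding i[symmetric] using assms by (intro U_mono[where K="max \<bar>c\<bar> 1"]) (auto simp: label_cdf_abs le_max_iff_disj)
  then show "c * (y' - y) \<le> drift m y' - drift m y" using drift_diff_height[OF assms(2)] by simp
  have "(\<integral>t. (if y \<le> t \<and> t < y' then label_cdf m t else 0) \<partial>U) \<le> d * (y' - y)"
    unfolding i[symmetric] using assms by (intro U_mono[where K="max \<bar>d\<bar> 1"]) (auto simp: label_cdf_abs le_max_iff_disj)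
  then show "drift m y' - drift m y \<le> d * (y' - y)" using drift_diff_height[OF assms(2)] by simp
qed

lemma drift_mono_height: "y \<le> y' \<Longrightarrow> drift m y \<le> drift m y'"
  unfolding drift_def by (intro integral_mono drift_integrable) (auto simp: label_cdf_bounds)

lemma drift_below: "y \<le> 0 \<Longrightarrow> drift m y = 0"
  unfolding drift_def by (subst integral_U_cong[where g="\<lambda>_. 0"]) auto

lemma drift_above: "1 \<le> y \<Longrightarrow> drift m y = clamp01 m"
  unfolding drift_def integral_label_cdf[symmetric] by (intro integral_U_cong) auto

lemma drift_lipschitz_height:
  assumes "y \<le> y'" shows "drift m y' - drift m y \<le> y' - y"
proof -
  define a where "a = clamp01 y"
  define b where "b = clamp01 y'"
  have ab: "0 \<le> a" "a \<le> b" "b \<le> 1" "b - a \<le> y' - y" using assms by (auto simp: a_def b_def clamp01_def)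
  have "drift m z = drift m (clamp01 z)" for z
    using drift_below[of z m] drift_below[of 0 m] drift_above[of z m] drift_above[of 1 m]
    by (auto simp: clamp01_def max_def min_def)
  then have "drift m y' - drift m y = drift m b - drift m a" by (simp add: a_def b_def)
  also have "\<dots> \<le> 1 * (b - a)" using ab by (intro drift_height_bounds(2)[where c=0]) (auto simp: label_cdf_bounds)
  finally show ?thesis using ab by simp
qed

lemma drift_mass_0: "m \<le> 0 \<Longrightarrow> drift m y = 0" by (simp add: drift_def label_cdf_eq_0 cong: if_cong)

lemma drift_mass_1: "1 \<le> m \<Longrightarrow> 0 \<le> y \<Longrightarrow> y \<le> 1 \<Longrightarrow> drift m y = y"
proof -
  assume *: "1 \<le> m" "0 \<le> y" "y \<le> 1"
  have "drift m y = (\<integral>t. (if 0 \<le> t \<and> t < y then 1 else 0) \<partial>U)"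
    unfolding drift_def by (intro integral_U_cong) (auto simp: label_cdf_eq_1 *)
  then show ?thesis using integral_U_interval[of 0 y] * by simp
qed

section \<open>Generic heights\<close>

text \<open>
  Almost every height satisfies this, by the lemma of Borel and Cantelli: there are \<open>2\<^sup>n\<close>
  dyadic points of order \<open>n\<close>, and \<open>(2/3)\<^sup>n\<close> is summable. On the other hand \<open>(1/3)\<^sup>n\<close>
  is large compared with \<open>(1/4)\<^sup>n\<close>, the oscillation of \<open>spread\<close> on a dyadic interval of
  order \<open>n\<close>.
\<close>

definition generic :: "real \<Rightarrow> bool" where
  "generic y \<longleftrightarrow> (\<forall>\<^sub>F n in sequentially. \<forall>k::int. (1/3) ^ n \<le> \<bar>y - of_int k / 2 ^ n\<bar>)"

lemma AE_generic: "AE y in U. generic y"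
proof -
  define A where "A n = (\<Union>k\<in>{0..2^n::int}. {of_int k / 2 ^ n - (1/3) ^ n <..< of_int k / 2 ^ n + (1/3::real) ^ n})" for n :: nat
  have meas: "measure lborel (A n) \<le> 4 * (2/3) ^ n" for n
  proof -
    have "measure lborel (A n) \<le> (\<Sum>k\<in>{0..2^n::int}. measure lborel {of_int k / 2 ^ n - (1/3) ^ n <..< of_int k / 2 ^ n + (1/3::real) ^ n})"
      unfolding A_def by (intro measure_UNION_le) auto
    also have "\<dots> = (2 ^ n + 1) * (2 * (1/3) ^ n)"
      by (simp add: nat_add_distrib nat_power_eq algebra_simps)
    also have "\<dots> \<le> (2 * 2 ^ n) * (2 * (1/3) ^ n)"
      by (intro mult_right_mono) auto
    also have "\<dots> = 4 * (2/3) ^ n" by (simp add: power_divide)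
    finally show ?thesis .
  qed
  have "AE y in lborel. \<forall>\<^sub>F n in sequentially. y \<in> space lborel - A n"
  proof (rule borel_cantelli_AE1)
    show "A n \<in> sets lborel" for n unfolding A_def by auto
    show "emeasure lborel (A n) < \<infinity>" for n
    proof -
      have "bounded (A n)" unfolding A_def by (intro bounded_UN) auto
      then show ?thesis using emeasure_bounded_finite by auto
    qed
    show "summable (\<lambda>n. measure lborel (A n))"
      by (rule summable_comparison_test'[where g="\<lambda>n. 4 * (2/3) ^ n" and N=0])
        (use meas in \<open>auto intro!: summable_mult summable_geometric\<close>)
  qed
  moreover have "generic y" if y: "0 \<le> y" "y < 1" and ev: "\<forall>\<^sub>F n in sequentially. y \<in> space lborel - A n" for y
    unfolding generic_def using ev
  proof eventually_elim
    case (elim n)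
    show ?case
    proof (rule ccontr)
      assume "\<not> ?case"
      then obtain k :: int where k: "\<bar>y - of_int k / 2 ^ n\<bar> < (1/3) ^ n" by (auto simp: not_le)
      have le: "(1/3::real) ^ n \<le> 1 / 2 ^ n" by (simp add: power_one_over frac_le power_mono)
      then have "\<bar>y - of_int k / 2 ^ n\<bar> < 1 / 2 ^ n" using k by linarith
      then have "\<bar>y * 2 ^ n - of_int k\<bar> < 1"
        by (simp add: abs_less_iff field_simps)
      moreover have "0 \<le> y * 2 ^ n" "y * 2 ^ n < 2 ^ n" using y by auto
      ultimately have "- 1 < real_of_int k" "real_of_int k < 2 ^ n + 1" by linarith+
      then have "real_of_int (- 1) < of_int k" "real_of_int k < of_int (2 ^ n + 1)" by simp_all
      then have "- 1 < k" "k < 2 ^ n + 1" by (simp_all only: of_int_less_iff)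
      then have "k \<in> {0..2^n}" by auto
      moreover have "y \<in> {of_int k / 2 ^ n - (1/3) ^ n <..< of_int k / 2 ^ n + (1/3::real) ^ n}"
        using k by (auto simp: abs_less_iff)
      ultimately have "y \<in> A n" unfolding A_def by blast
      then show False using elim by simp
    qed
  qed
  ultimately have "AE y in lborel. 0 \<le> y \<and> y < 1 \<longrightarrow> generic y" by auto
  then show ?thesis
    unfolding U_def by (subst AE_density) (auto simp: indicator_def elim!: eventually_mono split: if_splits)
qed

lemma same_level_near:
  fixes y y' :: real
  assumes "\<forall>k::int. d \<le> \<bar>y - of_int k / 2 ^ n\<bar>" "\<bar>y' - y\<bar> < d"
  shows "\<lfloor>2 ^ n * y'\<rfloor> = \<lfloor>2 ^ n * y\<rfloor>"
proof -
  let ?k = "\<lfloor>2 ^ n * y\<rfloor>"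
  have 1: "of_int ?k \<le> 2 ^ n * y" "2 ^ n * y < of_int ?k + 1" by linarith+
  have "d \<le> y - of_int ?k / 2 ^ n"
  proof -
    have "0 \<le> y - of_int ?k / 2 ^ n" using 1 by (simp add: field_simps)
    then show ?thesis using assms(1)[rule_format, of ?k] by linarith
  qed
  then have "of_int ?k / 2 ^ n \<le> y'" using assms(2) by linarith
  then have a: "of_int ?k \<le> 2 ^ n * y'" by (simp add: field_simps)
  have "d \<le> of_int (?k + 1) / 2 ^ n - y"
  proof -
    have "0 \<le> of_int (?k + 1) / 2 ^ n - y" using 1 by (simp add: field_simps)
    then show ?thesis using assms(1)[rule_format, of "?k + 1"] by linarith
  qed
  then have "y' < of_int (?k + 1) / 2 ^ n" using assms(2) by linarith
  then have b: "2 ^ n * y' < of_int ?k + 1" by (simp add: field_simps)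
  show ?thesis using a b by linarith
qed

text \<open>
  If \<open>y'\<close> is at a distance of about \<open>(1/3)\<^sup>n\<close> from \<open>y\<close>, then both are in the same dyadic
  interval of order \<open>n\<close>, on which \<open>spread\<close> varies by at most \<open>(1/4)\<^sup>n\<close>: the quotient is of
  order \<open>(3/4)\<^sup>n\<close>.
\<close>

lemma generic_flat:
  assumes "generic y" "0 < e"
  obtains d where "0 < d" "\<And>y'. \<bar>y' - y\<bar> < d \<Longrightarrow> \<bar>spread y' - spread y\<bar> \<le> e * \<bar>y' - y\<bar>"
proof -
  obtain N0 where N0: "\<And>n k. n \<ge> N0 \<Longrightarrow> (1/3) ^ n \<le> \<bar>y - of_int k / 2 ^ n\<bar>"
    using assms(1) unfolding generic_def eventually_sequentially by blast
  obtain N1 where N1: "(3/4) ^ N1 < e" using real_arch_pow_inv[of e "3/4"] assms by auto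
  define N where "N = max N0 N1"
  have "(3/4::real) ^ N \<le> (3/4) ^ N1" by (intro power_decreasing) (auto simp: N_def)
  then have N: "(3/4::real) ^ N < e" using N1 by linarith
  show ?thesis
  proof (rule that)
    show "0 < (1/3::real) ^ N" by simp
    fix y' assume y': "\<bar>y' - y\<bar> < (1/3) ^ N"
    show "\<bar>spread y' - spread y\<bar> \<le> e * \<bar>y' - y\<bar>"
    proof (cases "y' = y")
      case False
      define P where "P n \<longleftrightarrow> (1/3::real) ^ Suc n \<le> \<bar>y' - y\<bar>" for n
      obtain n1 where "(1/3::real) ^ n1 < \<bar>y' - y\<bar>"
        using real_arch_pow_inv[of "\<bar>y' - y\<bar>" "1/3"] False by auto
      moreover have "(1/3::real) ^ Suc n1 \<le> (1/3) ^ n1" by (intro power_decreasing) auto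
      ultimately have "P n1" unfolding P_def by linarith
      \<comment> \<open>the distance of the points lies between the powers of \<open>1/3\<close> with exponents \<open>n + 1\<close> and \<open>n\<close>\<close>
      define n where "n = (LEAST n. N \<le> n \<and> P n)"
      have "\<exists>n. N \<le> n \<and> P n"
      proof -
        have "(1/3::real) ^ Suc (max N n1) \<le> (1/3) ^ Suc n1" by (intro power_decreasing) auto
        then have "P (max N n1)" using \<open>P n1\<close> unfolding P_def by linarith
        then show ?thesis by (metis max.cobounded1)
      qed
      then have n: "N \<le> n" "P n" and least: "\<And>k. N \<le> k \<Longrightarrow> P k \<Longrightarrow> n \<le> k"
        using LeastI_ex[of "\<lambda>n. N \<le> n \<and> P n"] Least_le[of "\<lambda>n. N \<le> n \<and> P n"]
        unfolding n_def by blast+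
      have lt: "\<bar>y' - y\<bar> < (1/3) ^ n"
      proof (cases "n = N")
        case False
        then obtain k where k: "n = Suc k" "N \<le> k" using n(1) by (cases n) auto
        then have "\<not> P k" using least[of k] by auto
        then show ?thesis using k by (simp add: P_def)
      qed (use y' in simp)
      have "\<lfloor>2 ^ n * y'\<rfloor> = \<lfloor>2 ^ n * y\<rfloor>"
        using N0 n(1) lt by (intro same_level_near[where d="(1/3)^n"]) (auto simp: N_def)
      then have "\<bar>spread y' - spread y\<bar> \<le> (1/4) ^ n / 3" by (rule spread_same_level)
      also have "(1/4::real) ^ n / 3 = (3/4) ^ n * (1/3) ^ Suc n" by (simp add: power_divide)
      also have "\<dots> \<le> (3/4) ^ N * \<bar>y' - y\<bar>"
        using n by (intro mult_mono power_decreasing) (auto simp: P_def)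
      also have "\<dots> \<le> e * \<bar>y' - y\<bar>" using N by (intro mult_right_mono) auto
      finally show ?thesis .
    qed simp
  qed
qed

lemma generic_isCont_spread:
  assumes "generic y" shows "isCont spread y"
proof -
  obtain d where d: "0 < d" "\<And>y'. \<bar>y' - y\<bar> < d \<Longrightarrow> \<bar>spread y' - spread y\<bar> \<le> 1 * \<bar>y' - y\<bar>"
    using generic_flat[OF assms, of 1] by auto
  show ?thesis unfolding continuous_at_eps_delta dist_real_def
  proof (intro allI impI)
    fix e :: real assume "0 < e"
    then show "\<exists>d>0. \<forall>x'. \<bar>x' - y\<bar> < d \<longrightarrow> \<bar>spread x' - spread y\<bar> < e"
      using d by (intro exI[of _ "min d e"]) fastforce
  qed
qed

section \<open>Self-similarity of the drift\<close>

lemma drift_halves: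
  assumes "0 \<le> y" "y < 1"
  shows "drift m (y/2) = (drift (4*m-1) y + drift (4*m-3) y) / 4"
    "drift m ((1+y)/2) = (clamp01 (4*m-1) + clamp01 (4*m-3) + drift (4*m) y + drift (4*m-2) y) / 4"
proof -
  have split: "drift m z = ((\<integral>t. (if t/2 < z then label_cdf m (t/2) else 0) \<partial>U) + (\<integral>t. (if (1+t)/2 < z then label_cdf m ((1+t)/2) else 0) \<partial>U)) / 2" for z
    unfolding drift_def by (rule integral_U_half[where K=1]) (auto simp: label_cdf_abs)
  note ii = drift_integrable label_cdf_integrable
  have "(\<integral>t. (if t/2 < y/2 then label_cdf m (t/2) else 0) \<partial>U) = (\<integral>t. ((if t < y then label_cdf (4*m-1) t else 0) + (if t < y then label_cdf (4*m-3) t else 0)) / 2 \<partial>U)"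
    by (intro integral_U_cong) (auto simp: label_cdf_halves)
  also have "\<dots> = (drift (4*m-1) y + drift (4*m-3) y) / 2"
    unfolding drift_def using ii by simp
  finally have a: "(\<integral>t. (if t/2 < y/2 then label_cdf m (t/2) else 0) \<partial>U) = (drift (4*m-1) y + drift (4*m-3) y) / 2" .
  have "(\<integral>t. (if (1+t)/2 < y/2 then label_cdf m ((1+t)/2) else 0) \<partial>U) = (\<integral>t. 0 \<partial>U)"
    using assms by (intro integral_U_cong) (auto simp: label_cdf_halves)
  then show "drift m (y/2) = (drift (4*m-1) y + drift (4*m-3) y) / 4" using a split[of "y/2"] by simp
  have "(\<integral>t. (if (1+t)/2 < (1+y)/2 then label_cdf m ((1+t)/2) else 0) \<partial>U) = (\<integral>t. ((if t < y then label_cdf (4*m) t else 0) + (if t < y then label_cdf (4*m-2) t else 0)) / 2 \<partial>U)"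
    by (intro integral_U_cong) (auto simp: label_cdf_halves)
  also have "\<dots> = (drift (4*m) y + drift (4*m-2) y) / 2"
    unfolding drift_def using ii by simp
  finally have b: "(\<integral>t. (if (1+t)/2 < (1+y)/2 then label_cdf m ((1+t)/2) else 0) \<partial>U) = (drift (4*m) y + drift (4*m-2) y) / 2" .
  have "(\<integral>t. (if t/2 < (1+y)/2 then label_cdf m (t/2) else 0) \<partial>U) = (\<integral>t. (label_cdf (4*m-1) t + label_cdf (4*m-3) t) / 2 \<partial>U)"
    using assms by (intro integral_U_cong) (auto simp: label_cdf_halves)
  also have "\<dots> = (clamp01 (4*m-1) + clamp01 (4*m-3)) / 2"
    unfolding integral_label_cdf[symmetric] using ii by simp
  finally have c: "(\<integral>t. (if t/2 < (1+y)/2 then label_cdf m (t/2) else 0) \<partial>U) = (clamp01 (4*m-1) + clamp01 (4*m-3)) / 2" .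
  show "drift m ((1+y)/2) = (clamp01 (4*m-1) + clamp01 (4*m-3) + drift (4*m) y + drift (4*m-2) y) / 4"
    using b c split[of "(1+y)/2"] by (simp add: field_simps)
qed

text \<open>
  At the crossing points themselves the self-similarity of the drift closes up: all but one of
  the terms in \<open>drift_halves\<close> have masses outside the unit interval.
\<close>

lemma drift_crossing_halves:
  assumes "0 \<le> u" "u < 1" "0 \<le> y" "y < 1"
  defines "V \<equiv> drift (mass u y) y"
  shows "drift (mass (u/2) (y/2)) (y/2) = V / 4"
    "drift (mass ((1+u)/2) (y/2)) (y/2) = (y + V) / 4"
    "drift (mass (u/2) ((1+y)/2)) ((1+y)/2) = V / 4"
    "drift (mass ((1+u)/2) ((1+y)/2)) ((1+y)/2) = (1 + y + V) / 4"
  using assms(1-4) mass_pos[of u y] mass_less_1[of u y]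
  by (simp_all add: drift_halves mass_halves V_def drift_mass_0 drift_mass_1 clamp01_def field_simps)

lemma drift_nonneg: "0 \<le> drift m y"
  using drift_mono_height[of "min y 0" y m] drift_below[of "min y 0" m] by simp

lemma drift_le_1: "drift m y \<le> 1"
  using drift_mono_height[of y "max y 1" m] drift_above[of "max y 1" m] by (simp add: clamp01_def)

lemma UU_integrable:
  fixes f :: "real \<times> real \<Rightarrow> real"
  assumes [measurable]: "f \<in> borel_measurable (borel \<Otimes>\<^sub>M borel)" and "\<And>x. \<bar>f x\<bar> \<le> K"
  shows "integrable (U \<Otimes>\<^sub>M U) f"
proof -
  have [measurable]: "f \<in> borel_measurable (U \<Otimes>\<^sub>M U)" by measurable
  show ?thesis using assms(2) by (intro UU.P.integrable_const_bound[where B=K]) auto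
qed

section \<open>The flow in the model cell\<close>

locale flow =
  fixes lam :: real
  assumes lam_pos: "0 < lam" and lam_less_1: "lam < 1"
begin

text \<open>
  Crossing shrinks the width of a particle by the factor \<open>1 - lam\<close>, so each particle that has
  crossed pulls all those on its right to the left by \<open>lam\<close> times its mass.
\<close>

definition position :: "real \<Rightarrow> real \<Rightarrow> real" where
  "position m y = m - lam * drift m y"

lemma position_expand: "m \<le> m' \<Longrightarrow> (1 - lam) * (m' - m) \<le> position m' y - position m y"
  using mult_left_mono[OF drift_lipschitz_mass[of m m' y], of lam] lam_pos
  by (simp add: position_def algebra_simps)

lemma position_lipschitz_mass: "m \<le> m' \<Longrightarrow> position m' y - position m y \<le> m' - m"
  using mult_left_mono[OF drift_mono[of m m' y], of lam] lam_pos
  by (simp add: position_def algebra_simps)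

lemma position_strict_mono: "m < m' \<Longrightarrow> position m y < position m' y"
proof -
  assume "m < m'"
  then have "0 < (1 - lam) * (m' - m)" using lam_less_1 by simp
  then show ?thesis using position_expand[of m m' y] \<open>m < m'\<close> by linarith
qed

lemma position_less_iff: "position m y < position m' y \<longleftrightarrow> m < m'"
  using position_strict_mono[of m m' y] position_strict_mono[of m' m y] by (cases m m' rule: linorder_cases) auto

lemma position_le_iff': "position m y \<le> position m' y \<longleftrightarrow> m \<le> m'"
  using position_less_iff[of m' y m] by (auto simp: not_less[symmetric])

lemma position_eq_iff: "position m y = position m' y \<longleftrightarrow> m = m'"
  by (metis position_le_iff' order_antisym order_refl)

lemma position_lipschitz_height: "\<bar>position m y' - position m y\<bar> \<le> \<bar>y' - y\<bar>"
proof -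
  have "\<bar>drift m y' - drift m y\<bar> \<le> \<bar>y' - y\<bar>"
    using drift_lipschitz_height[of y y' m] drift_lipschitz_height[of y' y m] drift_mono_height[of y y' m] drift_mono_height[of y' y m]
    by (cases "y \<le> y'") auto
  then have "lam * \<bar>drift m y' - drift m y\<bar> \<le> 1 * \<bar>y' - y\<bar>" 
    using lam_pos lam_less_1 by (intro mult_mono) auto
  moreover have "position m y' - position m y = - lam * (drift m y' - drift m y)" by (simp add: position_def algebra_simps)
  ultimately show ?thesis using lam_pos by (simp add: abs_mult)
qed

lemma position_lipschitz: "\<bar>position m y - position m' y'\<bar> \<le> \<bar>m - m'\<bar> + \<bar>y - y'\<bar>"
proof -
  have "\<bar>position m y - position m' y\<bar> \<le> \<bar>m - m'\<bar>"
    using position_lipschitz_mass[of m m' y] position_lipschitz_mass[of m' m y] position_le_iff'[of m y m'] position_le_iff'[of m' y m] by linarith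
  then show ?thesis using position_lipschitz_height[of m' y y'] by linarith
qed

lemma position_expand_abs: "(1 - lam) * \<bar>m - m'\<bar> \<le> \<bar>position m y - position m' y\<bar>"
proof (cases "m \<le> m'")
  case True
  then show ?thesis using position_expand[of m m' y] by (simp add: abs_if)
next
  case False
  then show ?thesis using position_expand[of m' m y] by (simp add: abs_if)
qed

lemma lipschitz2_continuous:
  fixes f :: "real \<Rightarrow> real \<Rightarrow> real"
  assumes "\<And>a b a' b'. \<bar>f a b - f a' b'\<bar> \<le> C * (\<bar>a - a'\<bar> + \<bar>b - b'\<bar>)"
  shows "continuous_on UNIV (\<lambda>z. f (fst z) (snd z))"
proof (rule continuous_at_imp_continuous_on, rule ballI)
  fix z :: "real \<times> real"
  have "((\<lambda>w. C * (\<bar>fst w - fst z\<bar> + \<bar>snd w - snd z\<bar>)) \<longlongrightarrow> C * (\<bar>fst z - fst z\<bar> + \<bar>snd z - snd z\<bar>)) (at z)"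
    by (intro tendsto_intros)
  then have "((\<lambda>w. C * (\<bar>fst w - fst z\<bar> + \<bar>snd w - snd z\<bar>)) \<longlongrightarrow> 0) (at z)" by simp
  then have "((\<lambda>w. f (fst w) (snd w) - f (fst z) (snd z)) \<longlongrightarrow> 0) (at z)"
    by (rule Lim_null_comparison[rotated]) (use assms in \<open>auto intro!: always_eventually\<close>)
  then show "isCont (\<lambda>z. f (fst z) (snd z)) z"
    unfolding isCont_def by (subst (asm) LIM_zero_iff)
qed

lemma position_continuous: "continuous_on UNIV (\<lambda>z. position (fst z) (snd z))"
  by (rule lipschitz2_continuous[where C=1]) (use position_lipschitz in simp)

lemma position_measurable [measurable (raw)]:
  assumes "f \<in> borel_measurable M" "g \<in> borel_measurable M"
  shows "(\<lambda>x. position (f x) (g x)) \<in> borel_measurable M"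
  by (rule borel_measurable_continuous_Pair[OF assms position_continuous])

text \<open>
  The inverse of \<open>position\<close> at fixed height: the particle seen at the point \<open>(x, y)\<close>.
\<close>

definition mass_at :: "real \<Rightarrow> real \<Rightarrow> real" where
  "mass_at x y = (THE m. position m y = x)"

lemma position_surj: "\<exists>m. position m y = x"
proof -
  have "position x y \<le> x" using drift_nonneg[of x y] lam_pos by (simp add: position_def)
  moreover have "x \<le> position (x + 1) y"
  proof -
    have "lam * drift (x+1) y \<le> 1 * 1"
      using drift_nonneg[of "x+1" y] drift_le_1[of "x+1" y] lam_pos lam_less_1 by (intro mult_mono) auto
    then show ?thesis by (simp add: position_def)
  qed
  moreover have "continuous_on {x..x+1} (\<lambda>m. position m y)"
  proof -
    have "continuous_on {x..x+1} (\<lambda>m. (m, y))" by (intro continuous_intros)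
    then show ?thesis using continuous_on_compose2[OF position_continuous, of "{x..x+1}" "\<lambda>m. (m, y)"] by simp
  qed
  ultimately show ?thesis using IVT'[of "\<lambda>m. position m y" x x "x+1"] by auto
qed

lemma position_mass_at: "position (mass_at x y) y = x"
proof -
  obtain m where "position m y = x" using position_surj by blast
  then show ?thesis unfolding mass_at_def
    by (rule theI) (use \<open>position m y = x\<close> in \<open>auto simp: position_eq_iff\<close>)
qed

lemma mass_at_position: "mass_at (position m y) y = m"
  using position_mass_at[of "position m y" y] by (simp add: position_eq_iff)

lemma position_le_iff: "position m y \<le> x \<longleftrightarrow> m \<le> mass_at x y"
  using position_le_iff'[of m y "mass_at x y"] by (simp add: position_mass_at)

lemma mass_at_lipschitz: "\<bar>mass_at x y - mass_at x' y'\<bar> \<le> (\<bar>x - x'\<bar> + \<bar>y - y'\<bar>) / (1 - lam)"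
proof -
  have "(1 - lam) * \<bar>mass_at x y - mass_at x' y'\<bar> \<le> \<bar>position (mass_at x y) y - position (mass_at x' y') y\<bar>"
    by (rule position_expand_abs)
  also have "\<dots> \<le> \<bar>x - x'\<bar> + \<bar>y - y'\<bar>"
    using position_lipschitz_height[of "mass_at x' y'" y y'] by (simp add: position_mass_at)
  finally show ?thesis using lam_less_1 by (simp add: field_simps)
qed

lemma mass_at_continuous: "continuous_on UNIV (\<lambda>z. mass_at (fst z) (snd z))"
  by (rule lipschitz2_continuous[where C="1/(1-lam)"]) (use mass_at_lipschitz in simp)

lemma mass_at_measurable [measurable (raw)]:
  assumes "f \<in> borel_measurable M" "g \<in> borel_measurable M"
  shows "(\<lambda>x. mass_at (f x) (g x)) \<in> borel_measurable M"
  by (rule borel_measurable_continuous_Pair[OF assms mass_at_continuous])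

text \<open>
  The distribution function of the crossing points of height \<open>y\<close>, see \<open>G_eq\<close>. At the same time
  \<open>- lam * G\<close> is the velocity of the particle at \<open>(x, y)\<close>, because \<open>label_cdf\<close> is also the
  integrand of \<open>drift\<close>.
\<close>

definition G :: "real \<Rightarrow> real \<Rightarrow> real" where
  "G x y = label_cdf (mass_at x y) y"

text \<open>
  The abscissa of the crossing point with label \<open>u\<close> and height \<open>y\<close>.
\<close>

definition xi :: "real \<Rightarrow> real \<Rightarrow> real" where
  "xi u y = position (mass u y) y"

lemma G_measurable [measurable (raw)]:
  assumes [measurable]: "f \<in> borel_measurable M" "g \<in> borel_measurable M"
  shows "(\<lambda>x. G (f x) (g x)) \<in> borel_measurable M"
  unfolding G_def by measurable

lemma xi_measurable [measurable (raw)]: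
  assumes [measurable]: "f \<in> borel_measurable M" "g \<in> borel_measurable M"
  shows "(\<lambda>x. xi (f x) (g x)) \<in> borel_measurable M"
  unfolding xi_def by measurable

lemma G_bounds: "0 \<le> G x y" "G x y \<le> 1"
  by (simp_all add: G_def label_cdf_bounds)

lemma G_eq: "G x y = (\<integral>u. (if xi u y \<le> x then 1 else 0) \<partial>U)"
  by (simp add: G_def label_cdf_def xi_def position_le_iff)

lemma G_position: "G (position m y) y = label_cdf m y"
  by (simp add: G_def mass_at_position)

lemma G_xi: "0 \<le> u \<Longrightarrow> u < 1 \<Longrightarrow> G (xi u y) y = u"
  by (simp add: xi_def G_position label_cdf_mass)

lemma G_holder:
  "(G x y - G x' y')\<^sup>2 \<le> 3 * ((\<bar>x - x'\<bar> + \<bar>y - y'\<bar>) / (1 - lam) + \<bar>spread y - spread y'\<bar>)"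
  unfolding G_def by (rule order_trans[OF label_cdf_holder]) (intro mult_left_mono add_right_mono mass_at_lipschitz, simp)

lemma position_0: "position 0 y = 0" by (simp add: position_def drift_mass_0)

lemma position_1: "0 \<le> y \<Longrightarrow> y \<le> 1 \<Longrightarrow> position 1 y = 1 - lam * y" by (simp add: position_def drift_mass_1)

lemma position_mass_range:
  assumes "0 \<le> y" "y \<le> 1"
  shows "0 < position (mass u t) y" "position (mass u t) y < 1 - lam * y"
  using position_strict_mono[OF mass_pos[of u t], of y] position_strict_mono[OF mass_less_1[of u t], of y] position_0 position_1 assms by auto

lemma xi_range:
  assumes "0 \<le> y" "y \<le> 1"
  shows "0 < xi u y" "xi u y < 1 - lam * y"
  using position_mass_range[OF assms] by (simp_all add: xi_def)

lemma xi_close: "\<bar>xi u y - xi u' y'\<bar> \<le> 2 * \<bar>spread u - spread u'\<bar> + \<bar>spread y - spread y'\<bar> + \<bar>y - y'\<bar>"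
proof -
  have "\<bar>mass u y - mass u' y'\<bar> \<le> 2 * \<bar>spread u - spread u'\<bar> + \<bar>spread y - spread y'\<bar>"
  proof -
    have "mass u y - mass u' y' = 2 * (spread u - spread u') - (spread y - spread y')" by (simp add: mass_def)
    moreover have "2 * \<bar>spread u - spread u'\<bar> = \<bar>2 * (spread u - spread u')\<bar>" by (subst abs_mult) simp
    ultimately show ?thesis by (simp only: abs_triangle_ineq4)
  qed
  then show ?thesis using position_lipschitz[of "mass u y" y "mass u' y'" y'] by (simp add: xi_def)
qed

text \<open>
  The quadratic expansion of \<open>spread\<close> is inherited by the crossing points. This limits how much
  of the crossing measure a set of small diameter can carry.
\<close>

lemma xi_apart:
  assumes "0 \<le> u" "u < 1" "0 \<le> v" "v < 1"
  shows "(1 - lam) * (u - v)\<^sup>2 / 3 \<le> \<bar>xi u y - xi v y\<bar>"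
proof -
  have "(u - v)\<^sup>2 / 3 \<le> \<bar>mass u y - mass v y\<bar>"
    using spread_quadratic[of u v] spread_quadratic[of v u] assms
    by (cases "u \<le> v") (auto simp: mass_def power2_commute abs_if)
  then have "(1 - lam) * ((u - v)\<^sup>2 / 3) \<le> (1 - lam) * \<bar>mass u y - mass v y\<bar>"
    using lam_less_1 by (intro mult_left_mono) auto
  also have "\<dots> \<le> \<bar>xi u y - xi v y\<bar>" unfolding xi_def by (rule position_expand_abs)
  finally show ?thesis by simp
qed

text \<open>
  The particle that crosses at \<open>(xi u y, y)\<close> has the velocity \<open>- lam * u\<close> there. This shear
  compensates for the motion with that velocity.
\<close>

definition eta :: "real \<Rightarrow> real \<Rightarrow> real" where
  "eta u y = xi u y + lam * u * y"

lemma eta_measurable [measurable (raw)]: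
  assumes [measurable]: "f \<in> borel_measurable M" "g \<in> borel_measurable M"
  shows "(\<lambda>x. eta (f x) (g x)) \<in> borel_measurable M"
  unfolding eta_def by measurable

text \<open>
  Follow the particle crossing at height \<open>y\<close> up to \<open>y'\<close>. It moves to the left by at least
  \<open>lam * u * (y' - y)\<close>, since its label only grows after the crossing, and not much more, since
  the label is Hoelder continuous in the spread of the height. The crossing point with label \<open>u\<close>
  at height \<open>y'\<close> belongs to a particle whose mass is smaller by \<open>D\<close>. The second bound makes the
  derivative of the sheared curve negligible at generic heights.
\<close>

lemma eta_drop:
  assumes "0 \<le> u" "u < 1" "0 \<le> y" "y \<le> y'" "y' < 1"
  defines "D \<equiv> spread y' - spread y"
  shows "eta u y' \<le> eta u y" "eta u y - eta u y' \<le> D + (y' - y) * sqrt (3 * D)"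
proof -
  let ?m = "mass u y" and ?m' = "mass u y'"
  have D: "0 \<le> D" using assms spread_mono[of y y'] by auto
  have mm: "?m - ?m' = D" by (simp add: mass_def D_def)
  have Gu: "label_cdf ?m y = u" using assms by (simp add: label_cdf_mass)
  have lo: "u \<le> label_cdf ?m t" if "y \<le> t" "t < y'" for t
    using label_cdf_mono[of ?m ?m y t] spread_mono[of y t] that assms Gu by simp
  have up: "label_cdf ?m t \<le> u + sqrt (3 * D)" if "y \<le> t" "t < y'" for t
  proof -
    have "spread y \<le> spread t" "spread t \<le> spread y'" using spread_mono[of y t] spread_mono[of t y'] that assms by auto
    then have "(label_cdf ?m t - label_cdf ?m y)\<^sup>2 \<le> 3 * D"
      using label_cdf_holder[of ?m t ?m y] by (simp add: D_def)
    then have "label_cdf ?m t - u \<le> sqrt (3 * D)" unfolding Gu by (rule real_le_rsqrt)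
    then show ?thesis by simp
  qed
  have W1: "u * (y' - y) \<le> drift ?m y' - drift ?m y"
    using assms lo by (intro drift_height_bounds(1)[where d=1]) (auto simp: label_cdf_bounds)
  have W2: "drift ?m y' - drift ?m y \<le> (u + sqrt (3 * D)) * (y' - y)"
  proof (cases "u + sqrt (3 * D) \<le> 1")
    case True
    then show ?thesis using assms up by (intro drift_height_bounds(2)[where c=0]) (auto simp: label_cdf_bounds)
  next
    case False
    have "drift ?m y' - drift ?m y \<le> 1 * (y' - y)" using drift_lipschitz_height[of y y'] assms by simp
    also have "\<dots> \<le> (u + sqrt (3 * D)) * (y' - y)" using False assms by (intro mult_right_mono) auto
    finally show ?thesis .
  qed
  have e: "eta u y - eta u y' = (position ?m y' - position ?m' y') + lam * (drift ?m y' - drift ?m y - u * (y' - y))"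
    by (simp add: eta_def xi_def position_def algebra_simps)
  have x: "0 \<le> position ?m y' - position ?m' y'" "position ?m y' - position ?m' y' \<le> D"
    using position_le_iff'[of ?m' y' ?m] position_lipschitz_mass[of ?m' ?m y'] mm D by auto
  have w: "0 \<le> lam * (drift ?m y' - drift ?m y - u * (y' - y))" using W1 lam_pos by simp
  show "eta u y' \<le> eta u y" using e x w by linarith
  have "lam * (drift ?m y' - drift ?m y - u * (y' - y)) \<le> 1 * (sqrt (3 * D) * (y' - y))"
    using W1 W2 lam_pos lam_less_1 by (intro mult_mono) (auto simp: algebra_simps)
  then show "eta u y - eta u y' \<le> D + (y' - y) * sqrt (3 * D)" using e x by (simp add: mult.commute)
qed

lemma xi_halves:
  assumes "0 \<le> u" "u < 1" "0 \<le> y" "y < 1"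
  shows "xi (u/2) (y/2) = (1 + xi u y) / 4"
    "xi ((1+u)/2) (y/2) = (3 - lam * y + xi u y) / 4"
    "xi (u/2) ((1+y)/2) = xi u y / 4"
    "xi ((1+u)/2) ((1+y)/2) = (2 - lam * (1 + y) + xi u y) / 4"
  unfolding xi_def position_def unfolding drift_crossing_halves[OF assms] unfolding mass_halves[OF assms]
  by (simp_all add: field_simps)

text \<open>
  The particle at \<open>(x, y)\<close> has crossed if its crossing height is less than \<open>y\<close>.
\<close>

definition dens :: "real \<Rightarrow> real \<Rightarrow> real" where
  "dens x y = (if crossing_spread (mass_at x y) < spread y then 1 / (1 - lam) else 1)"

lemma dens_measurable [measurable (raw)]:
  assumes [measurable]: "f \<in> borel_measurable M" "g \<in> borel_measurable M"
  shows "(\<lambda>x. dens (f x) (g x)) \<in> borel_measurable M"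
  unfolding dens_def by measurable

lemma dens_position:
  assumes "0 \<le> t" "t < 1" "0 \<le> y" "y < 1"
  shows "dens (position (mass u t) y) y = (if t < y then 1 / (1 - lam) else 1)"
  using spread_strict_mono[of t y] spread_mono[of y t] assms
  by (auto simp: dens_def mass_at_position crossing_spread_mass not_less[symmetric])

lemma dens_bounds: "1 \<le> dens x y" "dens x y \<le> 1 / (1 - lam)"
  using lam_pos lam_less_1 by (auto simp: dens_def)

text \<open>
  The width per mass at height \<open>y\<close> of the particles crossing at height \<open>t\<close>, the reciprocal of
  their density.
\<close>

definition weight :: "real \<Rightarrow> real \<Rightarrow> real" where
  "weight t y = (if t < y then 1 - lam else 1)"

lemma weight_measurable [measurable (raw)]:
  assumes [measurable]: "f \<in> borel_measurable M" "g \<in> borel_measurable M"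
  shows "(\<lambda>x. weight (f x) (g x)) \<in> borel_measurable M"
  unfolding weight_def by measurable

lemma weight_bounds: "0 < weight t y" "1 - lam \<le> weight t y" "weight t y \<le> 1"
  using lam_pos lam_less_1 by (auto simp: weight_def)

text \<open>
  Mass that has crossed counts with the factor \<open>1 - lam\<close>: the total width right of the particle
  \<open>m\<close> is the width of the whole slice minus the position of \<open>m\<close>.
\<close>

lemma weighted_tail:
  assumes y: "0 \<le> y" "y \<le> 1"
  shows "(\<integral>z. weight (snd z) y * (if m < mass (fst z) (snd z) then 1 else 0) \<partial>(U \<Otimes>\<^sub>M U))
    = (1 - lam * y) - (clamp01 m - lam * drift m y)"
proof -
  let ?g = "\<lambda>u t. weight t y * (if m < mass u t then 1 else 0 :: real)"
  have "integrable (U \<Otimes>\<^sub>M U) (case_prod ?g)"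
    by (intro UU_integrable[where K=1]) (use weight_bounds lam_pos lam_less_1 in \<open>auto simp: weight_def\<close>)
  then have "(\<integral>t. (\<integral>u. ?g u t \<partial>U) \<partial>U) = (\<integral>z. ?g (fst z) (snd z) \<partial>(U \<Otimes>\<^sub>M U))"
    using UU.integral_snd[of ?g] by (simp add: case_prod_beta')
  moreover have "(\<integral>u. ?g u t \<partial>U) = 1 - label_cdf m t - lam * (if t < y then label_cdf 1 t else 0) + lam * (if t < y then label_cdf m t else 0)" for t
  proof -
    have "(\<integral>u. ?g u t \<partial>U) = (\<integral>u. weight t y * (1 - (if mass u t \<le> m then 1 else 0)) \<partial>U)"
      by (intro Bochner_Integration.integral_cong) auto
    also have "\<dots> = weight t y * (\<integral>u. 1 - (if mass u t \<le> m then 1 else 0) \<partial>U)" by simp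
    also have "(\<integral>u. 1 - (if mass u t \<le> m then 1 else 0) \<partial>U) = 1 - label_cdf m t" unfolding label_cdf_def
      using U.prob_space by (subst Bochner_Integration.integral_diff) (auto intro!: integrable_U[where K=1])
    finally have "(\<integral>u. ?g u t \<partial>U) = weight t y * (1 - label_cdf m t)" .
    then show ?thesis by (simp only:) (simp add: weight_def label_cdf_eq_1 algebra_simps)
  qed
  moreover have "(\<integral>t. 1 - label_cdf m t - lam * (if t < y then label_cdf 1 t else 0) + lam * (if t < y then label_cdf m t else 0) \<partial>U)
      = 1 - clamp01 m - lam * drift 1 y + lam * drift m y"
    using drift_integrable label_cdf_integrable U.prob_space by (simp add: drift_def integral_label_cdf)
  ultimately show ?thesis using drift_mass_1[of 1 y] y by simp
qed

text \<open>
  Particle coordinates on a slice: two finite measures on the line agree as soon as they agree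
  on half-lines, which is \<open>weighted_tail\<close>.
\<close>

lemma pushforward_eq:
  assumes y: "0 \<le> y" "y \<le> 1"
  shows "distr (density (U \<Otimes>\<^sub>M U) (\<lambda>z. ennreal (weight (snd z) y))) borel (\<lambda>z. position (mass (fst z) (snd z)) y)
    = density lborel (\<lambda>x. ennreal (indicator {0..1 - lam * y} x))" (is "?L = ?R")
proof (rule measure_eqI_lessThan)
  show "sets ?L = sets borel" "sets ?R = sets borel" by auto
  fix x
  define m where "m = mass_at x y"
  have x: "x = position m y" by (simp add: m_def position_mass_at)
  have "{z \<in> space (borel \<Otimes>\<^sub>M borel). x < position (mass (fst z) (snd z)) y} \<in> sets (borel \<Otimes>\<^sub>M borel)"
    by measurable
  then have [measurable]: "{z. x < position (mass (fst z) (snd z)) y} \<in> sets (borel \<Otimes>\<^sub>M borel)"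
    by (simp add: space_pair_measure)
  have "emeasure ?L {x<..} = (\<integral>\<^sup>+z. ennreal (weight (snd z) y) * indicator {z. x < position (mass (fst z) (snd z)) y} z \<partial>(U \<Otimes>\<^sub>M U))"
    by (subst emeasure_distr, simp, simp, subst emeasure_density)
      (auto simp: space_pair_measure vimage_def intro!: nn_integral_cong split: split_indicator)
  also have "\<dots> = (\<integral>\<^sup>+z. ennreal (weight (snd z) y * (if m < mass (fst z) (snd z) then 1 else 0)) \<partial>(U \<Otimes>\<^sub>M U))"
    unfolding x by (intro nn_integral_cong) (auto simp: position_less_iff split: split_indicator)
  also have "\<dots> = ennreal (\<integral>z. weight (snd z) y * (if m < mass (fst z) (snd z) then 1 else 0) \<partial>(U \<Otimes>\<^sub>M U))"
    using weight_bounds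
    by (intro nn_integral_eq_integral UU_integrable[where K=1]) (auto simp: less_imp_le abs_of_pos intro!: AE_I2)
  also have "\<dots> = ennreal ((1 - lam * y) - (clamp01 m - lam * drift m y))"
    by (simp only: weighted_tail[OF y])
  finally have L: "emeasure ?L {x<..} = ennreal ((1 - lam * y) - (clamp01 m - lam * drift m y))" .
  have "ennreal ((1 - lam * y) - (clamp01 m - lam * drift m y)) = emeasure ?R {x<..}"
  proof -
    have R: "emeasure ?R {x<..} = emeasure lborel ({x<..} \<inter> {0..1 - lam * y})"
    proof -
      have "emeasure ?R {x<..} = (\<integral>\<^sup>+z. indicator ({x<..} \<inter> {0..1 - lam * y}) z \<partial>lborel)"
        by (subst emeasure_density, simp, simp, intro nn_integral_cong) (auto split: split_indicator)
      then show ?thesis by simp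
    qed
    have ly: "lam * y \<le> 1" using y lam_pos lam_less_1 mult_mono[of lam 1 y 1] by auto
    consider "m < 0" | "1 \<le> m" | "0 \<le> m" "m < 1" by linarith
    then show ?thesis
    proof cases
      case 1
      then have "x < 0" using position_strict_mono[OF 1, of y] position_0 x by simp
      then have "{x<..} \<inter> {0..1 - lam * y} = {0..1 - lam * y}" by auto
      then show ?thesis unfolding R using 1 ly by (simp add: drift_mass_0 clamp01_def)
    next
      case 2
      then have "1 - lam * y \<le> x" using position_le_iff'[of 1 y m] position_1[OF y] x by simp
      then have "{x<..} \<inter> {0..1 - lam * y} = {}" by auto
      then show ?thesis unfolding R using 2 y by (simp add: drift_mass_1 clamp01_def)
    next
      case 3
      then have "0 \<le> x" "x \<le> 1 - lam * y" using position_le_iff'[of 0 y m] position_le_iff'[of m y 1] position_0 position_1[OF y] x by auto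
      then have "{x<..} \<inter> {0..1 - lam * y} = {x<..1 - lam * y}" by auto
      then show ?thesis unfolding R using 3 \<open>x \<le> _\<close> by (simp add: x position_def clamp01_def)
    qed
  qed
  then show "emeasure ?L {x<..} = emeasure ?R {x<..}" using L by simp
  show "emeasure ?L {x<..} < \<infinity>" unfolding L by simp
qed

lemma change_of_variables:
  fixes h :: "real \<Rightarrow> real"
  assumes y: "0 \<le> y" "y \<le> 1" and [measurable]: "h \<in> borel_measurable borel"
  shows "(\<integral>x. indicator {0..1 - lam * y} x * h x \<partial>lborel)
    = (\<integral>z. weight (snd z) y * h (position (mass (fst z) (snd z)) y) \<partial>(U \<Otimes>\<^sub>M U))"
proof -
  have "(\<integral>x. indicator {0..1 - lam * y} x * h x \<partial>lborel)
      = (\<integral>x. h x \<partial>density lborel (\<lambda>x. ennreal (indicator {0..1 - lam * y} x)))"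
    by (subst integral_density) auto
  also have "\<dots> = (\<integral>x. h x \<partial>distr (density (U \<Otimes>\<^sub>M U) (\<lambda>z. ennreal (weight (snd z) y))) borel (\<lambda>z. position (mass (fst z) (snd z)) y))"
    by (simp only: pushforward_eq[OF y])
  also have "\<dots> = (\<integral>z. weight (snd z) y * h (position (mass (fst z) (snd z)) y) \<partial>(U \<Otimes>\<^sub>M U))"
    using weight_bounds
    by (subst integral_distr, simp, simp, subst integral_density) (auto simp: less_imp_le)
  finally show ?thesis .
qed

end

section \<open>Integration over the slices\<close>

text \<open>
  The window contains all slices of the model cell and their shears by at most 1, and being
  finite it makes all bounded measurable functions integrable.
\<close>

definition L :: "real measure" where
  "L = density lborel (\<lambda>x. ennreal (indicator {-2..2} x))"

lemma sets_L [simp, measurable_cong]: "sets L = sets borel"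
  and space_L [simp]: "space L = UNIV"
  by (auto simp: L_def)

lemma emeasure_L: "A \<in> sets borel \<Longrightarrow> emeasure L A = emeasure lborel (A \<inter> {-2..2})"
proof -
  assume [measurable]: "A \<in> sets borel"
  have "emeasure L A = (\<integral>\<^sup>+x. indicator (A \<inter> {-2..2}) x \<partial>lborel)"
    unfolding L_def by (subst emeasure_density, simp, simp, intro nn_integral_cong) (auto split: split_indicator)
  then show ?thesis by simp
qed

interpretation L: finite_measure L
  by standard (simp add: emeasure_L)

interpretation UL: pair_sigma_finite U L ..
interpretation LU: pair_sigma_finite L U ..

lemma finite_UL: "finite_measure (U \<Otimes>\<^sub>M L)"
  by (intro finite_measure_pair_measure) unfold_locales

lemma integral_L:
  fixes f :: "real \<Rightarrow> real"
  assumes [measurable]: "f \<in> borel_measurable borel"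
  shows "(\<integral>x. f x \<partial>L) = (\<integral>x. indicator {-2..2} x * f x \<partial>lborel)"
  unfolding L_def by (subst integral_density) auto

lemma integrable_L:
  fixes f :: "real \<Rightarrow> real"
  assumes [measurable]: "f \<in> borel_measurable borel" and "\<And>x. \<bar>f x\<bar> \<le> K"
  shows "integrable L f"
  using assms by (intro L.integrable_const_bound[where B=K]) auto

lemma UL_integrable:
  fixes f :: "real \<times> real \<Rightarrow> real"
  assumes [measurable]: "f \<in> borel_measurable (borel \<Otimes>\<^sub>M borel)" and "\<And>x. \<bar>f x\<bar> \<le> K"
  shows "integrable (U \<Otimes>\<^sub>M L) f"
proof -
  have [measurable]: "f \<in> borel_measurable (U \<Otimes>\<^sub>M L)" by measurable
  show ?thesis using assms(2)
    by (intro finite_measure.integrable_const_bound[OF finite_UL, where B=K]) auto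
qed

lemma swap_UL:
  fixes h :: "real \<Rightarrow> real \<Rightarrow> real"
  assumes "(\<lambda>z. h (fst z) (snd z)) \<in> borel_measurable (borel \<Otimes>\<^sub>M borel)" "\<And>x y. \<bar>h x y\<bar> \<le> K"
  shows "(\<integral>x. \<integral>y. h x y \<partial>L \<partial>U) = (\<integral>y. \<integral>x. h x y \<partial>U \<partial>L)"
  using UL_integrable[OF assms(1), of K] assms(2)
  by (intro UL.Fubini_integral[symmetric]) (simp add: case_prod_beta')

lemma swap_UU:
  fixes h :: "real \<Rightarrow> real \<Rightarrow> real"
  assumes "(\<lambda>z. h (fst z) (snd z)) \<in> borel_measurable (borel \<Otimes>\<^sub>M borel)" "\<And>x y. \<bar>h x y\<bar> \<le> K"
  shows "(\<integral>x. \<integral>y. h x y \<partial>U \<partial>U) = (\<integral>y. \<integral>x. h x y \<partial>U \<partial>U)"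
  using UU_integrable[OF assms(1), of K] assms(2)
  by (intro UU.Fubini_integral[symmetric]) (simp add: case_prod_beta')

lemma integral_bound_U:
  fixes f :: "real \<Rightarrow> real"
  assumes [measurable]: "f \<in> borel_measurable borel" and K: "\<And>x. \<bar>f x\<bar> \<le> K"
  shows "\<bar>\<integral>x. f x \<partial>U\<bar> \<le> K"
proof -
  have "\<bar>\<integral>x. f x \<partial>U\<bar> \<le> (\<integral>x. \<bar>f x\<bar> \<partial>U)" by (rule integral_abs_bound)
  also have "\<dots> \<le> (\<integral>x. K \<partial>U)" using K by (intro integral_mono integrable_U[where K=K]) (auto intro: order_trans[OF abs_ge_zero])
  finally show ?thesis using U.prob_space by simp
qed

lemma integral_bound_L:
  fixes f :: "real \<Rightarrow> real"
  assumes [measurable]: "f \<in> borel_measurable borel" and K: "\<And>x. \<bar>f x\<bar> \<le> K"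
  shows "\<bar>\<integral>x. f x \<partial>L\<bar> \<le> 4 * K"
proof -
  have m: "measure L UNIV = 4" using emeasure_L[of UNIV] by (simp add: measure_def)
  have K0: "0 \<le> K" using order_trans[OF abs_ge_zero K] .
  have "\<bar>\<integral>x. f x \<partial>L\<bar> \<le> (\<integral>x. \<bar>f x\<bar> \<partial>L)" by (rule integral_abs_bound)
  also have "\<dots> \<le> (\<integral>x. K \<partial>L)" using K K0 by (intro integral_mono integrable_L[where K=K]) auto
  finally show ?thesis using m by simp
qed

lemma FTC_L:
  fixes g g' :: "real \<Rightarrow> real"
  assumes d: "\<And>x. (g has_real_derivative g' x) (at x)" and c: "continuous_on UNIV g'"
    and g2: "g 2 = 0" and ab: "-2 \<le> a" "a \<le> 2"
  shows "(\<integral>x. (if a \<le> x then 1 else 0) * g' x \<partial>L) = - g a"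
proof -
  have [measurable]: "g' \<in> borel_measurable borel" using c by (rule borel_measurable_continuous_onI)
  have "(\<integral>x. (if a \<le> x then 1 else 0) * g' x \<partial>L) = (\<integral>x. g' x * indicator {a..2} x \<partial>lborel)"
    using ab by (subst integral_L) (auto intro!: Bochner_Integration.integral_cong split: split_indicator)
  also have "\<dots> = g 2 - g a"
    using c d ab by (intro integral_FTC_Icc_real) (auto simp: continuous_on_eq_continuous_at)
  finally show ?thesis using g2 by simp
qed

section \<open>Velocity of the particles and level heights of the sheared curves\<close>

text \<open>
  The integrand \<open>label_cdf m\<close> is continuous at generic heights, because \<open>spread\<close> is.
\<close>

lemma drift_has_derivative:
  assumes g: "generic y" and y: "0 < y" "y < 1"
  shows "((\<lambda>y. drift m y) has_real_derivative label_cdf m y) (at y)"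
proof -
  have near: "\<exists>d>0. \<forall>t. \<bar>t - y\<bar> < d \<longrightarrow> \<bar>label_cdf m t - label_cdf m y\<bar> \<le> e" if e: "0 < e" for e
  proof -
    have "isCont spread y" using g by (rule generic_isCont_spread)
    moreover have "0 < e\<^sup>2 / 3" using e by simp
    ultimately obtain d where d: "0 < d" "\<And>t. \<bar>t - y\<bar> < d \<Longrightarrow> \<bar>spread t - spread y\<bar> < e\<^sup>2 / 3"
      unfolding continuous_at_eps_delta dist_real_def by blast
    have "\<bar>label_cdf m t - label_cdf m y\<bar> \<le> e" if "\<bar>t - y\<bar> < d" for t
    proof (rule power2_le_imp_le)
      have "(label_cdf m t - label_cdf m y)\<^sup>2 \<le> 3 * (\<bar>m - m\<bar> + \<bar>spread t - spread y\<bar>)" by (rule label_cdf_holder)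
      then show "\<bar>label_cdf m t - label_cdf m y\<bar>\<^sup>2 \<le> e\<^sup>2" using d(2)[OF that] by simp
    qed (use e in simp)
    then show ?thesis using d(1) by blast
  qed
  show ?thesis
    unfolding DERIV_def LIM_def dist_real_def
  proof (intro allI impI)
    fix r :: real assume r: "0 < r"
    obtain d where d: "0 < d" "\<And>t. \<bar>t - y\<bar> < d \<Longrightarrow> \<bar>label_cdf m t - label_cdf m y\<bar> \<le> r / 2"
      using near[of "r/2"] r by auto
    define e where "e = r / 2"
    have e: "0 < e" "e < r" using r by (auto simp: e_def)
    define d' where "d' = min d (min y (1 - y))"
    have d': "0 < d'" "d' \<le> d" "d' \<le> y" "d' \<le> 1 - y" using d y by (auto simp: d'_def)
    have inc: "\<bar>drift m b - drift m a - label_cdf m y * (b - a)\<bar> \<le> e * (b - a)"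
      if ab: "a \<le> b" "0 \<le> a" "b \<le> 1" "\<And>t. a \<le> t \<Longrightarrow> t < b \<Longrightarrow> \<bar>t - y\<bar> < d" for a b
    proof -
      have bd: "label_cdf m y - e \<le> label_cdf m t" "label_cdf m t \<le> label_cdf m y + e" if "a \<le> t" "t < b" for t
        using d(2)[OF ab(4)[OF that]] unfolding e_def abs_le_iff by linarith+
      have "(label_cdf m y - e) * (b - a) \<le> max 0 (label_cdf m y - e) * (b - a)" using ab by (intro mult_right_mono) auto
      also have "\<dots> \<le> drift m b - drift m a"
        using ab bd by (intro drift_height_bounds(1)[where d=1]) (auto simp: label_cdf_bounds)
      finally have 1: "(label_cdf m y - e) * (b - a) \<le> drift m b - drift m a" .
      have "drift m b - drift m a \<le> min 1 (label_cdf m y + e) * (b - a)"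
        using ab bd by (intro drift_height_bounds(2)[where c=0]) (auto simp: label_cdf_bounds)
      also have "\<dots> \<le> (label_cdf m y + e) * (b - a)" using ab by (intro mult_right_mono) auto
      finally show ?thesis using 1 by (simp add: abs_le_iff algebra_simps)
    qed
    show "\<exists>s>0. \<forall>h. h \<noteq> 0 \<and> \<bar>h - 0\<bar> < s \<longrightarrow> \<bar>(drift m (y + h) - drift m y) / h - label_cdf m y\<bar> < r"
    proof (intro exI[of _ d'] conjI allI impI)
      show "0 < d'" by (rule d')
      fix h assume "h \<noteq> 0 \<and> \<bar>h - 0\<bar> < d'"
      then have h: "h \<noteq> 0" "\<bar>h\<bar> < d'" by auto
      have "\<bar>drift m (y + h) - drift m y - label_cdf m y * h\<bar> \<le> e * \<bar>h\<bar>"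
      proof (cases "0 < h")
        case True
        then show ?thesis using inc[of y "y + h"] h d' y by (auto simp: abs_less_iff)
      next
        case False
        then have "\<bar>drift m y - drift m (y + h) - label_cdf m y * (y - (y + h))\<bar> \<le> e * (y - (y + h))"
          using h d' y by (intro inc) (auto simp: abs_less_iff abs_if split: if_splits)
        then show ?thesis using False h by (simp add: abs_if algebra_simps split: if_splits)
      qed
      moreover have "(drift m (y + h) - drift m y) / h - label_cdf m y = (drift m (y + h) - drift m y - label_cdf m y * h) / h"
        using h by (simp add: field_simps)
      ultimately have "\<bar>(drift m (y + h) - drift m y) / h - label_cdf m y\<bar> \<le> e"
        using h by (simp add: abs_divide divide_le_eq)
      then show "\<bar>(drift m (y + h) - drift m y) / h - label_cdf m y\<bar> < r" using e by simp
    qed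
  qed
qed

context flow
begin

text \<open>
  The height at which the decreasing sheared curve of label \<open>u\<close> passes the abscissa \<open>x\<close>, written
  as the measure of the heights at which it is still to the right of \<open>x\<close>, so that measurability
  and jumps of the curve need no care.
\<close>

definition level_height :: "real \<Rightarrow> real \<Rightarrow> real" where
  "level_height u x = (\<integral>t. (if x < eta u t then 1 else 0) \<partial>U)"

lemma level_height_measurable [measurable (raw)]:
  assumes [measurable]: "g \<in> borel_measurable M" "h \<in> borel_measurable M"
  shows "(\<lambda>x. level_height (g x) (h x)) \<in> borel_measurable M"
  unfolding level_height_def by measurable

lemma level_height_bounds: "0 \<le> level_height u x" "level_height u x \<le> 1"
proof -
  show "0 \<le> level_height u x" unfolding level_height_def by (intro integral_nonneg_AE) auto
  have "level_height u x \<le> (\<integral>u. 1 \<partial>U)" unfolding level_height_def by (intro U_mono[where K=1]) auto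
  then show "level_height u x \<le> 1" using U.prob_space by simp
qed

lemma level_height_less:
  assumes u: "0 \<le> u" "u < 1" and y: "0 \<le> y" "y < 1" and "y < level_height u x"
  shows "x < eta u y"
proof (rule ccontr)
  assume n: "\<not> x < eta u y"
  have "level_height u x \<le> (\<integral>t. (if 0 \<le> t \<and> t < y then 1 else 0) \<partial>U)" unfolding level_height_def
  proof (intro U_mono[where K=1])
    fix t :: real assume t: "0 \<le> t" "t < 1"
    have "eta u t \<le> eta u y" if "y \<le> t" using eta_drop(1)[of u y t] u y t that by simp
    then show "(if x < eta u t then 1 else 0) \<le> (if 0 \<le> t \<and> t < y then 1 else (0::real))"
      using n t by (cases "y \<le> t") auto
  qed auto
  then show False using integral_U_interval[of 0 y] y assms(5) by simp
qed

lemma level_height_greater: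
  assumes u: "0 \<le> u" "u < 1" and y: "0 \<le> y" "y < 1" and "level_height u x < y"
  shows "eta u y \<le> x"
proof (rule ccontr)
  assume n: "\<not> eta u y \<le> x"
  have "(\<integral>t. (if 0 \<le> t \<and> t < y then 1 else 0) \<partial>U) \<le> level_height u x" unfolding level_height_def
  proof (intro U_mono[where K=1])
    fix t :: real assume t: "0 \<le> t" "t < 1"
    have "eta u y \<le> eta u t" if "t < y" using eta_drop(1)[of u t y] u y t that by simp
    then show "(if 0 \<le> t \<and> t < y then 1 else 0) \<le> (if x < eta u t then 1 else (0::real))"
      using n t by (cases "t < y") auto
  qed auto
  then show False using integral_U_interval[of 0 y] y assms(5) by simp
qed

end

section \<open>Integration by parts in the model cell\<close>

text \<open>
  A test function in the coordinates of the model cell, with its partial derivatives.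
\<close>

locale flow_test = flow +
  fixes f fx fy :: "real \<times> real \<Rightarrow> real" and K :: real
  assumes f_deriv: "\<And>z. (f has_derivative (\<lambda>v. fst v * fx z + snd v * fy z)) (at z)"
    and fx_cont: "continuous_on UNIV fx" and fy_cont: "continuous_on UNIV fy"
    and f_bound: "\<And>z. \<bar>f z\<bar> \<le> K" and fx_bound: "\<And>z. \<bar>fx z\<bar> \<le> K" and fy_bound: "\<And>z. \<bar>fy z\<bar> \<le> K"
    and f_zero: "\<And>x y. \<not> (0 < y \<and> y < 1 \<and> 0 < x \<and> x < 1 - lam * y) \<Longrightarrow> f (x, y) = 0 \<and> fx (x, y) = 0 \<and> fy (x, y) = 0"
begin

lemma K_nonneg: "0 \<le> K" using order_trans[OF abs_ge_zero f_bound] .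

lemma f_cont: "continuous_on UNIV f"
  using has_derivative_continuous[OF f_deriv] by (auto simp: continuous_on_eq_continuous_at)

lemma test_measurable [measurable (raw)]:
  assumes [measurable]: "a \<in> borel_measurable M" "b \<in> borel_measurable M"
  shows "(\<lambda>x. f (a x, b x)) \<in> borel_measurable M" "(\<lambda>x. fx (a x, b x)) \<in> borel_measurable M"
    "(\<lambda>x. fy (a x, b x)) \<in> borel_measurable M"
  by (rule measurable_compose[OF _ borel_measurable_continuous_onI[OF f_cont]]
      measurable_compose[OF _ borel_measurable_continuous_onI[OF fx_cont]]
      measurable_compose[OF _ borel_measurable_continuous_onI[OF fy_cont]], simp)+

lemma f_curve_deriv:
  assumes "(c has_real_derivative c') (at y)"
  shows "((\<lambda>y. f (c y, y)) has_real_derivative (c' * fx (c y, y) + fy (c y, y))) (at y)"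
proof -
  have "((\<lambda>y. (c y, y)) has_derivative (\<lambda>h. (h * c', h))) (at y)"
    using assms by (intro has_derivative_Pair) (auto simp: has_field_derivative_def mult_commute_abs)
  from has_derivative_compose[OF this f_deriv]
  show ?thesis by (auto simp: has_field_derivative_def algebra_simps elim!: has_derivative_eq_rhs)
qed

lemma f_x_deriv: "((\<lambda>x. f (x, y)) has_real_derivative fx (x, y)) (at x)"
proof -
  have "((\<lambda>x. (x, y)) has_derivative (\<lambda>h. (h, 0))) (at x)"
    by (intro has_derivative_Pair) auto
  from has_derivative_compose[OF this f_deriv]
  show ?thesis by (auto simp: has_field_derivative_def algebra_simps elim!: has_derivative_eq_rhs)
qed

lemma f_lipschitz: "\<bar>f (x, y) - f (x', y')\<bar> \<le> 2 * K * (\<bar>x - x'\<bar> + \<bar>y - y'\<bar>)"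
proof -
  have on: "onorm (\<lambda>v. fst v * fx z + snd v * fy z) \<le> 2 * K" for z
  proof (rule onorm_bound)
    fix v :: "real \<times> real"
    have "\<bar>fst v\<bar> * \<bar>fx z\<bar> \<le> norm v * K"
      using fx_bound norm_fst_le[of "fst v" "snd v"] K_nonneg by (intro mult_mono) auto
    moreover have "\<bar>snd v\<bar> * \<bar>fy z\<bar> \<le> norm v * K"
      using fy_bound norm_snd_le[of "snd v" "fst v"] K_nonneg by (intro mult_mono) auto
    ultimately have "\<bar>fst v * fx z\<bar> + \<bar>snd v * fy z\<bar> \<le> 2 * K * norm v" by (simp add: abs_mult algebra_simps)
    then show "norm (fst v * fx z + snd v * fy z) \<le> 2 * K * norm v"
      by (simp add: order_trans[OF abs_triangle_ineq])
  qed (use K_nonneg in simp)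
  have "norm (f (x, y) - f (x', y')) \<le> 2 * K * norm ((x, y) - (x', y'))"
    using f_deriv on by (intro differentiable_bound[of UNIV]) auto
  also have "\<dots> \<le> 2 * K * (\<bar>x - x'\<bar> + \<bar>y - y'\<bar>)"
    using K_nonneg norm_Pair_le[of "x-x'" "y-y'"] by (intro mult_left_mono) auto
  finally show ?thesis by simp
qed

text \<open>
  The integrand is almost everywhere the derivative of \<open>f\<close> along the path of the particle \<open>m\<close>,
  which is Lipschitz and differentiable at generic heights. The fundamental theorem of calculus
  for it is obtained from the difference quotients, whose integrals vanish by translation
  invariance, and dominated convergence.
\<close>

lemma integral_along_flow:
  "(\<integral>y. fy (position m y, y) - lam * label_cdf m y * fx (position m y, y) \<partial>U) = 0"
proof -
  define F where "F y = f (position m y, y)" for y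
  define g where "g y = fy (position m y, y) - lam * label_cdf m y * fx (position m y, y)" for y
  \<comment> \<open>the difference quotients for the step \<open>1 / (n + 1)\<close>\<close>
  define q where "q n y = real (Suc n) * (F (y + 1 / real (Suc n)) - F y)" for n y
  have [measurable]: "F \<in> borel_measurable borel" "g \<in> borel_measurable borel"
    unfolding F_def g_def by measurable
  have F0: "F y = 0" if "y \<le> 0 \<or> 1 \<le> y" for y using f_zero[of y "position m y"] that by (auto simp: F_def)
  have Flip: "\<bar>F y - F y'\<bar> \<le> 4 * K * \<bar>y - y'\<bar>" for y y'
  proof -
    have "\<bar>F y - F y'\<bar> \<le> 2 * K * (\<bar>position m y - position m y'\<bar> + \<bar>y - y'\<bar>)" unfolding F_def by (rule f_lipschitz)
    also have "\<dots> \<le> 2 * K * (\<bar>y - y'\<bar> + \<bar>y - y'\<bar>)"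
      using position_lipschitz_height K_nonneg by (intro mult_left_mono) auto
    finally show ?thesis by simp
  qed
  have Fint: "integrable lborel F"
  proof -
    have "norm (F y) \<le> norm (K * indicator {0..1} y)" for y
      using F0[of y] f_bound[of "(position m y, y)"] K_nonneg by (auto simp: F_def split: split_indicator)
    then show ?thesis
      by (intro Bochner_Integration.integrable_bound[of lborel "\<lambda>y. K * indicator {0..1} y" F]) auto
  qed
  have Fderiv: "(F has_real_derivative g y) (at y)" if "generic y" "0 < y" "y < 1" for y
  proof -
    have "((\<lambda>y. position m y) has_real_derivative (0 - lam * label_cdf m y)) (at y)"
      unfolding position_def using drift_has_derivative[OF that] by (auto intro!: derivative_eq_intros)
    from f_curve_deriv[OF this] show ?thesis unfolding F_def g_def by (simp add: algebra_simps)
  qed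
  have gen: "AE y in lborel. 0 \<le> y \<and> y < 1 \<longrightarrow> generic y"
    using AE_generic unfolding U_def by (subst (asm) AE_density) (auto simp: indicator_def split: if_splits elim!: eventually_mono)
  have "(\<lambda>n. \<integral>y. q n y \<partial>lborel) \<longlonglongrightarrow> (\<integral>y. indicator {0..<1} y * g y \<partial>lborel)"
  proof (rule integral_dominated_convergence[where w="\<lambda>y. indicator {-1..1} y * (4 * K)"])
    show "(\<lambda>y. indicator {0..<1} y * g y) \<in> borel_measurable lborel" by simp
    show "q n \<in> borel_measurable lborel" for n unfolding q_def by measurable
    show "integrable lborel (\<lambda>y::real. indicator {-1..1} y * (4 * K))"
      by (intro integrable_mult_left integrable_real_indicator) auto
    show "AE y in lborel. norm (q n y) \<le> indicator {-1..1} y * (4 * K)" for n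
    proof (rule AE_I2)
      fix y :: real
      have s: "0 < 1 / real (Suc n)" "1 / real (Suc n) \<le> 1" by auto
      show "norm (q n y) \<le> indicator {-1..1} y * (4 * K)"
      proof (cases "-1 \<le> y \<and> y \<le> 1")
        case True
        have "\<bar>q n y\<bar> = real (Suc n) * \<bar>F (y + 1 / real (Suc n)) - F y\<bar>" by (simp add: q_def abs_mult)
        also have "\<dots> \<le> real (Suc n) * (4 * K * \<bar>(y + 1 / real (Suc n)) - y\<bar>)" by (intro mult_left_mono Flip) auto
        also have "\<dots> = 4 * K" by simp
        finally show ?thesis using True by simp
      next
        case False
        then have "y + 1 / real (Suc n) \<le> 0 \<or> 1 \<le> y + 1 / real (Suc n)" "y \<le> 0 \<or> 1 \<le> y"
          using s by linarith+
        then have "F (y + 1 / real (Suc n)) = 0" "F y = 0" using F0 by blast+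
        then show ?thesis using False by (simp add: q_def)
      qed
    qed
    show "AE y in lborel. (\<lambda>n. q n y) \<longlonglongrightarrow> indicator {0..<1} y * g y"
      using gen AE_lborel_singleton[of "0::real"]
    proof eventually_elim
      case (elim y)
      consider "y < 0" | "1 \<le> y" | "0 < y" "y < 1" using elim by linarith
      then show ?case
      proof cases
        case 1
        have "(\<lambda>n. 1 / real (Suc n)) \<longlonglongrightarrow> 0" by (rule LIMSEQ_Suc[OF lim_1_over_n])
        then have "\<forall>\<^sub>F n in sequentially. 1 / real (Suc n) < - y"
          using 1 by (intro order_tendstoD) auto
        then have "\<forall>\<^sub>F n in sequentially. 0 = q n y"
          by eventually_elim (use 1 in \<open>simp add: q_def F0\<close>)
        then show ?thesis using 1 by (auto intro: Lim_transform_eventually[OF tendsto_const])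
      next
        case 2
        have "q n y = 0" for n
        proof -
          have "0 < 1 / real (Suc n)" by simp
          then have "1 \<le> y + 1 / real (Suc n)" using 2 by linarith
          then show ?thesis using 2 F0 by (simp add: q_def)
        qed
        then show ?thesis using 2 by simp
      next
        case 3
        then have d: "((\<lambda>h. (F (y + h) - F y) / h) \<longlongrightarrow> g y) (at 0)"
          using Fderiv elim by (simp add: DERIV_def)
        have "(\<lambda>n. 1 / real (Suc n)) \<longlonglongrightarrow> 0" by (rule LIMSEQ_Suc[OF lim_1_over_n])
        then have "filterlim (\<lambda>n. 1 / real (Suc n)) (at 0) sequentially"
          by (simp add: filterlim_at)
        from filterlim_compose[OF d this]
        have "(\<lambda>n. q n y) \<longlonglongrightarrow> g y" by (simp add: q_def mult.commute)
        then show ?thesis using 3 by simp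
      qed
    qed
  qed
  moreover have "(\<integral>y. q n y \<partial>lborel) = 0" for n
  proof -
    have sh: "(\<integral>y. F (y + 1 / real (Suc n)) \<partial>lborel) = (\<integral>y. F y \<partial>lborel)"
      using lborel_integral_real_affine[of 1 F "1 / real (Suc n)"] by (simp add: add.commute)
    have "integrable lborel (\<lambda>y. F (1 / real (Suc n) + 1 * y))"
      by (rule lborel_integrable_real_affine[OF Fint]) simp
    then have i: "integrable lborel (\<lambda>y. F (y + 1 / real (Suc n)))" by (simp add: add.commute)
    show ?thesis unfolding q_def using i Fint sh by simp
  qed
  ultimately have "(\<integral>y. indicator {0..<1} y * g y \<partial>lborel) = 0" by (simp add: LIMSEQ_const_iff)
  then show ?thesis using integral_U[of g] by (simp add: g_def)
qed

text \<open>
  In particle coordinates the density cancels against \<open>weight\<close>, and what remains is an integral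
  over all particles of derivatives along their paths.
\<close>

lemma divergence_free_coords:
  "(\<integral>y. \<integral>x. dens x y * (fy (x, y) - lam * G x y * fx (x, y)) \<partial>L \<partial>U) = 0"
proof -
  let ?h = "\<lambda>x y. dens x y * (fy (x, y) - lam * G x y * fx (x, y))"
  let ?g = "\<lambda>z y. fy (position (mass (fst z) (snd z)) y, y) - lam * label_cdf (mass (fst z) (snd z)) y * fx (position (mass (fst z) (snd z)) y, y)"
  have AEu: "AE z in U \<Otimes>\<^sub>M U. 0 \<le> snd z \<and> snd z < 1"
  proof (rule UU.AE_pair_measure)
    have "{z \<in> space (borel \<Otimes>\<^sub>M borel). 0 \<le> snd z \<and> snd z < (1::real)} \<in> sets (borel \<Otimes>\<^sub>M (borel::real measure))"
      by measurable
    then show "{z \<in> space (U \<Otimes>\<^sub>M U). 0 \<le> snd z \<and> snd z < 1} \<in> sets (U \<Otimes>\<^sub>M U)"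
      by (simp add: space_pair_measure cong: sets_pair_measure_cong)
  qed (use AE_U_unit in simp)
  have gb: "\<bar>?g z y\<bar> \<le> 2 * K" for z y
  proof -
    have "\<bar>lam * label_cdf (mass (fst z) (snd z)) y * fx (position (mass (fst z) (snd z)) y, y)\<bar> \<le> 1 * 1 * K"
      unfolding abs_mult using lam_pos lam_less_1 label_cdf_bounds fx_bound by (intro mult_mono) (auto simp: abs_of_nonneg)
    then show ?thesis using fy_bound[of "(position (mass (fst z) (snd z)) y, y)"] by linarith
  qed
  have "(\<integral>y. \<integral>x. ?h x y \<partial>L \<partial>U) = (\<integral>y. (\<integral>z. ?g z y \<partial>(U \<Otimes>\<^sub>M U)) \<partial>U)"
  proof (rule integral_U_cong)
    fix y :: real assume y: "0 \<le> y" "y < 1"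
    have "(\<integral>x. ?h x y \<partial>L) = (\<integral>x. indicator {0..1 - lam * y} x * ?h x y \<partial>lborel)"
    proof (subst integral_L)
      have ly: "0 \<le> lam * y" using y lam_pos by simp
      show "(\<integral>x. indicator {-2..2} x * ?h x y \<partial>lborel) = (\<integral>x. indicator {0..1 - lam * y} x * ?h x y \<partial>lborel)"
        using f_zero[of y] ly by (intro Bochner_Integration.integral_cong) (auto split: split_indicator)
    qed measurable
    also have "\<dots> = (\<integral>z. weight (snd z) y * ?h (position (mass (fst z) (snd z)) y) y \<partial>(U \<Otimes>\<^sub>M U))"
      using y by (intro change_of_variables) auto
    also have "\<dots> = (\<integral>z. ?g z y \<partial>(U \<Otimes>\<^sub>M U))"
    proof (rule integral_cong_AE)
      show "AE z in U \<Otimes>\<^sub>M U. weight (snd z) y * ?h (position (mass (fst z) (snd z)) y) y = ?g z y"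
        using AEu
      proof eventually_elim
        case (elim z)
        have "weight (snd z) y * dens (position (mass (fst z) (snd z)) y) y = 1"
          using elim y lam_less_1 by (simp add: dens_position weight_def)
        then have "weight (snd z) y * ?h (position (mass (fst z) (snd z)) y) y
          = 1 * (fy (position (mass (fst z) (snd z)) y, y) - lam * G (position (mass (fst z) (snd z)) y) y * fx (position (mass (fst z) (snd z)) y, y))"
          by (simp only: mult.assoc[symmetric])
        then show ?case by (simp add: G_position)
      qed
    qed measurable
    finally show "(\<integral>x. ?h x y \<partial>L) = (\<integral>z. ?g z y \<partial>(U \<Otimes>\<^sub>M U))" .
  qed measurable
  also have "\<dots> = (\<integral>z. (\<integral>y. ?g z y \<partial>U) \<partial>(U \<Otimes>\<^sub>M U))"
  proof -
    interpret PU: pair_prob_space "U \<Otimes>\<^sub>M U" U by unfold_locales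
    have "integrable ((U \<Otimes>\<^sub>M U) \<Otimes>\<^sub>M U) (\<lambda>(z, y). ?g z y)"
      by (rule PU.P.integrable_const_bound[where B="2*K"]) (use gb in auto)
    then show ?thesis by (rule PU.Fubini_integral)
  qed
  also have "\<dots> = 0" by (simp only: integral_along_flow) simp
  finally show ?thesis .
qed

lemma step_integral:
  assumes "0 < y" "y < 1"
  shows "(\<integral>x. (if xi u y \<le> x then 1 else 0) * fx (x, y) \<partial>L) = - f (xi u y, y)"
proof (rule FTC_L)
  show "continuous_on UNIV (\<lambda>x. fx (x, y))"
    by (rule continuous_on_compose2[OF fx_cont]) (auto intro!: continuous_intros)
  have "0 \<le> lam * y" using assms lam_pos by simp
  then show "-2 \<le> xi u y" "xi u y \<le> 2" "f (2, y) = 0"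
    using xi_range[of y u] assms f_zero[of y 2] by auto
qed (rule f_x_deriv)

lemma outside_unit: "y \<le> 0 \<or> 1 \<le> y \<Longrightarrow> f (x, y) = 0 \<and> fx (x, y) = 0 \<and> fy (x, y) = 0"
  using f_zero[of y x] by auto

lemma step_integral':
  "(\<integral>x. (if xi u y \<le> x then 1 else 0) * fx (x, y) \<partial>L) = - f (xi u y, y)"
  using step_integral[of y u] outside_unit[of y] by (cases "0 < y \<and> y < 1") auto

text \<open>
  Here \<open>G\<close> is the average over the labels of indicators of half-lines.
\<close>

lemma layer_cake:
  assumes [measurable]: "(\<lambda>x. k x) \<in> borel_measurable borel" and "\<And>x. \<bar>k x\<bar> \<le> C"
  shows "(\<integral>x. G x y * k x \<partial>L) = (\<integral>u. \<integral>x. (if xi u y \<le> x then 1 else 0) * k x \<partial>L \<partial>U)"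
proof -
  have C: "0 \<le> C" using order_trans[OF abs_ge_zero assms(2)] .
  have "(\<integral>x. G x y * k x \<partial>L) = (\<integral>x. \<integral>u. (if xi u y \<le> x then 1 else 0) * k x \<partial>U \<partial>L)"
    by (simp add: G_eq)
  also have "\<dots> = (\<integral>u. \<integral>x. (if xi u y \<le> x then 1 else 0) * k x \<partial>L \<partial>U)"
    using assms(2) C by (intro swap_UL[where K=C, symmetric]) auto
  finally show ?thesis .
qed

lemma integral_G_dx:
  "(\<integral>y. \<integral>x. G x y * fx (x, y) \<partial>L \<partial>U) = - (\<integral>y. \<integral>u. f (xi u y, y) \<partial>U \<partial>U)"
proof -
  have "(\<integral>x. G x y * fx (x, y) \<partial>L) = - (\<integral>u. f (xi u y, y) \<partial>U)" for y
    using layer_cake[of "\<lambda>x. fx (x, y)" K y] by (simp add: fx_bound step_integral')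
  then show ?thesis by simp
qed

text \<open>
  Integrals along the direction \<open>(- lam * u, 1)\<close> become integrals over vertical lines in the
  sheared variable \<open>x + lam * u * y\<close>, for which the half-line begins at \<open>eta u y\<close>.
\<close>

lemma sheared_step:
  assumes u: "0 \<le> u" "u < 1" and y: "0 \<le> y" "y < 1"
  shows "(\<integral>x. (if xi u y \<le> x then 1 else 0) * (fy (x, y) - lam * u * fx (x, y)) \<partial>L)
    = (\<integral>x. (if eta u y \<le> x then 1 else 0) * (fy (x - lam * u * y, y) - lam * u * fx (x - lam * u * y, y)) \<partial>L)"
proof -
  let ?k = "\<lambda>x. fy (x, y) - lam * u * fx (x, y)"
  have s: "0 \<le> lam * u * y" "lam * u * y \<le> 1"
    using u y lam_pos lam_less_1 mult_mono[of lam 1 u 1] mult_mono[of "lam * u" 1 y 1] by auto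
  have z: "?k x = 0" if "x \<le> 0 \<or> 1 \<le> x" for x
  proof -
    have "0 \<le> lam * y" using y lam_pos by simp
    then show ?thesis using f_zero[of y x] that by auto
  qed
  have "(\<integral>x. (if xi u y \<le> x then 1 else 0) * ?k x \<partial>L) = (\<integral>x. (if xi u y \<le> x then 1 else 0) * ?k x \<partial>lborel)"
    by (subst integral_L, measurable, intro Bochner_Integration.integral_cong)
      (use z in \<open>auto split: split_indicator\<close>)
  also have "\<dots> = (\<integral>x. (if xi u y \<le> x - lam * u * y then 1 else 0) * ?k (x - lam * u * y) \<partial>lborel)"
    by (subst lborel_integral_real_affine[where c=1 and t="- (lam * u * y)"]) (simp_all add: algebra_simps)
  also have "\<dots> = (\<integral>x. (if eta u y \<le> x then 1 else 0) * ?k (x - lam * u * y) \<partial>lborel)"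
    by (intro Bochner_Integration.integral_cong) (auto simp: eta_def algebra_simps)
  also have "\<dots> = (\<integral>x. (if eta u y \<le> x then 1 else 0) * ?k (x - lam * u * y) \<partial>L)"
  proof (subst integral_L)
    have "?k (x - lam * u * y) = 0" if "x \<notin> {-2..2}" for x using s that by (intro z) auto
    then show "(\<integral>x. (if eta u y \<le> x then 1 else 0) * ?k (x - lam * u * y) \<partial>lborel) =
      (\<integral>x. indicator {-2..2} x * ((if eta u y \<le> x then 1 else 0) * ?k (x - lam * u * y)) \<partial>lborel)"
      by (intro Bochner_Integration.integral_cong) (auto split: split_indicator)
  qed measurable
  finally show ?thesis .
qed

text \<open>
  On a vertical line of the sheared picture the region right of \<open>eta u\<close> is an interval above
  \<open>level_height u x\<close>, because \<open>eta u\<close> is decreasing.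
\<close>

lemma sheared_column:
  assumes u: "0 \<le> u" "u < 1"
  shows "(\<integral>y. (if eta u y \<le> x then 1 else 0) * (fy (x - lam * u * y, y) - lam * u * fx (x - lam * u * y, y)) \<partial>U)
    = - f (x - lam * u * level_height u x, level_height u x)"
proof -
  define H where "H = level_height u x"
  define F where "F y = f (x - lam * u * y, y)" for y
  define F' where "F' y = fy (x - lam * u * y, y) - lam * u * fx (x - lam * u * y, y)" for y
  have H01: "0 \<le> H" "H \<le> 1" using level_height_bounds by (auto simp: H_def)
  have F1: "F 1 = 0" by (simp add: F_def outside_unit)
  have dF: "(F has_real_derivative F' y) (at y)" for y
  proof -
    have "((\<lambda>y. x - lam * u * y) has_real_derivative - (lam * u)) (at y)"
      by (auto intro!: derivative_eq_intros)
    from f_curve_deriv[OF this]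
    have "(F has_real_derivative - (lam * u) * fx (x - lam * u * y, y) + fy (x - lam * u * y, y)) (at y)"
      unfolding F_def .
    then show ?thesis by (simp add: F'_def)
  qed
  have cF: "continuous_on UNIV F'"
    unfolding F'_def
    by (intro continuous_intros continuous_on_compose2[OF fx_cont] continuous_on_compose2[OF fy_cont]) auto
  have [measurable]: "F' \<in> borel_measurable borel" using cF by (rule borel_measurable_continuous_onI)
  have "(\<integral>y. (if eta u y \<le> x then 1 else 0) * F' y \<partial>U)
      = (\<integral>y. indicator {0..<1} y * ((if eta u y \<le> x then 1 else 0) * F' y) \<partial>lborel)"
    by (intro integral_U) measurable
  also have "\<dots> = (\<integral>y. F' y * indicator {H..1} y \<partial>lborel)"
  proof (rule integral_cong_AE)
    show "AE y in lborel. indicator {0..<1} y * ((if eta u y \<le> x then 1 else 0) * F' y) = F' y * indicator {H..1} y"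
      using AE_lborel_singleton[of H] AE_lborel_singleton[of "1::real"]
    proof eventually_elim
      case (elim y)
      show ?case
      proof (cases "0 \<le> y \<and> y < 1")
        case True
        then have "eta u y \<le> x \<longleftrightarrow> H < y"
          using elim level_height_less[of u y x] level_height_greater[of u y x] u
          by (cases y H rule: linorder_cases) (auto simp: H_def)
        then show ?thesis using True elim by (auto split: split_indicator)
      next
        case False
        then show ?thesis using elim H01 by (auto split: split_indicator)
      qed
    qed
  qed measurable
  also have "\<dots> = F 1 - F H"
    using cF dF H01 by (intro integral_FTC_Icc_real) (auto simp: continuous_on_eq_continuous_at)
  finally show ?thesis using F1 by (simp add: F_def F'_def H_def)
qed

text \<open>
  For each label \<open>u\<close> write \<open>fy = (fy - lam * u * fx) + lam * u * fx\<close>. The bracket is a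
  derivative along the sheared direction and contributes the values of \<open>f\<close> on the sheared curve,
  by \<open>sheared_column\<close>; the last term contributes the value at the crossing point.
\<close>

lemma integral_G_dy:
  "(\<integral>y. \<integral>x. G x y * fy (x, y) \<partial>L \<partial>U)
    = - (\<integral>u. \<integral>x. f (x - lam * u * level_height u x, level_height u x) \<partial>L \<partial>U)
      - lam * (\<integral>y. \<integral>u. u * f (xi u y, y) \<partial>U \<partial>U)"
proof -
  define C where "C = 2 * K"
  have C: "0 \<le> C" using K_nonneg by (simp add: C_def)
  define cl where "cl u = clamp01 u" for u :: real
  have [measurable]: "cl \<in> borel_measurable borel" unfolding cl_def clamp01_def by measurable
  have cl: "0 \<le> cl u" "cl u \<le> 1" for u by (auto simp: cl_def clamp01_def)
  have clu: "cl u = u" if "0 \<le> u" "u < 1" for u using that by (simp add: cl_def clamp01_def)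
  have small: "\<bar>lam * cl u * a\<bar> \<le> K" if "\<bar>a\<bar> \<le> K" for u a
  proof -
    have "\<bar>lam * cl u * a\<bar> \<le> 1 * 1 * K"
      unfolding abs_mult using lam_pos lam_less_1 cl[of u] that by (intro mult_mono) auto
    then show ?thesis by simp
  qed
  let ?k = "\<lambda>u x y. fy (x, y) - lam * cl u * fx (x, y)"
  have kb: "\<bar>?k u x y\<bar> \<le> C" for u x y
    using fy_bound[of "(x,y)"] small[OF fx_bound[of "(x,y)"], of u] unfolding C_def by linarith
  let ?i = "\<lambda>u x y. (if xi u y \<le> x then 1 else 0 :: real)"
  let ?e = "\<lambda>u x y. (if eta u y \<le> x then 1 else 0 :: real)"
  have "(\<integral>y. \<integral>x. G x y * fy (x, y) \<partial>L \<partial>U) = (\<integral>y. \<integral>u. (\<integral>x. ?i u x y * fy (x, y) \<partial>L) \<partial>U \<partial>U)"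
    using layer_cake[of "\<lambda>x. fy (x, _)" K] by (simp add: fy_bound)
  also have "\<dots> = (\<integral>y. \<integral>u. (\<integral>x. ?i u x y * ?k u x y \<partial>L) - lam * (cl u * f (xi u y, y)) \<partial>U \<partial>U)"
  proof -
    have "(\<integral>x. ?i u x y * fy (x, y) \<partial>L) = (\<integral>x. ?i u x y * ?k u x y \<partial>L) - lam * (cl u * f (xi u y, y))" for u y
    proof -
      have "(\<integral>x. ?i u x y * fy (x, y) \<partial>L) = (\<integral>x. ?i u x y * ?k u x y + (lam * cl u) * (?i u x y * fx (x, y)) \<partial>L)"
        by (intro Bochner_Integration.integral_cong) (auto simp: algebra_simps)
      also have "\<dots> = (\<integral>x. ?i u x y * ?k u x y \<partial>L) + (\<integral>x. (lam * cl u) * (?i u x y * fx (x, y)) \<partial>L)"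
        using kb C small[OF fx_bound] K_nonneg
        by (intro Bochner_Integration.integral_add integrable_L[where K=C] integrable_L[where K=K]) (auto simp: mult.assoc[symmetric])
      also have "(\<integral>x. (lam * cl u) * (?i u x y * fx (x, y)) \<partial>L) = (lam * cl u) * (- f (xi u y, y))"
        using step_integral'[of u y] by (subst integral_mult_right_zero) simp
      finally show ?thesis by simp
    qed
    then show ?thesis by simp
  qed
  also have "\<dots> = (\<integral>y. (\<integral>u. (\<integral>x. ?i u x y * ?k u x y \<partial>L) \<partial>U) - lam * (\<integral>u. cl u * f (xi u y, y) \<partial>U) \<partial>U)"
  proof -
    have "(\<integral>u. (\<integral>x. ?i u x y * ?k u x y \<partial>L) - lam * (cl u * f (xi u y, y)) \<partial>U)
       = (\<integral>u. (\<integral>x. ?i u x y * ?k u x y \<partial>L) \<partial>U) - lam * (\<integral>u. cl u * f (xi u y, y) \<partial>U)" for y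
    proof (subst Bochner_Integration.integral_diff)
      show "integrable U (\<lambda>u. \<integral>x. ?i u x y * ?k u x y \<partial>L)"
        using kb C by (intro integrable_U[where K="4*C"] integral_bound_L) auto
      show "integrable U (\<lambda>u. lam * (cl u * f (xi u y, y)))"
        using small[OF f_bound] by (intro integrable_U[where K=K]) (auto simp: mult.assoc)
    qed simp
    then show ?thesis by simp
  qed
  also have "\<dots> = (\<integral>y. (\<integral>u. (\<integral>x. ?i u x y * ?k u x y \<partial>L) \<partial>U) \<partial>U) - lam * (\<integral>y. \<integral>u. cl u * f (xi u y, y) \<partial>U \<partial>U)"
  proof (subst Bochner_Integration.integral_diff)
    show "integrable U (\<lambda>y. \<integral>u. (\<integral>x. ?i u x y * ?k u x y \<partial>L) \<partial>U)"
      using kb C by (intro integrable_U[where K="4*C"] integral_bound_U integral_bound_L) auto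
    have "\<bar>cl u * f (xi u y, y)\<bar> \<le> K" for u y
    proof -
      have "\<bar>cl u * f (xi u y, y)\<bar> \<le> 1 * K"
        unfolding abs_mult using cl[of u] f_bound by (intro mult_mono) auto
      then show ?thesis by simp
    qed
    then show "integrable U (\<lambda>y. lam * (\<integral>u. cl u * f (xi u y, y) \<partial>U))"
      by (intro integrable_mult_right integrable_U[where K=K] integral_bound_U) auto
  qed simp
  also have "(\<integral>y. (\<integral>u. (\<integral>x. ?i u x y * ?k u x y \<partial>L) \<partial>U) \<partial>U) = (\<integral>u. (\<integral>y. (\<integral>x. ?i u x y * ?k u x y \<partial>L) \<partial>U) \<partial>U)"
    using kb C by (intro swap_UU[where K="4*C"] integral_bound_L) auto
  also have "\<dots> = (\<integral>u. (\<integral>x. - f (x - lam * u * level_height u x, level_height u x) \<partial>L) \<partial>U)"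
  proof (rule integral_U_cong)
    fix u :: real assume u: "0 \<le> u" "u < 1"
    have "(\<integral>y. (\<integral>x. ?i u x y * ?k u x y \<partial>L) \<partial>U) = (\<integral>y. (\<integral>x. ?e u x y * ?k u (x - lam * cl u * y) y \<partial>L) \<partial>U)"
      unfolding clu[OF u] by (intro integral_U_cong sheared_step u) measurable
    also have "\<dots> = (\<integral>x. (\<integral>y. ?e u x y * ?k u (x - lam * cl u * y) y \<partial>U) \<partial>L)"
      using kb C by (intro swap_UL[where K=C]) auto
    also have "\<dots> = (\<integral>x. - f (x - lam * u * level_height u x, level_height u x) \<partial>L)"
      unfolding clu[OF u] by (simp only: sheared_column[OF u])
    finally show "(\<integral>y. (\<integral>x. ?i u x y * ?k u x y \<partial>L) \<partial>U) = (\<integral>x. - f (x - lam * u * level_height u x, level_height u x) \<partial>L)" .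
  qed measurable
  also have "(\<integral>y. \<integral>u. cl u * f (xi u y, y) \<partial>U \<partial>U) = (\<integral>y. \<integral>u. u * f (xi u y, y) \<partial>U \<partial>U)"
    by (intro integral_U_cong) (auto simp: clu intro!: integral_U_cong)
  finally show ?thesis by simp
qed

lemma integral_fy_zero: "(\<integral>y. \<integral>x. fy (x, y) \<partial>L \<partial>U) = 0"
proof -
  have "(\<integral>y. \<integral>x. fy (x, y) \<partial>L \<partial>U) = (\<integral>x. \<integral>y. fy (x, y) \<partial>U \<partial>L)"
    using fy_bound by (intro swap_UL[where K=K]) auto
  moreover have "(\<integral>y. fy (x, y) \<partial>U) = 0" for x
  proof -
    have "(\<integral>y. fy (x, y) \<partial>U) = (\<integral>y. fy (x, y) * indicator {0..1} y \<partial>lborel)"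
      by (subst integral_U, measurable, intro Bochner_Integration.integral_cong)
        (auto split: split_indicator simp: outside_unit)
    also have "\<dots> = f (x, 1) - f (x, 0)"
    proof (rule integral_FTC_Icc_real)
      fix y
      show "DERIV (\<lambda>y. f (x, y)) y :> fy (x, y)"
        using f_curve_deriv[of "\<lambda>_. x" 0 y] by simp
      have "continuous_on UNIV (\<lambda>y. fy (x, y))"
        by (rule continuous_on_compose2[OF fy_cont]) (auto intro!: continuous_intros)
      then show "isCont (\<lambda>y. fy (x, y)) y" by (simp add: continuous_on_eq_continuous_at)
    qed simp
    finally show ?thesis by (simp add: outside_unit)
  qed
  ultimately show ?thesis by simp
qed

lemma integral_fx_zero: "(\<integral>y. \<integral>x. fx (x, y) \<partial>L \<partial>U) = 0"
proof -
  have "(\<integral>x. fx (x, y) \<partial>L) = 0" if y: "0 < y" "y < 1" for y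
  proof -
    have "(\<integral>x. fx (x, y) \<partial>L) = (\<integral>x. (if -2 \<le> x then 1 else 0) * fx (x, y) \<partial>L)"
      by (subst (1 2) integral_L, measurable, intro Bochner_Integration.integral_cong) (auto split: split_indicator)
    also have "\<dots> = - f (-2, y)"
    proof (rule FTC_L)
      show "continuous_on UNIV (\<lambda>x. fx (x, y))"
        by (rule continuous_on_compose2[OF fx_cont]) (auto intro!: continuous_intros)
      have "0 \<le> lam * y" using y lam_pos by simp
      then show "f (2, y) = 0" using f_zero[of y 2] by auto
    qed (auto intro: f_x_deriv)
    finally show ?thesis using f_zero[of y "-2"] by simp
  qed
  moreover have "(\<integral>x. fx (x, y) \<partial>L) = 0" if "\<not> (0 < y \<and> y < 1)" for y
    using that outside_unit[of y] by auto
  ultimately have "(\<integral>x. fx (x, y) \<partial>L) = 0" for y by blast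
  then show ?thesis by simp
qed

end

section \<open>Signed measures\<close>

lemma borel_subsets_iff: 
  "\<Omega> \<in> sets borel \<Longrightarrow> E \<in> borel_subsets \<Omega> \<longleftrightarrow> E \<subseteq> \<Omega> \<and> E \<in> sets borel"
  by (rule sets_restrict_space_iff) simp

lemma emeasure_measure_of_real:
  fixes f :: "'a set \<Rightarrow> real"
  assumes M: "sigma_algebra \<Omega> M" and nonneg: "\<And>E. E \<in> M \<Longrightarrow> 0 \<le> f E"
    and g: "\<And>E. E \<in> M \<Longrightarrow> g E = ennreal (f E)"
    and add: "\<And>A. range A \<subseteq> M \<Longrightarrow> disjoint_family A \<Longrightarrow> (\<lambda>i::nat. f (A i)) sums f (\<Union>i. A i)"
    and E: "E \<in> M"
  shows "emeasure (measure_of \<Omega> M g) E = ennreal (f E)"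
proof -
  interpret sigma_algebra \<Omega> M by fact
  have f0: "f {} = 0"
  proof -
    have "(\<lambda>i::nat. f {}) sums f {}" using add[of "\<lambda>_. {}"] by (auto simp: disjoint_family_on_def)
    then have "summable (\<lambda>i::nat. f {})" by (rule sums_summable)
    then show ?thesis by (simp add: summable_const_iff)
  qed
  have "countably_additive M g"
  proof (rule countably_additiveI)
    fix A :: "nat \<Rightarrow> 'a set" assume A: "range A \<subseteq> M" "disjoint_family A" "(\<Union>i. A i) \<in> M"
    have "(\<Sum>i. g (A i)) = (\<Sum>i. ennreal (f (A i)))" using A by (intro suminf_cong g) auto
    also have "\<dots> = ennreal (f (\<Union>i. A i))"
      using A add[OF A(1,2)] by (intro suminf_ennreal_eq nonneg) auto
    finally show "(\<Sum>i. g (A i)) = g (\<Union>i. A i)" using g A by simp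
  qed
  moreover have "positive M g" using g[of "{}"] f0 by (simp add: positive_def)
  ultimately show ?thesis using M E g by (subst emeasure_measure_of_sigma) auto
qed

lemma sigma_algebra_borel_subsets:
  "\<Omega> \<in> sets borel \<Longrightarrow> sigma_algebra \<Omega> (borel_subsets \<Omega>)"
  using sets.sigma_algebra_axioms[of "restrict_space borel \<Omega>"] by (simp add: space_restrict_space)

lemma partition_two:
  assumes "Y \<in> sets borel" "E \<in> sets borel"
  shows "(\<lambda>i::nat. if i = 0 then E \<inter> Y else if i = 1 then E - Y else {}) \<in>
    {A. range A \<subseteq> sets borel \<and> disjoint_family A \<and> (\<Union>i. A i) = E}"
proof -
  have "disjoint_family (\<lambda>i::nat. if i = 0 then E \<inter> Y else if i = 1 then E - Y else {})"
    by (auto simp: disjoint_family_on_def)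
  moreover have "(\<Union>i::nat. if i = 0 then E \<inter> Y else if i = 1 then E - Y else {}) = E"
    by (auto split: if_splits)
  ultimately show ?thesis using assms by auto
qed

lemma norm_le_total_var:
  assumes "E \<in> sets borel" "\<mu> {} = 0"
  shows "ennreal (norm (\<mu> E)) \<le> total_var \<mu> E"
proof -
  let ?A = "\<lambda>i::nat. if i = 0 then E \<inter> UNIV else if i = 1 then E - UNIV else {}"
  have "(\<Sum>i. ennreal (norm (\<mu> (?A i)))) = (\<Sum>i\<in>{0}. ennreal (norm (\<mu> (?A i))))"
    using assms by (intro suminf_finite) auto
  then have "ennreal (norm (\<mu> E)) = (\<Sum>i. ennreal (norm (\<mu> (?A i))))" by simp
  also have "\<dots> \<le> total_var \<mu> E" unfolding total_var_def
    by (rule SUP_upper) (use partition_two[of UNIV E] assms in simp)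
  finally show ?thesis .
qed

lemma total_var_le:
  fixes m :: "'a::topological_space set \<Rightarrow> real"
  assumes "\<And>A. A \<in> sets borel \<Longrightarrow> A \<subseteq> E \<Longrightarrow> norm (\<mu> A) \<le> m A"
    and "\<And>A. range A \<subseteq> sets borel \<Longrightarrow> disjoint_family A \<Longrightarrow> (\<lambda>i::nat. m (A i)) sums m (\<Union>i. A i)"
  shows "total_var \<mu> E \<le> ennreal (m E)"
  unfolding total_var_def
proof (rule SUP_least)
  fix A :: "nat \<Rightarrow> 'a set" assume "A \<in> {A. range A \<subseteq> sets borel \<and> disjoint_family A \<and> (\<Union>i. A i) = E}"
  then have A: "range A \<subseteq> sets borel" "disjoint_family A" "(\<Union>i. A i) = E" by auto
  have le: "norm (\<mu> (A i)) \<le> m (A i)" for i using A by (intro assms(1)) auto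
  then have "0 \<le> m (A i)" for i by (rule order_trans[OF norm_ge_zero])
  have "(\<Sum>i. ennreal (norm (\<mu> (A i)))) \<le> (\<Sum>i. ennreal (m (A i)))"
    using le by (intro suminf_le) (auto intro: ennreal_leI)
  also have "\<dots> = ennreal (m E)"
    using assms(2)[OF A(1,2)] A(3) \<open>\<And>i. 0 \<le> m (A i)\<close> by (intro suminf_ennreal_eq) auto
  finally show "(\<Sum>i. ennreal (norm (\<mu> (A i)))) \<le> ennreal (m E)" .
qed

lemma sums_measure:
  assumes "finite_measure N" "sets N = sets borel" "range A \<subseteq> sets borel" "disjoint_family A"
  shows "(\<lambda>i::nat. measure N (A i)) sums measure N (\<Union>i. A i)"
  using finite_measure.finite_measure_UNION[of N A] assms by simp

lemma integral_level_approx: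
  fixes \<phi> :: "'a \<Rightarrow> real"
  assumes N: "finite_measure N" and [measurable]: "\<phi> \<in> borel_measurable N" 
    and b: "\<And>x. x \<in> space N \<Longrightarrow> \<bar>\<phi> x\<bar> \<le> real J" and n: "0 < n"
  shows "\<bar>(\<integral>x. \<phi> x \<partial>N) - (\<Sum>j\<in>{- int (J*n)..int (J*n)}. of_int j / real n * measure N {x \<in> space N. \<lfloor>real n * \<phi> x\<rfloor> = j})\<bar>
    \<le> measure N (space N) / real n"
proof -
  interpret finite_measure N by fact
  let ?A = "\<lambda>j. {x \<in> space N. \<lfloor>real n * \<phi> x\<rfloor> = j}"
  let ?I = "{- int (J*n)..int (J*n)}"
  let ?g = "\<lambda>x. \<Sum>j\<in>?I. of_int j / real n * indicator (?A j) x"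
  have g: "?g x = of_int \<lfloor>real n * \<phi> x\<rfloor> / real n" if x: "x \<in> space N" for x
  proof -
    have "\<bar>real n * \<phi> x\<bar> \<le> real n * real J" unfolding abs_mult using b[OF x] by (intro mult_mono) auto
    then have "- real (J * n) \<le> real n * \<phi> x" "real n * \<phi> x \<le> real (J * n)" by (auto simp: abs_le_iff mult.commute)
    then have "\<lfloor>real n * \<phi> x\<rfloor> \<in> ?I" by (auto simp: le_floor_iff floor_le_iff)
    then have "?g x = (\<Sum>j\<in>?I. if j = \<lfloor>real n * \<phi> x\<rfloor> then of_int j / real n else 0)"
      using x by (intro sum.cong) (auto simp: indicator_def)
    also have "\<dots> = of_int \<lfloor>real n * \<phi> x\<rfloor> / real n"
      using \<open>\<lfloor>real n * \<phi> x\<rfloor> \<in> ?I\<close> by (subst sum.delta) auto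
    finally show ?thesis .
  qed
  have A [measurable]: "?A j \<in> sets N" for j by measurable
  have intg: "integrable N ?g"
    by (intro Bochner_Integration.integrable_sum integrable_mult_right integrable_real_indicator A) (simp add: less_top[symmetric])
  have intp: "integrable N \<phi>" using b by (intro integrable_const_bound[where B="real J"]) auto
  have "(\<integral>x. ?g x \<partial>N) = (\<Sum>j\<in>?I. \<integral>x. of_int j / real n * indicator (?A j) x \<partial>N)"
    by (intro Bochner_Integration.integral_sum integrable_mult_right integrable_real_indicator A) (simp add: less_top[symmetric])
  also have "\<dots> = (\<Sum>j\<in>?I. of_int j / real n * measure N (?A j))"
    by (intro sum.cong refl) (simp add: Int_def conj_commute)
  finally have e: "(\<integral>x. ?g x \<partial>N) = (\<Sum>j\<in>?I. of_int j / real n * measure N (?A j))" .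
  have "\<bar>(\<integral>x. \<phi> x \<partial>N) - (\<integral>x. ?g x \<partial>N)\<bar> = \<bar>\<integral>x. \<phi> x - ?g x \<partial>N\<bar>"
    using intp intg by simp
  also have "\<dots> \<le> (\<integral>x. \<bar>\<phi> x - ?g x\<bar> \<partial>N)" by (rule integral_abs_bound)
  also have "\<dots> \<le> (\<integral>x. 1 / real n \<partial>N)"
  proof (rule integral_mono)
    fix x assume x: "x \<in> space N"
    have "\<phi> x - ?g x = (real n * \<phi> x - of_int \<lfloor>real n * \<phi> x\<rfloor>) / real n" unfolding g[OF x] using n by (simp add: field_simps)
    moreover have "0 \<le> real n * \<phi> x - of_int \<lfloor>real n * \<phi> x\<rfloor>" "real n * \<phi> x - of_int \<lfloor>real n * \<phi> x\<rfloor> \<le> 1" by linarith+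
    ultimately show "\<bar>\<phi> x - ?g x\<bar> \<le> 1 / real n" using n by (simp add: divide_right_mono)
  qed (use intp intg in auto)
  also have "\<dots> = measure N (space N) / real n" by simp
  finally show ?thesis unfolding e .
qed

text \<open>
  Two signed combinations of finite measures that agree as set functions give the same
  integrals. The measures need not be comparable, so the integral is recovered from the measures
  of the level sets of \<open>\<lfloor>n * \<phi>\<rfloor>\<close>.
\<close>

lemma integral_lincomb_eq:
  fixes \<phi> :: "'a \<Rightarrow> real"
  assumes "finite I" "\<And>k. k \<in> I \<Longrightarrow> finite_measure (N k)" "\<And>k. k \<in> I \<Longrightarrow> sets (N k) = sets M"
    and "finite I'" "\<And>k. k \<in> I' \<Longrightarrow> finite_measure (N' k)" "\<And>k. k \<in> I' \<Longrightarrow> sets (N' k) = sets M"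
    and eq: "\<And>E. E \<in> sets M \<Longrightarrow> (\<Sum>k\<in>I. c k * measure (N k) E) = (\<Sum>k\<in>I'. c' k * measure (N' k) E)"
    and phi: "\<phi> \<in> borel_measurable M" "\<And>x. \<bar>\<phi> x\<bar> \<le> K"
  shows "(\<Sum>k\<in>I. c k * (\<integral>x. \<phi> x \<partial>N k)) = (\<Sum>k\<in>I'. c' k * (\<integral>x. \<phi> x \<partial>N' k))"
proof -
  obtain J where J: "K \<le> real J" using real_arch_simple by blast
  define A where "A n j = {x \<in> space M. \<lfloor>real (Suc n) * \<phi> x\<rfloor> = j}" for n j
  have A: "A n j \<in> sets M" for n j unfolding A_def using phi(1) by measurable
  define T where "T P n = (\<Sum>j\<in>{- int (J*Suc n)..int (J*Suc n)}. of_int j / real (Suc n) * measure P (A n j))" for P n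
  have lim: "T P \<longlonglongrightarrow> (\<integral>x. \<phi> x \<partial>P)" if P: "finite_measure P" "sets P = sets M" for P
  proof -
    have sp: "space P = space M" by (rule sets_eq_imp_space_eq[OF P(2)])
    have [measurable]: "\<phi> \<in> borel_measurable P" using phi(1) measurable_cong_sets[OF P(2) refl] by blast
    have "\<bar>(\<integral>x. \<phi> x \<partial>P) - T P n\<bar> \<le> measure P (space P) * (1 / real (Suc n))" for n
      using integral_level_approx[OF P(1), of \<phi> J "Suc n"] order_trans[OF phi(2) J] by (simp add: T_def A_def sp)
    then have ev: "\<forall>\<^sub>F n in sequentially. norm ((\<integral>x. \<phi> x \<partial>P) - T P n) \<le> measure P (space P) * (1 / real (Suc n))"
      by (intro always_eventually allI) (simp only: real_norm_def)
    have "(\<lambda>n. measure P (space P) * (1 / real (Suc n))) \<longlonglongrightarrow> measure P (space P) * 0"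
      by (intro tendsto_intros LIMSEQ_Suc[OF lim_1_over_n])
    then have "(\<lambda>n. (\<integral>x. \<phi> x \<partial>P) - T P n) \<longlonglongrightarrow> 0"
      unfolding mult_zero_right by (rule Lim_null_comparison[OF ev])
    then have "(\<lambda>n. (\<integral>x. \<phi> x \<partial>P) - ((\<integral>x. \<phi> x \<partial>P) - T P n)) \<longlonglongrightarrow> (\<integral>x. \<phi> x \<partial>P) - 0"
      by (intro tendsto_diff tendsto_const)
    then show ?thesis by simp
  qed
  have swap: "(\<Sum>k\<in>I. c k * T (N k) n) = (\<Sum>j\<in>{- int (J*Suc n)..int (J*Suc n)}. of_int j / real (Suc n) * (\<Sum>k\<in>I. c k * measure (N k) (A n j)))"
    for I :: "'k set" and c N and n
  proof -
    have "(\<Sum>k\<in>I. c k * T (N k) n) = (\<Sum>k\<in>I. \<Sum>j\<in>{- int (J*Suc n)..int (J*Suc n)}. of_int j / real (Suc n) * (c k * measure (N k) (A n j)))"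
      unfolding T_def sum_distrib_left by (intro sum.cong refl) (simp add: mult_ac)
    then show ?thesis unfolding sum_distrib_left by (subst (asm) sum.swap)
  qed
  have swap': "(\<Sum>k\<in>I. c k * T (N k) n) = (\<Sum>j\<in>{- int (J*Suc n)..int (J*Suc n)}. of_int j / real (Suc n) * (\<Sum>k\<in>I. c k * measure (N k) (A n j)))"
    for I :: "'l set" and c N and n
  proof -
    have "(\<Sum>k\<in>I. c k * T (N k) n) = (\<Sum>k\<in>I. \<Sum>j\<in>{- int (J*Suc n)..int (J*Suc n)}. of_int j / real (Suc n) * (c k * measure (N k) (A n j)))"
      unfolding T_def sum_distrib_left by (intro sum.cong refl) (simp add: mult_ac)
    then show ?thesis unfolding sum_distrib_left by (subst (asm) sum.swap)
  qed
  have "(\<lambda>n. \<Sum>k\<in>I. c k * T (N k) n) \<longlonglongrightarrow> (\<Sum>k\<in>I. c k * (\<integral>x. \<phi> x \<partial>N k))"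
    using assms by (intro tendsto_sum tendsto_mult tendsto_const lim) auto
  moreover have "(\<lambda>n. \<Sum>k\<in>I'. c' k * T (N' k) n) \<longlonglongrightarrow> (\<Sum>k\<in>I'. c' k * (\<integral>x. \<phi> x \<partial>N' k))"
    using assms by (intro tendsto_sum tendsto_mult tendsto_const lim) auto
  moreover have "(\<Sum>k\<in>I. c k * T (N k) n) = (\<Sum>k\<in>I'. c' k * T (N' k) n)" for n
    unfolding swap swap' using A eq by simp
  ultimately show ?thesis by (simp add: LIMSEQ_unique)
qed

text \<open>
  Collecting the terms with positive, and those with negative coefficients reduces signed
  combinations to differences of two measures.
\<close>

lemma exists_sum_measure:
  fixes c :: "'k \<Rightarrow> real" and N :: "'k \<Rightarrow> 'a::topological_space measure"
  assumes "finite I" "\<And>k. k \<in> I \<Longrightarrow> finite_measure (N k)" "\<And>k. k \<in> I \<Longrightarrow> sets (N k) = sets borel"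
    and c: "\<And>k. k \<in> I \<Longrightarrow> 0 \<le> c k"
  obtains P where "finite_measure P" "sets P = sets borel"
    "\<And>E. E \<in> sets borel \<Longrightarrow> measure P E = (\<Sum>k\<in>I. c k * measure (N k) E)"
proof -
  define f where "f E = (\<Sum>k\<in>I. c k * measure (N k) E)" for E
  define P where "P = measure_of UNIV (sets borel) (\<lambda>E. ennreal (f E))"
  have f: "0 \<le> f E" for E unfolding f_def using c by (intro sum_nonneg mult_nonneg_nonneg) auto
  have em: "emeasure P E = ennreal (f E)" if "E \<in> sets borel" for E
    unfolding P_def
  proof (rule emeasure_measure_of_real[OF _ _ refl _ that])
    show "sigma_algebra UNIV (sets (borel :: 'a measure))"
      using sets.sigma_algebra_axioms[of "borel::'a measure"] by simp
    fix A :: "nat \<Rightarrow> 'a set" assume A: "range A \<subseteq> sets borel" "disjoint_family A"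
    show "(\<lambda>i. f (A i)) sums f (\<Union>i. A i)" unfolding f_def
      using assms A by (intro sums_sum sums_mult sums_measure) auto
  qed (rule f)
  have s: "sets P = sets borel" unfolding P_def
    using sets.sigma_sets_eq[of "borel::'a measure"] by (simp add: sets_measure_of_conv)
  show ?thesis
  proof (rule that)
    show "finite_measure P"
      by (rule finite_measureI) (use em[of "space P"] sets.top[of P] s in simp)
    show "measure P E = (\<Sum>k\<in>I. c k * measure (N k) E)" if "E \<in> sets borel" for E
      using em[OF that] f[of E] by (simp add: measure_def f_def)
  qed (rule s)
qed

text \<open>
  A signed measure given as a difference of two finite measures, with a Hahn set \<open>Y\<close> for it.
\<close>

context
  fixes N1 N2 :: "'a::topological_space measure" and \<Omega> :: "'a set" and \<mu> :: "'a set \<Rightarrow> real" and Y :: "'a set"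
  assumes N1: "finite_measure N1" "sets N1 = sets borel" and N2: "finite_measure N2" "sets N2 = sets borel"
    and \<Omega>: "\<Omega> \<in> sets borel"
    and mu: "\<And>E. E \<in> borel_subsets \<Omega> \<Longrightarrow> \<mu> E = measure N1 E - measure N2 E"
    and Y: "Y \<in> sets borel" "\<And>X. X \<in> sets borel \<Longrightarrow> X \<subseteq> Y \<Longrightarrow> measure N2 X \<le> measure N1 X"
      "\<And>X. X \<in> sets borel \<Longrightarrow> X \<inter> Y = {} \<Longrightarrow> measure N1 X \<le> measure N2 X"
begin

lemma sums_diff_Int:
  assumes "range A \<subseteq> sets borel" "disjoint_family A" "Z \<in> sets borel"
  shows "(\<lambda>i::nat. measure N1 (A i \<inter> Z) - measure N2 (A i \<inter> Z)) sums (measure N1 ((\<Union>i. A i) \<inter> Z) - measure N2 ((\<Union>i. A i) \<inter> Z))"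
proof -
  have "range (\<lambda>i. A i \<inter> Z) \<subseteq> sets borel" "disjoint_family (\<lambda>i. A i \<inter> Z)"
    using assms by (auto simp: disjoint_family_on_def)
  from sums_diff[OF sums_measure[OF N1 this] sums_measure[OF N2 this]]
  show ?thesis by simp
qed

lemma total_var_Hahn:
  assumes E: "E \<in> borel_subsets \<Omega>"
  shows "total_var \<mu> E = ennreal ((measure N1 (E \<inter> Y) - measure N2 (E \<inter> Y)) + (measure N2 (E - Y) - measure N1 (E - Y)))"
    (is "_ = ennreal (?p E)")
proof (rule antisym)
  have Eb: "E \<subseteq> \<Omega>" "E \<in> sets borel" using E borel_subsets_iff[OF \<Omega>] by auto
  show "total_var \<mu> E \<le> ennreal (?p E)"
  proof (rule total_var_le)
    fix A assume A: "A \<in> sets borel" "A \<subseteq> E"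
    then have "A \<in> borel_subsets \<Omega>" using borel_subsets_iff[OF \<Omega>] Eb by auto
    then have "\<mu> A = measure N1 A - measure N2 A" by (rule mu)
    moreover have "measure N A = measure N (A \<inter> Y) + measure N (A - Y)" if "finite_measure N" "sets N = sets borel" for N
      using finite_measure.finite_measure_Union[OF that(1), of "A \<inter> Y" "A - Y"] that A Y
      by (simp add: Int_Diff_disjoint Int_Diff_Un)
    moreover have "measure N2 (A \<inter> Y) \<le> measure N1 (A \<inter> Y)" using A Y(1) by (intro Y(2)) auto
    moreover have "measure N1 (A - Y) \<le> measure N2 (A - Y)" using A Y(1) by (intro Y(3)) auto
    ultimately show "norm (\<mu> A) \<le> ?p A"
      using N1 N2 by auto
  next
    fix A :: "nat \<Rightarrow> 'a set" assume A: "range A \<subseteq> sets borel" "disjoint_family A"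
    have "(\<lambda>i. (measure N1 (A i \<inter> Y) - measure N2 (A i \<inter> Y)) - (measure N1 (A i \<inter> (-Y)) - measure N2 (A i \<inter> (-Y))))
      sums ((measure N1 ((\<Union>i. A i) \<inter> Y) - measure N2 ((\<Union>i. A i) \<inter> Y)) - (measure N1 ((\<Union>i. A i) \<inter> (-Y)) - measure N2 ((\<Union>i. A i) \<inter> (-Y))))"
      using A Y(1) by (intro sums_diff sums_diff_Int) auto
    then show "(\<lambda>i. ?p (A i)) sums ?p (\<Union>i. A i)" by (simp add: Diff_eq algebra_simps)
  qed
  let ?A = "\<lambda>i::nat. if i = 0 then E \<inter> Y else if i = 1 then E - Y else {}"
  have sub: "E \<inter> Y \<in> borel_subsets \<Omega>" "E - Y \<in> borel_subsets \<Omega>" "{} \<in> borel_subsets \<Omega>"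
    using borel_subsets_iff[OF \<Omega>] Eb Y(1) by auto
  have "(\<Sum>i. ennreal (norm (\<mu> (?A i)))) = (\<Sum>i\<in>{0,1}. ennreal (norm (\<mu> (?A i))))"
    using mu[OF sub(3)] by (intro suminf_finite) auto
  also have "\<dots> = ennreal (\<bar>\<mu> (E \<inter> Y)\<bar>) + ennreal (\<bar>\<mu> (E - Y)\<bar>)" by simp
  also have "\<dots> = ennreal (?p E)"
  proof -
    have "measure N2 (E \<inter> Y) \<le> measure N1 (E \<inter> Y)" using Eb Y(1) by (intro Y(2)) auto
    moreover have "measure N1 (E - Y) \<le> measure N2 (E - Y)" using Eb Y(1) by (intro Y(3)) auto
    ultimately have "\<bar>\<mu> (E \<inter> Y)\<bar> + \<bar>\<mu> (E - Y)\<bar> = ?p E" using mu[OF sub(1)] mu[OF sub(2)] by linarith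
    then show ?thesis by (metis abs_ge_zero ennreal_plus)
  qed
  finally have "ennreal (?p E) = (\<Sum>i. ennreal (norm (\<mu> (?A i))))" by simp
  also have "\<dots> \<le> total_var \<mu> E" unfolding total_var_def
    by (rule SUP_upper) (rule partition_two[OF Y(1) Eb(2)])
  finally show "ennreal (?p E) \<le> total_var \<mu> E" .
qed

lemma emeasure_pos_measure:
  assumes E: "E \<in> borel_subsets \<Omega>"
  shows "emeasure (pos_measure \<Omega> \<mu>) E = ennreal (measure N1 (E \<inter> Y) - measure N2 (E \<inter> Y))"
  unfolding pos_measure_def
proof (rule emeasure_measure_of_real[OF sigma_algebra_borel_subsets[OF \<Omega>] _ _ _ E])
  fix E assume E: "E \<in> borel_subsets \<Omega>"
  then have Eb: "E \<subseteq> \<Omega>" "E \<in> sets borel" using borel_subsets_iff[OF \<Omega>] by auto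
  show "0 \<le> measure N1 (E \<inter> Y) - measure N2 (E \<inter> Y)" using Y(2)[of "E \<inter> Y"] Eb Y(1) by auto
  have split: "measure N E = measure N (E \<inter> Y) + measure N (E - Y)" if "finite_measure N" "sets N = sets borel" for N
    using finite_measure.finite_measure_Union[OF that(1), of "E \<inter> Y" "E - Y"] that Eb Y
    by (simp add: Int_Diff_disjoint Int_Diff_Un)
  have n: "0 \<le> measure N1 (E \<inter> Y) - measure N2 (E \<inter> Y) + (measure N2 (E - Y) - measure N1 (E - Y))"
  proof -
    have "measure N2 (E \<inter> Y) \<le> measure N1 (E \<inter> Y)" using Eb Y(1) by (intro Y(2)) auto
    moreover have "measure N1 (E - Y) \<le> measure N2 (E - Y)" using Eb Y(1) by (intro Y(3)) auto
    ultimately show ?thesis by simp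
  qed
  show "ennreal ((enn2real (total_var \<mu> E) + \<mu> E) / 2) = ennreal (measure N1 (E \<inter> Y) - measure N2 (E \<inter> Y))"
    unfolding total_var_Hahn[OF E] enn2real_ennreal[OF n] mu[OF E]
    using split[OF N1] split[OF N2] by (intro arg_cong[where f=ennreal]) simp
next
  fix A :: "nat \<Rightarrow> 'a set" assume "range A \<subseteq> borel_subsets \<Omega>" "disjoint_family A"
  then show "(\<lambda>i. measure N1 (A i \<inter> Y) - measure N2 (A i \<inter> Y)) sums (measure N1 ((\<Union>i. A i) \<inter> Y) - measure N2 ((\<Union>i. A i) \<inter> Y))"
    using borel_subsets_iff[OF \<Omega>] Y(1) by (intro sums_diff_Int) auto
qed

end

lemma sets_pos_measure: 
  "\<Omega> \<in> sets borel \<Longrightarrow> sets (pos_measure \<Omega> \<mu>) = borel_subsets \<Omega>" "space (pos_measure \<Omega> \<mu>) = \<Omega>"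
proof -
  show "\<Omega> \<in> sets borel \<Longrightarrow> sets (pos_measure \<Omega> \<mu>) = borel_subsets \<Omega>" unfolding pos_measure_def
    using sigma_algebra.sigma_sets_eq[OF sigma_algebra_borel_subsets[of \<Omega>]] sigma_algebra_borel_subsets[of \<Omega>]
    by (subst sets_measure_of) (auto simp: borel_subsets_iff)
qed (simp add: pos_measure_def space_measure_of_conv)

text \<open>
  The positive and negative parts are computed from a Hahn set of the difference. The parts
  differ in general from \<open>N1\<close> and \<open>N2\<close>, but \<open>integral_lincomb_eq\<close> shows that the integrals do
  not depend on the representation.
\<close>

lemma signed_integral_diff:
  fixes \<phi> :: "'a::topological_space \<Rightarrow> real"
  assumes N1: "finite_measure N1" "sets N1 = sets borel" and N2: "finite_measure N2" "sets N2 = sets borel"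
    and \<Omega>: "\<Omega> \<in> sets borel"
    and mu: "\<And>E. E \<in> borel_subsets \<Omega> \<Longrightarrow> \<mu> E = measure N1 E - measure N2 E"
    and phi: "\<phi> \<in> borel_measurable borel" "\<And>x. \<bar>\<phi> x\<bar> \<le> K" "\<And>x. x \<notin> \<Omega> \<Longrightarrow> \<phi> x = 0"
  shows "signed_integral \<Omega> \<mu> \<phi> = (\<integral>x. \<phi> x \<partial>N1) - (\<integral>x. \<phi> x \<partial>N2)"
proof -
  interpret N1: finite_measure N1 by fact
  interpret N2: finite_measure N2 by fact
  obtain Y where Y: "Y \<in> sets borel" "\<And>X. X \<in> sets borel \<Longrightarrow> X \<subseteq> Y \<Longrightarrow> emeasure N2 X \<le> emeasure N1 X"
      "\<And>X. X \<in> sets borel \<Longrightarrow> X \<inter> Y = {} \<Longrightarrow> emeasure N1 X \<le> emeasure N2 X"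
    using finite_unsigned_Hahn_decomposition[OF N1(1) N2(1)] N1(2) N2(2) by auto
  have Y1: "measure N2 X \<le> measure N1 X" if "X \<in> sets borel" "X \<subseteq> Y" for X
    using Y(2)[OF that] by (simp add: N1.emeasure_eq_measure N2.emeasure_eq_measure)
  have Y2: "measure N1 X \<le> measure N2 X" if "X \<in> sets borel" "X \<inter> Y = {}" for X
    using Y(3)[OF that] by (simp add: N1.emeasure_eq_measure N2.emeasure_eq_measure)
  have mY: "- Y \<in> sets borel" using Y(1) by auto
  have pos: "emeasure (pos_measure \<Omega> \<mu>) E = ennreal (measure N1 (E \<inter> Y) - measure N2 (E \<inter> Y))"
    if "E \<in> borel_subsets \<Omega>" for E
    using emeasure_pos_measure[OF N1 N2 \<Omega> mu Y(1) Y1 Y2 that] by blast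
  have neg: "emeasure (pos_measure \<Omega> (\<lambda>E. - \<mu> E)) E = ennreal (measure N2 (E \<inter> -Y) - measure N1 (E \<inter> -Y))"
    if "E \<in> borel_subsets \<Omega>" for E
    by (rule emeasure_pos_measure[OF N2 N1 \<Omega> _ mY _ _ that]) (use mu Y1 Y2 in \<open>auto simp: disjoint_eq_subset_Compl\<close>)
  let ?P = "\<lambda>k::nat. if k = 0 then pos_measure \<Omega> \<mu> else pos_measure \<Omega> (\<lambda>E. - \<mu> E)"
  let ?N = "\<lambda>k::nat. if k = 0 then restrict_space N1 \<Omega> else restrict_space N2 \<Omega>"
  let ?c = "\<lambda>k::nat. if k = 0 then 1 else -1 :: real"
  have s\<Omega>: "\<Omega> \<in> borel_subsets \<Omega>" using borel_subsets_iff[OF \<Omega>] \<Omega> by auto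
  have "(\<Sum>k\<in>{0,1}. ?c k * (\<integral>x. \<phi> x \<partial>?P k)) = (\<Sum>k\<in>{0,1}. ?c k * (\<integral>x. \<phi> x \<partial>?N k))"
  proof (rule integral_lincomb_eq[where M="restrict_space borel \<Omega>"])
    show "finite_measure (?P k)" for k
      by (rule finite_measureI) (use pos[OF s\<Omega>] neg[OF s\<Omega>] in \<open>auto simp: sets_pos_measure\<close>)
    show "sets (?P k) = borel_subsets \<Omega>" for k using \<Omega> by (simp add: sets_pos_measure)
    show "finite_measure (?N k)" for k
      using \<Omega> N1 N2 by (auto intro!: finite_measure_restrict_space)
    show "sets (?N k) = borel_subsets \<Omega>" for k using sets_restrict_space_cong[OF N1(2)] sets_restrict_space_cong[OF N2(2)] by simp
    show "\<phi> \<in> borel_measurable (restrict_space borel \<Omega>)" using phi(1) by (rule measurable_restrict_space1)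
    fix E assume E: "E \<in> borel_subsets \<Omega>"
    then have Eb: "E \<subseteq> \<Omega>" "E \<in> sets borel" using borel_subsets_iff[OF \<Omega>] by auto
    have split: "measure N E = measure N (E \<inter> Y) + measure N (E \<inter> -Y)" if "finite_measure N" "sets N = sets borel" for N
      using finite_measure.finite_measure_Union[OF that(1), of "E \<inter> Y" "E \<inter> -Y"] that Eb Y(1)
      by (simp add: Int_Un_distrib[symmetric] Int_assoc Int_left_commute[of Y])
    have "measure (pos_measure \<Omega> \<mu>) E = measure N1 (E \<inter> Y) - measure N2 (E \<inter> Y)"
      unfolding measure_def[of "pos_measure \<Omega> \<mu>"] pos[OF E] using Y1[of "E \<inter> Y"] Eb Y(1) by simp
    moreover have "measure (pos_measure \<Omega> (\<lambda>E. - \<mu> E)) E = measure N2 (E \<inter> -Y) - measure N1 (E \<inter> -Y)"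
      unfolding measure_def[of "pos_measure \<Omega> (\<lambda>E. - \<mu> E)"] neg[OF E] using Y2[of "E \<inter> -Y"] Eb Y(1) by (subst enn2real_ennreal) auto
    moreover have "measure (restrict_space N1 \<Omega>) E = measure N1 E" "measure (restrict_space N2 \<Omega>) E = measure N2 E"
      using Eb \<Omega> N1 N2 by (auto intro!: measure_restrict_space)
    ultimately show "(\<Sum>k\<in>{0,1}. ?c k * measure (?P k) E) = (\<Sum>k\<in>{0,1}. ?c k * measure (?N k) E)"
      using split[OF N1] split[OF N2] by simp
  qed (use phi in auto)
  moreover have "(\<integral>x. \<phi> x \<partial>restrict_space N \<Omega>) = (\<integral>x. \<phi> x \<partial>N)" if "sets N = sets borel" for N
  proof -
    have "(\<integral>x. \<phi> x \<partial>restrict_space N \<Omega>) = (\<integral>x. indicator \<Omega> x *\<^sub>R \<phi> x \<partial>N)"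
      using \<Omega> that sets_eq_imp_space_eq[OF that] by (intro integral_restrict_space) auto
    also have "\<dots> = (\<integral>x. \<phi> x \<partial>N)" using phi(3) by (intro Bochner_Integration.integral_cong) (auto split: split_indicator)
    finally show ?thesis .
  qed
  ultimately show ?thesis using N1(2) N2(2) by (simp add: signed_integral_def)
qed

lemma signed_integral_lincomb:
  fixes \<phi> :: "'a::topological_space \<Rightarrow> real" and c :: "'k \<Rightarrow> real"
  assumes I: "finite I" "\<And>k. k \<in> I \<Longrightarrow> finite_measure (N k)" "\<And>k. k \<in> I \<Longrightarrow> sets (N k) = sets borel"
    and \<Omega>: "\<Omega> \<in> sets borel"
    and mu: "\<And>E. E \<in> borel_subsets \<Omega> \<Longrightarrow> \<mu> E = (\<Sum>k\<in>I. c k * measure (N k) E)"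
    and phi: "\<phi> \<in> borel_measurable borel" "\<And>x. \<bar>\<phi> x\<bar> \<le> K" "\<And>x. x \<notin> \<Omega> \<Longrightarrow> \<phi> x = 0"
  shows "signed_integral \<Omega> \<mu> \<phi> = (\<Sum>k\<in>I. c k * (\<integral>x. \<phi> x \<partial>N k))"
proof -
  obtain P where P: "finite_measure P" "sets P = sets borel"
    "\<And>E. E \<in> sets borel \<Longrightarrow> measure P E = (\<Sum>k\<in>I. max 0 (c k) * measure (N k) E)"
    by (rule exists_sum_measure[OF I, where c="\<lambda>k. max 0 (c k)"]) auto
  obtain Q where Q: "finite_measure Q" "sets Q = sets borel"
    "\<And>E. E \<in> sets borel \<Longrightarrow> measure Q E = (\<Sum>k\<in>I. max 0 (- c k) * measure (N k) E)"
    by (rule exists_sum_measure[OF I, where c="\<lambda>k. max 0 (- c k)"]) auto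
  have PQ: "measure P E - measure Q E = (\<Sum>k\<in>I. c k * measure (N k) E)" if "E \<in> sets borel" for E
    unfolding P(3)[OF that] Q(3)[OF that] sum_subtractf[symmetric]
    by (intro sum.cong refl) (auto simp: max_def)
  have "signed_integral \<Omega> \<mu> \<phi> = (\<integral>x. \<phi> x \<partial>P) - (\<integral>x. \<phi> x \<partial>Q)"
  proof (rule signed_integral_diff[OF P(1,2) Q(1,2) \<Omega> _ phi])
    fix E assume E: "E \<in> borel_subsets \<Omega>"
    then have "E \<in> sets borel" using borel_subsets_iff[OF \<Omega>] by auto
    then show "\<mu> E = measure P E - measure Q E" using mu[OF E] PQ by simp
  qed
  also have "\<dots> = (\<Sum>k\<in>{0,1::nat}. (if k = 0 then 1 else -1) * (\<integral>x. \<phi> x \<partial>(if k = 0 then P else Q)))" by simp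
  also have "\<dots> = (\<Sum>k\<in>I. c k * (\<integral>x. \<phi> x \<partial>N k))"
  proof (rule integral_lincomb_eq[where M=borel, OF _ _ _ I(1) I(2) I(3) _ phi(1,2)])
    show "finite_measure (if k = 0 then P else Q)" "sets (if k = 0 then P else Q) = sets borel" for k :: nat
      using P(1,2) Q(1,2) by simp_all
    show "(\<Sum>k\<in>{0,1::nat}. (if k = 0 then 1 else -1) * measure (if k = 0 then P else Q) E) = (\<Sum>k\<in>I. c k * measure (N k) E)"
      if "E \<in> sets borel" for E
      unfolding PQ[OF that, symmetric] by simp
  qed simp_all
  finally show ?thesis .
qed

text \<open>
  For a multiple of a positive measure the total variation is the same multiple up to sign.
\<close>

lemma var_measure_AE:
  assumes N: "finite_measure N" "sets N = sets borel" and \<Omega>: "\<Omega> \<in> sets borel"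
    and mu: "\<And>E. E \<in> borel_subsets \<Omega> \<Longrightarrow> \<mu> E = - c * measure N E" and c: "0 \<le> c"
    and Z: "Z \<in> sets borel" "measure N Z = 0" "\<And>x. x \<in> \<Omega> \<Longrightarrow> x \<notin> Z \<Longrightarrow> P x"
  shows "AE x in var_measure \<Omega> \<mu>. P x"
proof -
  have tv: "total_var \<mu> E = ennreal (c * measure N E)" if E: "E \<in> borel_subsets \<Omega>" for E
  proof (rule antisym)
    have Eb: "E \<subseteq> \<Omega>" "E \<in> sets borel" using E borel_subsets_iff[OF \<Omega>] by auto
    show "total_var \<mu> E \<le> ennreal (c * measure N E)"
    proof (rule total_var_le)
      fix A assume "A \<in> sets borel" "A \<subseteq> E"
      then have "A \<in> borel_subsets \<Omega>" using Eb borel_subsets_iff[OF \<Omega>] by auto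
      then show "norm (\<mu> A) \<le> c * measure N A" using mu c by simp
    qed (intro sums_mult sums_measure N)
    have "\<mu> {} = 0" using mu[of "{}"] by simp
    from norm_le_total_var[where \<mu>=\<mu>, OF Eb(2) this]
    show "ennreal (c * measure N E) \<le> total_var \<mu> E" using mu[OF E] c by simp
  qed
  have em: "emeasure (var_measure \<Omega> \<mu>) E = ennreal (c * measure N E)" if E: "E \<in> borel_subsets \<Omega>" for E
    unfolding var_measure_def
  proof (rule emeasure_measure_of_real[OF sigma_algebra_borel_subsets[OF \<Omega>] _ tv _ E])
    fix A :: "nat \<Rightarrow> 'a set" assume "range A \<subseteq> borel_subsets \<Omega>" "disjoint_family A"
    then show "(\<lambda>i. c * measure N (A i)) sums (c * measure N (\<Union>i. A i))"
      using borel_subsets_iff[OF \<Omega>] by (intro sums_mult sums_measure N) auto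
  qed (use c in simp_all)
  have s: "sets (var_measure \<Omega> \<mu>) = borel_subsets \<Omega>" unfolding var_measure_def
    using sigma_algebra.sigma_sets_eq[OF sigma_algebra_borel_subsets[OF \<Omega>]] sigma_algebra_borel_subsets[OF \<Omega>]
    by (subst sets_measure_of) (auto simp: borel_subsets_iff[OF \<Omega>])
  have sp: "space (var_measure \<Omega> \<mu>) = \<Omega>" by (simp add: var_measure_def space_measure_of_conv)
  have Z\<Omega>: "Z \<inter> \<Omega> \<in> borel_subsets \<Omega>" using Z \<Omega> borel_subsets_iff[OF \<Omega>] by auto
  show ?thesis
  proof (rule AE_I[where N="Z \<inter> \<Omega>"])
    show "{x \<in> space (var_measure \<Omega> \<mu>). \<not> P x} \<subseteq> Z \<inter> \<Omega>" using Z(3) sp by auto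
    have "measure N (Z \<inter> \<Omega>) \<le> measure N Z" using Z N
      by (intro finite_measure.finite_measure_mono) auto
    then have "measure N (Z \<inter> \<Omega>) = 0" using Z(2) measure_nonneg[of N "Z \<inter> \<Omega>"] by linarith
    then show "emeasure (var_measure \<Omega> \<mu>) (Z \<inter> \<Omega>) = 0" using em[OF Z\<Omega>] by simp
    show "Z \<inter> \<Omega> \<in> sets (var_measure \<Omega> \<mu>)" using Z\<Omega> s by simp
  qed
qed

section \<open>Affine coordinates\<close>

definition cross2 :: "real ^ 2 \<Rightarrow> real ^ 2 \<Rightarrow> real" where
  "cross2 p q = p $ 1 * q $ 2 - p $ 2 * q $ 1"

definition aff :: "real ^ 2 \<Rightarrow> real ^ 2 \<Rightarrow> real ^ 2 \<Rightarrow> real \<times> real \<Rightarrow> real ^ 2" where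
  "aff A p q z = A + fst z *\<^sub>R p + snd z *\<^sub>R q"

lemma aff_continuous: "continuous_on S (aff A p q)"
  unfolding aff_def by (intro continuous_intros)

lemma aff_measurable [measurable]: "aff A p q \<in> borel_measurable borel"
  by (rule borel_measurable_continuous_onI[OF aff_continuous])

lemma Basis_vec2: "(Basis :: (real ^ 2) set) = {axis 1 1, axis 2 1}"
  by (auto simp: Basis_vec_def UNIV_2)

lemma vec2_measurable: "(\<lambda>z::real \<times> real. vector [fst z, snd z] :: real ^ 2) \<in> borel_measurable borel"
proof (rule borel_measurable_continuous_onI)
  have "(\<lambda>z::real \<times> real. vector [fst z, snd z] :: real ^ 2) = (\<lambda>z. fst z *\<^sub>R axis 1 1 + snd z *\<^sub>R axis 2 1)"
    by (auto simp: fun_eq_iff vec_eq_iff forall_2 vector_2 axis_def)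
  then show "continuous_on UNIV (\<lambda>z::real \<times> real. vector [fst z, snd z] :: real ^ 2)"
    by (simp only:) (intro continuous_intros)
qed

lemma lborel_vec2: "lborel = distr (lborel :: (real \<times> real) measure) borel (\<lambda>z. vector [fst z, snd z] :: real ^ 2)"
proof (rule lborel_eqI)
  note vec2_measurable [measurable]
  fix l u :: "real ^ 2" assume le: "\<And>b. b \<in> Basis \<Longrightarrow> l \<bullet> b \<le> u \<bullet> b"
  have le': "l $ 1 \<le> u $ 1" "l $ 2 \<le> u $ 2"
    using le[of "axis 1 1"] le[of "axis 2 1"] by (auto simp: Basis_vec2 inner_axis)
  have "(\<lambda>z::real \<times> real. vector [fst z, snd z] :: real ^ 2) -` box l u = {l$1<..<u$1} \<times> {l$2<..<u$2}"
    by (auto simp: mem_box_cart forall_2 vector_2)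
  then have "emeasure (distr (lborel :: (real \<times> real) measure) borel (\<lambda>z. vector [fst z, snd z] :: real ^ 2)) (box l u)
      = emeasure (lborel \<Otimes>\<^sub>M lborel) ({l$1<..<u$1} \<times> {l$2<..<u$2})"
    by (subst emeasure_distr) (auto simp: lborel_prod)
  also have "\<dots> = ennreal (u$1 - l$1) * ennreal (u$2 - l$2)"
    using le' by (subst lborel.emeasure_pair_measure_Times) auto
  also have "\<dots> = ennreal (\<Prod>b\<in>Basis. (u - l) \<bullet> b)"
    using le' by (simp add: Basis_vec2 inner_axis axis_eq_axis ennreal_mult)
  finally show "emeasure (distr (lborel :: (real \<times> real) measure) borel (\<lambda>z. vector [fst z, snd z] :: real ^ 2)) (box l u)
    = ennreal (\<Prod>b\<in>Basis. (u - l) \<bullet> b)" .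
qed simp

text \<open>
  The preimage of a box is a translate of its image under the inverse linear map, whose
  determinant is \<open>1 / cross2 p q\<close>.
\<close>

lemma lborel_aff:
  assumes "cross2 p q \<noteq> 0"
  shows "lborel = distr (density (lborel :: (real \<times> real) measure) (\<lambda>_. ennreal \<bar>cross2 p q\<bar>)) borel (aff A p q)"
proof (rule lborel_eqI)
  let ?c = "cross2 p q"
  define Sinv where "Sinv w = (vector [(w$1 * q$2 - w$2 * q$1) / ?c, (p$1 * w$2 - p$2 * w$1) / ?c] :: real ^ 2)" for w :: "real ^ 2"
  have lin: "linear Sinv"
    by (rule linearI) (auto simp: Sinv_def vec_eq_iff forall_2 vector_2 add_divide_distrib diff_divide_distrib algebra_simps)
  have "det (matrix Sinv) = (p$1 * q$2 - p$2 * q$1) / (?c * ?c)"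
    by (simp add: det_2 matrix_def Sinv_def axis_def vector_2 diff_divide_distrib mult_ac)
  then have det: "det (matrix Sinv) = 1 / ?c" using assms by (simp add: cross2_def)
  fix l u :: "real ^ 2" assume le: "\<And>b. b \<in> Basis \<Longrightarrow> l \<bullet> b \<le> u \<bullet> b"
  let ?S = "Sinv ` box (l - A) (u - A)"
  have inv1: "Sinv (aff A p q z - A) = vector [fst z, snd z]" for z
  proof -
    have "(fst z * p$1 + snd z * q$1) * q$2 - (fst z * p$2 + snd z * q$2) * q$1 = fst z * ?c"
      "p$1 * (fst z * p$2 + snd z * q$2) - p$2 * (fst z * p$1 + snd z * q$1) = snd z * ?c"
      by (simp_all add: cross2_def algebra_simps)
    then show ?thesis using assms by (simp add: Sinv_def aff_def)
  qed
  have inv2: "aff A p q (Sinv v $ 1, Sinv v $ 2) = A + v" for v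
  proof -
    have "(v$1 * q$2 - v$2 * q$1) * p$1 + (p$1 * v$2 - p$2 * v$1) * q$1 = v$1 * ?c"
      "(v$1 * q$2 - v$2 * q$1) * p$2 + (p$1 * v$2 - p$2 * v$1) * q$2 = v$2 * ?c"
      by (simp_all add: cross2_def algebra_simps)
    then show ?thesis using assms
      by (simp add: Sinv_def aff_def vec_eq_iff forall_2 vector_2 add_divide_distrib[symmetric])
  qed
  have pre: "aff A p q -` box l u = (\<lambda>z. vector [fst z, snd z]) -` ?S"
  proof (intro set_eqI iffI)
    fix z assume "z \<in> aff A p q -` box l u"
    then have "aff A p q z - A \<in> box (l - A) (u - A)" by (auto simp: mem_box_cart)
    then show "z \<in> (\<lambda>z. vector [fst z, snd z]) -` ?S" using inv1[of z] by (auto intro!: image_eqI)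
  next
    fix z assume "z \<in> (\<lambda>z. vector [fst z, snd z]) -` ?S"
    then obtain v where v: "v \<in> box (l - A) (u - A)" "vector [fst z, snd z] = Sinv v" by auto
    then have "Sinv v $ 1 = fst z" "Sinv v $ 2 = snd z" by (metis vector_2(1)) (metis v(2) vector_2(2))
    then have "aff A p q z = A + v" using inv2[of v] by simp
    then show "z \<in> aff A p q -` box l u" using v(1) by (auto simp: mem_box_cart diff_less_eq less_diff_eq add.commute)
  qed
  have S: "?S \<in> lmeasurable" "measure lebesgue ?S = \<bar>1 / ?c\<bar> * measure lebesgue (box (l - A) (u - A))"
    using measurable_linear_image[OF lin] measure_linear_image[OF lin] det by auto
  have Sb: "?S \<in> sets borel"
  proof -
    have "inj Sinv"
    proof (rule injI)
      fix v w assume "Sinv v = Sinv w"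
      then have "A + v = A + w" using inv2[of v] inv2[of w] by (simp only:)
      then show "v = w" by (rule add_left_imp_eq)
    qed
    then have "surj Sinv" using linear_inj_imp_surj[OF lin] by simp
    then have "open ?S" by (rule open_surjective_linear_image[OF open_box lin])
    then show ?thesis by simp
  qed
  have "emeasure (distr (density lborel (\<lambda>_. ennreal \<bar>?c\<bar>)) borel (aff A p q)) (box l u)
      = ennreal \<bar>?c\<bar> * emeasure lborel (aff A p q -` box l u)"
    using measurable_sets[OF aff_measurable, of "box l u"]
    by (subst emeasure_distr, simp, simp, subst emeasure_density) (auto simp: nn_integral_cmult_indicator)
  also have "emeasure lborel (aff A p q -` box l u) = emeasure lborel ?S"
  proof -
    have "emeasure lborel ?S = emeasure (distr (lborel :: (real \<times> real) measure) borel (\<lambda>z. vector [fst z, snd z] :: real ^ 2)) ?S"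
      by (rule arg_cong[OF lborel_vec2, of "\<lambda>M. emeasure M ?S"])
    also have "\<dots> = emeasure lborel ((\<lambda>z. vector [fst z, snd z]) -` ?S)"
      using Sb vec2_measurable by (subst emeasure_distr) auto
    finally show ?thesis unfolding pre by simp
  qed
  also have "\<dots> = ennreal (measure lebesgue ?S)"
  proof -
    have "emeasure lebesgue ?S = emeasure lborel ?S" using Sb by simp
    then show ?thesis using emeasure_eq_measure2[OF S(1)] by simp
  qed
  also have "ennreal \<bar>?c\<bar> * \<dots> = ennreal (\<bar>?c\<bar> * measure lebesgue ?S)" by (simp add: ennreal_mult)
  also have "\<bar>?c\<bar> * measure lebesgue ?S = (\<Prod>b\<in>Basis. (u - l) \<bullet> b)"
    using S(2) assms le by (simp add: measure_lborel_box_eq inner_diff_left abs_divide)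
  finally show "emeasure (distr (density lborel (\<lambda>_. ennreal \<bar>?c\<bar>)) borel (aff A p q)) (box l u) = ennreal (\<Prod>b\<in>Basis. (u - l) \<bullet> b)" .
qed simp

lemma emeasure_aff:
  assumes "cross2 p q \<noteq> 0" and [measurable]: "B \<in> sets borel"
  shows "emeasure lborel B = ennreal \<bar>cross2 p q\<bar> * emeasure lborel (aff A p q -` B)"
  using measurable_sets[OF aff_measurable, of B]
  by (subst lborel_aff[OF assms(1)], subst emeasure_distr, simp, simp, subst emeasure_density)
    (auto simp: nn_integral_cmult_indicator)

lemma integral_aff:
  fixes k :: "real ^ 2 \<Rightarrow> real"
  assumes "cross2 p q \<noteq> 0" and [measurable]: "k \<in> borel_measurable borel"
  shows "(\<integral>w. k w \<partial>lborel) = \<bar>cross2 p q\<bar> * (\<integral>z. k (aff A p q z) \<partial>lborel)"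
  by (subst lborel_aff[OF assms(1)], subst integral_distr, simp, simp, subst integral_density) auto

text \<open>
  The complement of the closed support is open, hence \<open>\<phi>\<close> vanishes near \<open>w\<close>.
\<close>

lemma partial_deriv_outside:
  assumes "w \<notin> closure {x. \<phi> x \<noteq> 0}"
  shows "\<phi> w = 0" "partial_deriv j \<phi> w = 0"
proof -
  let ?O = "- closure {x. \<phi> x \<noteq> 0}"
  have z: "\<phi> x = 0" if "x \<in> ?O" for x using that closure_subset[of "{x. \<phi> x \<noteq> 0}"] by auto
  show "\<phi> w = 0" by (rule z) (use assms in \<open>simp only: Compl_iff not_False_eq_True\<close>)
  have "((\<lambda>x. 0) has_derivative (\<lambda>v. 0)) (at w)" by simp
  then have "(\<phi> has_derivative (\<lambda>v. 0)) (at w)"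
  proof (rule has_derivative_transform_within_open)
    show "open ?O" by (intro open_Compl closed_closure)
    show "w \<in> ?O" using assms by (simp only: Compl_iff not_False_eq_True)
    show "0 = \<phi> x" if "x \<in> ?O" for x using z[OF that] by (rule sym)
  qed
  then show "partial_deriv j \<phi> w = 0"
    unfolding partial_deriv_def by (simp add: frechet_derivative_at[symmetric])
qed

lemma test_function_bounded:
  assumes "continuous_on UNIV g" "compact C" "\<And>w::real^'n. w \<notin> C \<Longrightarrow> g w = (0::real)"
  shows "\<exists>K. \<forall>w. \<bar>g w\<bar> \<le> K"
proof -
  have "compact (g ` C)" using assms by (intro compact_continuous_image) (auto intro: continuous_on_subset)
  then obtain K where K: "\<And>w. w \<in> C \<Longrightarrow> \<bar>g w\<bar> \<le> K" using compact_imp_bounded[of "g ` C"] by (auto simp: bounded_iff)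
  have "\<bar>g w\<bar> \<le> max K 0" for w using K assms(3) by (cases "w \<in> C") (force simp: le_max_iff_disj)+
  then show ?thesis by blast
qed

text \<open>
  A cell with base vector \<open>p\<close>, left side \<open>q\<close> and ratio \<open>1 - lam\<close> of the bases.
\<close>

locale frame = flow +
  fixes A p q :: "real ^ 2"
  assumes cross_nonzero: "cross2 p q \<noteq> 0"
begin

abbreviation "T \<equiv> aff A p q"
abbreviation "Jac \<equiv> \<bar>cross2 p q\<bar>"

definition dual_p :: "real ^ 2" where "dual_p = vector [q$2 / cross2 p q, - q$1 / cross2 p q]"
definition dual_q :: "real ^ 2" where "dual_q = vector [- p$2 / cross2 p q, p$1 / cross2 p q]"

definition cx :: "real ^ 2 \<Rightarrow> real" where "cx w = dual_p \<bullet> (w - A)"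
definition cy :: "real ^ 2 \<Rightarrow> real" where "cy w = dual_q \<bullet> (w - A)"

lemma dual: "dual_p \<bullet> p = 1" "dual_p \<bullet> q = 0" "dual_q \<bullet> p = 0" "dual_q \<bullet> q = 1"
proof -
  have "q$2 * p$1 - q$1 * p$2 = cross2 p q" "p$1 * q$2 - p$2 * q$1 = cross2 p q" by (simp_all add: cross2_def)
  then show "dual_p \<bullet> p = 1" "dual_p \<bullet> q = 0" "dual_q \<bullet> p = 0" "dual_q \<bullet> q = 1"
    using cross_nonzero by (simp_all add: dual_p_def dual_q_def inner_vec_def sum_2 vector_2 field_simps)
qed

lemma cx_T [simp]: "cx (T z) = fst z" and cy_T [simp]: "cy (T z) = snd z"
  by (simp_all add: cx_def cy_def aff_def inner_add_right dual)

lemma expand: "(dual_p \<bullet> v) *\<^sub>R p + (dual_q \<bullet> v) *\<^sub>R q = v"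
proof -
  have "(q$2 * v$1 - q$1 * v$2) * p$1 + (p$1 * v$2 - p$2 * v$1) * q$1 = cross2 p q * v$1"
    "(q$2 * v$1 - q$1 * v$2) * p$2 + (p$1 * v$2 - p$2 * v$1) * q$2 = cross2 p q * v$2"
    by (simp_all add: cross2_def algebra_simps)
  moreover have "dual_p \<bullet> v = (q$2 * v$1 - q$1 * v$2) / cross2 p q" "dual_q \<bullet> v = (p$1 * v$2 - p$2 * v$1) / cross2 p q"
    by (simp_all add: dual_p_def dual_q_def inner_vec_def sum_2 vector_2 add_divide_distrib diff_divide_distrib)
  ultimately show ?thesis using cross_nonzero
    by (simp add: vec_eq_iff forall_2 add_divide_distrib[symmetric])
qed

lemma T_coords: "T (cx w, cy w) = w"
  using expand[of "w - A"] by (simp add: aff_def cx_def cy_def add.assoc)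

lemma cxy_measurable [measurable]: "cx \<in> borel_measurable borel" "cy \<in> borel_measurable borel"
  unfolding cx_def cy_def by measurable

lemma axis_expand: "axis j 1 = dual_p $ j *\<^sub>R p + dual_q $ j *\<^sub>R q"
  using expand[of "axis j 1"] by (simp add: inner_axis)

definition Om :: "(real ^ 2) set" where
  "Om = {w. 0 < cy w \<and> cy w < 1 \<and> 0 < cx w \<and> cx w < 1 - lam * cy w}"

lemma open_Om: "open Om"
  unfolding Om_def cx_def cy_def
  by (intro open_Collect_conj open_Collect_less continuous_intros)

lemma Om_borel [measurable, simp]: "Om \<in> sets borel" using open_Om by simp

lemma Om_T: "T (x, y) \<in> Om \<longleftrightarrow> 0 < y \<and> y < 1 \<and> 0 < x \<and> x < 1 - lam * y"
  by (simp add: Om_def)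

text \<open>
  The chain rule for a test function in the coordinates of the frame. The support is a compact
  part of the open cell, so that the pulled-back function and its derivatives vanish outside the
  model cell.
\<close>

lemma test_coords:
  assumes "\<phi> \<in> test_functions Om"
  obtains fx fy K where "flow_test lam (\<lambda>z. \<phi> (T z)) fx fy K" "\<And>w. \<bar>\<phi> w\<bar> \<le> K"
    "\<And>j z. partial_deriv j \<phi> (T z) = dual_p $ j * fx z + dual_q $ j * fy z"
    "\<And>w. w \<notin> Om \<Longrightarrow> \<phi> w = 0" "\<And>w j. w \<notin> Om \<Longrightarrow> partial_deriv j \<phi> w = 0"
    "\<And>j. partial_deriv j \<phi> \<in> borel_measurable borel" "\<phi> \<in> borel_measurable borel"
    "\<And>w j. \<bar>partial_deriv j \<phi> w\<bar> \<le> K"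
proof -
  let ?C = "closure {x. \<phi> x \<noteq> 0}"
  have ck: "C_k k \<phi>" for k using assms by (auto simp: test_functions_def)
  have C: "compact ?C" "?C \<subseteq> Om" using assms by (auto simp: test_functions_def)
  have diff: "\<phi> differentiable (at w)" for w using ck[of 1] by (auto simp: differentiable_on_def)
  have pc: "continuous_on UNIV (partial_deriv j \<phi>)" for j using ck[of "Suc 0"] by auto
  have fc: "continuous_on UNIV \<phi>" using ck[of 0] by simp
  note out = partial_deriv_outside
  obtain K0 where K0: "\<And>w. \<bar>\<phi> w\<bar> \<le> K0" using test_function_bounded[OF fc C(1)] out(1) by blast
  have "\<forall>j. \<exists>K. \<forall>w. \<bar>partial_deriv j \<phi> w\<bar> \<le> K" using test_function_bounded[OF pc C(1)] out(2) by blast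
  then obtain Kp where Kp: "\<And>j w. \<bar>partial_deriv j \<phi> w\<bar> \<le> Kp j" by metis
  define fx where "fx z = p$1 * partial_deriv 1 \<phi> (T z) + p$2 * partial_deriv 2 \<phi> (T z)" for z
  define fy where "fy z = q$1 * partial_deriv 1 \<phi> (T z) + q$2 * partial_deriv 2 \<phi> (T z)" for z
  define Kx where "Kx = \<bar>p$1\<bar> * Kp 1 + \<bar>p$2\<bar> * Kp 2"
  define Ky where "Ky = \<bar>q$1\<bar> * Kp 1 + \<bar>q$2\<bar> * Kp 2"
  define K where "K = Max {K0, Kx, Ky, Kp 1, Kp 2}"
  have K: "K0 \<le> K" "Kx \<le> K" "Ky \<le> K" "Kp 1 \<le> K" "Kp 2 \<le> K" by (auto simp: K_def)
  have deriv: "(\<phi> has_derivative (\<lambda>v. v$1 * partial_deriv 1 \<phi> w + v$2 * partial_deriv 2 \<phi> w)) (at w)" for w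
  proof -
    let ?D = "frechet_derivative \<phi> (at w)"
    have hd: "(\<phi> has_derivative ?D) (at w)" using diff frechet_derivative_works by blast
    then have lin: "linear ?D" by (rule has_derivative_linear)
    have "?D v = v$1 * partial_deriv 1 \<phi> w + v$2 * partial_deriv 2 \<phi> w" for v
    proof -
      have "v = v$1 *\<^sub>R axis 1 1 + v$2 *\<^sub>R axis 2 1" by (auto simp: vec_eq_iff forall_2 axis_def)
      then have "?D v = ?D (v$1 *\<^sub>R axis 1 1 + v$2 *\<^sub>R axis 2 1)" by simp
      then show ?thesis by (simp add: linear_add[OF lin] linear_scale[OF lin] partial_deriv_def)
    qed
    then have "?D = (\<lambda>v. v$1 * partial_deriv 1 \<phi> w + v$2 * partial_deriv 2 \<phi> w)" by (rule ext)
    then show ?thesis using hd by (simp only:)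
  qed
  have bx: "\<bar>fx z\<bar> \<le> Kx" for z
  proof -
    have "\<bar>p$1\<bar> * \<bar>partial_deriv 1 \<phi> (T z)\<bar> \<le> \<bar>p$1\<bar> * Kp 1" "\<bar>p$2\<bar> * \<bar>partial_deriv 2 \<phi> (T z)\<bar> \<le> \<bar>p$2\<bar> * Kp 2"
      using Kp by (auto intro!: mult_left_mono)
    then show ?thesis unfolding fx_def Kx_def by (intro order_trans[OF abs_triangle_ineq]) (simp add: abs_mult)
  qed
  have ybd: "\<bar>fy z\<bar> \<le> Ky" for z
  proof -
    have "\<bar>q$1\<bar> * \<bar>partial_deriv 1 \<phi> (T z)\<bar> \<le> \<bar>q$1\<bar> * Kp 1" "\<bar>q$2\<bar> * \<bar>partial_deriv 2 \<phi> (T z)\<bar> \<le> \<bar>q$2\<bar> * Kp 2"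
      using Kp by (auto intro!: mult_left_mono)
    then show ?thesis unfolding fy_def Ky_def by (intro order_trans[OF abs_triangle_ineq]) (simp add: abs_mult)
  qed
  have zero: "\<phi> w = 0 \<and> partial_deriv j \<phi> w = 0" if "w \<notin> Om" for w j
    using out(1)[of w \<phi>] out(2)[of w \<phi> j] C(2) that by blast
  have "flow_test lam (\<lambda>z. \<phi> (T z)) fx fy K"
  proof unfold_locales
    fix z :: "real \<times> real"
    have "(T has_derivative (\<lambda>v. fst v *\<^sub>R p + snd v *\<^sub>R q)) (at z)"
      unfolding aff_def by (auto intro!: derivative_eq_intros)
    from has_derivative_compose[OF this deriv]
    show "((\<lambda>z. \<phi> (T z)) has_derivative (\<lambda>v. fst v * fx z + snd v * fy z)) (at z)"
      by (rule has_derivative_eq_rhs) (simp add: fun_eq_iff fx_def fy_def algebra_simps)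
    show "continuous_on UNIV fx" "continuous_on UNIV fy"
      unfolding fx_def fy_def
      by (intro continuous_intros continuous_on_compose2[OF pc aff_continuous]; simp)+
    show "\<bar>\<phi> (T z)\<bar> \<le> K" "\<bar>fx z\<bar> \<le> K" "\<bar>fy z\<bar> \<le> K"
      using K0[of "T z"] bx[of z] ybd[of z] K by auto
  next
    fix x y assume "\<not> (0 < y \<and> y < 1 \<and> 0 < x \<and> x < 1 - lam * y)"
    then have "T (x, y) \<notin> Om" by (simp add: Om_T)
    then show "\<phi> (T (x, y)) = 0 \<and> fx (x, y) = 0 \<and> fy (x, y) = 0"
      using zero by (simp add: fx_def fy_def)
  qed
  moreover have "partial_deriv j \<phi> (T z) = dual_p $ j * fx z + dual_q $ j * fy z" for j z
  proof -
    have "j = 1 \<or> j = 2" using exhaust_2 by blast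
    then have "axis j 1 $ 1 * partial_deriv 1 \<phi> (T z) + axis j 1 $ 2 * partial_deriv 2 \<phi> (T z) = partial_deriv j \<phi> (T z)"
      by (auto simp: axis_def)
    then show ?thesis unfolding axis_expand[of j] by (simp add: fx_def fy_def algebra_simps)
  qed
  moreover have "\<bar>partial_deriv j \<phi> w\<bar> \<le> K" for j w
  proof -
    have "j = 1 \<or> j = 2" using exhaust_2 by blast
    then show ?thesis using Kp[of j w] K(4,5) by auto
  qed
  moreover have "\<bar>\<phi> w\<bar> \<le> K" for w using K0[of w] K(1) by linarith
  ultimately show ?thesis
    using zero borel_measurable_continuous_onI[OF pc] borel_measurable_continuous_onI[OF fc]
    by (intro that[of fx fy K]) auto
qed

lemma LU_density: "L \<Otimes>\<^sub>M U = density (lborel \<Otimes>\<^sub>M lborel) (\<lambda>(x, y). ennreal (indicator {-2..2} x) * ennreal (indicator {0..<1} y))"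
  unfolding L_def U_def
proof (rule pair_measure_density)
  show "sigma_finite_measure (density lborel (\<lambda>x::real. ennreal (indicator {0..<1} x)))"
    using U.sigma_finite_measure_axioms unfolding U_def .
qed (auto intro: lborel.sigma_finite_measure_axioms)

lemma LU_integrable:
  fixes f :: "real \<times> real \<Rightarrow> real"
  assumes [measurable]: "f \<in> borel_measurable (borel \<Otimes>\<^sub>M borel)" and "\<And>x. \<bar>f x\<bar> \<le> K"
  shows "integrable (L \<Otimes>\<^sub>M U) f"
proof -
  have f: "finite_measure (L \<Otimes>\<^sub>M U)" by (intro finite_measure_pair_measure) unfold_locales
  have [measurable]: "f \<in> borel_measurable (L \<Otimes>\<^sub>M U)" by measurable
  show ?thesis using assms(2)
    by (intro finite_measure.integrable_const_bound[OF f, where B=K]) auto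
qed

lemma integral_Om:
  fixes k :: "real ^ 2 \<Rightarrow> real"
  assumes [measurable]: "k \<in> borel_measurable borel" and K: "\<And>w. \<bar>k w\<bar> \<le> K" and z: "\<And>w. w \<notin> Om \<Longrightarrow> k w = 0"
  shows "(LINT w:Om|lebesgue. k w) = Jac * (\<integral>y. \<integral>x. k (T (x, y)) \<partial>L \<partial>U)"
proof -
  have "(LINT w:Om|lebesgue. k w) = (\<integral>w. k w \<partial>lebesgue)"
    unfolding set_lebesgue_integral_def using z by (intro Bochner_Integration.integral_cong) (auto split: split_indicator)
  also have "\<dots> = (\<integral>w. k w \<partial>lborel)" by (rule integral_completion) simp
  also have "\<dots> = Jac * (\<integral>z. k (T z) \<partial>lborel)" by (rule integral_aff[OF cross_nonzero]) simp
  also have "(\<integral>z. k (T z) \<partial>lborel) = (\<integral>z. k (T z) \<partial>(lborel \<Otimes>\<^sub>M lborel))" by (simp add: lborel_prod)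
  also have "\<dots> = (\<integral>z. k (T z) \<partial>(L \<Otimes>\<^sub>M U))"
  proof -
    have [measurable]: "(\<lambda>z. k (T z)) \<in> borel_measurable (borel \<Otimes>\<^sub>M borel)"
      unfolding borel_prod by (rule measurable_compose[OF aff_measurable]) simp
    have ind: "(\<lambda>(x, y). ennreal (indicator {-2..2} x) * ennreal (indicator {0..<1::real} y)) = (\<lambda>z. ennreal (indicator ({-2..2::real} \<times> {0..<1}) z))"
      by (auto simp: fun_eq_iff indicator_def)
    have "(\<integral>z. k (T z) \<partial>(L \<Otimes>\<^sub>M U)) = (\<integral>z. indicator ({-2..2::real} \<times> {0..<1}) z *\<^sub>R k (T z) \<partial>(lborel \<Otimes>\<^sub>M lborel))"
      unfolding LU_density ind by (subst integral_density) auto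
    also have "\<dots> = (\<integral>z. k (T z) \<partial>(lborel \<Otimes>\<^sub>M lborel))"
    proof (intro Bochner_Integration.integral_cong refl)
      fix w :: "real \<times> real"
      obtain x y where w: "w = (x, y)" by (cases w)
      have "k (T (x, y)) = 0" if "(x, y) \<notin> {-2..2} \<times> {0..<1}"
      proof (rule z)
        show "T (x, y) \<notin> Om"
        proof
          assume "T (x, y) \<in> Om"
          then have "0 < y" "y < 1" "0 < x" "x < 1 - lam * y" by (auto simp: Om_T)
          moreover from this have "0 \<le> lam * y" using lam_pos by simp
          ultimately show False using that by auto
        qed
      qed
      then show "indicator ({-2..2::real} \<times> {0..<1}) w *\<^sub>R k (T w) = k (T w)"
        unfolding w by (cases "(x, y) \<in> {-2..2} \<times> {0..<1}") (auto simp: indicator_def)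
    qed
    finally show ?thesis by simp
  qed
  also have "\<dots> = (\<integral>y. \<integral>x. k (T (x, y)) \<partial>L \<partial>U)"
  proof -
    have "(\<lambda>z. k (T z)) \<in> borel_measurable (borel \<Otimes>\<^sub>M borel)"
      unfolding borel_prod by (rule measurable_compose[OF aff_measurable]) simp
    then have "integrable (L \<Otimes>\<^sub>M U) (\<lambda>z. k (T z))" using K by (rule LU_integrable)
    then show ?thesis using LU.integral_snd[of "\<lambda>x y. k (T (x, y))"] by (simp add: case_prod_beta')
  qed
  finally show ?thesis .
qed

end

section \<open>The cells\<close>

text \<open>
  The cell with lower base \<open>p\<close>, left side \<open>q\<close> and upper base \<open>(1 - lam) * p\<close>. The normalization
  by \<open>lam\<close> is preserved by patching.
\<close>

definition trapezium :: "real \<Rightarrow> real ^ 2 \<Rightarrow> real ^ 2 \<Rightarrow> real ^ 2 \<Rightarrow> quad" where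
  "trapezium lam A p q = Quad A (A + p) (A + q + (1 - lam) *\<^sub>R p) (A + q)"

lemma patch_set_UN: "(patch_set ^^ n) (\<Union>i\<in>I. Q i) = (\<Union>i\<in>I. (patch_set ^^ n) (Q i))"
  by (induction n) (auto simp: patch_set_def)

lemma patch_iter_Suc: "patch_iter (Suc n) c = (\<Union>c'\<in>patch c. patch_iter n c')"
proof -
  have "patch_iter (Suc n) c = (patch_set ^^ n) (\<Union>c'\<in>patch c. {c'})"
    by (simp add: patch_iter_def funpow_swap1 patch_set_def)
  also have "\<dots> = (\<Union>c'\<in>patch c. patch_iter n c')"
    unfolding patch_set_UN by (simp add: patch_iter_def)
  finally show ?thesis .
qed

lemma S_level_0: "S_level c 0 = (if compressible c then quad_hull c else {})"
  by (auto simp: S_level_def patch_iter_def)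

lemma S_level_Suc: "S_level c (Suc n) = (\<Union>c'\<in>patch c. S_level c' n)"
  by (auto simp: S_level_def patch_iter_Suc)

lemma patch_incompressible: "\<not> compressible c \<Longrightarrow> patch c = {c}"
  by (cases c) auto

lemma S_level_incompressible: "\<not> compressible c \<Longrightarrow> S_level c n = {}"
  by (induction n) (auto simp: S_level_0 S_level_Suc patch_incompressible)

lemma finite_patch: "finite (patch c)"
  by (cases c) (auto simp: Let_def)

lemma compact_S_level: "compact (S_level c n)"
proof (induction n arbitrary: c)
  case 0
  show ?case by (cases c) (simp add: S_level_0 compact_convex_hull finite_imp_compact)
next
  case (Suc n)
  then show ?case unfolding S_level_Suc by (intro compact_UN finite_patch) auto
qed

context flow
begin

lemma compressible_trapezium: "p \<noteq> 0 \<Longrightarrow> compressible (trapezium lam A p q)"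
  using lam_pos lam_less_1 by (simp add: trapezium_def dist_norm)

text \<open>
  The four compressible cells of the patch have bases \<open>k\<close> and \<open>(1 - lam) * k\<close>, so they are
  trapezia with the same \<open>lam\<close>. The two cells on the left halves have a left side parallel to
  \<open>q\<close>, the other two a left side parallel to the segment joining the corresponding quarter
  points.
\<close>

lemma patch_trapezium:
  assumes p: "p \<noteq> 0"
  defines "k \<equiv> (1/4) *\<^sub>R p"
  shows "\<exists>I. patch (trapezium lam A p q) = I \<union>
      {trapezium lam (A + k) k ((1/2) *\<^sub>R q),
       trapezium lam (A + 3 *\<^sub>R k) k ((1/2) *\<^sub>R q - lam *\<^sub>R k),
       trapezium lam (A + (1/2) *\<^sub>R q) k ((1/2) *\<^sub>R q),
       trapezium lam (A + (1/2) *\<^sub>R q + (2 - lam) *\<^sub>R k) k ((1/2) *\<^sub>R q - lam *\<^sub>R k)}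
    \<and> (\<forall>c\<in>I. \<not> compressible c)"
proof -
  let ?C = "A + q + (1 - lam) *\<^sub>R p" and ?D = "A + q" and ?B = "A + p"
  have lam2: "0 < 2 - lam" using lam_less_1 by simp
  have c: "compressible (Quad A ?B ?C ?D)" using compressible_trapezium[OF p] by (simp add: trapezium_def)
  let ?U = "A + (1/2) *\<^sub>R q"
  have U: "midpoint A ?D = ?U" by (simp add: midpoint_def vec_eq_iff field_simps)
  have V: "midpoint ?C ?B - ?U = ((2 - lam) / 2) *\<^sub>R p"
    by (simp add: midpoint_def vec_eq_iff field_simps)
  have sg: "sgn (midpoint ?C ?B - ?U) = (1 / norm p) *\<^sub>R p"
  proof -
    have "sgn ((2 - lam) / 2) = 1" using lam2 by (intro sgn_pos) simp
    then show ?thesis unfolding V sgn_scaleR by (simp add: sgn_div_norm inverse_eq_divide)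
  qed
  have V': "midpoint ?C ?B = ?U + (2 * (2 - lam)) *\<^sub>R k"
  proof -
    have "midpoint ?C ?B = ?U + (midpoint ?C ?B - ?U)" by simp
    also have "\<dots> = ?U + (2 * (2 - lam)) *\<^sub>R k" unfolding V by (simp add: k_def field_simps)
    finally show ?thesis .
  qed
  have CD: "?C - ?D = (4 * (1 - lam)) *\<^sub>R k" by (simp add: k_def)
  have BA: "?B - A = 4 *\<^sub>R k" by (simp add: k_def)
  have nk: "norm k * (1 / norm p) = 1/4" using p by (simp add: k_def)
  have d1: "dist A (A + (1/4) *\<^sub>R (?B - A)) *\<^sub>R sgn (midpoint ?C ?B - ?U) = k"
    unfolding sg using p by (simp add: k_def dist_norm)
  have d2: "dist (?D + (1/4) *\<^sub>R (?C - ?D)) (?D + (2/4) *\<^sub>R (?C - ?D)) *\<^sub>R sgn (midpoint ?C ?B - ?U) = (1 - lam) *\<^sub>R k"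
  proof -
    have "dist (?D + (1/4) *\<^sub>R (?C - ?D)) (?D + (2/4) *\<^sub>R (?C - ?D)) = norm (((1/4 - 2/4) * (4 * (1 - lam))) *\<^sub>R k)"
      unfolding CD dist_norm by (intro arg_cong[where f=norm]) (simp add: vec_eq_iff field_simps)
    also have "\<dots> = (1 - lam) * norm k" using lam_less_1 by simp
    finally show ?thesis unfolding sg using p by (simp add: k_def)
  qed
  have d3: "dist (A + (2/4) *\<^sub>R (?B - A)) (A + (3/4) *\<^sub>R (?B - A)) *\<^sub>R sgn (midpoint ?C ?B - ?U) = k"
  proof -
    have "dist (A + (2/4) *\<^sub>R (?B - A)) (A + (3/4) *\<^sub>R (?B - A)) = norm (((2/4 - 3/4) * 4) *\<^sub>R k)"
      unfolding BA dist_norm by (intro arg_cong[where f=norm]) (simp add: vec_eq_iff field_simps)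
    then show ?thesis unfolding sg using p by (simp add: k_def)
  qed
  define I where "I = {Quad A (A + k) (?U + k) ?U,
     Quad (?U + k) (?U + k + (1 - lam) *\<^sub>R k) (?D + (2 * (1 - lam)) *\<^sub>R k) (?D + (1 - lam) *\<^sub>R k),
     Quad (A + 2 *\<^sub>R k) (A + 3 *\<^sub>R k) (?U + k + (1 - lam) *\<^sub>R k + k) (?U + k + (1 - lam) *\<^sub>R k),
     Quad (?U + k + (1 - lam) *\<^sub>R k + k) (?U + (2 * (2 - lam)) *\<^sub>R k) (?D + (4 * (1 - lam)) *\<^sub>R k) (?D + (3 * (1 - lam)) *\<^sub>R k)}"
  have q: "patch (Quad A ?B ?C ?D) = I \<union>
     {Quad ?U (?U + k) (?D + (1 - lam) *\<^sub>R k) ?D,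
      Quad (A + k) (A + 2 *\<^sub>R k) (?U + k + (1 - lam) *\<^sub>R k) (?U + k),
      Quad (?U + k + (1 - lam) *\<^sub>R k) (?U + k + (1 - lam) *\<^sub>R k + k) (?D + (3 * (1 - lam)) *\<^sub>R k) (?D + (2 * (1 - lam)) *\<^sub>R k),
      Quad (A + 3 *\<^sub>R k) ?B (?U + (2 * (2 - lam)) *\<^sub>R k) (?U + k + (1 - lam) *\<^sub>R k + k)}"
  proof -
    have C': "?C = ?D + (4 * (1 - lam)) *\<^sub>R k" using CD by (simp add: algebra_simps)
    have pts: "A + (1/4) *\<^sub>R (?B - A) = A + k" "A + (2/4) *\<^sub>R (?B - A) = A + 2 *\<^sub>R k" "A + (3/4) *\<^sub>R (?B - A) = A + 3 *\<^sub>R k"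
      "?D + (1/4) *\<^sub>R (?C - ?D) = ?D + (1 - lam) *\<^sub>R k" "?D + (2/4) *\<^sub>R (?C - ?D) = ?D + (2 * (1 - lam)) *\<^sub>R k"
      "?D + (3/4) *\<^sub>R (?C - ?D) = ?D + (3 * (1 - lam)) *\<^sub>R k"
      unfolding CD BA by simp_all
    show ?thesis
      unfolding patch.simps if_P[OF c] Let_def I_def
      unfolding U
      unfolding d1 d2 d3
      unfolding pts V' C'[symmetric]
      by (simp only: insert_commute Un_insert_left Un_empty_left)
  qed
  have 1: "Quad (A + k) (A + 2 *\<^sub>R k) (?U + k + (1 - lam) *\<^sub>R k) (?U + k) = trapezium lam (A + k) k ((1/2) *\<^sub>R q)"
    by (simp add: trapezium_def algebra_simps scaleR_2)
  have 2: "Quad (A + 3 *\<^sub>R k) ?B (?U + (2 * (2 - lam)) *\<^sub>R k) (?U + k + (1 - lam) *\<^sub>R k + k)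
    = trapezium lam (A + 3 *\<^sub>R k) k ((1/2) *\<^sub>R q - lam *\<^sub>R k)"
  proof -
    have "A + p = A + 3 *\<^sub>R k + k" by (simp add: k_def scaleR_add_left[symmetric] add.assoc)
    then show ?thesis by (simp add: trapezium_def vec_eq_iff algebra_simps)
  qed
  have 3: "Quad ?U (?U + k) (?D + (1 - lam) *\<^sub>R k) ?D = trapezium lam (A + (1/2) *\<^sub>R q) k ((1/2) *\<^sub>R q)"
    by (simp add: trapezium_def vec_eq_iff algebra_simps)
  have 4: "Quad (?U + k + (1 - lam) *\<^sub>R k) (?U + k + (1 - lam) *\<^sub>R k + k) (?D + (3 * (1 - lam)) *\<^sub>R k) (?D + (2 * (1 - lam)) *\<^sub>R k)
    = trapezium lam (A + (1/2) *\<^sub>R q + (2 - lam) *\<^sub>R k) k ((1/2) *\<^sub>R q - lam *\<^sub>R k)"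
    by (simp add: trapezium_def vec_eq_iff algebra_simps)
  have inc: "\<forall>c\<in>I. \<not> compressible c"
  proof -
    have par: "\<not> compressible (Quad P R S' Q)" if "R = P + v" "S' = Q + v" for P Q R S' v :: "real ^ 2"
      using that by (simp add: dist_norm norm_minus_commute)
    have "\<not> compressible (Quad A (A + k) (?U + k) ?U)" by (rule par) simp_all
    moreover have "\<not> compressible (Quad (?U + k) (?U + k + (1 - lam) *\<^sub>R k) (?D + (2 * (1 - lam)) *\<^sub>R k) (?D + (1 - lam) *\<^sub>R k))"
      by (rule par[of _ _ "(1 - lam) *\<^sub>R k"]) (simp_all add: vec_eq_iff algebra_simps)
    moreover have "\<not> compressible (Quad (A + 2 *\<^sub>R k) (A + 3 *\<^sub>R k) (?U + k + (1 - lam) *\<^sub>R k + k) (?U + k + (1 - lam) *\<^sub>R k))"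
      by (rule par[of _ _ k]) (simp_all add: vec_eq_iff algebra_simps)
    moreover have "\<not> compressible (Quad (?U + k + (1 - lam) *\<^sub>R k + k) (?U + (2 * (2 - lam)) *\<^sub>R k) (?D + (4 * (1 - lam)) *\<^sub>R k) (?D + (3 * (1 - lam)) *\<^sub>R k))"
      by (rule par[of _ _ "(1 - lam) *\<^sub>R k"]) (simp_all add: vec_eq_iff algebra_simps)
    ultimately show ?thesis unfolding I_def ball_simps by (intro conjI TrueI)
  qed
  show ?thesis
    by (intro exI[of _ I] conjI inc) (use q in \<open>simp only: trapezium_def[of lam A p q] 1 2 3 4 insert_commute Un_insert_right Un_empty_right\<close>)
qed

lemma S_level_trapezium_Suc:
  assumes p: "p \<noteq> 0"
  defines "k \<equiv> (1/4) *\<^sub>R p"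
  shows "S_level (trapezium lam A p q) (Suc n) =
      S_level (trapezium lam (A + k) k ((1/2) *\<^sub>R q)) n \<union>
      S_level (trapezium lam (A + 3 *\<^sub>R k) k ((1/2) *\<^sub>R q - lam *\<^sub>R k)) n \<union>
      S_level (trapezium lam (A + (1/2) *\<^sub>R q) k ((1/2) *\<^sub>R q)) n \<union>
      S_level (trapezium lam (A + (1/2) *\<^sub>R q + (2 - lam) *\<^sub>R k) k ((1/2) *\<^sub>R q - lam *\<^sub>R k)) n"
proof -
  obtain I where I: "patch (trapezium lam A p q) = I \<union>
      {trapezium lam (A + k) k ((1/2) *\<^sub>R q),
       trapezium lam (A + 3 *\<^sub>R k) k ((1/2) *\<^sub>R q - lam *\<^sub>R k),
       trapezium lam (A + (1/2) *\<^sub>R q) k ((1/2) *\<^sub>R q),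
       trapezium lam (A + (1/2) *\<^sub>R q + (2 - lam) *\<^sub>R k) k ((1/2) *\<^sub>R q - lam *\<^sub>R k)}" "\<forall>c\<in>I. \<not> compressible c"
    using patch_trapezium[OF p, of A q] unfolding k_def by blast
  have "(\<Union>c\<in>I. S_level c n) = {}" using I(2) S_level_incompressible by auto
  then show ?thesis unfolding S_level_Suc I(1) by auto
qed

lemma quad_hull_trapezium:
  "quad_hull (trapezium lam A p q) \<subseteq> aff A p q ` ({0..1} \<times> {0..1})"
proof -
  have "convex (aff A p q ` ({0..1} \<times> {0..1}))"
  proof -
    have e: "aff A p q ` ({0..1} \<times> {0..1}) = (+) A ` ((\<lambda>z. fst z *\<^sub>R p + snd z *\<^sub>R q) ` ({0..1} \<times> {0..1}))"
      by (auto simp: aff_def image_image add.assoc)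
    have "linear (\<lambda>z::real\<times>real. fst z *\<^sub>R p + snd z *\<^sub>R q)"
      by (rule linearI) (auto simp: algebra_simps)
    then show ?thesis unfolding e
      by (intro convex_translation convex_linear_image convex_Times) auto
  qed
  moreover have "A \<in> aff A p q ` ({0..1} \<times> {0..1})" by (rule image_eqI[of _ _ "(0,0)"]) (auto simp: aff_def)
  moreover have "A + p \<in> aff A p q ` ({0..1} \<times> {0..1})" by (rule image_eqI[of _ _ "(1,0)"]) (auto simp: aff_def)
  moreover have "A + q \<in> aff A p q ` ({0..1} \<times> {0..1})" by (rule image_eqI[of _ _ "(0,1)"]) (auto simp: aff_def)
  moreover have "A + q + (1 - lam) *\<^sub>R p \<in> aff A p q ` ({0..1} \<times> {0..1})"
    by (rule image_eqI[of _ _ "(1 - lam,1)"]) (use lam_pos lam_less_1 in \<open>auto simp: aff_def algebra_simps\<close>)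
  ultimately show ?thesis unfolding trapezium_def quad_hull.simps by (intro hull_minimal insert_subsetI empty_subsetI)
qed

text \<open>
  Each of the four smaller cells has an eighth of the area of the parallelogram spanned by \<open>p\<close>
  and \<open>q\<close>, so the total is halved in each generation.
\<close>

lemma emeasure_S_level:
  assumes "cross2 p q \<noteq> 0"
  shows "emeasure lborel (S_level (trapezium lam A p q) n) \<le> ennreal (\<bar>cross2 p q\<bar> / 2 ^ n)"
  using assms
proof (induction n arbitrary: A p q)
  case 0
  have p: "p \<noteq> 0" using 0 by (auto simp: cross2_def)
  have inj: "inj (aff A p q)"
  proof (rule injI)
    fix z w :: "real \<times> real" assume e: "aff A p q z = aff A p q w"
    define a b where "a = fst z - fst w" and "b = snd z - snd w"
    have "a *\<^sub>R p + b *\<^sub>R q = 0" using e by (simp add: aff_def a_def b_def algebra_simps)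
    then have c: "a * p$1 + b * q$1 = 0" "a * p$2 + b * q$2 = 0" by (auto simp: vec_eq_iff forall_2)
    have "a * cross2 p q = (a * p$1 + b * q$1) * q$2 - (a * p$2 + b * q$2) * q$1"
      "b * cross2 p q = (a * p$2 + b * q$2) * p$1 - (a * p$1 + b * q$1) * p$2" by (simp_all add: cross2_def algebra_simps)
    then have "a * cross2 p q = 0" "b * cross2 p q = 0" unfolding c by simp_all
    then show "z = w" using 0 by (simp add: a_def b_def prod_eq_iff)
  qed
  have "emeasure lborel (S_level (trapezium lam A p q) 0) \<le> emeasure lborel (aff A p q ` ({0..1} \<times> {0..1}))"
  proof (rule emeasure_mono)
    show "S_level (trapezium lam A p q) 0 \<subseteq> aff A p q ` ({0..1} \<times> {0..1})"
      using quad_hull_trapezium by (simp add: S_level_0)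
    have "compact (aff A p q ` ({0..1} \<times> {0..1}))"
      by (intro compact_continuous_image aff_continuous compact_Times) auto
    then show "aff A p q ` ({0..1} \<times> {0..1}) \<in> sets lborel" by (simp add: compact_imp_closed)
  qed
  also have "\<dots> = ennreal \<bar>cross2 p q\<bar> * emeasure lborel (aff A p q -` (aff A p q ` ({0..1} \<times> {0..1})))"
  proof (rule emeasure_aff[OF 0])
    have "compact (aff A p q ` ({0..1} \<times> {0..1}))"
      by (intro compact_continuous_image aff_continuous compact_Times) auto
    then show "aff A p q ` ({0..1} \<times> {0..1}) \<in> sets borel" by (simp add: compact_imp_closed)
  qed
  also have "aff A p q -` (aff A p q ` ({0..1} \<times> {0..1})) = {0..1} \<times> {0..1}"
    by (rule inj_vimage_image_eq[OF inj])
  also have "emeasure lborel ({0..1::real} \<times> {0..1::real}) = 1"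
    unfolding lborel_prod[symmetric] by (subst lborel.emeasure_pair_measure_Times) auto
  finally show ?case by simp
next
  case (Suc n)
  have p: "p \<noteq> 0" using Suc.prems by (auto simp: cross2_def)
  define k where "k = (1/4) *\<^sub>R p"
  define q' where "q' = (1/2) *\<^sub>R q - lam *\<^sub>R k"
  have c: "cross2 k ((1/2) *\<^sub>R q) = cross2 p q / 8" "cross2 k q' = cross2 p q / 8"
    by (simp_all add: cross2_def k_def q'_def field_simps)
  have m: "S_level d j \<in> sets lborel" for d j using compact_S_level[of d j] by (simp add: compact_imp_closed)
  have s: "emeasure lborel (S_level (trapezium lam A' k ((1/2) *\<^sub>R q)) n) \<le> ennreal (\<bar>cross2 p q\<bar> / 8 / 2 ^ n)"
    "emeasure lborel (S_level (trapezium lam A' k q') n) \<le> ennreal (\<bar>cross2 p q\<bar> / 8 / 2 ^ n)" for A'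
    using Suc.IH[of k "(1/2) *\<^sub>R q" A'] Suc.IH[of k q' A'] Suc.prems c by (simp_all add: abs_divide)
  have "emeasure lborel (S_level (trapezium lam A p q) (Suc n)) \<le>
      emeasure lborel (S_level (trapezium lam (A + k) k ((1/2) *\<^sub>R q)) n) +
      emeasure lborel (S_level (trapezium lam (A + 3 *\<^sub>R k) k q') n) +
      emeasure lborel (S_level (trapezium lam (A + (1/2) *\<^sub>R q) k ((1/2) *\<^sub>R q)) n) +
      emeasure lborel (S_level (trapezium lam (A + (1/2) *\<^sub>R q + (2 - lam) *\<^sub>R k) k q') n)"
    unfolding S_level_trapezium_Suc[OF p] k_def[symmetric] q'_def[symmetric]
    by (intro order_trans[OF emeasure_subadditive] add_mono order_refl sets.Un m)
  also have "\<dots> \<le> ennreal (\<bar>cross2 p q\<bar> / 8 / 2 ^ n) + ennreal (\<bar>cross2 p q\<bar> / 8 / 2 ^ n)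
     + ennreal (\<bar>cross2 p q\<bar> / 8 / 2 ^ n) + ennreal (\<bar>cross2 p q\<bar> / 8 / 2 ^ n)"
    by (intro add_mono s)
  also have "\<dots> = ennreal (\<bar>cross2 p q\<bar> / 2 ^ Suc n)"
    by (simp add: ennreal_plus[symmetric] del: ennreal_plus)
  finally show ?case .
qed

lemma emeasure_S_limit:
  assumes "cross2 p q \<noteq> 0"
  shows "emeasure lborel (S_limit (trapezium lam A p q)) = 0"
proof -
  have le: "emeasure lborel (S_limit (trapezium lam A p q)) \<le> ennreal (\<bar>cross2 p q\<bar> / 2 ^ n)" for n
  proof -
    have "emeasure lborel (S_limit (trapezium lam A p q)) \<le> emeasure lborel (S_level (trapezium lam A p q) n)"
      using compact_S_level[of "trapezium lam A p q" n]
      by (intro emeasure_mono) (auto simp: S_limit_def compact_imp_closed)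
    then show ?thesis using emeasure_S_level[OF assms] order_trans by blast
  qed
  have "(\<lambda>n. \<bar>cross2 p q\<bar> * (1/2) ^ n) \<longlonglongrightarrow> \<bar>cross2 p q\<bar> * 0"
    by (intro tendsto_intros LIMSEQ_realpow_zero) auto
  then have "(\<lambda>n. ennreal (\<bar>cross2 p q\<bar> / 2 ^ n)) \<longlonglongrightarrow> ennreal 0"
    by (intro tendsto_ennrealI) (simp add: power_one_over)
  then show ?thesis using LIMSEQ_le_const[of _ "ennreal 0" "emeasure lborel (S_limit (trapezium lam A p q))"] le by auto
qed

lemma trapezium_point:
  assumes y: "0 \<le> y" "y \<le> 1" and a: "0 \<le> a" "a < 1 - lam * y"
  shows "aff A p q (a, y) \<in> quad_hull (trapezium lam A p q)"
proof -
  let ?H = "convex hull {A, A + p, A + q + (1 - lam) *\<^sub>R p, A + q}"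
  define d where "d = 1 - lam * y"
  define s where "s = a / d"
  have s: "0 \<le> s" "s \<le> 1" "s * d = a" using a by (auto simp: s_def d_def)
  have mem: "A \<in> ?H" "A + p \<in> ?H" "A + q + (1 - lam) *\<^sub>R p \<in> ?H" "A + q \<in> ?H" by (auto intro: hull_inc)
  have cv: "convex ?H" by (rule convex_convex_hull)
  have 1: "(1 - y) *\<^sub>R A + y *\<^sub>R (A + q) \<in> ?H" "(1 - y) *\<^sub>R (A + p) + y *\<^sub>R (A + q + (1 - lam) *\<^sub>R p) \<in> ?H"
    using y mem by (auto intro!: convexD[OF cv])
  have "(1 - s) *\<^sub>R ((1 - y) *\<^sub>R A + y *\<^sub>R (A + q)) + s *\<^sub>R ((1 - y) *\<^sub>R (A + p) + y *\<^sub>R (A + q + (1 - lam) *\<^sub>R p)) \<in> ?H"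
    using s 1 by (auto intro!: convexD[OF cv])
  moreover have "(1 - s) *\<^sub>R ((1 - y) *\<^sub>R A + y *\<^sub>R (A + q)) + s *\<^sub>R ((1 - y) *\<^sub>R (A + p) + y *\<^sub>R (A + q + (1 - lam) *\<^sub>R p))
    = A + (s * d) *\<^sub>R p + y *\<^sub>R q" by (simp add: d_def vec_eq_iff algebra_simps)
  ultimately show ?thesis by (simp add: s aff_def trapezium_def)
qed

text \<open>
  The first digits of \<open>u\<close> and \<open>y\<close> select one of the four compressible cells, and the
  self-similarity \<open>xi_halves\<close> says that within this cell the point is again a crossing point.
\<close>

lemma crossing_in_S_level:
  assumes "p \<noteq> 0" "0 \<le> u" "u < 1" "0 \<le> y" "y < 1"
  shows "aff A p q (xi u y, y) \<in> S_level (trapezium lam A p q) n"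
  using assms
proof (induction n arbitrary: A p q u y)
  case 0
  have x: "0 < xi u y" "xi u y < 1 - lam * y" using xi_range[of y u] 0 by auto
  have "aff A p q (xi u y, y) \<in> quad_hull (trapezium lam A p q)" using 0 x by (intro trapezium_point) auto
  then show ?case using 0 compressible_trapezium by (simp add: S_level_0)
next
  case (Suc n)
  define k where "k = (1/4) *\<^sub>R p"
  have k: "k \<noteq> 0" "p = 4 *\<^sub>R k" using Suc.prems by (auto simp: k_def)
  note S = S_level_trapezium_Suc[OF Suc.prems(1), of A q n, folded k_def]
  have half: "\<exists>v. 0 \<le> v \<and> v < 1 \<and> (w = v/2 \<or> w = (1+v)/2)" if "0 \<le> w" "w < 1" for w :: real
  proof (cases "w < 1/2")
    case True then show ?thesis using that by (intro exI[of _ "2*w"]) auto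
  next
    case False then show ?thesis using that by (intro exI[of _ "2*w-1"]) auto
  qed
  obtain v where v: "0 \<le> v" "v < 1" "u = v/2 \<or> u = (1+v)/2" using half Suc.prems by blast
  obtain t where t: "0 \<le> t" "t < 1" "y = t/2 \<or> y = (1+t)/2" using half Suc.prems by blast
  note xh = xi_halves[OF v(1,2) t(1,2)]
  consider "u = v/2" "y = t/2" | "u = (1+v)/2" "y = t/2" | "u = v/2" "y = (1+t)/2" | "u = (1+v)/2" "y = (1+t)/2"
    using v t by blast
  then show ?case
  proof cases
    case 1
    have "aff A p q (xi u y, y) = aff (A + k) k ((1/2) *\<^sub>R q) (xi v t, t)"
      unfolding 1 xh k(2) by (simp add: aff_def vec_eq_iff field_simps)
    then show ?thesis unfolding S using Suc.IH[OF k(1) v(1,2) t(1,2)] by simp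
  next
    case 2
    have "aff A p q (xi u y, y) = aff (A + 3 *\<^sub>R k) k ((1/2) *\<^sub>R q - lam *\<^sub>R k) (xi v t, t)"
      unfolding 2 xh k(2) by (simp add: aff_def vec_eq_iff field_simps)
    then show ?thesis unfolding S using Suc.IH[OF k(1) v(1,2) t(1,2)] by simp
  next
    case 3
    have "aff A p q (xi u y, y) = aff (A + (1/2) *\<^sub>R q) k ((1/2) *\<^sub>R q) (xi v t, t)"
      unfolding 3 xh k(2) by (simp add: aff_def vec_eq_iff field_simps)
    then show ?thesis unfolding S using Suc.IH[OF k(1) v(1,2) t(1,2)] by simp
  next
    case 4
    have "aff A p q (xi u y, y) = aff (A + (1/2) *\<^sub>R q + (2 - lam) *\<^sub>R k) k ((1/2) *\<^sub>R q - lam *\<^sub>R k) (xi v t, t)"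
      unfolding 4 xh k(2) by (simp add: aff_def vec_eq_iff field_simps)
    then show ?thesis unfolding S using Suc.IH[OF k(1) v(1,2) t(1,2)] by simp
  qed
qed

end

context frame
begin

lemma quad_interior_trapezium: "quad_interior (trapezium lam A p q) = Om"
proof
  let ?H = "quad_hull (trapezium lam A p q)"
  let ?K = "{w. dual_q \<bullet> (A - w) \<le> 0} \<inter> {w. dual_q \<bullet> (w - A) \<le> 1} \<inter> {w. dual_p \<bullet> (A - w) \<le> 0} \<inter> {w. (dual_p + lam *\<^sub>R dual_q) \<bullet> (w - A) \<le> 1}"
  have nz: "dual_p \<noteq> 0" "dual_q \<noteq> 0" using dual by auto
  have nz': "dual_p + lam *\<^sub>R dual_q \<noteq> 0"
  proof
    assume "dual_p + lam *\<^sub>R dual_q = 0"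
    then have "(dual_p + lam *\<^sub>R dual_q) \<bullet> p = 0" by simp
    then show False by (simp add: inner_add_left dual)
  qed
  have half: "{w. a \<bullet> (w - A) \<le> c} = {w. a \<bullet> w \<le> c + a \<bullet> A}" "{w. a \<bullet> (A - w) \<le> 0} = {w. (- a) \<bullet> w \<le> - (a \<bullet> A)}" for a and c
    by (auto simp: inner_diff_right)
  have H: "?H \<subseteq> ?K"
  proof -
    have cv: "convex ?K" unfolding half by (intro convex_Int convex_halfspace_le)
    have "{A, A + p, A + q + (1 - lam) *\<^sub>R p, A + q} \<subseteq> ?K"
      using lam_pos lam_less_1 by (auto simp: inner_add_right inner_add_left inner_diff_right dual algebra_simps)
    then show ?thesis unfolding trapezium_def quad_hull.simps by (intro hull_minimal cv)
  qed
  have "interior ?K = Om"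
  proof -
    have "interior ?K = {w. (- dual_q) \<bullet> w < - (dual_q \<bullet> A)} \<inter> {w. dual_q \<bullet> w < 1 + dual_q \<bullet> A} \<inter> {w. (- dual_p) \<bullet> w < - (dual_p \<bullet> A)} \<inter> {w. (dual_p + lam *\<^sub>R dual_q) \<bullet> w < 1 + (dual_p + lam *\<^sub>R dual_q) \<bullet> A}"
      unfolding half interior_Int using nz nz' by (simp only: interior_halfspace_le neg_equal_0_iff_equal not_False_eq_True)
    also have "\<dots> = Om" by (auto simp: Om_def cx_def cy_def inner_diff_right inner_add_left algebra_simps)
    finally show ?thesis .
  qed
  then show "quad_interior (trapezium lam A p q) \<subseteq> Om"
    unfolding quad_interior_def using interior_mono[OF H] by simp
  have "Om \<subseteq> ?H"
  proof
    fix w assume "w \<in> Om"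
    then have w: "0 < cy w" "cy w < 1" "0 < cx w" "cx w < 1 - lam * cy w" by (auto simp: Om_def)
    then have "T (cx w, cy w) \<in> ?H" by (intro trapezium_point) auto
    then show "w \<in> ?H" by (simp add: T_coords)
  qed
  then show "Om \<subseteq> quad_interior (trapezium lam A p q)"
    unfolding quad_interior_def by (rule interior_maximal[OF _ open_Om])
qed

lemma p_nonzero: "p \<noteq> 0" using cross_nonzero by (auto simp: cross2_def)

lemma crossing_in_S:
  "0 \<le> u \<Longrightarrow> u < 1 \<Longrightarrow> 0 \<le> y \<Longrightarrow> y < 1 \<Longrightarrow> T (xi u y, y) \<in> S_limit (trapezium lam A p q)"
  unfolding S_limit_def using crossing_in_S_level[OF p_nonzero] by blast

section \<open>The field, the density and their derivatives\<close>

definition crossing :: "real \<times> real \<Rightarrow> real ^ 2" where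
  "crossing z = T (xi (fst z) (snd z), snd z)"

text \<open>
  The point of the sheared curve of label \<open>u\<close> at the sheared abscissa \<open>x\<close>, with the shear
  undone. The curves may jump, in which case these points also fill the vertical gaps of their
  graphs.
\<close>

definition level_point :: "real \<times> real \<Rightarrow> real ^ 2" where
  "level_point z = T (snd z - lam * fst z * level_height (fst z) (snd z), level_height (fst z) (snd z))"

lemma crossing_measurable [measurable]: "crossing \<in> borel_measurable (borel \<Otimes>\<^sub>M borel)"
  unfolding crossing_def by measurable

lemma level_point_measurable [measurable]: "level_point \<in> borel_measurable (borel \<Otimes>\<^sub>M borel)"
  unfolding level_point_def by measurable

lemma clamp_measurable [measurable]: "clamp01 \<in> borel_measurable borel"
  unfolding clamp01_def by measurable

lemma clamp_bounds: "0 \<le> clamp01 u" "clamp01 u \<le> 1" by (auto simp: clamp01_def)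

definition nu :: "(real ^ 2) measure" where
  "nu = distr (U \<Otimes>\<^sub>M U) borel crossing"

text \<open>
  The crossing measure weighted by the label. Labels outside the unit interval, which form a
  null set, are clamped in order that the density is bounded.
\<close>

definition nu_label :: "(real ^ 2) measure" where
  "nu_label = distr (density (U \<Otimes>\<^sub>M U) (\<lambda>z. ennreal (clamp01 (fst z)))) borel crossing"

definition level_measure :: "(real ^ 2) measure" where
  "level_measure = distr (U \<Otimes>\<^sub>M L) borel level_point"

lemma sets_N [simp]: "sets nu = sets borel" "sets nu_label = sets borel" "sets level_measure = sets borel"
  by (simp_all add: nu_def nu_label_def level_measure_def)

lemma space_N [simp]: "space nu = UNIV" "space nu_label = UNIV" "space level_measure = UNIV"
  by (simp_all add: nu_def nu_label_def level_measure_def)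

lemma finite_nu: "finite_measure nu"
  unfolding nu_def by (intro finite_measure.finite_measure_distr UU.P.finite_measure_axioms) measurable

lemma finite_level_measure: "finite_measure level_measure"
  unfolding level_measure_def by (intro finite_measure.finite_measure_distr finite_UL) measurable

lemma finite_nu_label: "finite_measure nu_label"
proof -
  have "finite_measure (density (U \<Otimes>\<^sub>M U) (\<lambda>z. ennreal (clamp01 (fst z))))"
  proof (rule finite_measureI)
    have "emeasure (density (U \<Otimes>\<^sub>M U) (\<lambda>z. ennreal (clamp01 (fst z)))) UNIV = (\<integral>\<^sup>+z. ennreal (clamp01 (fst z)) \<partial>(U \<Otimes>\<^sub>M U))"
      by (subst emeasure_density) (auto simp: space_pair_measure sets.top[of "U \<Otimes>\<^sub>M U", simplified space_pair_measure, simplified])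
    also have "\<dots> \<le> (\<integral>\<^sup>+z. 1 \<partial>(U \<Otimes>\<^sub>M U))" using clamp_bounds by (intro nn_integral_mono) simp
    also have "\<dots> = 1" using UU.P.emeasure_space_1 by simp
    finally show "emeasure (density (U \<Otimes>\<^sub>M U) (\<lambda>z. ennreal (clamp01 (fst z)))) (space (density (U \<Otimes>\<^sub>M U) (\<lambda>z. ennreal (clamp01 (fst z))))) \<noteq> \<infinity>"
      by (auto simp: space_pair_measure top_unique)
  qed
  then show ?thesis unfolding nu_label_def by (intro finite_measure.finite_measure_distr) measurable
qed

lemma integral_nu:
  fixes \<phi> :: "real ^ 2 \<Rightarrow> real"
  assumes [measurable]: "\<phi> \<in> borel_measurable borel" and K: "\<And>w. \<bar>\<phi> w\<bar> \<le> K"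
  shows "(\<integral>w. \<phi> w \<partial>nu) = (\<integral>y. \<integral>u. \<phi> (crossing (u, y)) \<partial>U \<partial>U)"
proof -
  have "(\<integral>w. \<phi> w \<partial>nu) = (\<integral>z. \<phi> (crossing z) \<partial>(U \<Otimes>\<^sub>M U))"
    unfolding nu_def by (subst integral_distr) auto
  also have "\<dots> = (\<integral>y. \<integral>u. \<phi> (crossing (u, y)) \<partial>U \<partial>U)"
  proof -
    have "integrable (U \<Otimes>\<^sub>M U) (\<lambda>z. \<phi> (crossing z))" by (intro UU_integrable[where K=K] K) measurable
    then show ?thesis
      using UU.integral_snd[of "\<lambda>u y. \<phi> (crossing (u, y))"] by (simp only: case_prod_beta' prod.collapse)
  qed
  finally show ?thesis .
qed

lemma integral_nu_label:
  fixes \<phi> :: "real ^ 2 \<Rightarrow> real"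
  assumes [measurable]: "\<phi> \<in> borel_measurable borel" and K: "\<And>w. \<bar>\<phi> w\<bar> \<le> K"
  shows "(\<integral>w. \<phi> w \<partial>nu_label) = (\<integral>y. \<integral>u. clamp01 u * \<phi> (crossing (u, y)) \<partial>U \<partial>U)"
proof -
  have "(\<integral>w. \<phi> w \<partial>nu_label) = (\<integral>z. clamp01 (fst z) * \<phi> (crossing z) \<partial>(U \<Otimes>\<^sub>M U))"
    unfolding nu_label_def using clamp_bounds by (subst integral_distr, simp, simp, subst integral_density) auto
  also have "\<dots> = (\<integral>y. \<integral>u. clamp01 u * \<phi> (crossing (u, y)) \<partial>U \<partial>U)"
  proof -
    have "\<bar>clamp01 u * \<phi> w\<bar> \<le> 1 * K" for u w
      unfolding abs_mult using clamp_bounds[of u] K by (intro mult_mono) auto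
    then have "integrable (U \<Otimes>\<^sub>M U) (\<lambda>z. clamp01 (fst z) * \<phi> (crossing z))"
      by (intro UU_integrable[where K="1 * K"]) auto
    then show ?thesis
      using UU.integral_snd[of "\<lambda>u y. clamp01 u * \<phi> (crossing (u, y))"] by (simp only: case_prod_beta' prod.collapse fst_conv)
  qed
  finally show ?thesis .
qed

lemma integral_level_measure:
  fixes \<phi> :: "real ^ 2 \<Rightarrow> real"
  assumes [measurable]: "\<phi> \<in> borel_measurable borel" and K: "\<And>w. \<bar>\<phi> w\<bar> \<le> K"
  shows "(\<integral>w. \<phi> w \<partial>level_measure) = (\<integral>u. \<integral>x. \<phi> (level_point (u, x)) \<partial>L \<partial>U)"
proof -
  have "(\<integral>w. \<phi> w \<partial>level_measure) = (\<integral>z. \<phi> (level_point z) \<partial>(U \<Otimes>\<^sub>M L))"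
    unfolding level_measure_def by (subst integral_distr) auto
  also have "\<dots> = (\<integral>u. \<integral>x. \<phi> (level_point (u, x)) \<partial>L \<partial>U)"
  proof -
    have "integrable (U \<Otimes>\<^sub>M L) (\<lambda>z. \<phi> (level_point z))" by (intro UL_integrable[where K=K] K) measurable
    from UL.integral_fst'[OF this] show ?thesis by (rule sym)
  qed
  finally show ?thesis .
qed

lemma measure_nu: "E \<in> sets borel \<Longrightarrow> measure nu E = (\<integral>y. \<integral>u. indicator E (crossing (u, y)) \<partial>U \<partial>U)"
  using integral_nu[of "indicator E" 1] by simp

lemma measure_nu_label: "E \<in> sets borel \<Longrightarrow> measure nu_label E = (\<integral>y. \<integral>u. clamp01 u * indicator E (crossing (u, y)) \<partial>U \<partial>U)"
  using integral_nu_label[of "indicator E" 1] by simp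

lemma measure_level_measure: "E \<in> sets borel \<Longrightarrow> measure level_measure E = (\<integral>u. \<integral>x. indicator E (level_point (u, x)) \<partial>L \<partial>U)"
  using integral_level_measure[of "indicator E" 1] by simp

text \<open>
  In the frame \<open>p\<close>, \<open>q\<close> this is the velocity of the particles.
\<close>

definition field :: "real ^ 2 \<Rightarrow> real ^ 2" where
  "field w = q - (lam * G (cx w) (cy w)) *\<^sub>R p"

definition rho :: "real ^ 2 \<Rightarrow> real" where
  "rho w = dens (cx w) (cy w)"

lemma field_measurable [measurable]: "field \<in> borel_measurable borel"
  unfolding field_def by measurable

lemma field_nth_measurable [measurable]: "(\<lambda>w. field w $ i) \<in> borel_measurable borel"
  unfolding field_def by simp

lemma rho_measurable [measurable]: "rho \<in> borel_measurable borel"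
  unfolding rho_def by measurable

lemma field_bound: "norm (field w) \<le> norm q + norm p"
proof -
  have "norm (field w) \<le> norm q + norm ((lam * G (cx w) (cy w)) *\<^sub>R p)" unfolding field_def by (rule norm_triangle_ineq4)
  also have "norm ((lam * G (cx w) (cy w)) *\<^sub>R p) \<le> 1 * norm p"
    unfolding norm_scaleR abs_mult using lam_pos lam_less_1 G_bounds[of "cx w" "cy w"]
    by (intro mult_right_mono mult_le_one) auto
  finally show ?thesis by simp
qed

lemma rho_bound: "\<bar>rho w\<bar> \<le> 1 / (1 - lam)"
  using dens_bounds[of "cx w" "cy w"] by (simp add: rho_def)

definition outer :: "real ^ 2 \<Rightarrow> real ^ 2 \<Rightarrow> real ^ 2 ^ 2" where
  "outer a b = (\<chi> i j. a $ i * b $ j)"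

text \<open>
  The derivative of \<open>- lam * G * p\<close>, where the differentials of the coordinates are \<open>dual_p\<close> and
  \<open>dual_q\<close>; the coefficients are those of \<open>integral_G_dx\<close> and \<open>integral_G_dy\<close>.
\<close>

definition grad :: "(real ^ 2) set \<Rightarrow> real ^ 2 ^ 2" where
  "grad E = (- (lam * Jac)) *\<^sub>R (measure nu E *\<^sub>R outer p dual_p + (lam * measure nu_label E + measure level_measure E) *\<^sub>R outer p dual_q)"

definition cantor :: "(real ^ 2) set \<Rightarrow> real" where
  "cantor E = - (lam * Jac) * measure nu E"

lemma sum_dual: "(\<Sum>i\<in>UNIV. p $ i * (dual_p $ i * a + dual_q $ i * b)) = a" "(\<Sum>i\<in>UNIV. q $ i * (dual_p $ i * a + dual_q $ i * b)) = b"
proof -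
  have "(\<Sum>i\<in>UNIV. v $ i * (dual_p $ i * a + dual_q $ i * b)) = (dual_p \<bullet> v) * a + (dual_q \<bullet> v) * b" for v
    by (simp add: inner_vec_def sum_2 algebra_simps)
  then show "(\<Sum>i\<in>UNIV. p $ i * (dual_p $ i * a + dual_q $ i * b)) = a" "(\<Sum>i\<in>UNIV. q $ i * (dual_p $ i * a + dual_q $ i * b)) = b"
    by (simp_all add: dual)
qed

lemma comp_bound: "\<bar>field w $ i\<bar> \<le> norm q + norm p"
  using component_le_norm_cart[of "field w" i] field_bound[of w] by (rule order_trans)

lemma integrals_test:
  assumes ft: "flow_test lam (\<lambda>z. \<phi> (T z)) fx fy K" and b: "\<And>w. \<bar>\<phi> w\<bar> \<le> K" and [measurable]: "\<phi> \<in> borel_measurable borel"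
  shows "(\<integral>y. \<integral>x. G x y * fx (x, y) \<partial>L \<partial>U) = - (\<integral>w. \<phi> w \<partial>nu)"
    "(\<integral>y. \<integral>x. G x y * fy (x, y) \<partial>L \<partial>U) = - (\<integral>w. \<phi> w \<partial>level_measure) - lam * (\<integral>w. \<phi> w \<partial>nu_label)"
proof -
  interpret ft: flow_test lam "\<lambda>z. \<phi> (T z)" fx fy K by (rule ft)
  show "(\<integral>y. \<integral>x. G x y * fx (x, y) \<partial>L \<partial>U) = - (\<integral>w. \<phi> w \<partial>nu)"
    unfolding ft.integral_G_dx integral_nu[OF assms(3) b] by (simp add: crossing_def)
  have "(\<integral>y. \<integral>u. u * \<phi> (T (xi u y, y)) \<partial>U \<partial>U) = (\<integral>y. \<integral>u. clamp01 u * \<phi> (crossing (u, y)) \<partial>U \<partial>U)"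
    by (intro integral_U_cong) (auto simp: clamp01_def crossing_def intro!: integral_U_cong)
  then show "(\<integral>y. \<integral>x. G x y * fy (x, y) \<partial>L \<partial>U) = - (\<integral>w. \<phi> w \<partial>level_measure) - lam * (\<integral>w. \<phi> w \<partial>nu_label)"
    unfolding ft.integral_G_dy integral_nu_label[OF assms(3) b] integral_level_measure[OF assms(3) b] by (simp add: level_point_def)
qed

lemma LUint:
  fixes h :: "real \<Rightarrow> real \<Rightarrow> real"
  assumes "(\<lambda>z. h (fst z) (snd z)) \<in> borel_measurable (borel \<Otimes>\<^sub>M borel)" "\<And>x y. \<bar>h x y\<bar> \<le> K"
  shows "integrable L (\<lambda>x. h x y)" "integrable U (\<lambda>y. \<integral>x. h x y \<partial>L)"
proof -
  note [measurable] = assms(1)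
  have h1: "(\<lambda>x. h x y) \<in> borel_measurable borel" for y
    using measurable_compose[OF _ assms(1), of "\<lambda>x. (x, y)" borel] by simp
  show "integrable L (\<lambda>x. h x y)" by (intro integrable_L[where K=K] h1 assms(2))
  have "integrable (L \<Otimes>\<^sub>M U) (\<lambda>z. h (fst z) (snd z))" using assms by (intro LU_integrable)
  then show "integrable U (\<lambda>y. \<integral>x. h x y \<partial>L)"
    using LU.integrable_snd[of h] by (simp add: case_prod_beta')
qed

lemma gradient_measure: "is_gradient_measure Om field grad"
  unfolding is_gradient_measure_def
proof (intro conjI ballI allI)
  show "vector_measure Om grad"
    unfolding vector_measure_def grad_def
  proof (intro allI impI)
    fix A :: "nat \<Rightarrow> (real ^ 2) set" assume "range A \<subseteq> borel_subsets Om" "disjoint_family A"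
    then have A: "range A \<subseteq> sets borel" "disjoint_family A" using borel_subsets_iff[of Om] by auto
    note s = sums_measure[OF finite_nu _ A] sums_measure[OF finite_nu_label _ A] sums_measure[OF finite_level_measure _ A]
    show "(\<lambda>i. (- (lam * Jac)) *\<^sub>R (measure nu (A i) *\<^sub>R outer p dual_p + (lam * measure nu_label (A i) + measure level_measure (A i)) *\<^sub>R outer p dual_q))
       sums ((- (lam * Jac)) *\<^sub>R (measure nu (\<Union>i. A i) *\<^sub>R outer p dual_p + (lam * measure nu_label (\<Union>i. A i) + measure level_measure (\<Union>i. A i)) *\<^sub>R outer p dual_q))"
      by (intro sums_scaleR_right sums_add sums_scaleR_left sums_mult s) simp_all
  qed
next
  fix \<phi> i j assume phi: "\<phi> \<in> test_functions Om"
  obtain fx fy K where ft: "flow_test lam (\<lambda>z. \<phi> (T z)) fx fy K" and phiK: "\<And>w. \<bar>\<phi> w\<bar> \<le> K"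
    and pd: "\<And>j z. partial_deriv j \<phi> (T z) = dual_p $ j * fx z + dual_q $ j * fy z"
    and z: "\<And>w. w \<notin> Om \<Longrightarrow> \<phi> w = 0" "\<And>w j. w \<notin> Om \<Longrightarrow> partial_deriv j \<phi> w = 0"
    and m [measurable]: "\<And>j. partial_deriv j \<phi> \<in> borel_measurable borel" "\<phi> \<in> borel_measurable borel"
    and pK: "\<And>w j. \<bar>partial_deriv j \<phi> w\<bar> \<le> K" by (rule test_coords[OF phi], rule that) blast+
  interpret ft: flow_test lam "\<lambda>z. \<phi> (T z)" fx fy K by (rule ft)
  have mm [measurable]: "fx \<in> borel_measurable (borel \<Otimes>\<^sub>M borel)" "fy \<in> borel_measurable (borel \<Otimes>\<^sub>M borel)"
    using borel_measurable_continuous_onI[OF ft.fx_cont] borel_measurable_continuous_onI[OF ft.fy_cont] by (simp_all add: borel_prod)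
  have K: "0 \<le> K" using order_trans[OF abs_ge_zero phiK] .
  have "(LINT x:Om|lebesgue. field x $ i * partial_deriv j \<phi> x) = Jac * (\<integral>y. \<integral>x. field (T (x, y)) $ i * partial_deriv j \<phi> (T (x, y)) \<partial>L \<partial>U)"
  proof (rule integral_Om)
    show "\<bar>field w $ i * partial_deriv j \<phi> w\<bar> \<le> (norm q + norm p) * K" for w
      unfolding abs_mult using comp_bound pK by (intro mult_mono) auto
  qed (use z in auto)
  also have "(\<integral>y. \<integral>x. field (T (x, y)) $ i * partial_deriv j \<phi> (T (x, y)) \<partial>L \<partial>U)
     = (\<integral>y. \<integral>x. q $ i * dual_p $ j * fx (x, y) + (q $ i * dual_q $ j * fy (x, y) + ((- lam * p $ i * dual_p $ j) * (G x y * fx (x, y)) + (- lam * p $ i * dual_q $ j) * (G x y * fy (x, y)))) \<partial>L \<partial>U)"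
    by (simp add: field_def pd algebra_simps)
  also have "\<dots> = q $ i * dual_p $ j * (\<integral>y. \<integral>x. fx (x, y) \<partial>L \<partial>U) + (q $ i * dual_q $ j * (\<integral>y. \<integral>x. fy (x, y) \<partial>L \<partial>U)
     + ((- lam * p $ i * dual_p $ j) * (\<integral>y. \<integral>x. G x y * fx (x, y) \<partial>L \<partial>U) + (- lam * p $ i * dual_q $ j) * (\<integral>y. \<integral>x. G x y * fy (x, y) \<partial>L \<partial>U)))"
  proof -
    have gb: "\<bar>G x y * k\<bar> \<le> K" if "\<bar>k\<bar> \<le> K" for x y k
    proof -
      have "\<bar>G x y * k\<bar> \<le> 1 * K" unfolding abs_mult using G_bounds[of x y] that by (intro mult_mono) auto
      then show ?thesis by simp
    qed
    have i1: "integrable L (\<lambda>x. fx (x, y))" "integrable U (\<lambda>y. \<integral>x. fx (x, y) \<partial>L)" for y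
      using LUint(1)[of "\<lambda>x y. fx (x, y)" K y] LUint(2)[of "\<lambda>x y. fx (x, y)" K] ft.fx_bound mm by auto
    have i2: "integrable L (\<lambda>x. fy (x, y))" "integrable U (\<lambda>y. \<integral>x. fy (x, y) \<partial>L)" for y
      using LUint(1)[of "\<lambda>x y. fy (x, y)" K y] LUint(2)[of "\<lambda>x y. fy (x, y)" K] ft.fy_bound mm by auto
    have i3: "integrable L (\<lambda>x. G x y * fx (x, y))" "integrable U (\<lambda>y. \<integral>x. G x y * fx (x, y) \<partial>L)" for y
      using LUint(1)[of "\<lambda>x y. G x y * fx (x, y)" K y] LUint(2)[of "\<lambda>x y. G x y * fx (x, y)" K] gb[OF ft.fx_bound] by auto
    have i4: "integrable L (\<lambda>x. G x y * fy (x, y))" "integrable U (\<lambda>y. \<integral>x. G x y * fy (x, y) \<partial>L)" for y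
      using LUint(1)[of "\<lambda>x y. G x y * fy (x, y)" K y] LUint(2)[of "\<lambda>x y. G x y * fy (x, y)" K] gb[OF ft.fy_bound] by auto
    note s = Bochner_Integration.integral_add integral_mult_right_zero integrable_mult_right Bochner_Integration.integrable_add
    show ?thesis using i1 i2 i3 i4 by (simp add: s del: mult_minus_left)
  qed
  also have "\<dots> = lam * p $ i * (dual_p $ j * (\<integral>w. \<phi> w \<partial>nu) + dual_q $ j * ((\<integral>w. \<phi> w \<partial>level_measure) + lam * (\<integral>w. \<phi> w \<partial>nu_label)))"
    unfolding integrals_test[OF ft phiK m(2)] ft.integral_fx_zero ft.integral_fy_zero by (simp add: algebra_simps)
  also have "Jac * \<dots> = - signed_integral Om (\<lambda>E. grad E $ i $ j) \<phi>"
  proof -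
    let ?N = "\<lambda>k::nat. if k = 0 then nu else if k = 1 then nu_label else level_measure"
    let ?c = "\<lambda>k::nat. - (lam * Jac * p $ i) * (if k = 0 then dual_p $ j else if k = 1 then lam * dual_q $ j else dual_q $ j)"
    have "signed_integral Om (\<lambda>E. grad E $ i $ j) \<phi> = (\<Sum>k\<in>{0,1,2}. ?c k * (\<integral>x. \<phi> x \<partial>?N k))"
    proof (rule signed_integral_lincomb[where K=K])
      show "finite_measure (?N k)" for k using finite_nu finite_nu_label finite_level_measure by auto
      show "grad E $ i $ j = (\<Sum>k\<in>{0,1,2}. ?c k * measure (?N k) E)" for E
        by (simp add: grad_def outer_def algebra_simps)
    qed (use phiK z in auto)
    then show ?thesis by (simp add: algebra_simps)
  qed
  finally show "(LINT x:Om|lebesgue. field x $ i * partial_deriv j \<phi> x) = - signed_integral Om (\<lambda>E. grad E $ i $ j) \<phi>" .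
qed

lemma field_BV: "field \<in> BV Om"
proof -
  have "emeasure lborel Om < \<infinity>"
  proof -
    have "Om \<subseteq> T ` ({0..1} \<times> {0..1})"
    proof
      fix w assume w: "w \<in> Om"
      then have "0 \<le> lam * cy w" using lam_pos by (auto simp: Om_def)
      then show "w \<in> T ` ({0..1} \<times> {0..1})"
        using w by (intro image_eqI[of _ _ "(cx w, cy w)"]) (auto simp: Om_def T_coords)
    qed
    moreover have "bounded (T ` ({0..1} \<times> {0..1}))"
      by (intro compact_imp_bounded compact_continuous_image aff_continuous compact_Times) auto
    ultimately show ?thesis using emeasure_bounded_finite bounded_subset by blast
  qed
  then have "integrable lborel (\<lambda>x. indicator Om x *\<^sub>R field x)"
    using field_bound by (intro integrableI_bounded_set_indicator[where B="norm q + norm p"]) auto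
  then have "set_integrable lebesgue Om field"
    unfolding set_integrable_def by (subst integrable_completion) auto
  then show ?thesis using gradient_measure by (auto simp: BV_def)
qed

lemma sum_field: "(\<Sum>i\<in>UNIV. field w $ i * (dual_p $ i * a + dual_q $ i * b)) = b - lam * G (cx w) (cy w) * a"
proof -
  have "(\<Sum>i\<in>UNIV. field w $ i * (dual_p $ i * a + dual_q $ i * b)) = (\<Sum>i\<in>UNIV. q $ i * (dual_p $ i * a + dual_q $ i * b)) - lam * G (cx w) (cy w) * (\<Sum>i\<in>UNIV. p $ i * (dual_p $ i * a + dual_q $ i * b))"
    by (simp add: field_def sum_2 algebra_simps)
  then show ?thesis by (simp add: sum_dual)
qed

text \<open>
  The Jacobian is constant, and only the two components of the field in the frame matter.
\<close>

lemma integral_divergence: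
  assumes "\<phi> \<in> test_functions Om" and [measurable]: "h \<in> borel_measurable borel" and H: "\<And>w. \<bar>h w\<bar> \<le> H"
  obtains fx fy K where "flow_test lam (\<lambda>z. \<phi> (T z)) fx fy K" "\<And>w. \<bar>\<phi> w\<bar> \<le> K" "\<phi> \<in> borel_measurable borel" "\<And>w. w \<notin> Om \<Longrightarrow> \<phi> w = 0"
    "(LINT x:Om|lebesgue. \<Sum>i\<in>UNIV. (h x *\<^sub>R field x) $ i * partial_deriv i \<phi> x) = Jac * (\<integral>y. \<integral>x. h (T (x, y)) * (fy (x, y) - lam * G x y * fx (x, y)) \<partial>L \<partial>U)"
proof -
  obtain fx fy K where ft: "flow_test lam (\<lambda>z. \<phi> (T z)) fx fy K" and phiK: "\<And>w. \<bar>\<phi> w\<bar> \<le> K"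
    and pd: "\<And>j z. partial_deriv j \<phi> (T z) = dual_p $ j * fx z + dual_q $ j * fy z"
    and z: "\<And>w. w \<notin> Om \<Longrightarrow> \<phi> w = 0" "\<And>w j. w \<notin> Om \<Longrightarrow> partial_deriv j \<phi> w = 0"
    and m [measurable]: "\<And>j. partial_deriv j \<phi> \<in> borel_measurable borel" "\<phi> \<in> borel_measurable borel"
    and pK: "\<And>w j. \<bar>partial_deriv j \<phi> w\<bar> \<le> K" by (rule test_coords[OF assms(1)], rule that) blast+
  have K: "0 \<le> K" using order_trans[OF abs_ge_zero phiK] .
  have H0: "0 \<le> H" using order_trans[OF abs_ge_zero H] .
  have "(LINT x:Om|lebesgue. \<Sum>i\<in>UNIV. (h x *\<^sub>R field x) $ i * partial_deriv i \<phi> x)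
    = Jac * (\<integral>y. \<integral>x. (\<Sum>i\<in>UNIV. (h (T (x, y)) *\<^sub>R field (T (x, y))) $ i * partial_deriv i \<phi> (T (x, y))) \<partial>L \<partial>U)"
  proof (rule integral_Om)
    show "\<bar>\<Sum>i\<in>UNIV. (h w *\<^sub>R field w) $ i * partial_deriv i \<phi> w\<bar> \<le> (\<Sum>i\<in>(UNIV::2 set). (H * (norm q + norm p)) * K)" for w
    proof (rule order_trans[OF sum_abs], rule sum_mono)
      fix i :: 2
      have "\<bar>h w * field w $ i\<bar> \<le> H * (norm q + norm p)"
        unfolding abs_mult using comp_bound H H0 by (intro mult_mono) auto
      then show "\<bar>(h w *\<^sub>R field w) $ i * partial_deriv i \<phi> w\<bar> \<le> (H * (norm q + norm p)) * K"
        unfolding abs_mult[of "(h w *\<^sub>R field w) $ i"] using pK H0 by (intro mult_mono) auto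
    qed
  qed (use z in auto)
  moreover have sm: "(\<Sum>i\<in>UNIV. (h (T (x, y)) *\<^sub>R field (T (x, y))) $ i * partial_deriv i \<phi> (T (x, y))) = h (T (x, y)) * (fy (x, y) - lam * G x y * fx (x, y))" for x y
  proof -
    have "(\<Sum>i\<in>UNIV. (h (T (x, y)) *\<^sub>R field (T (x, y))) $ i * partial_deriv i \<phi> (T (x, y)))
      = h (T (x, y)) * (\<Sum>i\<in>UNIV. field (T (x, y)) $ i * (dual_p $ i * fx (x, y) + dual_q $ i * fy (x, y)))"
      unfolding pd sum_distrib_left by (intro sum.cong) auto
    then show ?thesis unfolding sum_field by simp
  qed
  ultimately have I: "(LINT x:Om|lebesgue. \<Sum>i\<in>UNIV. (h x *\<^sub>R field x) $ i * partial_deriv i \<phi> x)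
    = Jac * (\<integral>y. \<integral>x. h (T (x, y)) * (fy (x, y) - lam * G x y * fx (x, y)) \<partial>L \<partial>U)" by (simp only: sm)
  show ?thesis by (rule that[of fx fy K]) (rule ft phiK m(2) z(1) I, assumption?)+
qed

lemma divergence_measure: "is_divergence_measure Om field cantor"
  unfolding is_divergence_measure_def
proof (intro conjI ballI)
  show "vector_measure Om cantor"
    unfolding vector_measure_def cantor_def
  proof (intro allI impI)
    fix A :: "nat \<Rightarrow> (real ^ 2) set" assume "range A \<subseteq> borel_subsets Om" "disjoint_family A"
    then have A: "range A \<subseteq> sets borel" "disjoint_family A" using borel_subsets_iff[of Om] by auto
    show "(\<lambda>i. - (lam * Jac) * measure nu (A i)) sums (- (lam * Jac) * measure nu (\<Union>i. A i))"
      by (intro sums_mult sums_measure[OF finite_nu _ A]) simp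
  qed
next
  fix \<phi> assume phi: "\<phi> \<in> test_functions Om"
  obtain fx fy K where ft: "flow_test lam (\<lambda>z. \<phi> (T z)) fx fy K" and phiK: "\<And>w. \<bar>\<phi> w\<bar> \<le> K" and m: "\<phi> \<in> borel_measurable borel"
    and z: "\<And>w. w \<notin> Om \<Longrightarrow> \<phi> w = 0"
    and I: "(LINT x:Om|lebesgue. \<Sum>i\<in>UNIV. (1 *\<^sub>R field x) $ i * partial_deriv i \<phi> x) = Jac * (\<integral>y. \<integral>x. 1 * (fy (x, y) - lam * G x y * fx (x, y)) \<partial>L \<partial>U)"
    by (rule integral_divergence[OF phi, of "\<lambda>_. 1" 1]) auto
  interpret ft: flow_test lam "\<lambda>z. \<phi> (T z)" fx fy K by (rule ft)
  have mm [measurable]: "fx \<in> borel_measurable (borel \<Otimes>\<^sub>M borel)" "fy \<in> borel_measurable (borel \<Otimes>\<^sub>M borel)"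
    using borel_measurable_continuous_onI[OF ft.fx_cont] borel_measurable_continuous_onI[OF ft.fy_cont] by (simp_all add: borel_prod)
  have gb: "\<bar>G x y * k\<bar> \<le> K" if "\<bar>k\<bar> \<le> K" for x y k
  proof -
    have "\<bar>G x y * k\<bar> \<le> 1 * K" unfolding abs_mult using G_bounds[of x y] that by (intro mult_mono) auto
    then show ?thesis by simp
  qed
  have i2: "integrable L (\<lambda>x. fy (x, y))" "integrable U (\<lambda>y. \<integral>x. fy (x, y) \<partial>L)" for y
    using LUint(1)[of "\<lambda>x y. fy (x, y)" K y] LUint(2)[of "\<lambda>x y. fy (x, y)" K] ft.fy_bound mm by auto
  have i3: "integrable L (\<lambda>x. G x y * fx (x, y))" "integrable U (\<lambda>y. \<integral>x. G x y * fx (x, y) \<partial>L)" for y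
    using LUint(1)[of "\<lambda>x y. G x y * fx (x, y)" K y] LUint(2)[of "\<lambda>x y. G x y * fx (x, y)" K] gb[OF ft.fx_bound] by auto
  have "(\<integral>y. \<integral>x. 1 * (fy (x, y) - lam * G x y * fx (x, y)) \<partial>L \<partial>U) = (\<integral>y. \<integral>x. fy (x, y) \<partial>L \<partial>U) - lam * (\<integral>y. \<integral>x. G x y * fx (x, y) \<partial>L \<partial>U)"
    using i2 i3 by (simp add: mult.assoc)
  also have "\<dots> = lam * (\<integral>w. \<phi> w \<partial>nu)"
    unfolding integrals_test[OF ft phiK m] ft.integral_fy_zero by simp
  finally have "(LINT x:Om|lebesgue. \<Sum>i\<in>UNIV. field x $ i * partial_deriv i \<phi> x) = Jac * (lam * (\<integral>w. \<phi> w \<partial>nu))"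
    using I by simp
  moreover have "signed_integral Om cantor \<phi> = (\<Sum>k\<in>{0::nat}. - (lam * Jac) * (\<integral>w. \<phi> w \<partial>nu))"
    by (rule signed_integral_lincomb[where K=K]) (use finite_nu m phiK z in \<open>auto simp: cantor_def\<close>)
  ultimately show "(LINT x:Om|lebesgue. \<Sum>i\<in>UNIV. field x $ i * partial_deriv i \<phi> x) = - signed_integral Om cantor \<phi>"
    by simp
qed

lemma divergence_free_rho: "divergence_free Om (\<lambda>x. rho x *\<^sub>R field x)"
  unfolding divergence_free_def
proof
  fix \<phi> assume phi: "\<phi> \<in> test_functions Om"
  obtain fx fy K where ft: "flow_test lam (\<lambda>z. \<phi> (T z)) fx fy K"
    and "\<And>w. \<bar>\<phi> w\<bar> \<le> K" "\<phi> \<in> borel_measurable borel" "\<And>w. w \<notin> Om \<Longrightarrow> \<phi> w = 0"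
    and I: "(LINT x:Om|lebesgue. \<Sum>i\<in>UNIV. (rho x *\<^sub>R field x) $ i * partial_deriv i \<phi> x) = Jac * (\<integral>y. \<integral>x. rho (T (x, y)) * (fy (x, y) - lam * G x y * fx (x, y)) \<partial>L \<partial>U)"
    by (rule integral_divergence[OF phi rho_measurable rho_bound], rule that) blast+
  interpret ft: flow_test lam "\<lambda>z. \<phi> (T z)" fx fy K by (rule ft)
  show "(LINT x:Om|lebesgue. \<Sum>i\<in>UNIV. (rho x *\<^sub>R field x) $ i * partial_deriv i \<phi> x) = 0"
    unfolding I using ft.divergence_free_coords by (simp add: rho_def)
qed

end

section \<open>The measures on small sets\<close>

lemma quarter_power_scale:
  assumes "0 < t" "t \<le> (1::real)"
  obtains n where "(1/4) ^ n \<le> t" "t \<le> 4 * (1/4) ^ n"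
proof -
  obtain m where "(1/4) ^ m < t" using real_arch_pow_inv[OF assms(1), of "1/4"] by auto
  then have ex: "\<exists>n. (1/4::real) ^ n \<le> t" by (auto intro: less_imp_le)
  define n where "n = (LEAST n. (1/4::real) ^ n \<le> t)"
  have n: "(1/4) ^ n \<le> t" unfolding n_def using ex by (rule LeastI_ex)
  have "t \<le> 4 * (1/4) ^ n"
  proof (cases n)
    case 0
    then show ?thesis using assms by simp
  next
    case (Suc k)
    then have "\<not> (1/4) ^ k \<le> t" using not_less_Least[of k "\<lambda>n. (1/4::real) ^ n \<le> t"] by (simp add: n_def)
    then show ?thesis using Suc by simp
  qed
  then show ?thesis using n that by blast
qed

lemma integral_U_dyadic:
  assumes "0 \<le> u" "u < 1"
  shows "(\<integral>v. (if \<lfloor>2 ^ n * v\<rfloor> = \<lfloor>2 ^ n * u\<rfloor> then 1 else 0 :: real) \<partial>U) = (1/2) ^ n"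
proof -
  let ?k = "\<lfloor>2 ^ n * u\<rfloor>"
  have k: "0 \<le> ?k" "?k < 2 ^ n"
    using assms by (auto simp: floor_less_iff)
  then have k1: "of_int ?k + 1 \<le> (2 ^ n :: real)"
  proof -
    have "real_of_int (?k + 1) \<le> real_of_int (2 ^ n)" using k(2) by (subst of_int_le_iff) linarith
    then show ?thesis by simp
  qed
  have "(\<integral>v. (if \<lfloor>2 ^ n * v\<rfloor> = ?k then 1 else 0 :: real) \<partial>U) = (\<integral>v. (if of_int ?k / 2 ^ n \<le> v \<and> v < (of_int ?k + 1) / 2 ^ n then 1 else 0) \<partial>U)"
    by (intro Bochner_Integration.integral_cong) (auto simp: floor_eq_iff field_simps)
  also have "\<dots> = (of_int ?k + 1) / 2 ^ n - of_int ?k / 2 ^ n"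
    using k k1 by (intro integral_U_interval) (auto simp: field_simps)
  finally show ?thesis by (simp add: field_simps)
qed

lemma integral_U_window:
  assumes "0 \<le> l"
  shows "(\<integral>u. (if \<bar>u - c\<bar> \<le> l then 1 else 0 :: real) \<partial>U) \<le> 2 * l"
proof -
  have "(\<integral>u. (if \<bar>u - c\<bar> \<le> l then 1 else 0 :: real) \<partial>U) = (\<integral>u. indicator {0..<1} u * (if \<bar>u - c\<bar> \<le> l then 1 else 0) \<partial>lborel)"
    by (rule integral_U) measurable
  also have "\<dots> = (\<integral>u. indicator ({0..<1} \<inter> {c - l..c + l}) u \<partial>lborel)"
    by (intro Bochner_Integration.integral_cong) (auto split: split_indicator)
  also have "\<dots> = measure lborel ({0..<1} \<inter> {c - l..c + l})" by simp
  also have "\<dots> \<le> measure lborel {c - l..c + l}"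
    by (intro measure_mono_fmeasurable) (auto simp: fmeasurable_def emeasure_lborel_Icc_eq)
  also have "\<dots> = 2 * l" using assms by simp
  finally show ?thesis .
qed

lemma integral_L_interval:
  assumes "lo \<le> hi"
  shows "(\<integral>x. indicator {lo..hi} x \<partial>L) \<le> hi - (lo::real)"
proof -
  have "(\<integral>x. indicator {lo..hi} x \<partial>L) = measure L {lo..hi}" by simp
  also have "\<dots> \<le> measure lborel {lo..hi}"
  proof -
    have "measure L {lo..hi} = measure lborel ({lo..hi} \<inter> {-2..2})" by (simp add: measure_def emeasure_L)
    also have "\<dots> \<le> measure lborel {lo..hi}" by (intro measure_mono_fmeasurable) (auto simp: fmeasurable_def emeasure_lborel_Icc_eq)
    finally show ?thesis .
  qed
  finally show ?thesis using assms by simp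
qed

context frame
begin

definition coord_lip :: real where "coord_lip = norm dual_p + norm dual_q + 1"

lemma coord_lip_pos: "0 < coord_lip" unfolding coord_lip_def by (intro add_nonneg_pos add_nonneg_nonneg) auto

lemma coords_lipschitz: "\<bar>cx w - cx w'\<bar> \<le> coord_lip * dist w w'" "\<bar>cy w - cy w'\<bar> \<le> coord_lip * dist w w'"
proof -
  have *: "\<bar>v \<bullet> (w - A) - v \<bullet> (w' - A)\<bar> \<le> norm v * dist w w'" for v :: "real ^ 2"
    using Cauchy_Schwarz_ineq2[of v "w - w'"] by (simp add: inner_diff_right dist_norm)
  have "norm dual_p * dist w w' \<le> coord_lip * dist w w'" "norm dual_q * dist w w' \<le> coord_lip * dist w w'"
    unfolding coord_lip_def by (intro mult_right_mono; simp)+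
  then show "\<bar>cx w - cx w'\<bar> \<le> coord_lip * dist w w'" "\<bar>cy w - cy w'\<bar> \<le> coord_lip * dist w w'"
    unfolding cx_def cy_def using *[of dual_p] *[of dual_q] by linarith+
qed

lemma T_lipschitz: "dist (T (x, y)) (T (x', y')) \<le> norm p * \<bar>x - x'\<bar> + norm q * \<bar>y - y'\<bar>"
proof -
  have "T (x, y) - T (x', y') = (x - x') *\<^sub>R p + (y - y') *\<^sub>R q" by (simp add: aff_def algebra_simps)
  then show ?thesis unfolding dist_norm by (metis norm_triangle_ineq norm_scaleR mult.commute)
qed

lemma indicator_measurable [measurable]: 
  assumes [measurable]: "E \<in> sets borel"
  shows "(\<lambda>u. indicator E (crossing (u, y)) :: real) \<in> borel_measurable borel"
    "(\<lambda>x. indicator E (level_point (u, x)) :: real) \<in> borel_measurable borel"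
    "(\<lambda>y. \<integral>u. indicator E (crossing (u, y)) \<partial>U :: real) \<in> borel_measurable borel"
    "(\<lambda>u. \<integral>x. indicator E (level_point (u, x)) \<partial>L :: real) \<in> borel_measurable borel"
  by measurable

lemma ind_abs: "\<bar>indicator E w :: real\<bar> \<le> 1" by (simp add: indicator_def)

text \<open>
  A dyadic interval of \<open>2\<^sup>-\<^sup>n\<close> labels around \<open>u0\<close> moves the crossing point by about
  \<open>4\<^sup>-\<^sup>n\<close> only, and a height window of this size does no more, \<open>y0\<close> being generic.
  With \<open>r\<close> of order \<open>4\<^sup>-\<^sup>n\<close>, the product \<open>2\<^sup>-\<^sup>n * 4\<^sup>-\<^sup>n\<close> is
  of order \<open>r powr (3/2)\<close>.
\<close>

lemma nu_ball_lower:
  assumes g: "generic y0" and y0: "0 < y0" "y0 < 1" and u0: "0 \<le> u0" "u0 < 1"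
  obtains c R where "0 < c" "0 < R" "\<And>r. 0 < r \<Longrightarrow> r < R \<Longrightarrow> c * (r * sqrt r) \<le> measure nu (ball (crossing (u0, y0)) r)"
proof -
  obtain d where d: "0 < d" "\<And>y. \<bar>y - y0\<bar> < d \<Longrightarrow> \<bar>spread y - spread y0\<bar> \<le> 1 * \<bar>y - y0\<bar>"
    using generic_flat[OF g, of 1] by auto
  define m where "m = norm p + norm q + 1"
  have m: "0 < m" unfolding m_def by (intro add_nonneg_pos add_nonneg_nonneg) auto
  define R where "R = m * min 1 (min d (min y0 (1 - y0)))"
  define c where "c = sqrt (1 / (8 * m)) / (2 * m)"
  show ?thesis
  proof (rule that[of c R])
    show "0 < c" "0 < R" using m d y0 by (auto simp: c_def R_def)
    fix r :: real assume r: "0 < r" "r < R"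
    define s where "s = r / m"
    have s: "0 < s" "s < 1" "s < d" "s < y0" "s < 1 - y0"
    proof -
      have "s < min 1 (min d (min y0 (1 - y0)))"
        using r(2) unfolding s_def R_def by (simp only: pos_divide_less_eq[OF m] mult.commute)
      then show "s < 1" "s < d" "s < y0" "s < 1 - y0" by auto
    qed (use r m in \<open>simp add: s_def\<close>)
    obtain n where n: "(1/4) ^ n \<le> s / 2" "s / 2 \<le> 4 * (1/4) ^ n" using quarter_power_scale[of "s/2"] s by auto
    have mem: "crossing (u, y) \<in> ball (crossing (u0, y0)) r"
      if u: "\<lfloor>2 ^ n * u\<rfloor> = \<lfloor>2 ^ n * u0\<rfloor>" and y: "\<bar>y - y0\<bar> \<le> s / 4" for u y
    proof -
      have su: "\<bar>spread u - spread u0\<bar> \<le> (1/4) ^ n / 3" using u by (rule spread_same_level)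
      have sy: "\<bar>spread y - spread y0\<bar> \<le> \<bar>y - y0\<bar>" using d(2)[of y] y s by simp
      have x: "\<bar>xi u y - xi u0 y0\<bar> \<le> s" proof -
        have "2 * \<bar>spread u - spread u0\<bar> \<le> s / 3" using order_trans[OF su, of "s / 6"] n by simp
        moreover have "\<bar>spread y - spread y0\<bar> \<le> s / 4" using sy y by simp
        ultimately have "2 * \<bar>spread u - spread u0\<bar> + \<bar>spread y - spread y0\<bar> + \<bar>y - y0\<bar> \<le> s / 3 + s / 4 + s / 4"
          using y by (intro add_mono) auto
        then show ?thesis using xi_close[of u y u0 y0] s(1) by (simp add: field_simps)
      qed
      have "dist (crossing (u, y)) (crossing (u0, y0)) \<le> norm p * \<bar>xi u y - xi u0 y0\<bar> + norm q * \<bar>y - y0\<bar>"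
        unfolding crossing_def using T_lipschitz by simp
      also have "\<dots> \<le> norm p * s + norm q * s" using x y s by (intro add_mono mult_left_mono) auto
      also have "\<dots> < m * s" using s by (simp add: m_def algebra_simps)
      finally show ?thesis using m by (simp add: s_def dist_commute)
    qed
    have "(s / 2) * (1/2) ^ n = (\<integral>y. (if y0 - s/4 \<le> y \<and> y < y0 + s/4 then 1 else 0) * (\<integral>u. (if \<lfloor>2 ^ n * u\<rfloor> = \<lfloor>2 ^ n * u0\<rfloor> then 1 else 0) \<partial>U) \<partial>U)"
      unfolding integral_U_dyadic[OF u0] using integral_U_interval[of "y0 - s/4" "y0 + s/4"] s y0 by simp
    also have "\<dots> \<le> (\<integral>y. \<integral>u. indicator (ball (crossing (u0, y0)) r) (crossing (u, y)) \<partial>U \<partial>U)"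
    proof (rule integral_mono)
      show "integrable U (\<lambda>y. (if y0 - s/4 \<le> y \<and> y < y0 + s/4 then 1 else 0) * (\<integral>u. (if \<lfloor>2 ^ n * u\<rfloor> = \<lfloor>2 ^ n * u0\<rfloor> then 1 else 0) \<partial>U) :: real)"
        unfolding integral_U_dyadic[OF u0] by (intro integrable_U[where K=1]) (auto simp: power_le_one)
      show "integrable U (\<lambda>y. \<integral>u. indicator (ball (crossing (u0, y0)) r) (crossing (u, y)) \<partial>U :: real)"
        by (intro integrable_U[where K=1] integral_bound_U ind_abs) measurable
      show "(if y0 - s/4 \<le> y \<and> y < y0 + s/4 then 1 else 0) * (\<integral>u. (if \<lfloor>2 ^ n * u\<rfloor> = \<lfloor>2 ^ n * u0\<rfloor> then 1 else 0) \<partial>U)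
        \<le> (\<integral>u. indicator (ball (crossing (u0, y0)) r) (crossing (u, y)) \<partial>U :: real)" for y
      proof (cases "y0 - s/4 \<le> y \<and> y < y0 + s/4")
        case True
        then have y: "\<bar>y - y0\<bar> \<le> s / 4" unfolding abs_le_iff by linarith
        have "(\<integral>u. (if \<lfloor>2 ^ n * u\<rfloor> = \<lfloor>2 ^ n * u0\<rfloor> then 1 else 0 :: real) \<partial>U) \<le> (\<integral>u. indicator (ball (crossing (u0, y0)) r) (crossing (u, y)) \<partial>U)"
          using mem[OF _ y] by (intro U_mono[where K=1] ind_abs) auto
        then show ?thesis using True by simp
      next
        case False
        have "0 \<le> (\<integral>u. indicator (ball (crossing (u0, y0)) r) (crossing (u, y)) \<partial>U :: real)" by (intro integral_nonneg_AE) auto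
        then show ?thesis using False by auto
      qed
    qed
    also have "\<dots> = measure nu (ball (crossing (u0, y0)) r)" by (rule measure_nu[symmetric]) simp
    finally have low: "(s / 2) * (1/2) ^ n \<le> measure nu (ball (crossing (u0, y0)) r)" .
    have "sqrt (s / 8) \<le> sqrt ((1/4) ^ n)" using n by (intro real_sqrt_le_mono) simp
    also have "sqrt ((1/4::real) ^ n) = (1/2) ^ n"
      by (rule real_sqrt_unique) (simp_all add: power2_eq_square power_mult_distrib[symmetric])
    finally have "(s / 2) * sqrt (s / 8) \<le> (s / 2) * (1/2) ^ n" using s by (intro mult_left_mono) auto
    moreover have "(s / 2) * sqrt (s / 8) = c * (r * sqrt r)"
    proof -
      have "sqrt (s / 8) = sqrt (1 / (8 * m)) * sqrt r"
        unfolding s_def real_sqrt_mult[symmetric] by (simp add: field_simps)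
      then show ?thesis
        by (simp only: c_def s_def times_divide_eq_left times_divide_eq_right divide_divide_eq_left mult_ac)
    qed
    ultimately show "c * (r * sqrt r) \<le> measure nu (ball (crossing (u0, y0)) r)" using low by linarith
  qed
qed

text \<open>
  In the height window of size \<open>r\<close> around a generic height, each sheared curve moves by \<open>o(r)\<close>
  only, by \<open>eta_drop\<close> and \<open>generic_flat\<close>, and the labels of the curves meeting the ball lie in
  an interval of length of order \<open>sqrt r\<close>, by the Hoelder estimate for \<open>G\<close>.
\<close>

lemma level_measure_ball_small:
  assumes g: "generic y0" and y0: "0 < y0" "y0 < 1" and u0: "0 \<le> u0" "u0 < 1" and eps: "0 < eps"
  obtains R where "0 < R" "\<And>r. 0 < r \<Longrightarrow> r < R \<Longrightarrow> measure level_measure (ball (crossing (u0, y0)) r) \<le> eps * (r * sqrt r)"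
proof -
  define a where "a = coord_lip"
  have a: "0 < a" using coord_lip_pos by (simp add: a_def)
  define x0 where "x0 = xi u0 y0"
  define K1 where "K1 = 2 * a + 2 * a * sqrt (6 * a)"
  define K2 where "K2 = 3 * ((K1 + 4 * a) / (1 - lam) + a)"
  have K: "0 < K1" "0 < K2"
  proof -
    show "0 < K1" unfolding K1_def using a by (intro add_pos_nonneg) auto
    then show "0 < K2" unfolding K2_def using a lam_less_1 by (intro mult_pos_pos add_pos_pos divide_pos_pos) auto
  qed
  define K3 where "K3 = 2 * sqrt K2 * K1 + 1"
  have K3: "0 < K3" using K by (simp add: K3_def add_pos_pos)
  define e where "e = min 1 ((eps / K3)\<^sup>2)"
  have e: "0 < e" "e \<le> 1" "sqrt e \<le> eps / K3"
  proof -
    show "0 < e" "e \<le> 1" using eps K3 by (auto simp: e_def)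
    have "sqrt e \<le> sqrt ((eps / K3)\<^sup>2)" by (intro real_sqrt_le_mono) (simp add: e_def)
    then show "sqrt e \<le> eps / K3" using eps K3 by simp
  qed
  have ese: "e \<le> sqrt e" using e by (intro real_le_rsqrt) (simp add: power2_eq_square mult_le_one)
  obtain d where d: "0 < d" "\<And>y. \<bar>y - y0\<bar> < d \<Longrightarrow> \<bar>spread y - spread y0\<bar> \<le> e * \<bar>y - y0\<bar>"
    using generic_flat[OF g e(1)] by auto
  define R where "R = min 1 (min (d / a) (min (y0 / a) ((1 - y0) / a)))"
  show ?thesis
  proof (rule that[of R])
    show "0 < R" using a d y0 by (auto simp: R_def)
    fix r :: real assume r: "0 < r" "r < R"
    have ar: "0 < a * r" "a * r < d" "a * r < y0" "a * r < 1 - y0" "r < 1"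
      using r a by (auto simp: R_def field_simps)
    define ym yp where "ym = y0 - a * r" and "yp = y0 + a * r"
    have y: "0 < ym" "ym < y0" "y0 < yp" "yp < 1" using ar by (auto simp: ym_def yp_def)
    define Dl where "Dl = spread yp - spread ym"
    have flat: "\<bar>spread yp - spread y0\<bar> \<le> e * (a * r)" "\<bar>spread ym - spread y0\<bar> \<le> e * (a * r)"
      using d(2)[of yp] d(2)[of ym] ar by (auto simp: yp_def ym_def)
    have Dl: "0 \<le> Dl" "Dl \<le> 2 * a * r * e"
    proof -
      show "0 \<le> Dl" using spread_mono[of ym yp] y by (simp add: Dl_def)
      have "Dl \<le> 2 * (e * (a * r))" using flat unfolding Dl_def by linarith
      then show "Dl \<le> 2 * a * r * e" by (simp add: mult_ac)
    qed
    define D where "D = Dl + (yp - ym) * sqrt (3 * Dl)"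
    have D: "0 \<le> D" "D \<le> K1 * sqrt e * r"
    proof -
      show "0 \<le> D" unfolding D_def using Dl y by (intro add_nonneg_nonneg mult_nonneg_nonneg) auto
      have "sqrt (3 * Dl) \<le> sqrt (6 * a * e)"
      proof (rule real_sqrt_le_mono)
        have "3 * Dl \<le> 6 * a * e * r" using Dl by (simp add: algebra_simps)
        also have "\<dots> \<le> 6 * a * e * 1" using ar a e by (intro mult_left_mono) auto
        finally show "3 * Dl \<le> 6 * a * e" by simp
      qed
      also have "\<dots> = sqrt (6 * a) * sqrt e" by (simp add: real_sqrt_mult)
      finally have "(yp - ym) * sqrt (3 * Dl) \<le> (2 * a * r) * (sqrt (6 * a) * sqrt e)"
        using y by (intro mult_mono) (auto simp: yp_def ym_def Dl)
      moreover have "Dl \<le> 2 * a * r * sqrt e"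
        by (rule order_trans[OF Dl(2)], intro mult_left_mono ese) (use a r in simp)
      ultimately show "D \<le> K1 * sqrt e * r" unfolding D_def K1_def by (simp add: algebra_simps)
    qed
    have Dr: "D \<le> K1 * r"
    proof -
      have "K1 * sqrt e * r \<le> K1 * 1 * r" using K e r by (intro mult_right_mono mult_left_mono) auto
      then show ?thesis using D by simp
    qed
    have key: "eta u yp \<le> x" "x \<le> eta u ym" "eta u ym - eta u yp \<le> D" "\<bar>u - u0\<bar> \<le> sqrt (K2 * r)"
      if u: "0 \<le> u" "u < 1" and j: "level_point (u, x) \<in> ball (crossing (u0, y0)) r" for u x
    proof -
      define H where "H = level_height u x"
      have dist: "dist (level_point (u, x)) (crossing (u0, y0)) < r" using j by (simp add: dist_commute)
      have "\<bar>cx (level_point (u, x)) - cx (crossing (u0, y0))\<bar> < a * r" "\<bar>cy (level_point (u, x)) - cy (crossing (u0, y0))\<bar> < a * r"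
        using coords_lipschitz[of "level_point (u, x)" "crossing (u0, y0)"] mult_strict_left_mono[OF dist a] by (auto simp: a_def)
      then have xh: "\<bar>x - lam * u * H - x0\<bar> < a * r" and yh: "\<bar>H - y0\<bar> < a * r"
        by (auto simp: level_point_def crossing_def H_def x0_def)
      have Hy: "ym < H" "H < yp" using yh by (auto simp: ym_def yp_def abs_less_iff)
      show 1: "eta u yp \<le> x" using level_height_greater[OF u, of yp x] y Hy by (simp add: H_def)
      show 2: "x \<le> eta u ym" using level_height_less[OF u, of ym x] y Hy by (simp add: H_def)
      show 3: "eta u ym - eta u yp \<le> D"
        using eta_drop(2)[OF u, of ym yp] y by (simp add: D_def Dl_def)
      have e1: "xi u yp = eta u yp - lam * u * yp" by (simp add: eta_def)
      have lu: "0 \<le> lam * u" "lam * u \<le> 1" using u lam_pos lam_less_1 by (auto intro: mult_le_one)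
      have "\<bar>lam * u * (yp - H)\<bar> \<le> 1 * (2 * (a * r))"
        unfolding abs_mult[of "lam * u"] using lu Hy yh by (intro mult_mono) (auto simp: yp_def abs_le_iff)
      then have "\<bar>lam * u * yp - lam * u * H\<bar> \<le> 2 * (a * r)" by (simp add: algebra_simps)
      then have xx: "\<bar>xi u yp - x0\<bar> \<le> D + 3 * (a * r)" using e1 1 2 3 xh by linarith
      have "(G (xi u yp) yp - G x0 y0)\<^sup>2 \<le> 3 * ((\<bar>xi u yp - x0\<bar> + \<bar>yp - y0\<bar>) / (1 - lam) + \<bar>spread yp - spread y0\<bar>)"
        by (rule G_holder)
      also have "\<dots> \<le> 3 * ((K1 * r + 4 * (a * r)) / (1 - lam) + a * r)"
      proof -
        have "e * (a * r) \<le> 1 * (a * r)" using e ar by (intro mult_right_mono) auto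
        then have "\<bar>spread yp - spread y0\<bar> \<le> a * r" using flat by linarith
        moreover have "\<bar>xi u yp - x0\<bar> + \<bar>yp - y0\<bar> \<le> K1 * r + 4 * (a * r)"
          using xx Dr ar by (simp add: yp_def)
        ultimately show ?thesis using lam_less_1
          by (intro mult_left_mono[OF add_mono[OF divide_right_mono]]) auto
      qed
      also have "\<dots> = K2 * r" by (simp add: K2_def field_simps)
      finally have "(u - u0)\<^sup>2 \<le> K2 * r" using G_xi[OF u, of yp] G_xi[OF u0, of y0] by (simp add: x0_def)
      then show "\<bar>u - u0\<bar> \<le> sqrt (K2 * r)" using real_sqrt_le_mono by fastforce
    qed
    have inner: "(\<integral>x. indicator (ball (crossing (u0, y0)) r) (level_point (u, x)) \<partial>L) \<le> (if \<bar>u - u0\<bar> \<le> sqrt (K2 * r) then 1 else 0) * D"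
      if u: "0 \<le> u" "u < 1" for u
    proof (cases "\<bar>u - u0\<bar> \<le> sqrt (K2 * r) \<and> eta u ym - eta u yp \<le> D")
      case True
      have le: "eta u yp \<le> eta u ym" using eta_drop(1)[OF u, of ym yp] y by simp
      have "(\<integral>x. indicator (ball (crossing (u0, y0)) r) (level_point (u, x)) \<partial>L) \<le> (\<integral>x. indicator {eta u yp..eta u ym} x \<partial>L :: real)"
        using key(1,2)[OF u] by (intro integral_mono integrable_L[where K=1] ind_abs) (auto split: split_indicator)
      also have "\<dots> \<le> eta u ym - eta u yp" by (rule integral_L_interval[OF le])
      finally show ?thesis using True by simp
    next
      case False
      then have "level_point (u, x) \<notin> ball (crossing (u0, y0)) r" for x using key(3,4)[OF u] by blast
      then have "(\<lambda>x. indicator (ball (crossing (u0, y0)) r) (level_point (u, x)) :: real) = (\<lambda>x. 0)" by (simp add: fun_eq_iff)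
      then have "(\<integral>x. indicator (ball (crossing (u0, y0)) r) (level_point (u, x)) \<partial>L :: real) = 0" by simp
      then show ?thesis using D by simp
    qed
    have "measure level_measure (ball (crossing (u0, y0)) r) = (\<integral>u. \<integral>x. indicator (ball (crossing (u0, y0)) r) (level_point (u, x)) \<partial>L \<partial>U)"
      by (rule measure_level_measure) simp
    also have "\<dots> \<le> (\<integral>u. (if \<bar>u - u0\<bar> \<le> sqrt (K2 * r) then 1 else 0) * D \<partial>U)"
    proof (rule U_mono[where K="max 4 D"])
      show "\<bar>\<integral>x. indicator (ball (crossing (u0, y0)) r) (level_point (u, x)) \<partial>L :: real\<bar> \<le> max 4 D" for u
        using integral_bound_L[of "\<lambda>x. indicator (ball (crossing (u0, y0)) r) (level_point (u, x))" 1] ind_abs by simp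
    qed (use inner D in auto)
    also have "\<dots> = (\<integral>u. (if \<bar>u - u0\<bar> \<le> sqrt (K2 * r) then 1 else 0) \<partial>U) * D" by simp
    also have "\<dots> \<le> (2 * sqrt (K2 * r)) * D"
      using K r D by (intro mult_right_mono integral_U_window) auto
    also have "\<dots> \<le> (2 * sqrt (K2 * r)) * (K1 * sqrt e * r)" using D K r by (intro mult_left_mono) auto
    also have "\<dots> = (2 * sqrt K2 * K1) * sqrt e * (r * sqrt r)" by (simp add: real_sqrt_mult)
    also have "\<dots> \<le> K3 * (eps / K3) * (r * sqrt r)"
      using e K K3 r by (intro mult_right_mono mult_mono) (auto simp: K3_def)
    also have "\<dots> = eps * (r * sqrt r)" using K3 by simp
    finally show "measure level_measure (ball (crossing (u0, y0)) r) \<le> eps * (r * sqrt r)" .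
  qed
qed

text \<open>
  At a generic height \<open>G\<close> is continuous, and its value at the crossing point is the label.
\<close>

lemma crossing_label_close:
  assumes g: "generic y0" and u0: "0 \<le> u0" "u0 < 1" and eps: "0 < eps"
  obtains R where "0 < R" "\<And>w. dist w (crossing (u0, y0)) < R \<Longrightarrow> \<bar>G (cx w) (cy w) - u0\<bar> \<le> eps"
proof -
  obtain d where d: "0 < d" "\<And>y. \<bar>y - y0\<bar> < d \<Longrightarrow> \<bar>spread y - spread y0\<bar> \<le> 1 * \<bar>y - y0\<bar>"
    using generic_flat[OF g, of 1] by auto
  define C where "C = 3 * (2 * coord_lip / (1 - lam) + coord_lip)"
  have C: "0 < C" unfolding C_def using coord_lip_pos lam_less_1 by (intro mult_pos_pos add_pos_pos divide_pos_pos) auto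
  define R where "R = min (d / coord_lip) (eps\<^sup>2 / C)"
  show ?thesis
  proof (rule that[of R])
    show "0 < R" using d coord_lip_pos C eps by (simp add: R_def)
    fix w assume w: "dist w (crossing (u0, y0)) < R"
    let ?r = "dist w (crossing (u0, y0))"
    have r: "coord_lip * ?r < d" "C * ?r \<le> eps\<^sup>2" using w coord_lip_pos C by (auto simp: R_def field_simps)
    have x: "\<bar>cx w - xi u0 y0\<bar> \<le> coord_lip * ?r" and y: "\<bar>cy w - y0\<bar> \<le> coord_lip * ?r"
      using coords_lipschitz[of w "crossing (u0, y0)"] by (auto simp: crossing_def)
    have s: "\<bar>spread (cy w) - spread y0\<bar> \<le> coord_lip * ?r" using d(2)[of "cy w"] y r by simp
    have "(G (cx w) (cy w) - G (xi u0 y0) y0)\<^sup>2 \<le> 3 * ((\<bar>cx w - xi u0 y0\<bar> + \<bar>cy w - y0\<bar>) / (1 - lam) + \<bar>spread (cy w) - spread y0\<bar>)"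
      by (rule G_holder)
    also have "\<dots> \<le> 3 * ((coord_lip * ?r + coord_lip * ?r) / (1 - lam) + coord_lip * ?r)"
      using x y s lam_less_1 by (intro mult_left_mono add_mono divide_right_mono) auto
    also have "\<dots> = C * ?r" by (simp add: C_def field_simps)
    also have "\<dots> \<le> eps\<^sup>2" by (rule r)
    finally have "(G (cx w) (cy w) - u0)\<^sup>2 \<le> eps\<^sup>2" using G_xi[OF u0] by simp
    then show "\<bar>G (cx w) (cy w) - u0\<bar> \<le> eps" using eps by (simp add: abs_le_square_iff[symmetric])
  qed
qed

lemma nu_label_close:
  assumes [measurable]: "E \<in> sets borel" and u0: "0 \<le> u0" "u0 < 1" and e: "0 \<le> e" 
    and c: "\<And>w. w \<in> E \<Longrightarrow> \<bar>G (cx w) (cy w) - u0\<bar> \<le> e"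
  shows "\<bar>measure nu_label E - u0 * measure nu E\<bar> \<le> e * measure nu E"
proof -
  let ?i = "\<lambda>u y. indicator E (crossing (u, y)) :: real"
  have b: "\<bar>clamp01 u * ?i u y\<bar> \<le> 1" for u y using clamp_bounds[of u] by (auto simp: indicator_def)
  have i1: "integrable U (\<lambda>u. clamp01 u * ?i u y)" "integrable U (\<lambda>u. ?i u y)" for y
    by (intro integrable_U[where K=1] b ind_abs; measurable)+
  have i2: "integrable U (\<lambda>y. \<integral>u. clamp01 u * ?i u y \<partial>U)" "integrable U (\<lambda>y. \<integral>u. ?i u y \<partial>U)"
    by (intro integrable_U[where K=1] integral_bound_U b ind_abs; measurable)+
  have up: "(\<integral>u. clamp01 u * ?i u y \<partial>U) \<le> (u0 + e) * (\<integral>u. ?i u y \<partial>U)"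
    and lo: "(u0 - e) * (\<integral>u. ?i u y \<partial>U) \<le> (\<integral>u. clamp01 u * ?i u y \<partial>U)" for y
  proof -
    have *: "(u0 - e) * ?i u y \<le> clamp01 u * ?i u y" "clamp01 u * ?i u y \<le> (u0 + e) * ?i u y" if "0 \<le> u" "u < 1" for u
      using c[of "crossing (u, y)"] G_xi[OF that, of y] that by (auto simp: indicator_def crossing_def clamp01_def)
    have "(\<integral>u. clamp01 u * ?i u y \<partial>U) \<le> (\<integral>u. (u0 + e) * ?i u y \<partial>U)"
      using i1 *(2) AE_U_unit by (intro integral_mono_AE) auto
    then show "(\<integral>u. clamp01 u * ?i u y \<partial>U) \<le> (u0 + e) * (\<integral>u. ?i u y \<partial>U)" by simp
    have "(\<integral>u. (u0 - e) * ?i u y \<partial>U) \<le> (\<integral>u. clamp01 u * ?i u y \<partial>U)"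
      using i1 *(1) AE_U_unit by (intro integral_mono_AE) auto
    then show "(u0 - e) * (\<integral>u. ?i u y \<partial>U) \<le> (\<integral>u. clamp01 u * ?i u y \<partial>U)" by simp
  qed
  have "measure nu_label E \<le> (\<integral>y. (u0 + e) * (\<integral>u. ?i u y \<partial>U) \<partial>U)"
    unfolding measure_nu_label[OF assms(1)] using i2 up by (intro integral_mono) auto
  moreover have "(\<integral>y. (u0 - e) * (\<integral>u. ?i u y \<partial>U) \<partial>U) \<le> measure nu_label E"
    unfolding measure_nu_label[OF assms(1)] using i2 lo by (intro integral_mono) auto
  ultimately have "measure nu_label E \<le> (u0 + e) * measure nu E" "(u0 - e) * measure nu E \<le> measure nu_label E"
    unfolding measure_nu[OF assms(1)] by simp_all
  then show ?thesis by (simp add: abs_le_iff algebra_simps)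
qed

text \<open>
  The heights of the points of \<open>E\<close> fill an interval of length of order \<open>d\<close>, and at each height
  the labels fill one of length of order \<open>sqrt d\<close>, by \<open>xi_apart\<close>.
\<close>

lemma nu_small_sets:
  assumes [measurable]: "E \<in> sets borel" and d: "\<And>w w'. w \<in> E \<Longrightarrow> w' \<in> E \<Longrightarrow> dist w w' \<le> d" and d0: "0 \<le> d"
  shows "measure nu E \<le> 4 * coord_lip * sqrt (3 * coord_lip / (1 - lam)) * (d * sqrt d)"
proof (cases "E = {}")
  case True
  then show ?thesis using d0 coord_lip_pos lam_less_1 by simp
next
  case False
  then obtain w0 where w0: "w0 \<in> E" by blast
  define l where "l = sqrt (3 * (coord_lip * d) / (1 - lam))"
  have l: "0 \<le> l" unfolding l_def using d0 coord_lip_pos lam_less_1 by simp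
  have inner: "(\<integral>u. indicator E (crossing (u, y)) \<partial>U) \<le> (if \<bar>y - cy w0\<bar> \<le> coord_lip * d then 1 else 0) * (2 * l)" for y
  proof (cases "\<exists>u. 0 \<le> u \<and> u < 1 \<and> crossing (u, y) \<in> E")
    case True
    then obtain v where v: "0 \<le> v" "v < 1" "crossing (v, y) \<in> E" by blast
    have yy: "\<bar>y - cy w0\<bar> \<le> coord_lip * d"
      proof -
      have "coord_lip * dist (crossing (v, y)) w0 \<le> coord_lip * d" using coord_lip_pos by (intro mult_left_mono d v w0) simp
      then show ?thesis using coords_lipschitz(2)[of "crossing (v, y)" w0] by (simp add: crossing_def)
    qed
    have uu: "\<bar>u - v\<bar> \<le> l" if u: "0 \<le> u" "u < 1" "crossing (u, y) \<in> E" for u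
    proof -
      have "\<bar>xi u y - xi v y\<bar> \<le> coord_lip * d"
        proof -
        have "coord_lip * dist (crossing (u, y)) (crossing (v, y)) \<le> coord_lip * d" using coord_lip_pos by (intro mult_left_mono d u v) simp
        then show ?thesis using coords_lipschitz(1)[of "crossing (u, y)" "crossing (v, y)"] by (simp add: crossing_def)
      qed
      then have "(1 - lam) * (u - v)\<^sup>2 / 3 \<le> coord_lip * d" using xi_apart[OF u(1,2) v(1,2), of y] by linarith
      then have "(u - v)\<^sup>2 \<le> 3 * (coord_lip * d) / (1 - lam)" using lam_less_1 by (simp add: field_simps)
      then show ?thesis unfolding l_def using real_sqrt_le_mono by fastforce
    qed
    have "(\<integral>u. indicator E (crossing (u, y)) \<partial>U) \<le> (\<integral>u. (if \<bar>u - v\<bar> \<le> l then 1 else 0 :: real) \<partial>U)"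
      using uu by (intro U_mono[where K=1] ind_abs) (auto split: split_indicator)
    also have "\<dots> \<le> 2 * l" using l by (rule integral_U_window)
    finally show ?thesis using yy by simp
  next
    case False
    then have "(\<integral>u. indicator E (crossing (u, y)) \<partial>U :: real) = (\<integral>u. 0 \<partial>U)" by (intro integral_U_cong) auto
    then show ?thesis using l by simp
  qed
  have "measure nu E \<le> (\<integral>y. (if \<bar>y - cy w0\<bar> \<le> coord_lip * d then 1 else 0) * (2 * l) \<partial>U)"
    unfolding measure_nu[OF assms(1)] 
  proof (rule integral_mono)
    show "integrable U (\<lambda>y. \<integral>u. indicator E (crossing (u, y)) \<partial>U :: real)"
      by (intro integrable_U[where K=1] integral_bound_U ind_abs) measurable
    show "integrable U (\<lambda>y. (if \<bar>y - cy w0\<bar> \<le> coord_lip * d then 1 else 0) * (2 * l))"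
      using l by (intro integrable_U[where K="2 * l"]) auto
  qed (rule inner)
  also have "\<dots> = (\<integral>y. (if \<bar>y - cy w0\<bar> \<le> coord_lip * d then 1 else 0) \<partial>U) * (2 * l)" by simp
  also have "\<dots> \<le> (2 * (coord_lip * d)) * (2 * l)"
    using l coord_lip_pos d0 by (intro mult_right_mono integral_U_window) auto
  also have "\<dots> = 4 * coord_lip * sqrt (3 * coord_lip / (1 - lam)) * (d * sqrt d)"
    by (simp add: l_def real_sqrt_mult real_sqrt_divide)
  finally show ?thesis .
qed

text \<open>
  For a covering by sets of diameters at most \<open>\<delta>\<close>, the previous bound is \<open>sqrt \<delta>\<close>
  times the sum of the diameters, which stays bounded as \<open>\<delta>\<close> tends to zero. The covering
  sets are replaced by their closures, which are Borel sets of the same diameters.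
\<close>

lemma nu_hausdorff_null:
  assumes E [measurable]: "E \<in> sets borel" and H: "hausdorff_measure 1 E < \<infinity>"
  shows "measure nu E = 0"
proof -
  interpret nu: finite_measure nu by (rule finite_nu)
  define C where "C = 4 * coord_lip * sqrt (3 * coord_lip / (1 - lam))"
  have C: "0 \<le> C" unfolding C_def using coord_lip_pos lam_less_1 by simp
  obtain h where h: "0 \<le> h" "hausdorff_measure 1 E = ennreal h" using H by (cases "hausdorff_measure 1 E") auto
  have vol: "unit_ball_vol (real 1) = 2" by (simp add: unit_ball_vol_1)
  have bound: "measure nu E \<le> C * sqrt \<delta> * (h + 1)" if delta: "0 < \<delta>" for \<delta>
  proof -
    let ?cov = "{A :: nat \<Rightarrow> (real ^ 2) set. E \<subseteq> (\<Union>i. A i) \<and> (\<forall>i. bounded (A i) \<and> diameter (A i) \<le> \<delta>)}"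
    let ?s = "\<lambda>A :: nat \<Rightarrow> (real ^ 2) set. \<Sum>i. ennreal (unit_ball_vol (real 1) / 2 ^ 1 * (if A i = {} then 0 else diameter (A i) ^ 1))"
    have "(INF A\<in>?cov. ?s A) \<le> hausdorff_measure 1 E"
      unfolding hausdorff_measure_def using delta by (intro SUP_upper) auto
    also have "\<dots> < ennreal (h + 1)" using h by (simp add: ennreal_lessI)
    finally obtain A where A: "A \<in> ?cov" "?s A < ennreal (h + 1)" unfolding INF_less_iff by blast
    have Ad: "E \<subseteq> (\<Union>i. A i)" "\<And>i. bounded (A i)" "\<And>i. diameter (A i) \<le> \<delta>" using A by auto
    have s: "?s A = (\<Sum>i. ennreal (diameter (A i)))"
      unfolding vol by (intro suminf_cong) auto
    have one: "emeasure nu (closure (A i)) \<le> ennreal (C * sqrt \<delta>) * ennreal (diameter (A i))" for i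
    proof -
      have dn: "0 \<le> diameter (A i)" using Ad(2) by (rule diameter_ge_0)
      have "measure nu (closure (A i)) \<le> C * (diameter (A i) * sqrt (diameter (A i)))"
        unfolding C_def
      proof (rule nu_small_sets)
        show "dist w w' \<le> diameter (A i)" if "w \<in> closure (A i)" "w' \<in> closure (A i)" for w w'
          using diameter_bounded_bound[of "closure (A i)" w w'] that bounded_closure[OF Ad(2)[of i]] diameter_closure[OF Ad(2)[of i]] by simp
      qed (use dn in auto)
      also have "\<dots> \<le> C * (diameter (A i) * sqrt \<delta>)"
        using C dn Ad(3) by (intro mult_left_mono) auto
      finally have "measure nu (closure (A i)) \<le> (C * sqrt \<delta>) * diameter (A i)" by (simp add: mult_ac)
      then show ?thesis using C delta dn
        by (simp add: nu.emeasure_eq_measure ennreal_mult[symmetric] ennreal_leI)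
    qed
    have "emeasure nu E \<le> emeasure nu (\<Union>i. closure (A i))"
      using Ad(1) closure_subset by (intro emeasure_mono) (auto, blast)
    also have "\<dots> \<le> (\<Sum>i. emeasure nu (closure (A i)))"
      by (intro emeasure_subadditive_countably) auto
    also have "\<dots> \<le> (\<Sum>i. ennreal (C * sqrt \<delta>) * ennreal (diameter (A i)))"
      by (intro suminf_le one) auto
    also have "\<dots> = ennreal (C * sqrt \<delta>) * (\<Sum>i. ennreal (diameter (A i)))" by simp
    also have "\<dots> \<le> ennreal (C * sqrt \<delta>) * ennreal (h + 1)"
      using A(2) unfolding s by (intro mult_left_mono) auto
    also have "\<dots> = ennreal (C * sqrt \<delta> * (h + 1))" using C delta h by (simp add: ennreal_mult)
    finally show ?thesis using C delta h by (simp add: nu.emeasure_eq_measure)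
  qed
  show ?thesis
  proof (rule ccontr)
    assume "measure nu E \<noteq> 0"
    then have m: "0 < measure nu E" using measure_nonneg[of nu E] by linarith
    define t where "t = measure nu E / (2 * (C * (h + 1) + 1))"
    have Ch: "0 \<le> C * (h + 1)" using C h by simp
    have t: "0 < t" unfolding t_def using m Ch by (intro divide_pos_pos) auto
    have "measure nu E \<le> C * sqrt (t\<^sup>2) * (h + 1)" using t by (intro bound) simp
    then have "measure nu E \<le> t * (C * (h + 1))" using t by (simp add: mult_ac)
    also have "\<dots> \<le> t * (C * (h + 1) + 1)" using t by (intro mult_left_mono) auto
    also have "\<dots> = measure nu E / 2"
    proof -
      have "C * (h + 1) + 1 \<noteq> 0" using Ch by linarith
      then show ?thesis unfolding t_def by (simp add: field_simps)
    qed
    finally show False using m by simp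
  qed
qed

end

section \<open>The tangential property\<close>

lemma L1_approx_limitI:
  fixes f :: "real ^ 2 \<Rightarrow> real ^ 2"
  assumes "\<And>e. 0 < e \<Longrightarrow> \<exists>R>0. \<forall>w. dist w x < R \<longrightarrow> norm (f w - v) \<le> e"
  shows "L1_approx_limit f x v"
  unfolding L1_approx_limit_def tendsto_iff eventually_at_right_field
proof (intro allI impI)
  fix e :: real assume "0 < e"
  then obtain R where R: "0 < R" "\<And>w. dist w x < R \<Longrightarrow> norm (f w - v) \<le> e / 2" using assms[of "e/2"] by auto
  show "\<exists>b>0. \<forall>r>0. r < b \<longrightarrow> dist ((LINT y:ball x r|lebesgue. norm (f y - v)) / measure lebesgue (ball x r)) 0 < e"
  proof (intro exI[of _ R] conjI allI impI)
    fix r :: real assume r: "0 < r" "r < R"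
    have vol: "0 < measure lebesgue (ball x r)" using content_ball_pos[OF r(1), of x] by simp
    have "(LINT y:ball x r|lebesgue. norm (f y - v)) \<le> (\<integral>y. indicator (ball x r) y * (e / 2) \<partial>lebesgue)"
      unfolding set_lebesgue_integral_def
    proof (rule integral_mono')
      show "integrable lebesgue (\<lambda>y. indicator (ball x r) y * (e / 2))"
        by (intro integrable_mult_left integrable_real_indicator) (use emeasure_bounded_finite[OF bounded_ball, of x r] in auto)
    qed (use R r \<open>0 < e\<close> in \<open>auto simp: dist_commute split: split_indicator\<close>)
    also have "\<dots> = measure lebesgue (ball x r) * (e / 2)" by simp
    finally have "(LINT y:ball x r|lebesgue. norm (f y - v)) / measure lebesgue (ball x r) \<le> e / 2"
      using vol by (simp add: divide_le_eq mult.commute)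
    moreover have "0 \<le> (LINT y:ball x r|lebesgue. norm (f y - v))"
      unfolding set_lebesgue_integral_def by (intro integral_nonneg_AE) auto
    then have "0 \<le> (LINT y:ball x r|lebesgue. norm (f y - v)) / measure lebesgue (ball x r)"
      by (intro divide_nonneg_nonneg) auto
    ultimately show "dist ((LINT y:ball x r|lebesgue. norm (f y - v)) / measure lebesgue (ball x r)) 0 < e"
      using \<open>0 < e\<close> unfolding dist_real_def by linarith
  qed (rule R)
qed

lemma digit_frac: "digit z = (if frac z < 1/2 then 0 else 1)"
proof -
  have "z = frac z + of_int \<lfloor>z\<rfloor>" by (simp add: frac_def)
  then have "digit z = digit (frac z)" using digit_add_int[of "frac z" "\<lfloor>z\<rfloor>"] by simp
  then show ?thesis using digit_unit[OF frac_ge_0 frac_lt_1, of z] by simp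
qed

lemma frac_double: "frac (2 * z) = (if frac z < 1/2 then 2 * frac z else 2 * frac z - 1)"
proof -
  have z: "2 * z = of_int (2 * \<lfloor>z\<rfloor>) + 2 * frac z" by (simp add: frac_def)
  have f: "0 \<le> frac z" "frac z < 1" by (auto simp: frac_lt_1)
  have "\<lfloor>2 * z\<rfloor> = 2 * \<lfloor>z\<rfloor> + (if frac z < 1/2 then 0 else 1)"
    using z f by (intro floor_unique) (auto simp: frac_def)
  then show ?thesis by (simp add: frac_def)
qed

text \<open>
  Doubling modulo 1 moves the point away from 1 as long as the digits are 1, and away from 0 as
  long as they are 0. So digits equal to 1 from some place on are impossible, and digits equal
  to 0 from some place on would make \<open>y\<close> a dyadic rational.
\<close>

lemma frequently_digit:
  assumes "generic y"
  shows "\<exists>n\<ge>N. digit (2 ^ n * y) = 0" "\<exists>n\<ge>N. digit (2 ^ n * y) = 1"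
proof -
  let ?f = "\<lambda>n. frac (2 ^ n * y)"
  have rec: "?f (Suc n) = (if ?f n < 1/2 then 2 * ?f n else 2 * ?f n - 1)" for n
    using frac_double[of "2 ^ n * y"] by (simp add: mult.assoc)
  show "\<exists>n\<ge>N. digit (2 ^ n * y) = 0"
  proof (rule ccontr)
    assume "\<not> ?thesis"
    then have one: "\<not> ?f n < 1/2" if "N \<le> n" for n using that by (auto simp: digit_frac)
    have "1 - ?f (N + k) = 2 ^ k * (1 - ?f N)" for k
      by (induction k) (use rec one in \<open>auto simp: algebra_simps\<close>)
    moreover obtain k where "1 < 2 ^ k * (1 - ?f N)"
    proof -
      have "0 < 1 - ?f N" by (simp add: frac_lt_1)
      then obtain k where "(1/2) ^ k < 1 - ?f N" using real_arch_pow_inv[of "1 - ?f N" "1/2"] by auto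
      then have "1 < 2 ^ k * (1 - ?f N)" by (simp add: power_one_over field_simps)
      then show ?thesis using that by blast
    qed
    ultimately have "1 < 1 - ?f (N + k)" by simp
    then show False using frac_ge_0[of "2 ^ (N + k) * y"] by linarith
  qed
  show "\<exists>n\<ge>N. digit (2 ^ n * y) = 1"
  proof (rule ccontr)
    assume "\<not> ?thesis"
    then have zero: "?f n < 1/2" if "N \<le> n" for n
    proof -
      have "digit (2 ^ n * y) \<noteq> 1" using that \<open>\<not> (\<exists>n\<ge>N. digit (2 ^ n * y) = 1)\<close> by blast
      then show ?thesis by (simp add: digit_frac split: if_splits)
    qed
    have step: "?f (Suc n) = 2 * ?f n" if "N \<le> n" for n using rec[of n] zero[OF that] by simp
    have dbl: "?f (N + k) = 2 ^ k * ?f N" for k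
    proof (induction k)
      case (Suc k)
      have "?f (N + Suc k) = 2 * ?f (N + k)" using step[of "N + k"] by simp
      then show ?case using Suc by simp
    qed simp
    have "?f N = 0"
    proof (rule ccontr)
      assume "?f N \<noteq> 0"
      then have "0 < ?f N" using frac_ge_0[of "2 ^ N * y"] by linarith
      then obtain k where "(1/2) ^ k < ?f N" using real_arch_pow_inv[of "?f N" "1/2"] by auto
      then have "1 < 2 ^ k * ?f N" by (simp add: power_one_over field_simps)
      then show False using dbl[of k] frac_lt_1[of "2 ^ (N + k) * y"] by linarith
    qed
    obtain M where M: "\<And>n k. M \<le> n \<Longrightarrow> (1/3) ^ n \<le> \<bar>y - of_int k / 2 ^ n\<bar>"
      using assms unfolding generic_def eventually_sequentially by blast
    have "?f (N + M) = 0" using dbl[of M] \<open>?f N = 0\<close> by simp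
    then have "2 ^ (N + M) * y = of_int \<lfloor>2 ^ (N + M) * y\<rfloor>" by (simp add: frac_def)
    then have "y - of_int \<lfloor>2 ^ (N + M) * y\<rfloor> / 2 ^ (N + M) = 0" by (simp add: field_simps)
    then have "(1/3::real) ^ (N + M) \<le> 0" using M[of "N + M" "\<lfloor>2 ^ (N + M) * y\<rfloor>"] by simp
    then show False using zero_less_power[of "1/3::real" "N + M"] by linarith
  qed
qed

lemma floor_double: "\<lfloor>2 ^ Suc n * (z::real)\<rfloor> = 2 * \<lfloor>2 ^ n * z\<rfloor> + digit (2 ^ n * z)"
proof -
  have "\<lfloor>2 ^ n * z\<rfloor> = \<lfloor>2 ^ Suc n * z\<rfloor> div 2"
    using floor_divide_real_eq_div[of 2 "2 ^ Suc n * z"] by simp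
  then show ?thesis by (simp add: digit_def mult.assoc)
qed

context frame
begin

text \<open>
  The density of \<open>grad\<close> with respect to \<open>nu\<close> at crossing points of label \<open>u\<close>, where the level
  measure is negligible.
\<close>

definition polar :: "real \<Rightarrow> real ^ 2 ^ 2" where
  "polar u = (- (lam * Jac)) *\<^sub>R (outer p dual_p + (lam * u) *\<^sub>R outer p dual_q)"

lemma polar_apply: "polar u *v x = (- (lam * Jac) * (dual_p \<bullet> x + lam * u * (dual_q \<bullet> x))) *\<^sub>R p"
  by (simp add: polar_def outer_def vec_eq_iff matrix_vector_mult_def inner_vec_def sum_2 algebra_simps)

lemma polar_nonzero: "polar u \<noteq> 0"
proof
  assume "polar u = 0"
  then have "polar u *v p = 0" by simp
  then show False using p_nonzero lam_pos cross_nonzero by (simp add: polar_apply dual)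
qed

text \<open>
  In a small ball, \<open>nu_label\<close> is nearly \<open>u0\<close> times \<open>nu\<close>, since labels are continuous, and
  \<open>level_measure\<close> is negligible against the lower bound for \<open>nu\<close>. Applied to the pieces of a
  partition, the same estimate bounds the total variation.
\<close>

lemma grad_asymptotics:
  assumes g: "generic y0" and y0: "0 < y0" "y0 < 1" and u0: "0 \<le> u0" "u0 < 1" and eps: "0 < eps"
  obtains R where "0 < R"
    "\<And>r. 0 < r \<Longrightarrow> r < R \<Longrightarrow> 0 < measure nu (ball (crossing (u0, y0)) r)"
    "\<And>r. 0 < r \<Longrightarrow> r < R \<Longrightarrow> norm (grad (ball (crossing (u0, y0)) r) - measure nu (ball (crossing (u0, y0)) r) *\<^sub>R polar u0) \<le> eps * measure nu (ball (crossing (u0, y0)) r)"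
    "\<And>r. 0 < r \<Longrightarrow> r < R \<Longrightarrow> total_var grad (ball (crossing (u0, y0)) r) \<le> ennreal ((norm (polar u0) + eps) * measure nu (ball (crossing (u0, y0)) r))"
proof -
  define c1 where "c1 = lam * Jac * norm (outer p dual_q)"
  have c1: "0 \<le> c1" using lam_pos by (simp add: c1_def)
  define e where "e = eps / (2 * c1 + 1)"
  have e: "0 < e" "2 * c1 * e \<le> eps"
  proof -
    show "0 < e" using eps c1 by (simp add: e_def)
    have "(2 * c1 + 1) * e = eps" using c1 by (simp add: e_def)
    then show "2 * c1 * e \<le> eps" using \<open>0 < e\<close> by (simp add: algebra_simps)
  qed
  obtain R1 where R1: "0 < R1" "\<And>w. dist w (crossing (u0, y0)) < R1 \<Longrightarrow> \<bar>G (cx w) (cy w) - u0\<bar> \<le> e"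
    by (rule crossing_label_close[OF g u0 e(1)]) blast
  obtain c R2 where R2: "0 < c" "0 < R2" "\<And>r. 0 < r \<Longrightarrow> r < R2 \<Longrightarrow> c * (r * sqrt r) \<le> measure nu (ball (crossing (u0, y0)) r)"
    by (rule nu_ball_lower[OF g y0 u0]) blast
  have ec: "0 < e * c" using e R2 by simp
  obtain R3 where R3: "0 < R3" "\<And>r. 0 < r \<Longrightarrow> r < R3 \<Longrightarrow> measure level_measure (ball (crossing (u0, y0)) r) \<le> e * c * (r * sqrt r)"
    by (rule level_measure_ball_small[OF g y0 u0 ec]) blast
  define R where "R = min R1 (min R2 R3)"
  let ?B = "\<lambda>r. ball (crossing (u0, y0)) r"
  have n3: "measure level_measure (?B r) \<le> e * measure nu (?B r)" if "0 < r" "r < R" for r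
  proof -
    have "measure level_measure (?B r) \<le> e * (c * (r * sqrt r))" using R3(2)[of r] that by (simp add: R_def mult.assoc)
    also have "\<dots> \<le> e * measure nu (?B r)" using R2(3)[of r] that e by (intro mult_left_mono) (auto simp: R_def)
    finally show ?thesis .
  qed
  have diff: "norm (grad E - measure nu E *\<^sub>R polar u0) \<le> c1 * (e * measure nu E + measure level_measure E)"
    if E: "E \<in> sets borel" "E \<subseteq> ?B r" and r: "0 < r" "r < R" for E r
  proof -
    have "\<bar>measure nu_label E - u0 * measure nu E\<bar> \<le> e * measure nu E"
      using R1(2) E r e by (intro nu_label_close u0) (auto simp: R_def dist_commute)
    then have "lam * \<bar>measure nu_label E - u0 * measure nu E\<bar> \<le> 1 * (e * measure nu E)"
      using lam_pos lam_less_1 e by (intro mult_mono) auto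
    then have b: "\<bar>lam * (measure nu_label E - u0 * measure nu E) + measure level_measure E\<bar> \<le> e * measure nu E + measure level_measure E"
      using lam_pos by (intro order_trans[OF abs_triangle_ineq]) (simp add: abs_mult)
    have "grad E - measure nu E *\<^sub>R polar u0 = (- (lam * Jac)) *\<^sub>R ((lam * (measure nu_label E - u0 * measure nu E) + measure level_measure E) *\<^sub>R outer p dual_q)"
      by (simp add: grad_def polar_def algebra_simps)
    then have "norm (grad E - measure nu E *\<^sub>R polar u0) = c1 * \<bar>lam * (measure nu_label E - u0 * measure nu E) + measure level_measure E\<bar>"
      using lam_pos by (simp add: c1_def abs_mult)
    also have "\<dots> \<le> c1 * (e * measure nu E + measure level_measure E)" using b c1 by (rule mult_left_mono)
    finally show ?thesis .
  qed
  have small: "c1 * (e * measure nu (?B r) + measure level_measure (?B r)) \<le> eps * measure nu (?B r)" if r: "0 < r" "r < R" for r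
  proof -
    have "c1 * (e * measure nu (?B r) + measure level_measure (?B r)) \<le> c1 * (2 * e * measure nu (?B r))"
      using n3[OF r] c1 by (intro mult_left_mono) auto
    also have "\<dots> = (2 * c1 * e) * measure nu (?B r)" by simp
    also have "\<dots> \<le> eps * measure nu (?B r)" using e by (intro mult_right_mono) auto
    finally show ?thesis .
  qed
  show ?thesis
  proof (rule that[of R])
    show "0 < R" using R1 R2 R3 by (simp add: R_def)
    fix r assume r: "0 < r" "r < R"
    have "0 < c * (r * sqrt r)" using R2(1) r by simp
    then show "0 < measure nu (?B r)" using R2(3)[of r] r by (auto simp: R_def)
    show "norm (grad (?B r) - measure nu (?B r) *\<^sub>R polar u0) \<le> eps * measure nu (?B r)"
      using diff[of "?B r" r] small[OF r] r by simp
    let ?m = "\<lambda>E. norm (polar u0) * measure nu E + c1 * (e * measure nu E + measure level_measure E)"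
    have "total_var grad (?B r) \<le> ennreal (?m (?B r))"
    proof (rule total_var_le)
      fix E assume E: "E \<in> sets borel" "E \<subseteq> ?B r"
      have "norm (grad E) \<le> norm (measure nu E *\<^sub>R polar u0) + norm (grad E - measure nu E *\<^sub>R polar u0)"
        by (metis add_diff_cancel_left' diff_add_cancel add.commute norm_triangle_ineq)
      then show "norm (grad E) \<le> ?m E" using diff[OF E r] by (simp add: mult.commute)
    next
      fix E :: "nat \<Rightarrow> (real ^ 2) set" assume E: "range E \<subseteq> sets borel" "disjoint_family E"
      show "(\<lambda>i. ?m (E i)) sums ?m (\<Union>i. E i)"
        by (intro sums_add sums_mult sums_measure[OF finite_nu _ E] sums_measure[OF finite_level_measure _ E]) simp_all
    qed
    also have "\<dots> \<le> ennreal ((norm (polar u0) + eps) * measure nu (?B r))"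
      using small[OF r] by (intro ennreal_leI) (simp add: distrib_right)
    finally show "total_var grad (?B r) \<le> ennreal ((norm (polar u0) + eps) * measure nu (?B r))" .
  qed
qed

lemma grad_empty: "grad {} = 0" by (simp add: grad_def)

lemma crossing_in_Om: "0 < y \<Longrightarrow> y < 1 \<Longrightarrow> crossing (u, y) \<in> Om"
  using xi_range[of y u] by (simp add: crossing_def Om_T)

lemma field_limit:
  assumes g: "generic y0" and u0: "0 \<le> u0" "u0 < 1"
  shows "L1_approx_limit field (crossing (u0, y0)) (q - (lam * u0) *\<^sub>R p)"
proof (rule L1_approx_limitI)
  fix e :: real assume e: "0 < e"
  have np: "0 < norm p" using p_nonzero by simp
  have e': "0 < e / norm p" using e np by simp
  obtain R where R: "0 < R" "\<And>w. dist w (crossing (u0, y0)) < R \<Longrightarrow> \<bar>G (cx w) (cy w) - u0\<bar> \<le> e / norm p"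
    by (rule crossing_label_close[OF g u0 e']) blast
  show "\<exists>R>0. \<forall>w. dist w (crossing (u0, y0)) < R \<longrightarrow> norm (field w - (q - (lam * u0) *\<^sub>R p)) \<le> e"
  proof (intro exI[of _ R] conjI allI impI R(1))
    fix w assume "dist w (crossing (u0, y0)) < R"
    then have w: "\<bar>G (cx w) (cy w) - u0\<bar> \<le> e / norm p" by (rule R)
    have "field w - (q - (lam * u0) *\<^sub>R p) = (- (lam * (G (cx w) (cy w) - u0))) *\<^sub>R p"
      by (simp add: field_def algebra_simps)
    then have "norm (field w - (q - (lam * u0) *\<^sub>R p)) = lam * \<bar>G (cx w) (cy w) - u0\<bar> * norm p"
      using lam_pos by (simp add: abs_mult)
    also have "\<dots> \<le> 1 * (e / norm p) * norm p"
      using w lam_pos lam_less_1 np by (intro mult_right_mono mult_mono) auto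
    finally show "norm (field w - (q - (lam * u0) *\<^sub>R p)) \<le> e" using np by simp
  qed
qed

text \<open>
  By \<open>grad_asymptotics\<close> the quotient of the derivative by its total variation tends to the
  normalized \<open>polar u0\<close>. Evaluated at \<open>q - lam * u0 * p\<close>, the two parts of \<open>polar u0\<close> give
  \<open>- lam * u0\<close> and \<open>lam * u0\<close>.
\<close>

lemma crossing_tangential:
  assumes g: "generic y0" and y0: "0 < y0" "y0 < 1" and u0: "0 \<le> u0" "u0 < 1"
  shows "crossing (u0, y0) \<in> tangential_set Om field"
proof -
  let ?B = "\<lambda>r. ball (crossing (u0, y0)) r"
  let ?n = "\<lambda>r. measure nu (?B r)"
  let ?V = "polar u0"
  define t where "t r = enn2real (total_var grad (?B r))" for r
  have V: "0 < norm ?V" using polar_nonzero by simp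
  have lower: "ennreal (norm (grad (?B r))) \<le> total_var grad (?B r)" for r
    by (rule norm_le_total_var) (auto simp: grad_empty)
  have asym: "\<exists>R>0. \<forall>r>0. r < R \<longrightarrow> 0 < ?n r \<and> norm (grad (?B r) - ?n r *\<^sub>R ?V) \<le> eps * ?n r \<and>
      norm (grad (?B r)) \<le> t r \<and> t r \<le> (norm ?V + eps) * ?n r \<and> 0 < total_var grad (?B r)"
    if eps: "0 < eps" "eps < norm ?V" for eps
  proof -
    obtain R where R: "0 < R" "\<And>r. 0 < r \<Longrightarrow> r < R \<Longrightarrow> 0 < ?n r"
      "\<And>r. 0 < r \<Longrightarrow> r < R \<Longrightarrow> norm (grad (?B r) - ?n r *\<^sub>R ?V) \<le> eps * ?n r"
      "\<And>r. 0 < r \<Longrightarrow> r < R \<Longrightarrow> total_var grad (?B r) \<le> ennreal ((norm ?V + eps) * ?n r)"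
      by (rule grad_asymptotics[OF g y0 u0 eps(1)]) blast
    show ?thesis
    proof (intro exI[of _ R] conjI allI impI R)
      fix r :: real assume r: "0 < r" "r < R"
      have nn: "0 \<le> (norm ?V + eps) * ?n r" using eps R(2)[OF r] by simp
      obtain s where s: "0 \<le> s" "total_var grad (?B r) = ennreal s" "s \<le> (norm ?V + eps) * ?n r"
        using R(4)[OF r] nn by (cases "total_var grad (?B r)") (auto simp: top_unique)
      then show "t r \<le> (norm ?V + eps) * ?n r" by (simp add: t_def)
      show le: "norm (grad (?B r)) \<le> t r" using lower[of r] s by (simp add: t_def)
      have "?n r * norm ?V \<le> norm (grad (?B r)) + norm (grad (?B r) - ?n r *\<^sub>R ?V)"
        using norm_triangle_ineq4[of "grad (?B r)" "grad (?B r) - ?n r *\<^sub>R ?V"] by simp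
      then have "?n r * norm ?V - eps * ?n r \<le> norm (grad (?B r))" using R(3)[OF r] by linarith
      moreover have "0 < ?n r * (norm ?V - eps)" using R(2)[OF r] eps by simp
      moreover have "?n r * (norm ?V - eps) = ?n r * norm ?V - eps * ?n r" by (simp add: algebra_simps)
      ultimately have "0 < norm (grad (?B r))" by linarith
      then have "0 < ennreal (norm (grad (?B r)))" by simp
      then show "0 < total_var grad (?B r)" using lower[of r] by (rule less_le_trans)
    qed auto
  qed
  have pos: "\<forall>\<^sub>F r in at_right 0. 0 < total_var grad (?B r) \<and> 0 < ?n r"
    using asym[of "norm ?V / 2"] V unfolding eventually_at_right_field by auto
  have lim1: "((\<lambda>r. grad (?B r) /\<^sub>R ?n r) \<longlongrightarrow> ?V) (at_right 0)"
    unfolding tendsto_iff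
  proof (intro allI impI)
    fix e :: real assume e: "0 < e"
    define eps where "eps = min (e / 2) (norm ?V / 2)"
    have "0 < eps" "eps < norm ?V" "eps < e" using e V unfolding eps_def min_def by auto
    then obtain R where R: "0 < R" "\<And>r. 0 < r \<Longrightarrow> r < R \<Longrightarrow> 0 < ?n r \<and> norm (grad (?B r) - ?n r *\<^sub>R ?V) \<le> eps * ?n r"
      using asym[of eps] by blast
    have "dist (grad (?B r) /\<^sub>R ?n r) ?V < e" if r: "0 < r" "r < R" for r
    proof -
      have n: "0 < ?n r" using R(2)[OF r] by simp
      have "grad (?B r) /\<^sub>R ?n r - ?V = (grad (?B r) - ?n r *\<^sub>R ?V) /\<^sub>R ?n r"
        using n by (simp add: scaleR_diff_right)
      then have "norm (grad (?B r) /\<^sub>R ?n r - ?V) = norm (grad (?B r) - ?n r *\<^sub>R ?V) / ?n r"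
        using n by (simp add: divide_inverse mult.commute)
      also have "\<dots> \<le> eps" using R(2)[OF r] n by (simp add: divide_le_eq)
      finally show ?thesis using \<open>eps < e\<close> by (simp add: dist_norm)
    qed
    then show "\<forall>\<^sub>F r in at_right 0. dist (grad (?B r) /\<^sub>R ?n r) ?V < e"
      unfolding eventually_at_right_field using R(1) by blast
  qed
  have lim2: "((\<lambda>r. t r / ?n r) \<longlongrightarrow> norm ?V) (at_right 0)"
    unfolding tendsto_iff
  proof (intro allI impI)
    fix e :: real assume e: "0 < e"
    define eps where "eps = min (e / 2) (norm ?V / 2)"
    have "0 < eps" "eps < norm ?V" "eps < e" using e V unfolding eps_def min_def by auto
    then obtain R where R: "0 < R" "\<And>r. 0 < r \<Longrightarrow> r < R \<Longrightarrow> 0 < ?n r \<and> norm (grad (?B r) - ?n r *\<^sub>R ?V) \<le> eps * ?n r \<and>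
      norm (grad (?B r)) \<le> t r \<and> t r \<le> (norm ?V + eps) * ?n r"
      using asym[of eps] by blast
    have "dist (t r / ?n r) (norm ?V) < e" if r: "0 < r" "r < R" for r
    proof -
      have n: "0 < ?n r" using R(2)[OF r] by simp
      have "?n r * norm ?V \<le> norm (grad (?B r)) + norm (grad (?B r) - ?n r *\<^sub>R ?V)"
        using norm_triangle_ineq4[of "grad (?B r)" "grad (?B r) - ?n r *\<^sub>R ?V"] by simp
      then have "(norm ?V - eps) * ?n r \<le> t r" using R(2)[OF r] by (simp add: algebra_simps)
      then have "norm ?V - eps \<le> t r / ?n r" using n by (simp add: le_divide_eq)
      moreover have "t r / ?n r \<le> norm ?V + eps" using R(2)[OF r] n by (simp add: divide_le_eq)
      ultimately show ?thesis using \<open>eps < e\<close> unfolding dist_real_def by linarith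
    qed
    then show "\<forall>\<^sub>F r in at_right 0. dist (t r / ?n r) (norm ?V) < e"
      unfolding eventually_at_right_field using R(1) by blast
  qed
  have "((\<lambda>r. inverse (t r / ?n r) *\<^sub>R (grad (?B r) /\<^sub>R ?n r)) \<longlongrightarrow> inverse (norm ?V) *\<^sub>R ?V) (at_right 0)"
    using V by (intro tendsto_scaleR tendsto_inverse lim1 lim2) auto
  then have lim: "((\<lambda>r. grad (?B r) /\<^sub>R enn2real (total_var grad (?B r))) \<longlongrightarrow> ?V /\<^sub>R norm ?V) (at_right 0)"
  proof (rule Lim_transform_eventually)
    show "\<forall>\<^sub>F r in at_right 0. inverse (t r / ?n r) *\<^sub>R (grad (?B r) /\<^sub>R ?n r) = grad (?B r) /\<^sub>R enn2real (total_var grad (?B r))"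
      using pos by eventually_elim (simp add: t_def[symmetric] inverse_eq_divide)
  qed
  have "(?V /\<^sub>R norm ?V) *v (q - (lam * u0) *\<^sub>R p) = inverse (norm ?V) *\<^sub>R (?V *v (q - (lam * u0) *\<^sub>R p))"
    by (simp add: scaleR_matrix_vector_assoc)
  also have "\<dots> = 0" by (simp add: polar_apply inner_diff_right dual)
  finally have zero: "(?V /\<^sub>R norm ?V) *v (q - (lam * u0) *\<^sub>R p) = 0" .
  have "\<forall>\<^sub>F r in at_right 0. 0 < total_var grad (?B r)" using pos by eventually_elim simp
  then show ?thesis
    unfolding tangential_set_def using crossing_in_Om[OF y0] gradient_measure lim field_limit[OF g u0] zero by blast
qed

text \<open>
  Consider the particles with labels in the dyadic interval of order \<open>n\<close> of \<open>u0\<close> whose crossing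
  heights are in the dyadic interval of order \<open>n\<close> of \<open>y0\<close>, but in the half of it that does not
  contain \<open>y0\<close>. Near the height \<open>y0\<close>, they are within a distance of order \<open>4\<^sup>-\<^sup>n\<close>
  from the crossing point. If the digit of \<open>y0\<close> is 1, they all have crossed, otherwise none of
  them has. Their mass is of order \<open>4\<^sup>-\<^sup>n\<close>, and a height window of size
  \<open>4\<^sup>-\<^sup>n\<close> avoids the nearest dyadic points, \<open>y0\<close> being generic, whence an area of
  order \<open>16\<^sup>-\<^sup>n\<close>.
\<close>

lemma dens_oscillation:
  assumes g: "generic y0" and y0: "0 < y0" "y0 < 1" and u0: "0 \<le> u0" "u0 < 1"
  defines "C \<equiv> 2 * norm p + norm q + 1"
  obtains N where "\<And>n. N \<le> n \<Longrightarrow> ball (crossing (u0, y0)) (C * (1/4) ^ n) \<subseteq> Om"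
    "\<And>n v. N \<le> n \<Longrightarrow> Jac * (1 - lam) * \<bar>(if digit (2 ^ n * y0) = 1 then 1 / (1 - lam) else 1) - v\<bar> * ((1/4) ^ n)\<^sup>2
      \<le> (LINT w:ball (crossing (u0, y0)) (C * (1/4) ^ n)|lebesgue. norm (rho w - v))"
proof -
  have C: "0 < C" unfolding C_def by (intro add_nonneg_pos add_nonneg_nonneg) auto
  define x0 where "x0 = xi u0 y0"
  obtain M where M: "\<And>n k. M \<le> n \<Longrightarrow> (1/3) ^ n \<le> \<bar>y0 - of_int k / 2 ^ n\<bar>"
    using g unfolding generic_def eventually_sequentially by blast
  obtain d where d: "0 < d" "ball (crossing (u0, y0)) d \<subseteq> Om"
    using open_Om crossing_in_Om[OF y0] open_contains_ball by blast
  obtain M2 where M2: "(1/4) ^ M2 < d / C" using real_arch_pow_inv[of "d/C" "1/4"] d C by auto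
  define N where "N = max M (max M2 4)"
  have four: "(1/4::real) ^ n < (1/3) ^ Suc n" if "4 \<le> n" for n
  proof -
    have "(3::real) < (4/3) ^ 4" by (simp add: power_divide)
    also have "(4/3::real) ^ 4 \<le> (4/3) ^ n" using that by (intro power_increasing) auto
    finally show ?thesis by (simp add: power_divide field_simps)
  qed
  have sub: "ball (crossing (u0, y0)) (C * (1/4) ^ n) \<subseteq> Om" if "N \<le> n" for n
  proof -
    have "(1/4::real) ^ n \<le> (1/4) ^ M2" using that by (intro power_decreasing) (auto simp: N_def)
    then have "(1/4) ^ n \<le> d / C" using M2 by linarith
    then have "C * (1/4) ^ n \<le> C * (d / C)" using C by (intro mult_left_mono) auto
    then have "C * (1/4) ^ n \<le> d" using C by simp
    then show ?thesis using d(2) subset_ball order_trans by blast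
  qed
  show ?thesis
  proof (rule that[of N, OF sub])
    fix n :: nat and v :: real assume n: "N \<le> n"
    define h where "h = (1/4::real) ^ n"
    define b where "b = digit (2 ^ n * y0)"
    define val where "val = (if b = 1 then 1 / (1 - lam) else 1)"
    define K where "K = \<lfloor>2 ^ n * y0\<rfloor>"
    \<comment> \<open>the midpoint of the other half of the dyadic interval of \<open>y0\<close>\<close>
    define t0 :: real where "t0 = (2 * of_int K + 1 - of_int b) / 2 ^ Suc n + 1 / 2 ^ Suc (Suc n)"
    have b: "b = 0 \<or> b = 1" unfolding b_def by (rule digit_cases)
    have h: "0 < h" "h < (1/3) ^ Suc n" using four[of n] n by (auto simp: h_def N_def)
    have K: "0 \<le> K" "K < 2 ^ n" unfolding K_def using y0 by (auto simp: floor_less_iff)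
    have gap: "(1/3) ^ Suc n \<le> \<bar>y0 - of_int k / 2 ^ Suc n\<bar>" for k :: int using M[of "Suc n" k] n by (auto simp: N_def)
    have yb: "h < y0" "y0 < 1 - h"
      using gap[of 0] gap[of "2 ^ Suc n"] h y0 by auto
    have ft0: "\<lfloor>2 ^ Suc n * t0\<rfloor> = 2 * K + 1 - b"
    proof (rule floor_unique)
      have "2 ^ Suc n * t0 = of_int (2 * K + 1 - b) + 1/2" unfolding t0_def distrib_left by simp
      then show "of_int (2 * K + 1 - b) \<le> 2 ^ Suc n * t0" "2 ^ Suc n * t0 < of_int (2 * K + 1 - b) + 1" by simp_all
    qed
    have t0: "0 \<le> t0" "t0 < 1"
    proof -
      have "0 \<le> 2 * K + 1 - b" "2 * K + 1 - b < 2 ^ Suc n" using b K by auto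
      then have "0 \<le> \<lfloor>2 ^ Suc n * t0\<rfloor>" "\<lfloor>2 ^ Suc n * t0\<rfloor> < 2 ^ Suc n" using ft0 by auto
      then have a: "0 \<le> 2 ^ Suc n * t0" and b: "2 ^ Suc n * t0 < 2 ^ Suc n" by (auto simp: floor_less_iff)
      have p: "(0::real) < 2 ^ Suc n" by simp
      show "0 \<le> t0" by (rule ccontr) (use a mult_pos_neg[OF p, of t0] in linarith)
      show "t0 < 1" by (rule ccontr) (use b mult_left_mono[of 1 t0 "2 ^ Suc n"] in \<open>simp del: power_Suc add: not_less\<close>)
    qed
    let ?B = "ball (crossing (u0, y0)) (C * h)"
    define k where "k w = indicator ?B w * \<bar>rho w - v\<bar>" for w
    have [measurable]: "k \<in> borel_measurable borel" unfolding k_def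
      by (intro borel_measurable_times borel_measurable_indicator borel_measurable_abs borel_measurable_diff) (use rho_measurable in auto)
    have kb: "\<bar>k w\<bar> \<le> 1 / (1 - lam) + \<bar>v\<bar>" for w
    proof -
      have "\<bar>rho w - v\<bar> \<le> 1 / (1 - lam) + \<bar>v\<bar>" using rho_bound[of w] by linarith
      moreover have "0 \<le> 1 / (1 - lam) + \<bar>v\<bar>" using lam_less_1 by simp
      ultimately show ?thesis by (auto simp: k_def indicator_def)
    qed
    have kz: "k w = 0" if "w \<notin> Om" for w using sub[OF n] that by (auto simp: k_def h_def indicator_def)
    have kn: "0 \<le> k w" for w by (simp add: k_def)
    let ?lab = "\<lambda>u t. (if \<lfloor>2 ^ n * u\<rfloor> = \<lfloor>2 ^ n * u0\<rfloor> then 1 else 0) * (if \<lfloor>2 ^ Suc n * t\<rfloor> = \<lfloor>2 ^ Suc n * t0\<rfloor> then 1 else 0 :: real)"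
    have key: "\<bar>val - v\<bar> * ?lab u t \<le> k (T (position (mass u t) y, y))"
      if u: "0 \<le> u" "u < 1" and t: "0 \<le> t" "t < 1" and y: "\<bar>y - y0\<bar> \<le> h" for u t y
    proof (cases "\<lfloor>2 ^ n * u\<rfloor> = \<lfloor>2 ^ n * u0\<rfloor> \<and> \<lfloor>2 ^ Suc n * t\<rfloor> = \<lfloor>2 ^ Suc n * t0\<rfloor>")
      case True
      have fy: "\<lfloor>2 ^ Suc n * y\<rfloor> = \<lfloor>2 ^ Suc n * y0\<rfloor>"
        using gap y h by (intro same_level_near[where d="(1/3) ^ Suc n"]) auto
      have fy0: "\<lfloor>2 ^ Suc n * y0\<rfloor> = 2 * K + b" unfolding K_def b_def by (rule floor_double)
      have ft: "\<lfloor>2 ^ Suc n * t\<rfloor> = 2 * K + 1 - b" using True ft0 by simp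
      have y01: "0 \<le> y" "y < 1" using y yb by (auto simp: abs_le_iff)
      have tless: "t < y \<longleftrightarrow> b = 1"
      proof
        assume "t < y"
        then have "\<lfloor>2 ^ Suc n * t\<rfloor> \<le> \<lfloor>2 ^ Suc n * y\<rfloor>" by (intro floor_mono mult_left_mono) auto
        then show "b = 1" using ft fy fy0 b by auto
      next
        assume "b = 1"
        then have "\<lfloor>2 ^ Suc n * t\<rfloor> < \<lfloor>2 ^ Suc n * y\<rfloor>" using ft fy fy0 by simp
        then have "2 ^ Suc n * t < 2 ^ Suc n * y" by (rule floor_less_cancel)
        then show "t < y" by (rule mult_left_less_imp_less) simp
      qed
      have val: "rho (T (position (mass u t) y, y)) = val"
        using dens_position[OF t y01, of u] tless by (simp add: rho_def val_def)
      have "\<lfloor>2 ^ n * t\<rfloor> = K"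
      proof -
        have "2 * \<lfloor>2 ^ n * t\<rfloor> + digit (2 ^ n * t) = 2 * K + 1 - b" using floor_double[of n t] ft by simp
        then show ?thesis using digit_cases[of "2 ^ n * t"] b by presburger
      qed
      then have st: "\<bar>spread t - spread y0\<bar> \<le> h / 3" unfolding h_def K_def by (intro spread_same_level) simp
      have su: "\<bar>spread u - spread u0\<bar> \<le> h / 3" unfolding h_def using True by (intro spread_same_level) simp
      have "\<bar>mass u t - mass u0 y0\<bar> \<le> h"
      proof -
        have "mass u t - mass u0 y0 = 2 * (spread u - spread u0) - (spread t - spread y0)" by (simp add: mass_def)
        then show ?thesis using su st h(1) unfolding abs_le_iff by (simp add: field_simps)
      qed
      then have xx: "\<bar>position (mass u t) y - x0\<bar> \<le> 2 * h"
        using position_lipschitz[of "mass u t" y "mass u0 y0" y0] y unfolding x0_def xi_def by linarith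
      have "dist (T (position (mass u t) y, y)) (crossing (u0, y0)) \<le> norm p * \<bar>position (mass u t) y - x0\<bar> + norm q * \<bar>y - y0\<bar>"
        unfolding crossing_def x0_def using T_lipschitz by simp
      also have "\<dots> \<le> norm p * (2 * h) + norm q * h" using xx y by (intro add_mono mult_left_mono) auto
      also have "\<dots> < C * h" using h by (simp add: C_def algebra_simps)
      finally have "T (position (mass u t) y, y) \<in> ?B" by (simp add: dist_commute)
      then show ?thesis using True val by (simp add: k_def)
    next
      case False
      then show ?thesis using kn by auto
    qed
    have labint: "(\<integral>z. ?lab (fst z) (snd z) \<partial>(U \<Otimes>\<^sub>M U)) = h / 2"
    proof -
      have "integrable (U \<Otimes>\<^sub>M U) (case_prod ?lab)" by (intro UU_integrable[where K=1]) auto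
      then have "(\<integral>z. ?lab (fst z) (snd z) \<partial>(U \<Otimes>\<^sub>M U)) = (\<integral>t. \<integral>u. ?lab u t \<partial>U \<partial>U)"
        using UU.integral_snd[of ?lab] by (simp add: case_prod_beta')
      also have "\<dots> = (\<integral>t. (1/2) ^ n * (if \<lfloor>2 ^ Suc n * t\<rfloor> = \<lfloor>2 ^ Suc n * t0\<rfloor> then 1 else 0) \<partial>U)"
        by (simp only: integral_mult_left_zero integral_U_dyadic[OF u0])
      also have "\<dots> = (1/2) ^ n * (1/2) ^ Suc n"
        by (simp only: integral_mult_right_zero integral_U_dyadic[OF t0])
      also have "\<dots> = h / 2" unfolding h_def by (simp add: power_mult_distrib[symmetric])
      finally show ?thesis .
    qed
    have AEuu: "AE z in U \<Otimes>\<^sub>M U. (0 \<le> fst z \<and> fst z < 1) \<and> (0 \<le> snd z \<and> snd z < 1)"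
    proof (rule UU.AE_pair_measure)
      have "{z \<in> space (borel \<Otimes>\<^sub>M borel). (0 \<le> fst z \<and> fst z < (1::real)) \<and> 0 \<le> snd z \<and> snd z < (1::real)} \<in> sets (borel \<Otimes>\<^sub>M (borel::real measure))"
        by measurable
      then show "{z \<in> space (U \<Otimes>\<^sub>M U). (0 \<le> fst z \<and> fst z < 1) \<and> 0 \<le> snd z \<and> snd z < 1} \<in> sets (U \<Otimes>\<^sub>M U)"
        by (simp add: space_pair_measure cong: sets_pair_measure_cong)
      show "AE x in U. AE y in U. (0 \<le> fst (x, y) \<and> fst (x, y) < 1) \<and> 0 \<le> snd (x, y) \<and> snd (x, y) < 1"
        using AE_U_unit by eventually_elim (use AE_U_unit in simp)
    qed
    have slice: "(1 - lam) * \<bar>val - v\<bar> * (h / 2) \<le> (\<integral>x. k (T (x, y)) \<partial>L)" if y: "\<bar>y - y0\<bar> \<le> h" for y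
    proof -
      have y01: "0 < y" "y < 1" using y yb by (auto simp: abs_le_iff)
      have "(1 - lam) * \<bar>val - v\<bar> * (h / 2) = (\<integral>z. (1 - lam) * \<bar>val - v\<bar> * ?lab (fst z) (snd z) \<partial>(U \<Otimes>\<^sub>M U))"
        by (simp only: integral_mult_right_zero labint)
      also have "\<dots> \<le> (\<integral>z. weight (snd z) y * k (T (position (mass (fst z) (snd z)) y, y)) \<partial>(U \<Otimes>\<^sub>M U))"
      proof (rule integral_mono_AE)
        show "integrable (U \<Otimes>\<^sub>M U) (\<lambda>z. (1 - lam) * \<bar>val - v\<bar> * ?lab (fst z) (snd z))"
          by (intro integrable_mult_right UU_integrable[where K=1]) auto
        show "integrable (U \<Otimes>\<^sub>M U) (\<lambda>z. weight (snd z) y * k (T (position (mass (fst z) (snd z)) y, y)))"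
        proof (rule UU_integrable[where K="1 * (1 / (1 - lam) + \<bar>v\<bar>)"])
          show "\<bar>weight (snd z) y * k (T (position (mass (fst z) (snd z)) y, y))\<bar> \<le> 1 * (1 / (1 - lam) + \<bar>v\<bar>)" for z
            unfolding abs_mult using weight_bounds[of "snd z" y] kb by (intro mult_mono) auto
        qed measurable
        show "AE z in U \<Otimes>\<^sub>M U. (1 - lam) * \<bar>val - v\<bar> * ?lab (fst z) (snd z) \<le> weight (snd z) y * k (T (position (mass (fst z) (snd z)) y, y))"
          using AEuu
        proof eventually_elim
          case (elim z)
          have "(1 - lam) * (\<bar>val - v\<bar> * ?lab (fst z) (snd z)) \<le> weight (snd z) y * k (T (position (mass (fst z) (snd z)) y, y))"
            using key[of "fst z" "snd z" y] elim y weight_bounds[of "snd z" y] by (intro mult_mono) auto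
          then show ?case by (simp only: mult.assoc)
        qed
      qed
      also have "\<dots> = (\<integral>x. indicator {0..1 - lam * y} x * k (T (x, y)) \<partial>lborel)"
        using y01 by (intro change_of_variables[symmetric]) auto
      also have "\<dots> = (\<integral>x. k (T (x, y)) \<partial>L)"
      proof (subst integral_L)
        have ly: "0 \<le> lam * y" using y01 lam_pos by simp
        show "(\<integral>x. indicator {0..1 - lam * y} x * k (T (x, y)) \<partial>lborel) = (\<integral>x. indicator {-2..2} x * k (T (x, y)) \<partial>lborel)"
        proof (intro Bochner_Integration.integral_cong refl)
          fix x
          have "k (T (x, y)) = 0" if "x \<notin> {0..1 - lam * y}" using that by (intro kz) (auto simp: Om_T)
          then show "indicator {0..1 - lam * y} x * k (T (x, y)) = indicator {-2..2} x * k (T (x, y))"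
            using ly by (cases "x \<in> {0..1 - lam * y}") auto
        qed
      qed measurable
      finally show ?thesis .
    qed
    have "(1 - lam) * \<bar>val - v\<bar> * h\<^sup>2 = (\<integral>y. (if y0 - h \<le> y \<and> y < y0 + h then 1 else 0) * ((1 - lam) * \<bar>val - v\<bar> * (h / 2)) \<partial>U)"
      using integral_U_interval[of "y0 - h" "y0 + h"] yb h by (simp add: power2_eq_square)
    also have "\<dots> \<le> (\<integral>y. \<integral>x. k (T (x, y)) \<partial>L \<partial>U)"
    proof (rule integral_mono)
      show "integrable U (\<lambda>y. (if y0 - h \<le> y \<and> y < y0 + h then 1 else 0) * ((1 - lam) * \<bar>val - v\<bar> * (h / 2)))"
        by (intro integrable_mult_left integrable_U[where K=1]) auto
      show "integrable U (\<lambda>y. \<integral>x. k (T (x, y)) \<partial>L)"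
        by (intro integrable_U[where K="4 * (1 / (1 - lam) + \<bar>v\<bar>)"] integral_bound_L kb) measurable
      fix y
      show "(if y0 - h \<le> y \<and> y < y0 + h then 1 else 0) * ((1 - lam) * \<bar>val - v\<bar> * (h / 2)) \<le> (\<integral>x. k (T (x, y)) \<partial>L)"
      proof (cases "y0 - h \<le> y \<and> y < y0 + h")
        case True
        then have "\<bar>y - y0\<bar> \<le> h" unfolding abs_le_iff by linarith
        then show ?thesis using slice[of y] True by simp
      next
        case False
        have "0 \<le> (\<integral>x. k (T (x, y)) \<partial>L)" using kn by (intro integral_nonneg_AE) auto
        then show ?thesis using False by auto
      qed
    qed
    finally have "Jac * ((1 - lam) * \<bar>val - v\<bar> * h\<^sup>2) \<le> Jac * (\<integral>y. \<integral>x. k (T (x, y)) \<partial>L \<partial>U)"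
      by (intro mult_left_mono) auto
    also have "\<dots> = (LINT w:Om|lebesgue. k w)" by (rule integral_Om[symmetric, OF _ kb kz]) auto
    also have "\<dots> = (LINT w:?B|lebesgue. norm (rho w - v))"
      unfolding set_lebesgue_integral_def using sub[OF n]
      by (intro Bochner_Integration.integral_cong) (auto simp: k_def h_def split: split_indicator)
    finally show "Jac * (1 - lam) * \<bar>(if digit (2 ^ n * y0) = 1 then 1 / (1 - lam) else 1) - v\<bar> * ((1/4) ^ n)\<^sup>2
      \<le> (LINT w:ball (crossing (u0, y0)) (C * (1/4) ^ n)|lebesgue. norm (rho w - v))"
      by (simp add: val_def b_def h_def mult_ac)
  qed
qed

end

context frame
begin

section \<open>The Cantor part and the two phases\<close>

abbreviation "S \<equiv> S_limit (trapezium lam A p q)"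

lemma S_borel [measurable]: "S \<in> sets borel"
  unfolding S_limit_def using compact_S_level by (intro sets.countable_INT'') (auto simp: compact_imp_closed)

lemma nu_off_S:
  assumes "E \<in> sets borel" "E \<inter> S = {}"
  shows "measure nu E = 0"
proof -
  have "measure nu E = (\<integral>y. \<integral>u. indicator E (crossing (u, y)) \<partial>U \<partial>U)" using assms(1) by (rule measure_nu)
  also have "\<dots> = (\<integral>y. 0 \<partial>U)"
  proof (rule integral_U_cong)
    fix y :: real assume y: "0 \<le> y" "y < 1"
    have "(\<integral>u. indicator E (crossing (u, y)) \<partial>U) = (\<integral>u. 0 \<partial>U :: real)"
    proof (rule integral_U_cong)
      fix u :: real assume u: "0 \<le> u" "u < 1"
      have "crossing (u, y) \<in> S" using crossing_in_S[OF u y] by (simp add: crossing_def)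
      then have "crossing (u, y) \<notin> E" using assms(2) by blast
      then show "indicator E (crossing (u, y)) = (0::real)" by simp
    qed (use assms in measurable)
    then show "(\<integral>u. indicator E (crossing (u, y)) \<partial>U :: real) = 0" by simp
  qed (use assms in measurable)
  finally show ?thesis by simp
qed

lemma nu_Om: "measure nu Om \<noteq> 0"
proof -
  have "(1/2::real) = (\<integral>y. (if 1/2 \<le> y \<and> y < 1 then 1 else 0) \<partial>U)" using integral_U_interval[of "1/2" 1] by simp
  also have "\<dots> \<le> (\<integral>y. \<integral>u. indicator Om (crossing (u, y)) \<partial>U \<partial>U)"
  proof (rule integral_mono)
    show "integrable U (\<lambda>y. if 1/2 \<le> y \<and> y < 1 then 1 else (0::real))" by (intro integrable_U[where K=1]) auto
    show "integrable U (\<lambda>y. \<integral>u. indicator Om (crossing (u, y)) \<partial>U :: real)"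
      by (intro integrable_U[where K=1] integral_bound_U ind_abs) measurable
    fix y :: real
    show "(if 1/2 \<le> y \<and> y < 1 then 1 else 0) \<le> (\<integral>u. indicator Om (crossing (u, y)) \<partial>U :: real)"
    proof (cases "1/2 \<le> y \<and> y < 1")
      case True
      then have "crossing (u, y) \<in> Om" for u by (intro crossing_in_Om) auto
      then have "(\<lambda>u. indicator Om (crossing (u, y)) :: real) = (\<lambda>_. 1)" by (simp add: fun_eq_iff)
      then show ?thesis using U.prob_space by simp
    next
      case False
      have "0 \<le> (\<integral>u. indicator Om (crossing (u, y)) \<partial>U :: real)" by (intro integral_nonneg_AE) auto
      then show ?thesis using False by auto
    qed
  qed
  also have "\<dots> = measure nu Om" by (rule measure_nu[symmetric]) simp
  finally show ?thesis by simp
qed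

lemma hausdorff_empty: "hausdorff_measure k ({} :: (real ^ 2) set) < \<infinity>"
proof -
  have "hausdorff_measure k ({} :: (real ^ 2) set) \<le> 0"
    unfolding hausdorff_measure_def
  proof (rule SUP_least)
    fix \<delta> :: real assume "\<delta> \<in> {0<..}"
    then show "(INF A\<in>{A. {} \<subseteq> (\<Union>i. A i) \<and> (\<forall>i. bounded (A i) \<and> diameter (A i) \<le> \<delta>)}.
        \<Sum>i. ennreal (unit_ball_vol (real k) / 2 ^ k * (if A i = ({} :: (real ^ 2) set) then 0 else diameter (A i) ^ k))) \<le> 0"
      by (intro INF_lower2[of "\<lambda>_. {}"]) auto
  qed
  then show ?thesis by (simp add: top.not_eq_extremum)
qed

lemma cantor_part: "is_div_cantor Om field cantor"
  unfolding is_div_cantor_def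
proof (rule exI[of _ cantor], rule exI[of _ "\<lambda>_. 0"], rule exI[of _ "\<lambda>_. 0"], intro conjI divergence_measure)
  have vm: "vector_measure Om cantor" using divergence_measure by (simp add: is_divergence_measure_def)
  have z: "vector_measure Om (\<lambda>_. 0 :: real)" by (simp add: vector_measure_def)
  have SOm: "S \<inter> Om \<in> borel_subsets Om" using borel_subsets_iff[of Om] by auto
  show "ajc_decomposition Om cantor (\<lambda>_. 0) (\<lambda>_. 0) cantor"
    unfolding ajc_decomposition_def
  proof (intro conjI vm z ballI impI)
    show "\<exists>N\<in>borel_subsets Om. emeasure lborel N = 0 \<and> concentrated_on Om (\<lambda>E. 0 + cantor E) N"
    proof (intro bexI[OF _ SOm] conjI)
      have "emeasure lborel (S \<inter> Om) \<le> emeasure lborel S" by (intro emeasure_mono) auto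
      then show "emeasure lborel (S \<inter> Om) = 0" using emeasure_S_limit[OF cross_nonzero] by simp
      show "concentrated_on Om (\<lambda>E. 0 + cantor E) (S \<inter> Om)"
        unfolding concentrated_on_def
      proof (intro ballI impI)
        fix E assume E: "E \<in> borel_subsets Om" "E \<inter> (S \<inter> Om) = {}"
        then have "E \<in> sets borel" "E \<inter> S = {}" using borel_subsets_iff[of Om] by auto
        then show "0 + cantor E = 0" using nu_off_S by (simp add: cantor_def)
      qed
    qed
    show "\<exists>J\<in>borel_subsets Om. hausdorff_sigma_finite (CARD(2) - 1) J \<and> concentrated_on Om (\<lambda>_. 0) J"
    proof (intro bexI[of _ "{}"] conjI)
      show "hausdorff_sigma_finite (CARD(2) - 1) ({} :: (real ^ 2) set)"
        unfolding hausdorff_sigma_finite_def by (intro exI[of _ "\<lambda>_. {}"]) (use hausdorff_empty[of 1] in auto)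
    qed (auto simp: concentrated_on_def)
    show "cantor E = 0" if "E \<in> borel_subsets Om" "hausdorff_measure (CARD(2) - 1) E < \<infinity>" for E
      using nu_hausdorff_null[of E] that borel_subsets_iff[of Om] by (simp add: cantor_def)
  qed simp_all
qed

text \<open>
  The set of crossing points with exceptional heights is contained in a null set, and so is the
  complement of the set of all crossing points. The latter set is described by means of \<open>G\<close>,
  which recovers the label, so that it is visibly a Borel set.
\<close>

lemma AE_cantor:
  assumes P: "\<And>u0 y0. generic y0 \<Longrightarrow> 0 < y0 \<Longrightarrow> y0 < 1 \<Longrightarrow> 0 \<le> u0 \<Longrightarrow> u0 < 1 \<Longrightarrow> P (crossing (u0, y0))"
  shows "AE x in var_measure Om cantor. P x"
proof -
  obtain N where N: "N \<in> sets borel" "emeasure U N = 0" "{y. \<not> generic y} \<subseteq> N"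
    using AE_generic by (auto elim!: AE_E)
  define Z where "Z = {w. cy w \<in> N \<or> \<not> (xi (G (cx w) (cy w)) (cy w) = cx w \<and> G (cx w) (cy w) < 1)}"
  have Zb [measurable]: "Z \<in> sets borel"
  proof -
    have [measurable]: "N \<in> sets borel" by (rule N)
    have "{w \<in> space borel. cy w \<in> N \<or> \<not> (xi (G (cx w) (cy w)) (cy w) = cx w \<and> G (cx w) (cy w) < 1)} \<in> sets (borel :: (real ^ 2) measure)"
      by measurable
    then show ?thesis by (simp add: Z_def)
  qed
  have "measure nu Z = (\<integral>y. \<integral>u. indicator Z (crossing (u, y)) \<partial>U \<partial>U)" by (rule measure_nu) simp
  also have "\<dots> = (\<integral>y. indicator N y \<partial>U)"
  proof (rule integral_U_cong)
    fix y :: real assume y: "0 \<le> y" "y < 1"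
    have "(\<integral>u. indicator Z (crossing (u, y)) \<partial>U :: real) = (\<integral>u. indicator N y \<partial>U)"
    proof (rule integral_U_cong)
      fix u :: real assume u: "0 \<le> u" "u < 1"
      show "indicator Z (crossing (u, y)) = (indicator N y :: real)"
        using G_xi[OF u, of y] u by (simp add: Z_def crossing_def indicator_def)
    qed measurable
    then show "(\<integral>u. indicator Z (crossing (u, y)) \<partial>U :: real) = indicator N y" using U.prob_space by simp
  qed (use N in measurable)
  also have "\<dots> = measure U N" using N(1) by simp
  also have "\<dots> = 0" using N(2) by (simp add: measure_def)
  finally have mZ: "measure nu Z = 0" .
  show ?thesis
  proof (rule var_measure_AE[OF finite_nu _ Om_borel _ _ Zb mZ])
    show "cantor E = - (lam * Jac) * measure nu E" for E by (simp add: cantor_def)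
    show "0 \<le> lam * Jac" using lam_pos by simp
    fix w assume w: "w \<in> Om" "w \<notin> Z"
    have "w = T (cx w, cy w)" by (simp add: T_coords)
    also have "\<dots> = crossing (G (cx w) (cy w), cy w)" using w(2) by (simp add: Z_def crossing_def)
    finally have e: "w = crossing (G (cx w) (cy w), cy w)" .
    have "P (crossing (G (cx w) (cy w), cy w))"
      using w N(3) G_bounds[of "cx w" "cy w"] by (intro P) (auto simp: Z_def Om_def)
    then show "P w" using e by simp
  qed simp
qed

text \<open>
  An approximate limit would have to be at distance zero from both values of \<open>rho\<close>, because
  either digit occurs infinitely often.
\<close>

lemma rho_not_continuous:
  assumes g: "generic y0" and y0: "0 < y0" "y0 < 1" and u0: "0 \<le> u0" "u0 < 1"
  shows "\<not> L1_approx_continuity_point rho (crossing (u0, y0))"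
proof
  assume "L1_approx_continuity_point rho (crossing (u0, y0))"
  then obtain v where v: "L1_approx_limit rho (crossing (u0, y0)) v" by (auto simp: L1_approx_continuity_point_def)
  define C where "C = 2 * norm p + norm q + 1"
  have C: "0 < C" unfolding C_def by (intro add_nonneg_pos add_nonneg_nonneg) auto
  let ?val = "\<lambda>n. if digit (2 ^ n * y0) = 1 then 1 / (1 - lam) else 1"
  obtain N where N: "\<And>n. N \<le> n \<Longrightarrow> ball (crossing (u0, y0)) (C * (1/4) ^ n) \<subseteq> Om"
    "\<And>n v. N \<le> n \<Longrightarrow> Jac * (1 - lam) * \<bar>?val n - v\<bar> * ((1/4) ^ n)\<^sup>2
      \<le> (LINT w:ball (crossing (u0, y0)) (C * (1/4) ^ n)|lebesgue. norm (rho w - v))"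
    unfolding C_def by (rule dens_oscillation[OF g y0 u0]) blast
  define B where "B = measure lebesgue (ball (0 :: real ^ 2) 1)"
  have B: "0 < B" unfolding B_def using content_ball_pos[of 1 "0 :: real ^ 2"] by simp
  define c where "c = Jac * (1 - lam) / (C\<^sup>2 * B)"
  have c: "0 < c" unfolding c_def using cross_nonzero lam_less_1 C B by simp
  have lo: "c * \<bar>?val n - v\<bar> \<le> (LINT w:ball (crossing (u0, y0)) (C * (1/4) ^ n)|lebesgue. norm (rho w - v)) / measure lebesgue (ball (crossing (u0, y0)) (C * (1/4) ^ n))"
    if "N \<le> n" for n
  proof -
    let ?h = "(1/4::real) ^ n"
    have "measure lebesgue (ball (crossing (u0, y0)) (C * ?h)) = (C * ?h)\<^sup>2 * B"
      using content_ball_conv_unit_ball[of "C * ?h" "crossing (u0, y0)"] C by (simp add: B_def)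
    moreover have "c * \<bar>?val n - v\<bar> * ((C * ?h)\<^sup>2 * B) = Jac * (1 - lam) * \<bar>?val n - v\<bar> * ?h\<^sup>2"
      using C B by (simp add: c_def power_mult_distrib field_simps)
    moreover have "0 < (C * ?h)\<^sup>2 * B" using C B by simp
    ultimately show ?thesis using N(2)[OF that, of v] by (simp only: pos_le_divide_eq)
  qed
  have "(\<lambda>n. C * (1/4::real) ^ n) \<longlonglongrightarrow> C * 0" by (intro tendsto_intros LIMSEQ_realpow_zero) auto
  then have "filterlim (\<lambda>n. C * (1/4::real) ^ n) (at_right 0) sequentially"
    using C by (auto simp: filterlim_at intro!: always_eventually)
  from filterlim_compose[OF v[unfolded L1_approx_limit_def] this]
  have lim: "(\<lambda>n. (LINT w:ball (crossing (u0, y0)) (C * (1/4) ^ n)|lebesgue. norm (rho w - v)) / measure lebesgue (ball (crossing (u0, y0)) (C * (1/4) ^ n))) \<longlonglongrightarrow> 0" .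
  have zero: "\<bar>w - v\<bar> = 0" if fr: "\<And>M. \<exists>n\<ge>M. ?val n = w" for w
  proof (rule ccontr)
    assume "\<bar>w - v\<bar> \<noteq> 0"
    then have "0 < c * \<bar>w - v\<bar>" using c by simp
    from order_tendstoD(2)[OF lim this] obtain M where
      M: "\<And>n. M \<le> n \<Longrightarrow> (LINT w:ball (crossing (u0, y0)) (C * (1/4) ^ n)|lebesgue. norm (rho w - v)) / measure lebesgue (ball (crossing (u0, y0)) (C * (1/4) ^ n)) < c * \<bar>w - v\<bar>"
      unfolding eventually_sequentially by blast
    obtain n where n: "max M N \<le> n" "?val n = w" using fr[of "max M N"] by blast
    then show False using lo[of n] M[of n] by simp
  qed
  have "\<exists>n\<ge>M. ?val n = 1" for M using frequently_digit(1)[OF g, of M] by fastforce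
  then have "v = 1" using zero[of 1] by simp
  moreover have "\<exists>n\<ge>M. ?val n = 1 / (1 - lam)" for M using frequently_digit(2)[OF g, of M] by fastforce
  then have "v = 1 / (1 - lam)" using zero[of "1 / (1 - lam)"] by simp
  ultimately show False using lam_pos lam_less_1 by (simp add: field_simps)
qed

lemma rho_values: "rho ` (Om - S) = {1} \<union> {1 / (1 - lam)}"
proof
  show "rho ` (Om - S) \<subseteq> {1} \<union> {1 / (1 - lam)}" by (auto simp: rho_def dens_def)
  obtain y0 :: real where g: "generic y0" and y0: "0 < y0" "y0 < 1"
  proof -
    have "AE y in U. generic y \<and> 0 \<le> y \<and> y < 1" using AE_generic AE_U_unit by eventually_elim simp
    moreover have "ae_filter U \<noteq> bot" using U.AE_False by (simp add: trivial_limit_def)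
    ultimately have "\<exists>y. generic y \<and> 0 \<le> y \<and> y < 1" using eventually_happens' by blast
    then obtain y where y: "generic y" "0 \<le> y" "y < 1" by blast
    have "y \<noteq> 0"
    proof
      assume "y = 0"
      then obtain n where "\<forall>k::int. (1/3::real) ^ n \<le> \<bar>0 - of_int k / 2 ^ n\<bar>"
        using y(1) unfolding generic_def eventually_sequentially by auto
      then have "(1/3::real) ^ n \<le> 0" by (auto dest: spec[of _ 0])
      then show False using zero_less_power[of "1/3::real" n] by linarith
    qed
    then show ?thesis using that y by auto
  qed
  define C where "C = 2 * norm p + norm q + 1"
  let ?val = "\<lambda>n. if digit (2 ^ n * y0) = 1 then 1 / (1 - lam) else 1"
  obtain N where N: "\<And>n. N \<le> n \<Longrightarrow> ball (crossing (0, y0)) (C * (1/4) ^ n) \<subseteq> Om"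
    "\<And>n v. N \<le> n \<Longrightarrow> Jac * (1 - lam) * \<bar>?val n - v\<bar> * ((1/4) ^ n)\<^sup>2
      \<le> (LINT w:ball (crossing (0, y0)) (C * (1/4) ^ n)|lebesgue. norm (rho w - v))"
    unfolding C_def by (rule dens_oscillation[OF g y0, of 0]) auto
  have ne: "1 / (1 - lam) \<noteq> 1" using lam_pos lam_less_1 by simp
  have S0: "AE w in lebesgue. w \<notin> S"
    using emeasure_S_limit[OF cross_nonzero] by (intro AE_completion AE_not_in) (auto simp: null_sets_def)
  \<comment> \<open>if only one phase occurred off the null set S, the oscillation around the other value would vanish\<close>
  have attained: "w \<in> rho ` (Om - S)"
    if w: "w \<in> {1, 1 / (1 - lam)}" and n: "N \<le> n" "?val n = w" for w n
  proof (rule ccontr)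
    assume nw: "w \<notin> rho ` (Om - S)"
    define v where "v = (if w = 1 then 1 / (1 - lam) else 1)"
    have v: "rho x = v" if "x \<in> Om" "x \<notin> S" for x
      using nw that w by (auto simp: v_def rho_def dens_def)
    have "(LINT x:ball (crossing (0, y0)) (C * (1/4) ^ n)|lebesgue. norm (rho x - v)) = (\<integral>x. 0 \<partial>(lebesgue :: (real ^ 2) measure))"
      unfolding set_lebesgue_integral_def
    proof (rule Bochner_Integration.integral_cong_AE)
      show "AE x in lebesgue. indicat_real (ball (crossing (0, y0)) (C * (1/4) ^ n)) x *\<^sub>R norm (rho x - v) = 0"
        using S0 by eventually_elim (use N(1)[OF n(1)] v in \<open>auto split: split_indicator\<close>)
    qed (use rho_measurable in \<open>auto intro!: measurable_completion borel_measurable_times borel_measurable_indicator borel_measurable_abs borel_measurable_diff\<close>)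
    then have "Jac * (1 - lam) * \<bar>w - v\<bar> * ((1/4) ^ n)\<^sup>2 \<le> 0" using N(2)[OF n(1), of v] n(2) by simp
    moreover have "w \<noteq> v" using w ne by (auto simp: v_def)
    then have "0 < Jac * (1 - lam) * \<bar>w - v\<bar> * ((1/4) ^ n)\<^sup>2"
      using cross_nonzero lam_less_1 by (intro mult_pos_pos) auto
    ultimately show False by linarith
  qed
  obtain n1 where "N \<le> n1" "digit (2 ^ n1 * y0) = 0" using frequently_digit(1)[OF g] by blast
  then have "1 \<in> rho ` (Om - S)" by (intro attained[of _ n1]) auto
  moreover obtain n2 where "N \<le> n2" "digit (2 ^ n2 * y0) = 1" using frequently_digit(2)[OF g] by blast
  then have "1 / (1 - lam) \<in> rho ` (Om - S)" by (intro attained[of _ n2]) auto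
  ultimately show "{1} \<union> {1 / (1 - lam)} \<subseteq> rho ` (Om - S)" by simp
qed

end

section \<open>Reduction of a cell to the model\<close>

text \<open>
  The two bases are parallel with the same direction, and the side \<open>AD\<close> is transversal to them
  because its product with \<open>e2\<close> is not zero.
\<close>

lemma cell_is_trapezium:
  assumes "norm e1 = 1" "e1 \<bullet> e2 = 0" and cell: "is_cell e1 e2 (Quad A B C D)" and comp: "compressible (Quad A B C D)"
  obtains lam where "0 < lam" "lam < 1" "Quad A B C D = trapezium lam A (B - A) (D - A)"
    "cross2 (B - A) (D - A) \<noteq> 0" "dist A B / dist C D = 1 / (1 - lam)"
proof -
  obtain a c where ac: "B - A = a *\<^sub>R e1" "C - D = c *\<^sub>R e1" "0 < a * c" and h: "0 < (D - A) \<bullet> e2"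
    using cell by auto
  have nz: "a \<noteq> 0" "c \<noteq> 0" using ac(3) by auto
  have dab: "dist A B = \<bar>a\<bar>" using ac(1) assms(1) by (subst dist_commute) (simp add: dist_norm)
  have dcd: "dist C D = \<bar>c\<bar>" using ac(2) assms(1) by (simp add: dist_norm)
  have k: "0 < c / a" "c / a < 1"
  proof -
    show "0 < c / a" using ac(3) by (auto simp: zero_less_divide_iff zero_less_mult_iff)
    have "\<bar>c\<bar> < \<bar>a\<bar>" using comp dab dcd by simp
    then show "c / a < 1" using ac(3) by (auto simp: divide_less_eq zero_less_mult_iff abs_if split: if_splits)
  qed
  define lam where "lam = 1 - c / a"
  have Ceq: "A + (D - A) + (1 - lam) *\<^sub>R (B - A) = C"
    unfolding ac(1) lam_def using nz ac(2) by (simp add: algebra_simps)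
  have cross: "cross2 (B - A) (D - A) \<noteq> 0"
  proof
    let ?q = "D - A"
    assume "cross2 (B - A) ?q = 0"
    then have "a * (e1$1 * ?q$2 - e1$2 * ?q$1) = 0" unfolding ac(1) cross2_def by (simp add: algebra_simps)
    then have c0: "e1$1 * ?q$2 = e1$2 * ?q$1" using nz by simp
    have o: "e1$1 * e2$1 + e1$2 * e2$2 = 0" using assms(2) by (simp add: inner_vec_def sum_2)
    have i: "?q \<bullet> e2 = ?q$1 * e2$1 + ?q$2 * e2$2" by (simp add: inner_vec_def sum_2)
    have "e1$1 * (?q \<bullet> e2) = ?q$1 * (e1$1 * e2$1 + e1$2 * e2$2) + e2$2 * (e1$1 * ?q$2 - e1$2 * ?q$1)"
      "e1$2 * (?q \<bullet> e2) = ?q$2 * (e1$1 * e2$1 + e1$2 * e2$2) - e2$1 * (e1$1 * ?q$2 - e1$2 * ?q$1)"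
      unfolding i by (simp_all add: algebra_simps)
    then have "e1$1 = 0" "e1$2 = 0" using c0 o h by auto
    then have "e1 = 0" by (simp add: vec_eq_iff forall_2)
    then show False using assms(1) by simp
  qed
  have "dist A B / dist C D = 1 / (1 - lam)"
    using ac(3) by (auto simp: dab dcd lam_def zero_less_mult_iff abs_if)
  then show ?thesis
    using that[of lam] k Ceq cross by (simp add: lam_def trapezium_def)
qed

theorem mainTheorem1:
  fixes e1 e2 A B C D :: "real ^ 2" and \<Omega> S :: "(real ^ 2) set" and r :: real
  assumes "norm e1 = 1" and "norm e2 = 1" and "e1 \<bullet> e2 = 0"
    and "is_cell e1 e2 (Quad A B C D)"
    and "compressible (Quad A B C D)"
    and "\<Omega> = quad_interior (Quad A B C D)"
    and "S = S_limit (Quad A B C D)"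
    and "r = dist A B / dist C D"
  shows "\<exists>(b :: real ^ 2 \<Rightarrow> real ^ 2) (\<rho> :: real ^ 2 \<Rightarrow> real) (\<mu>c :: (real ^ 2) set \<Rightarrow> real).
     b \<in> BV \<Omega> \<and> bounded (b ` \<Omega>) \<and>
     \<rho> \<in> borel_measurable (lebesgue_on \<Omega>) \<and> bounded (\<rho> ` \<Omega>) \<and>
     is_div_cantor \<Omega> b \<mu>c \<and>
     (\<exists>E\<in>borel_subsets \<Omega>. \<mu>c E \<noteq> 0) \<and>
     (\<forall>E\<in>borel_subsets \<Omega>. \<mu>c E \<le> 0) \<and>
     concentrated_on \<Omega> \<mu>c S \<and>
     (AE x in var_measure \<Omega> \<mu>c. x \<in> S \<longrightarrow> x \<in> tangential_set \<Omega> b) \<and>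
     \<rho> ` (\<Omega> - S) = {1} \<union> {r} \<and>
     divergence_free \<Omega> (\<lambda>x. \<rho> x *\<^sub>R b x) \<and>
     (AE x in var_measure \<Omega> \<mu>c. x \<in> S \<longrightarrow> \<not> L1_approx_continuity_point \<rho> x)"
proof -
  obtain lam where lam: "0 < lam" "lam < 1" and Q: "Quad A B C D = trapezium lam A (B - A) (D - A)"
    and cr: "cross2 (B - A) (D - A) \<noteq> 0" and ratio: "dist A B / dist C D = 1 / (1 - lam)"
    by (rule cell_is_trapezium[OF assms(1,3,4,5)])
  interpret F: frame lam A "B - A" "D - A"
    using lam cr by unfold_locales
  have Om: "\<Omega> = F.Om" unfolding assms(6) Q by (rule F.quad_interior_trapezium)
  have S: "S = S_limit (trapezium lam A (B - A) (D - A))" unfolding assms(7) Q ..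
  have r: "r = 1 / (1 - lam)" unfolding assms(8) by (rule ratio)
  show ?thesis
    unfolding Om S r
  proof (intro exI[of _ F.field] exI[of _ F.rho] exI[of _ F.cantor] conjI)
    show "bounded (F.field ` F.Om)" using F.field_bound by (auto simp: bounded_iff)
    show "bounded (F.rho ` F.Om)" using F.rho_bound by (auto simp: bounded_iff)
    show "F.rho \<in> borel_measurable (lebesgue_on F.Om)"
      by (intro measurable_restrict_space1 measurable_completion) simp
    show "\<exists>E\<in>borel_subsets F.Om. F.cantor E \<noteq> 0"
      using F.nu_Om lam cr borel_subsets_iff[OF F.Om_borel] by (intro bexI[of _ F.Om]) (auto simp: F.cantor_def)
    show "\<forall>E\<in>borel_subsets F.Om. F.cantor E \<le> 0"
      using lam by (auto simp: F.cantor_def intro!: mult_nonneg_nonneg)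
    show "concentrated_on F.Om F.cantor (S_limit (trapezium lam A (B - A) (D - A)))"
      unfolding concentrated_on_def using F.nu_off_S borel_subsets_iff[OF F.Om_borel] by (auto simp: F.cantor_def)
    show "AE x in var_measure F.Om F.cantor. x \<in> S_limit (trapezium lam A (B - A) (D - A)) \<longrightarrow> x \<in> tangential_set F.Om F.field"
      by (rule F.AE_cantor) (use F.crossing_tangential in blast)
    show "AE x in var_measure F.Om F.cantor. x \<in> S_limit (trapezium lam A (B - A) (D - A)) \<longrightarrow> \<not> L1_approx_continuity_point F.rho x"
      by (rule F.AE_cantor) (use F.rho_not_continuous in blast)
  qed (rule F.field_BV F.cantor_part F.rho_values F.divergence_free_rho)+
qed

end
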